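(* Let $2<p<+\infty$, let $a\equiv1$ on $[0,1]$, and let $q,\alpha_1,\alpha_2,\beta_1,\gamma_1,\mu_1$ satisfy $(A2)$ and $(A3)$ of the context. Then there exist two positive constants $M$ and $\nu$ such that, for every initial condition $(u_0,u_1,\eta_{1,0},\eta_{2,0},\zeta_{1,0})\in W^{1,p}(0,1)\times L^p(0,1)\times\mathbb{R}^3$, the corresponding unique weak solution $(u,\eta_1,\eta_2,\zeta_1)$ of system (S) of the context satisfies, for every $t\ge0$, $$E_p(t)\le M e^{-\nu t}E_p(0)$$ and $$\max_{x\in[0,1]}|u(t,x)-u_*|^p\le M E_p(0)e^{-\nu t},$$ where $u_*=u_0(1)-\eta_{2,0}$ and $$E_p(t)=\frac1p\int_0^1\big(|u_t(t,x)|^p+|u_x(t,x)|^p\big)\,dx+\frac{1}{p\beta_1}|\eta_1(t)|^p+\frac{\alpha_2}{p\beta_1}|\eta_2(t)|^p+\frac{1}{p\mu_1}|\zeta_1(t)|^p .$$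
   Context: Assumptions. $(A2)$: $q\in L^\infty(0,1)$, $q\ge 0$ a.e. in $(0,1)$, and there are a nonempty open interval $\omega\subset(0,1)$ and constants $\underline q,\overline q>0$ with $\underline q\le q\le\overline q$ a.e. in $\omega$. $(A3)$: $\alpha_1,\alpha_2,\beta_1,\gamma_1,\mu_1$ are constants with $\alpha_1,\alpha_2,\beta_1,\gamma_1,\mu_1>0$. System (S) (with $a\equiv1$) for $(u,\eta_1,\eta_2,\zeta_1)$: $u_{tt}-u_{xx}=-q u_t$ on $\mathbb{R}_+\times(0,1)$; $u_t(t,1)=\eta_1(t)$, $u_t(t,0)=\zeta_1(t)$; $\dot\eta_1(t)=-\alpha_1\eta_1(t)-\alpha_2\eta_2(t)-\beta_1u_x(t,1)$, $\dot\eta_2(t)=\eta_1(t)$, $\dot\zeta_1(t)=-\gamma_1\zeta_1(t)+\mu_1u_x(t,0)$, for $t\ge0$; $u(0,\cdot)=u_0$, $u_t(0,\cdot)=u_1$, $\eta_1(0)=\eta_{1,0}$, $\eta_2(0)=\eta_{2,0}$, $\zeta_1(0)=\zeta_{1,0}$. Weak solution: $(u,\eta_1,\eta_2,\zeta_1)$ with $u\in C^0([0,\infty);W^{1,p}(0,1))\cap C^1([0,\infty);L^p(0,1))$, $\eta_1,\eta_2,\zeta_1\in C^0([0,\infty);\mathbb{R})$, and $\partial_tu,\partial_xu\in C([0,1];L^p(0,T))$ (as functions of $x$ with values in functions of $t$) for all $T>0$, such that $u_{tt}-u_{xx}=-qu_t$ holds in the distributional sense, and the boundary conditions, the differential equations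 for $\eta_1,\eta_2,\zeta_1$ (with the traces $u_t(\cdot,x),u_x(\cdot,x)$, $x=0,1$, in $L^p(0,T)$) and the initial conditions hold in the usual sense allowed by this regularity. For initial data as in the statement such a weak solution exists and is unique. *)

theory Defs
  imports "HOL-Analysis.Analysis"
begin

text \<open>
  Elements of \<open>L\<^sup>p\<close> and \<open>W\<^sup>1\<^sup>,\<^sup>p\<close> are rendered by representatives: \<open>L\<^sup>p\<close> functions are
  arbitrary representatives, compared almost everywhere or through the norm, while a function
  in \<open>W\<^sup>1\<^sup>,\<^sup>p(0,1)\<close> is always its continuous representative on \<open>[0,1]\<close>, so that the point values
  in the theorem make sense.
\<close>

definition dir_deriv :: "'a::euclidean_space \<Rightarrow> ('a \<Rightarrow> real) \<Rightarrow> 'a \<Rightarrow> real" where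
  "dir_deriv v f = (\<lambda>z. frechet_derivative f (at z) v)"

primrec Ck :: "nat \<Rightarrow> ('a::euclidean_space \<Rightarrow> real) \<Rightarrow> bool" where
  "Ck 0 f \<longleftrightarrow> continuous_on UNIV f"
| "Ck (Suc k) f \<longleftrightarrow> (\<forall>z. f differentiable (at z)) \<and> (\<forall>v. Ck k (dir_deriv v f))"

definition test_function :: "'a::euclidean_space set \<Rightarrow> ('a \<Rightarrow> real) \<Rightarrow> bool" where
  "test_function \<Omega> \<phi> \<longleftrightarrow>
     (\<forall>k. Ck k \<phi>) \<and> compact (closure {z. \<phi> z \<noteq> 0}) \<and> closure {z. \<phi> z \<noteq> 0} \<subseteq> \<Omega>"

definition has_weak_deriv :: "real set \<Rightarrow> (real \<Rightarrow> real) \<Rightarrow> (real \<Rightarrow> real) \<Rightarrow> bool" where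
  "has_weak_deriv \<Omega> f g \<longleftrightarrow>
     (\<forall>\<phi>. test_function \<Omega> \<phi> \<longrightarrow>
        (LINT x|lebesgue_on \<Omega>. f x * deriv \<phi> x) = - (LINT x|lebesgue_on \<Omega>. g x * \<phi> x))"

definition Lp :: "real \<Rightarrow> real set \<Rightarrow> (real \<Rightarrow> real) \<Rightarrow> bool" where
  "Lp p S f \<longleftrightarrow>
     f \<in> borel_measurable (lebesgue_on S) \<and> integrable (lebesgue_on S) (\<lambda>x. \<bar>f x\<bar> powr p)"

definition Lp_norm :: "real \<Rightarrow> real set \<Rightarrow> (real \<Rightarrow> real) \<Rightarrow> real" where
  "Lp_norm p S f = (LINT x|lebesgue_on S. \<bar>f x\<bar> powr p) powr (1 / p)"

definition Linf :: "real set \<Rightarrow> (real \<Rightarrow> real) \<Rightarrow> bool" where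
  "Linf S f \<longleftrightarrow>
     f \<in> borel_measurable (lebesgue_on S) \<and> (\<exists>C. AE x in lebesgue_on S. \<bar>f x\<bar> \<le> C)"

definition W1p_deriv :: "real \<Rightarrow> (real \<Rightarrow> real) \<Rightarrow> (real \<Rightarrow> real) \<Rightarrow> bool" where
  "W1p_deriv p f g \<longleftrightarrow> continuous_on {0..1} f \<and> Lp p {0<..<1} f \<and> Lp p {0<..<1} g \<and>
     has_weak_deriv {0<..<1} f g"

definition W1p :: "real \<Rightarrow> (real \<Rightarrow> real) \<Rightarrow> bool" where
  "W1p p f \<longleftrightarrow> (\<exists>g. W1p_deriv p f g)"

text \<open>\<open>C\<^sup>0(I; L\<^sup>p(S))\<close>, for a curve \<open>F\<close> given by representatives.\<close>

definition Lp_continuous_on :: "real \<Rightarrow> real set \<Rightarrow> real set \<Rightarrow> (real \<Rightarrow> real \<Rightarrow> real) \<Rightarrow> bool" where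
  "Lp_continuous_on p S I F \<longleftrightarrow> (\<forall>t\<in>I. Lp p S (F t)) \<and>
     (\<forall>t\<in>I. ((\<lambda>s. Lp_norm p S (\<lambda>x. F s x - F t x)) \<longlongrightarrow> 0) (at t within I))"

definition Lp_has_deriv_on ::
    "real \<Rightarrow> real set \<Rightarrow> real set \<Rightarrow> (real \<Rightarrow> real \<Rightarrow> real) \<Rightarrow> (real \<Rightarrow> real \<Rightarrow> real) \<Rightarrow> bool" where
  "Lp_has_deriv_on p S I F G \<longleftrightarrow>
     (\<forall>t\<in>I. ((\<lambda>s. Lp_norm p S (\<lambda>x. (F s x - F t x) / (s - t) - G t x)) \<longlongrightarrow> 0) (at t within I))"

definition assumption_A2 :: "(real \<Rightarrow> real) \<Rightarrow> bool" where
  "assumption_A2 q \<longleftrightarrow>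
     Linf {0<..<1} q \<and> (AE x in lebesgue_on {0<..<1}. 0 \<le> q x) \<and>
     (\<exists>a b q_lo q_up. 0 \<le> a \<and> a < b \<and> b \<le> 1 \<and> 0 < q_lo \<and> 0 < q_up \<and>
        (AE x in lebesgue_on {a<..<b}. q_lo \<le> q x \<and> q x \<le> q_up))"

definition assumption_A3 :: "real \<Rightarrow> real \<Rightarrow> real \<Rightarrow> real \<Rightarrow> real \<Rightarrow> bool" where
  "assumption_A3 \<alpha>1 \<alpha>2 \<beta>1 \<gamma>1 \<mu>1 \<longleftrightarrow> 0 < \<alpha>1 \<and> 0 < \<alpha>2 \<and> 0 < \<beta>1 \<and> 0 < \<gamma>1 \<and> 0 < \<mu>1"

definition spacetime :: "(real \<times> real) set" where
  "spacetime = {0<..} \<times> {0<..<1}"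

text \<open>
  \<open>ut\<close> and \<open>ux\<close> represent \<open>u\<^sub>t\<close> and \<open>u\<^sub>x\<close> as curves in \<open>L\<^sup>p(0,1)\<close>. Such curves always have
  jointly measurable representatives; requiring one makes statements about almost every \<open>(t,x)\<close>
  meaningful.
\<close>

definition solution_regularity ::
    "real \<Rightarrow> (real \<Rightarrow> real \<Rightarrow> real) \<Rightarrow> (real \<Rightarrow> real \<Rightarrow> real) \<Rightarrow> (real \<Rightarrow> real \<Rightarrow> real) \<Rightarrow> bool" where
  "solution_regularity p u ut ux \<longleftrightarrow>
     (\<forall>t\<ge>0. W1p_deriv p (u t) (ux t)) \<and>
     Lp_continuous_on p {0<..<1} {0..} u \<and>
     Lp_continuous_on p {0<..<1} {0..} ux \<and>
     Lp_has_deriv_on p {0<..<1} {0..} u ut \<and>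
     Lp_continuous_on p {0<..<1} {0..} ut \<and>
     (\<lambda>z. ut (fst z) (snd z)) \<in> borel_measurable (lebesgue_on spacetime) \<and>
     (\<lambda>z. ux (fst z) (snd z)) \<in> borel_measurable (lebesgue_on spacetime)"

text \<open>
  \<open>F \<in> C([0,1]; L\<^sup>p(0,T))\<close> for all \<open>T > 0\<close>: the same function of \<open>(t,x)\<close>, up to a null set, is
  given by \<open>G x t\<close> with \<open>x \<mapsto> G x\<close> continuous into \<open>L\<^sup>p(0,T)\<close>. Its trace at \<open>x\<close> is \<open>G x\<close>.
\<close>

definition sideways_version ::
    "real \<Rightarrow> (real \<Rightarrow> real \<Rightarrow> real) \<Rightarrow> (real \<Rightarrow> real \<Rightarrow> real) \<Rightarrow> bool" where
  "sideways_version p F G \<longleftrightarrow>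
     (\<forall>T>0. Lp_continuous_on p {0<..<T} {0..1} G) \<and>
     (AE z in lebesgue_on spacetime. G (snd z) (fst z) = F (fst z) (snd z))"

definition damped_wave_eq ::
    "(real \<Rightarrow> real) \<Rightarrow> (real \<Rightarrow> real \<Rightarrow> real) \<Rightarrow> (real \<Rightarrow> real \<Rightarrow> real) \<Rightarrow> bool" where
  "damped_wave_eq q u ut \<longleftrightarrow>
     (\<forall>\<phi>. test_function spacetime \<phi> \<longrightarrow>
        (LINT z|lebesgue_on spacetime. u (fst z) (snd z) *
           (dir_deriv (1, 0) (dir_deriv (1, 0) \<phi>) z - dir_deriv (0, 1) (dir_deriv (0, 1) \<phi>) z))
        = (LINT z|lebesgue_on spacetime. - q (snd z) * ut (fst z) (snd z) * \<phi> z))"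

text \<open>
  The equations for \<open>\<eta>\<^sub>1\<close> and \<open>\<zeta>\<^sub>1\<close>, whose right-hand sides are only \<open>L\<^sup>p\<close> in time, hold in the
  sense of Caratheodory.
\<close>

definition weak_solution ::
    "real \<Rightarrow> (real \<Rightarrow> real) \<Rightarrow> real \<Rightarrow> real \<Rightarrow> real \<Rightarrow> real \<Rightarrow> real \<Rightarrow>
     (real \<Rightarrow> real) \<Rightarrow> (real \<Rightarrow> real) \<Rightarrow> real \<Rightarrow> real \<Rightarrow> real \<Rightarrow>
     (real \<Rightarrow> real \<Rightarrow> real) \<Rightarrow> (real \<Rightarrow> real \<Rightarrow> real) \<Rightarrow> (real \<Rightarrow> real \<Rightarrow> real) \<Rightarrow>
     (real \<Rightarrow> real) \<Rightarrow> (real \<Rightarrow> real) \<Rightarrow> (real \<Rightarrow> real) \<Rightarrow> bool" where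
  "weak_solution p q \<alpha>1 \<alpha>2 \<beta>1 \<gamma>1 \<mu>1 u0 u1 \<eta>10 \<eta>20 \<zeta>10 u ut ux \<eta>1 \<eta>2 \<zeta>1 \<longleftrightarrow>
     solution_regularity p u ut ux \<and>
     continuous_on {0..} \<eta>1 \<and> continuous_on {0..} \<eta>2 \<and> continuous_on {0..} \<zeta>1 \<and>
     damped_wave_eq q u ut \<and>
     (\<exists>Ut Ux. sideways_version p ut Ut \<and> sideways_version p ux Ux \<and>
        (AE t in lebesgue_on {0<..}. Ut 1 t = \<eta>1 t) \<and>
        (AE t in lebesgue_on {0<..}. Ut 0 t = \<zeta>1 t) \<and>
        (\<forall>t\<ge>0. \<eta>1 t = \<eta>1 0 +
           (LINT s|lebesgue_on {0<..<t}. - \<alpha>1 * \<eta>1 s - \<alpha>2 * \<eta>2 s - \<beta>1 * Ux 1 s)) \<and>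
        (\<forall>t\<ge>0. (\<eta>2 has_real_derivative \<eta>1 t) (at t within {0..})) \<and>
        (\<forall>t\<ge>0. \<zeta>1 t = \<zeta>1 0 +
           (LINT s|lebesgue_on {0<..<t}. - \<gamma>1 * \<zeta>1 s + \<mu>1 * Ux 0 s))) \<and>
     (\<forall>x\<in>{0..1}. u 0 x = u0 x) \<and> (AE x in lebesgue_on {0<..<1}. ut 0 x = u1 x) \<and>
     \<eta>1 0 = \<eta>10 \<and> \<eta>2 0 = \<eta>20 \<and> \<zeta>1 0 = \<zeta>10"

definition energy ::
    "real \<Rightarrow> real \<Rightarrow> real \<Rightarrow> real \<Rightarrow> (real \<Rightarrow> real \<Rightarrow> real) \<Rightarrow> (real \<Rightarrow> real \<Rightarrow> real) \<Rightarrow>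
     (real \<Rightarrow> real) \<Rightarrow> (real \<Rightarrow> real) \<Rightarrow> (real \<Rightarrow> real) \<Rightarrow> real \<Rightarrow> real" where
  "energy p \<alpha>2 \<beta>1 \<mu>1 ut ux \<eta>1 \<eta>2 \<zeta>1 t =
     1 / p * (LINT x|lebesgue_on {0<..<1}. \<bar>ut t x\<bar> powr p + \<bar>ux t x\<bar> powr p) +
     1 / (p * \<beta>1) * \<bar>\<eta>1 t\<bar> powr p + \<alpha>2 / (p * \<beta>1) * \<bar>\<eta>2 t\<bar> powr p +
     1 / (p * \<mu>1) * \<bar>\<zeta>1 t\<bar> powr p"

end

theory Submission
  imports Defs "HOL-Computational_Algebra.Polynomial"
begin

text \<open>
  Write \<open>r = u\<^sub>x + u\<^sub>t\<close> and \<open>z = u\<^sub>x - u\<^sub>t\<close>. Testing the wave equation with products of a function of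
  \<open>x\<close> and a function of \<open>t + x\<close> or \<open>t - x\<close> shows that \<open>r\<close> and \<open>z\<close> are primitives of \<open>q u\<^sub>t\<close> along almost
  all characteristics, with boundary values coupled to \<open>\<eta>\<^sub>1\<close>, \<open>\<eta>\<^sub>2\<close>, \<open>\<zeta>\<^sub>1\<close>. For such functions the quadratic
  energy satisfies an exact dissipation identity, and averaging over \<open>\<omega>\<close> bounds the energy by the
  dissipation over a time window of fixed length, hence exponential decay for \<open>p = 2\<close>.

  For \<open>p > 2\<close>, treat the other family as a source: multiplied by the integrating factor
  \<open>exp (- \<integral> q/2)\<close>, the trace of \<open>r\<close> at \<open>x = 0\<close> is contracted by a fixed factor during each round trip, up to
  integrals of \<open>z\<close> transversal to its own characteristics. These are bounded by the quadratic energy,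
  which already decays, so the \<open>p\<close>-th powers decay too by convexity of \<open>|x|\<^sup>p\<close>.
  All estimates hold at almost every time, and continuity in \<open>L\<^sup>p\<close> extends them to every time at the cost
  of a factor \<open>4\<^sup>p\<close>.
\<close>

hide_fact (open) Henstock_Kurzweil_Integration.integrable_add Henstock_Kurzweil_Integration.integrable_bound
  Henstock_Kurzweil_Integration.integrable_cong Henstock_Kurzweil_Integration.integrable_diff
  Henstock_Kurzweil_Integration.integral_add Henstock_Kurzweil_Integration.integral_cong Henstock_Kurzweil_Integration.integral_diff

text \<open>Differentiating \<open>E_p\<close> in time does not work directly for p > 2: the
  products of \<eta>1 and \<eta>2 produced by their two equations cancel only for p = 2, so no
  dissipation identity results. The quadratic energy therefore comes first, and for p > 2 it serves
  as a decaying source. In mean square the obstacle is that damping on \<omega> sees only u_t there,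
  that is, the difference of the two families; a common value of both stays invisible. Following one
  family through \<omega> shows that the increments of F, the trace of r at x = 0, are controlled by
  the dissipation. The missing constant is the mean of F over a window, which the equation of
  \<zeta> supplies. F then determines the rest: the trace H at x = 1, both families in the strip,
  and \<eta>2 through the equation of \<eta>1. Coefficients, damping and the length of \<omega> are
  bounded through a single K, so that every constant is fixed before the solution. Since solutions
  are only weak, identities hold at almost every time or on almost every characteristic; the
  admissible ones are singled out by predicates such as \<open>regular\<close>, \<open>good\<close>
  and \<open>nice\<close>.\<close>

abbreviation nbint :: "('a::euclidean_space \<Rightarrow> ennreal) \<Rightarrow> ennreal" (binder "NBINT " 10) where
  "nbint f \<equiv> nn_integral lborel f"

abbreviation ind :: "'a set \<Rightarrow> 'a \<Rightarrow> 'b::zero_neq_one" where "ind \<equiv> indicator"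

abbreviation ae_lborel :: "('a::euclidean_space \<Rightarrow> bool) \<Rightarrow> bool" (binder "AEL " 10) where
  "ae_lborel P \<equiv> almost_everywhere lborel P"

abbreviation lborel2 :: "(real \<times> real) measure" where "lborel2 \<equiv> lborel \<Otimes>\<^sub>M lborel"

abbreviation borel_fun :: "('a::topological_space => 'b::topological_space) => bool" where
  "borel_fun f \<equiv> f \<in> borel_measurable borel"

abbreviation joint_borel :: "(real \<Rightarrow> real \<Rightarrow> 'b::topological_space) \<Rightarrow> bool" where
  "joint_borel f \<equiv> (\<lambda>z. f (fst z) (snd z)) \<in> borel_measurable (borel \<Otimes>\<^sub>M borel)"

section \<open>Test functions and the lemma of du Bois-Reymond\<close>

lemma Ck_Suc_D: "Ck (Suc k) f ==> Ck k f"
proof (induction k arbitrary: f)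
 case 0
 then show ?case
  by (auto simp: continuous_on_eq_continuous_at differentiable_imp_continuous_within)
next
 case (Suc k)
 show ?case using Suc.prems Suc.IH by auto
qed

lemma dir_deriv_eqI: "(f has_derivative f') (at z) ==> dir_deriv v f z = f' v"
 unfolding dir_deriv_def using frechet_derivative_at by metis

lemma Ck_differentiable: "Ck (Suc k) f ==> (f has_derivative (\<lambda>v. dir_deriv v f z)) (at z)"
 unfolding dir_deriv_def using frechet_derivative_works by auto

lemma Ck_const: "Ck k (\<lambda>z. c)"
proof (induction k arbitrary: c)
 case (Suc k)
 have "dir_deriv v (\<lambda>z::'a. c) = (\<lambda>z. 0)" for v
  by (rule ext, rule dir_deriv_eqI) (auto intro!: derivative_eq_intros)
 then show ?case using Suc by simp
qed simp

lemma Ck_add: "Ck k f ==> Ck k g ==> Ck k (\<lambda>z. f z + g z)"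
proof (induction k arbitrary: f g)
 case 0 then show ?case by (auto intro: continuous_intros)
next
 case (Suc k)
 have D: "((\<lambda>z. f z + g z) has_derivative (\<lambda>v. dir_deriv v f z + dir_deriv v g z)) (at z)" for z
  using Ck_differentiable[OF Suc.prems(1)] Ck_differentiable[OF Suc.prems(2)] by (auto intro!: derivative_eq_intros)
 have "dir_deriv v (\<lambda>z. f z + g z) = (\<lambda>z. dir_deriv v f z + dir_deriv v g z)" for v
  by (rule ext, rule dir_deriv_eqI[OF D])
 moreover have "(\<lambda>z. f z + g z) differentiable (at z)" for z using D differentiable_def by blast
 ultimately show ?case using Suc by simp
qed

lemma Ck_mult: "Ck k f ==> Ck k g ==> Ck k (\<lambda>z. f z * g z)"
proof (induction k arbitrary: f g)
 case 0 then show ?case by (auto intro: continuous_intros)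
next
 case (Suc k)
 have D: "((\<lambda>z. f z * g z) has_derivative (\<lambda>v. f z * dir_deriv v g z + dir_deriv v f z * g z)) (at z)" for z
  using Ck_differentiable[OF Suc.prems(1)] Ck_differentiable[OF Suc.prems(2)] by (auto intro!: derivative_eq_intros)
 have "dir_deriv v (\<lambda>z. f z * g z) = (\<lambda>z. f z * dir_deriv v g z + dir_deriv v f z * g z)" for v
  by (rule ext, rule dir_deriv_eqI[OF D])
 moreover have "(\<lambda>z. f z * g z) differentiable (at z)" for z using D differentiable_def by blast
 ultimately show ?case using Suc Ck_Suc_D[of k f] Ck_Suc_D[of k g] by (simp add: Ck_add)
qed

lemma Ck_minus: "Ck k f ==> Ck k (\<lambda>z. - f z)"
 using Ck_mult[OF Ck_const[of k "-1"]] by fastforce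

lemma Ck_diff: "Ck k f ==> Ck k g ==> Ck k (\<lambda>z. f z - g z)"
 using Ck_add[OF _ Ck_minus] by fastforce

lemma Ck_inverse: "Ck k f ==> (\<And>z. f z \<noteq> 0) ==> Ck k (\<lambda>z. inverse (f z))"
proof (induction k arbitrary: f)
 case 0 then show ?case by (auto intro!: continuous_intros)
next
 case (Suc k)
 have D: "((\<lambda>z. inverse (f z)) has_derivative (\<lambda>v. - (inverse (f z) * dir_deriv v f z * inverse (f z)))) (at z)" for z
  using Ck_differentiable[OF Suc.prems(1)] Suc.prems(2) by (auto intro!: derivative_eq_intros)
 have "dir_deriv v (\<lambda>z. inverse (f z)) = (\<lambda>z. - (inverse (f z) * dir_deriv v f z * inverse (f z)))" for v
  by (rule ext, rule dir_deriv_eqI[OF D])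
 moreover have "(\<lambda>z. inverse (f z)) differentiable (at z)" for z using D differentiable_def by blast
 ultimately show ?case using Suc Ck_Suc_D[of k f] by (simp add: Ck_mult Ck_minus)
qed

lemma dir_deriv_real:
 assumes "(f has_real_derivative d) (at x)" shows "dir_deriv v f x = v * d"
 using dir_deriv_eqI[OF assms[unfolded has_field_derivative_def]] by (simp add: mult.commute)

lemma Ck_Suc_real:
 assumes "\<And>x. (f has_real_derivative f' x) (at x)" "Ck k f'"
 shows "Ck (Suc k) f"
proof -
 have "dir_deriv v f = (\<lambda>x. v * f' x)" for v using dir_deriv_real[OF assms(1)] by auto
 then show ?thesis using assms by (auto simp: Ck_mult Ck_const real_differentiable_def)
qed

lemma Ck_deriv_real:
 fixes f :: "real => real"
 assumes "Ck (Suc k) f"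
 shows "(f has_real_derivative deriv f x) (at x)" "Ck k (deriv f)"
proof -
 show D: "(f has_real_derivative deriv f x) (at x)" for x
  using assms by (simp add: DERIV_deriv_iff_real_differentiable)
 have "deriv f = dir_deriv 1 f" using dir_deriv_real[OF D] by auto
 then show "Ck k (deriv f)" using assms by simp
qed

text \<open>Differentiation only multiplies by the constant \<open>L v\<close> and replaces
  \<open>g\<close> by \<open>deriv g\<close>, so the induction stays inside functions of one real
  variable. On the plane this yields the factors \<open>\<kappa> (snd z)\<close> and
  \<open>\<psi> (fst z + \<sigma> * snd z)\<close> of the test functions; on the line it yields
  rescaled steps.\<close>

lemma Ck_compose_affine:
 fixes g :: "real => real" and L :: "'a::euclidean_space => real"
 assumes "Ck k g" "bounded_linear L"
 shows "Ck k (\<lambda>z. g (L z + c))"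
 using assms(1)
proof (induction k arbitrary: g)
 case 0 then show ?case
  using linear_continuous_on[OF assms(2)] by (auto intro!: continuous_intros continuous_on_compose2[of UNIV g])
next
 case (Suc k)
 have D: "((\<lambda>z. g (L z + c)) has_derivative (\<lambda>v. L v * deriv g (L z + c))) (at z)" for z
 proof -
  have "((\<lambda>z. L z + c) has_derivative L) (at z)"
   using has_derivative_add[OF bounded_linear_imp_has_derivative[OF assms(2)] has_derivative_const] by simp
  from has_derivative_compose[OF this Ck_deriv_real(1)[OF Suc.prems, of "L z + c", unfolded has_field_derivative_def]]
  show ?thesis by (simp add: mult.commute)
 qed
 have "dir_deriv v (\<lambda>z. g (L z + c)) = (\<lambda>z. L v * deriv g (L z + c))" for v
  by (rule ext, rule dir_deriv_eqI[OF D])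
 moreover have "(\<lambda>z. g (L z + c)) differentiable (at z)" for z using D differentiable_def by blast
 ultimately show ?case using Suc.IH[OF Ck_deriv_real(2)[OF Suc.prems]] by (simp add: Ck_mult Ck_const)
qed

text \<open>The family is closed under differentiation, with \<open>P\<close> replaced by \<open>y\<^sup>2 (P - P')\<close>.\<close>

definition flat_exp :: "real poly => real => real" where
 "flat_exp P x = (if x > 0 then poly P (1 / x) * exp (- (1 / x)) else 0)"

lemma poly_exp_tendsto_0: "((\<lambda>y. poly P y * exp (- y)) \<longlongrightarrow> (0::real)) at_top"
proof -
 have "((\<lambda>y. \<Sum>i\<le>degree P. coeff P i * (y ^ i / exp y)) \<longlongrightarrow> (\<Sum>i\<le>degree P. coeff P i * 0)) at_top"
  by (intro tendsto_intros tendsto_power_div_exp_0)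
 then show ?thesis
  by (simp add: poly_altdef exp_minus sum_distrib_right sum_distrib_left divide_inverse mult.assoc)
qed

lemma flat_exp_tendsto_0: "(flat_exp P \<longlongrightarrow> 0) (at 0)"
proof -
 have "((\<lambda>x. poly P (1 / x) * exp (- (1 / x))) \<longlongrightarrow> 0) (at_right 0)"
  using filterlim_compose[OF poly_exp_tendsto_0 filterlim_inverse_at_top_right, of P] by (simp add: inverse_eq_divide)
 then have "(flat_exp P \<longlongrightarrow> 0) (at_right 0)"
  by (rule Lim_transform_eventually) (auto simp: flat_exp_def eventually_at_right_less intro: eventually_mono[OF eventually_at_right_less])
 moreover have "(flat_exp P \<longlongrightarrow> 0) (at_left 0)"
  by (rule Lim_transform_eventually[OF tendsto_const])
   (auto simp: flat_exp_def eventually_at intro!: exI[of _ 1])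
 ultimately show ?thesis by (simp add: filterlim_split_at)
qed

lemma flat_exp_deriv:
 "(flat_exp P has_real_derivative flat_exp (pCons 0 (pCons 0 (P - pderiv P))) x) (at x)"
proof -
 consider "x > 0" | "x < 0" | "x = 0" by linarith
 then show ?thesis
 proof cases
  case 1
  have "((\<lambda>x. poly P (1 / x) * exp (- (1 / x))) has_real_derivative
    flat_exp (pCons 0 (pCons 0 (P - pderiv P))) x) (at x)"
   using 1 by (auto intro!: derivative_eq_intros poly_DERIV DERIV_chain2[where f="poly P"]
     simp: flat_exp_def field_simps power2_eq_square)
  then show ?thesis
   by (rule has_field_derivative_transform_within_open[where S="{0<..}"])
    (use 1 in \<open>auto simp: flat_exp_def\<close>)
 next
  case 2
  have "((\<lambda>x. 0) has_real_derivative flat_exp (pCons 0 (pCons 0 (P - pderiv P))) x) (at x)"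
   using 2 by (simp add: flat_exp_def)
  then show ?thesis
   by (rule has_field_derivative_transform_within_open[where S="{..<0}"])
    (use 2 in \<open>auto simp: flat_exp_def\<close>)
 next
  case 3
  \<comment> \<open>The difference quotient at 0 belongs to the same family: division by
    \<open>h\<close> multiplies the polynomial in \<open>1 / h\<close> by its variable.\<close>
  have "((\<lambda>h. flat_exp (pCons 0 P) h) \<longlongrightarrow> 0) (at 0)" by (rule flat_exp_tendsto_0)
  moreover have "(\<lambda>h. (flat_exp P (0 + h) - flat_exp P 0) / h) = (\<lambda>h. flat_exp (pCons 0 P) h)"
   by (auto simp: flat_exp_def)
  ultimately show ?thesis using 3 by (simp add: DERIV_def) (simp add: flat_exp_def)
 qed
qed

lemma Ck_flat_exp: "Ck k (flat_exp P)"
proof (induction k arbitrary: P)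
 case 0
 show ?case using DERIV_isCont[OF flat_exp_deriv] by (simp add: continuous_on_eq_continuous_at)
next
 case (Suc k)
 show ?case by (rule Ck_Suc_real[OF flat_exp_deriv Suc])
qed

text \<open>The usual smooth transition from 0 to 1, used in two ways:
  \<open>smooth_step (n * (z - x))\<close> tends to the indicator of \<open>z > x\<close>, and its
  derivative in \<open>z\<close> is an approximate identity concentrated just to the right of
  \<open>x\<close>.\<close>

definition smooth_step :: "real => real" where
 "smooth_step x = flat_exp 1 x * inverse (flat_exp 1 x + flat_exp 1 (1 - x))"

lemma flat_exp_1_nonneg: "0 <= flat_exp 1 x" by (simp add: flat_exp_def)

lemma smooth_step_denom_pos: "0 < flat_exp 1 x + flat_exp 1 (1 - x)"
 by (auto simp: flat_exp_def add_pos_pos)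

lemma smooth_step_simps:
 "x <= 0 ==> smooth_step x = 0" "x \<ge> 1 ==> smooth_step x = 1"
 by (auto simp: smooth_step_def flat_exp_def)

lemma smooth_step_bounds: "0 <= smooth_step x" "smooth_step x <= 1"
 using smooth_step_denom_pos[of x] flat_exp_1_nonneg[of x] flat_exp_1_nonneg[of "1-x"]
 by (auto simp: smooth_step_def divide_inverse[symmetric])

lemma Ck_smooth_step: "Ck k smooth_step"
proof -
 have "Ck k (\<lambda>x. flat_exp 1 (- x + 1))"
  by (rule Ck_compose_affine[OF Ck_flat_exp bounded_linear_minus[OF bounded_linear_ident]])
 then have "Ck k (\<lambda>x. flat_exp 1 (1 - x))" by simp
 then have "Ck k (\<lambda>x. flat_exp 1 x * inverse (flat_exp 1 x + flat_exp 1 (1 - x)))"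
  using smooth_step_denom_pos by (intro Ck_mult Ck_flat_exp Ck_inverse Ck_add) (auto simp: less_imp_neq[symmetric])
 then show ?thesis unfolding smooth_step_def[abs_def] .
qed

lemma smooth_step_deriv: "(smooth_step has_real_derivative deriv smooth_step x) (at x)"
 by (rule Ck_deriv_real(1)[OF Ck_smooth_step[of "Suc 0"]])

lemma continuous_deriv_smooth_step: "continuous_on A (deriv smooth_step)"
 using Ck_deriv_real(2)[OF Ck_smooth_step[of "Suc 0"]] continuous_on_subset by auto

lemma deriv_smooth_step_eq_0: assumes "x \<notin> {0..1}" shows "deriv smooth_step x = 0"
proof (cases "x < 0")
 case True
 have "((\<lambda>x. 0) has_real_derivative 0) (at x)" by simp
 then have "(smooth_step has_real_derivative 0) (at x)"
  by (rule has_field_derivative_transform_within_open[where S="{..<0}"])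
   (use True in \<open>auto simp: smooth_step_simps\<close>)
 then show ?thesis by (rule DERIV_imp_deriv)
next
 case False
 have "((\<lambda>x. 1) has_real_derivative 0) (at x)" by simp
 then have "(smooth_step has_real_derivative 0) (at x)"
  by (rule has_field_derivative_transform_within_open[where S="{1<..}"])
   (use False assms in \<open>auto simp: smooth_step_simps\<close>)
 then show ?thesis by (rule DERIV_imp_deriv)
qed

lemma smooth_step_scaled_deriv:
 "((\<lambda>z. smooth_step (c * (z - x))) has_real_derivative c * deriv smooth_step (c * (z - x))) (at z)"
proof -
 have "((\<lambda>z. c * (z - x)) has_real_derivative c) (at z)" by (auto intro!: derivative_eq_intros)
 from DERIV_chain2[OF smooth_step_deriv this] show ?thesis by (simp add: mult.commute)
qed

lemma smooth_step_kernel_integral: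
 assumes "0 < n"
 shows "((\<lambda>z. n * deriv smooth_step (n * (z - x))) has_integral 1) {x..x + 1 / real n}"
proof -
 have "((\<lambda>z. smooth_step (n * (z - x))) has_vector_derivative n * deriv smooth_step (n * (z - x))) (at z within S)" for z S
  unfolding has_real_derivative_iff_has_vector_derivative[symmetric]
  by (rule DERIV_subset[OF smooth_step_scaled_deriv subset_UNIV])
 then have "((\<lambda>z. n * deriv smooth_step (n * (z - x))) has_integral
   smooth_step (n * ((x + 1 / n) - x)) - smooth_step (n * (x - x))) {x..x + 1 / real n}"
  using assms by (intro fundamental_theorem_of_calculus) auto
 then show ?thesis using assms by (simp add: smooth_step_simps)
qed

text \<open>The kernel has mass 1 and lives on \<open>{x..x + 1 / n}\<close>, where its modulus is
  at most \<open>n * C\<close>; hence its absolute integral is at most \<open>C\<close>, and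
  continuity of \<open>f\<close> at \<open>x\<close> suffices. As the kernel lies to the right of
  \<open>x\<close>, room is required there, which is the condition \<open>x < b\<close>.\<close>

lemma smooth_step_kernel_tendsto:
 fixes f :: "real => real"
 assumes f: "continuous_on {a..b} f" and x: "a <= x" "x < b"
 shows "(\<lambda>n. integral {a..b} (\<lambda>z. f z * (real n * deriv smooth_step (real n * (z - x))))) \<longlonglongrightarrow> f x"
proof (rule LIMSEQ_I)
 fix e :: real assume e: "0 < e"
 obtain C where C: "\<And>z. \<bar>deriv smooth_step z\<bar> <= C" "0 < C"
 proof -
  have "bounded (deriv smooth_step ` {0..1})"
   by (intro compact_imp_bounded compact_continuous_image continuous_deriv_smooth_step) auto
  then obtain B where B: "0 < B" "\<And>z. z \<in> {0..1} ==> \<bar>deriv smooth_step z\<bar> <= B"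
   unfolding bounded_pos by auto
  show ?thesis
   by (rule that[of B]) (use B deriv_smooth_step_eq_0 in \<open>force+\<close>)
 qed
 \<comment> \<open>Chosen so that the error \<open>e'\<close> times the bound \<open>C\<close> for
   the absolute mass of the kernel is \<open>e / 2\<close>.\<close>
 define e' where "e' = e / (2 * C)"
 have "0 < e'" using e C by (simp add: e'_def)
 obtain d where d: "0 < d" "\<And>z. z \<in> {a..b} ==> \<bar>z - x\<bar> < d ==> \<bar>f z - f x\<bar> < e'"
  using f x \<open>0 < e'\<close> unfolding continuous_on_iff dist_real_def
  by (metis atLeastAtMost_iff less_imp_le)
 obtain N where N: "1 / real N < min d (b - x)" "0 < N"
  using d(1) x(2) by (metis diff_gt_0_iff_gt min_less_iff_conj nat_approx_posE zero_less_Suc)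
 show "\<exists>N. \<forall>n\<ge>N. norm (integral {a..b} (\<lambda>z. f z * (real n * deriv smooth_step (real n * (z - x)))) - f x) < e"
 proof (intro exI allI impI)
  fix n assume "N <= n"
  then have n: "0 < n" "1 / real n < d" "1 / real n < b - x"
   using N by (auto simp: frac_le[of 1 1 "real N" "real n", THEN le_less_trans])
  let ?k = "\<lambda>z. real n * deriv smooth_step (real n * (z - x))"
  have k0: "?k z = 0" if "z \<notin> {x..x + 1 / real n}" for z
   using that n by (auto intro!: deriv_smooth_step_eq_0 simp: field_simps)
  have cont: "continuous_on A ?k" for A
   by (intro continuous_intros continuous_on_compose2[OF continuous_deriv_smooth_step[of UNIV]]) auto
  have sub: "{x..x + 1 / real n} \<subseteq> {a..b}" using x n by auto
  have cf: "continuous_on {x..x + 1 / real n} f" using f sub continuous_on_subset by blast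
  define I where "I = integral {x..x + 1 / real n} (\<lambda>z. f z * ?k z)"
  have I: "((\<lambda>z. f z * ?k z) has_integral I) {x..x + 1 / real n}"
   unfolding I_def by (intro integrable_integral integrable_continuous_real continuous_intros cf cont)
  have "((\<lambda>z. f z * ?k z) has_integral I) {a..b}"
   by (rule has_integral_on_superset[OF I _ sub]) (use k0 in auto)
  then have eq: "integral {a..b} (\<lambda>z. f z * ?k z) = I" by (rule integral_unique)
  have diff: "((\<lambda>z. f z * ?k z - f x * ?k z) has_integral (I - f x * 1)) {x..x + 1 / real n}"
   using n by (intro has_integral_diff I has_integral_mult_right smooth_step_kernel_integral) auto
  have "norm (I - f x * 1) <= (e' * (real n * C)) * Henstock_Kurzweil_Integration.content {x..x + 1 / real n}"
  proof (rule has_integral_bound_real[OF _ finite.emptyI diff])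
   show "0 <= e' * (real n * C)" using \<open>0 < e'\<close> C by auto
   show "\<And>z. z \<in> {x..x + 1 / real n} - {} ==> norm (f z * ?k z - f x * ?k z) <= e' * (real n * C)"
   proof -
    fix z assume z: "z \<in> {x..x + 1 / real n} - {}"
    then have "\<bar>f z - f x\<bar> <= e'" using d(2)[of z] sub n by fastforce
    moreover have "\<bar>?k z\<bar> <= real n * C" using C by (simp add: abs_mult mult_left_mono)
    ultimately have "\<bar>f z - f x\<bar> * \<bar>?k z\<bar> <= e' * (real n * C)" using \<open>0 < e'\<close> by (intro mult_mono) auto
    then show "norm (f z * ?k z - f x * ?k z) <= e' * (real n * C)"
     by (simp add: left_diff_distrib[symmetric] abs_mult)
   qed
  qed
  also have "... = e / 2" using n C by (simp add: e'_def)
  finally show "norm (integral {a..b} (\<lambda>z. f z * ?k z) - f x) < e" using e eq by simp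
 qed
qed

lemma closure_support_subset: "(\<And>z. z \<notin> S ==> f z = 0) ==> closed S ==> closure {z. f z \<noteq> 0} \<subseteq> S"
 by (rule closure_minimal) auto

lemma test_functionI:
 assumes "\<And>k. Ck k f" "compact S" "S \<subseteq> \<Omega>" "\<And>z. z \<notin> S ==> f z = 0"
 shows "test_function \<Omega> f"
 using assms closure_support_subset[of S f] compact_imp_closed[OF assms(2)]
 unfolding test_function_def by (meson bounded_subset closed_closure compact_eq_bounded_closed subset_trans)

lemma Ck_smooth_step_scaled: "Ck k (\<lambda>z. smooth_step (n * (z - x)))"
 using Ck_compose_affine[OF Ck_smooth_step, of "\<lambda>z. n * z" k "- n * x"] bounded_linear_mult_right[of n]
 by (simp add: algebra_simps)

section \<open>From weak derivatives to integrals on the line\<close>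

lemma lebesgue_on_continuous_integrable:
 fixes f :: "real => real"
 assumes "continuous_on {a..b} f"
 shows "integrable (lebesgue_on {a<..<b}) f"
 by (rule absolutely_integrable_imp_integrable)
  (auto intro: set_integrable_subset[OF absolutely_integrable_continuous_real[OF assms]])

lemma lebesgue_on_continuous_eq_integral:
 fixes f :: "real => real"
 assumes "continuous_on {a..b} f"
 shows "(LINT x|lebesgue_on {a<..<b}. f x) = integral {a..b} f"
 using lebesgue_integral_eq_integral[OF lebesgue_on_continuous_integrable[OF assms]]
 by (simp add: integral_open_interval_real)

text \<open>The theorem of du Bois-Reymond, by testing with smooth approximations of indicator functions.\<close>

lemma weak_deriv_imp_integral_interior:
 assumes f: "continuous_on {a..b} f" and g: "integrable (lebesgue_on {a<..<b}) g"
  and weak: "\<And>\<phi>. test_function {a<..<b} \<phi> ==>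
   (LINT x|lebesgue_on {a<..<b}. f x * deriv \<phi> x) = - (LINT x|lebesgue_on {a<..<b}. g x * \<phi> x)"
  and xy: "a < x" "x < y" "y < b"
 shows "f y - f x = (LINT t|lebesgue_on {x<..<y}. g t)"
proof -
 let ?M = "lebesgue_on {a<..<b}"
 let ?k = "\<lambda>n x z. real n * deriv smooth_step (real n * (z - x))"
 \<comment> \<open>A step up to the right of \<open>x\<close> minus a step up to the right of
   \<open>y\<close>: this approximates the indicator of \<open>{x<..y}\<close>, while its derivative
   is the difference of two approximate identities and so reads off
   \<open>f x - f y\<close>.\<close>
 define \<phi> where "\<phi> n z = smooth_step (real n * (z - x)) - smooth_step (real n * (z - y))" for n z
 have d\<phi>: "(\<phi> n has_real_derivative ?k n x z - ?k n y z) (at z)" for n z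
  unfolding \<phi>_def by (intro DERIV_diff smooth_step_scaled_deriv)
 have \<phi>0: "\<phi> n z = 0" if "z \<notin> {x..y + 1 / real n}" "0 < n" for n z
 proof (cases "z < x")
  case True
  then show ?thesis using that xy by (simp add: \<phi>_def smooth_step_simps mult_nonneg_nonpos)
 next
  case False
  then have "1 / real n < z - y" using that by auto
  then have "1 < real n * (z - y)" using that by (simp add: field_simps)
  moreover have "real n * (z - y) <= real n * (z - x)" using xy by (intro mult_left_mono) auto
  ultimately show ?thesis by (simp add: \<phi>_def smooth_step_simps)
 qed
 have cont: "continuous_on A (?k n x)" for A n x
  by (intro continuous_intros continuous_on_compose2[OF continuous_deriv_smooth_step[of UNIV]]) auto
 \<comment> \<open>The support of \<open>\<phi> n\<close> extends to \<open>y + 1 / n\<close>, so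
   \<open>\<phi> n\<close> is an admissible test function only for large \<open>n\<close>.\<close>
 obtain N where N: "1 / real N < b - y" "0 < N"
  using xy by (metis diff_gt_0_iff_gt nat_approx_posE zero_less_Suc)
 have test: "test_function {a<..<b} (\<phi> n)" if "N <= n" for n
 proof (rule test_functionI[of _ "{x..y + 1 / real n}"])
  show "Ck k (\<phi> n)" for k unfolding \<phi>_def by (intro Ck_diff Ck_smooth_step_scaled)
  have "1 / real n <= 1 / real N" using that N by (simp add: frac_le)
  then show "{x..y + 1 / real n} \<subseteq> {a<..<b}" using xy N by auto
  show "\<phi> n z = 0" if "z \<notin> {x..y + 1 / real n}" for z
   using \<phi>0[OF that] \<open>N <= n\<close> N by auto
 qed auto
 have "(\<lambda>n. LINT z|?M. g z * \<phi> n z) \<longlonglongrightarrow> (LINT z|?M. g z * ind {x<..y} z)"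
 proof (rule integral_dominated_convergence[where w="\<lambda>z. \<bar>g z\<bar>"])
  show "integrable ?M (\<lambda>z. \<bar>g z\<bar>)" using g by auto
  show "(\<lambda>z. g z * \<phi> n z) \<in> borel_measurable ?M" for n
  proof -
   have "continuous_on UNIV (\<phi> n)"
    using d\<phi> by (intro continuous_at_imp_continuous_on) (auto intro: DERIV_isCont)
   then have "\<phi> n \<in> borel_measurable ?M"
    by (intro continuous_imp_measurable_on_sets_lebesgue) (auto intro: continuous_on_subset)
   then show ?thesis using g by auto
  qed
  show "(\<lambda>z. g z * ind {x<..y} z) \<in> borel_measurable ?M"
   using g by (intro borel_measurable_times) (auto intro!: measurable_restrict_space1[OF borel_measurable_indicator])
  have "(\<lambda>n. \<phi> n z) \<longlonglongrightarrow> ind {x<..y} z" for z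
  proof -
   have step: "(\<lambda>n. smooth_step (real n * c)) \<longlonglongrightarrow> (if c > 0 then 1 else 0)" for c
   proof (cases "c > 0")
    case True
    obtain m :: nat where "1 / c < m" using reals_Archimedean2 by blast
    then have "smooth_step (real n * c) = 1" if "m <= n" for n
    proof -
     have "1 / c <= n" using that \<open>1/c < m\<close> by linarith
     then have "1 <= real n * c" using True by (simp add: field_simps)
     then show ?thesis by (rule smooth_step_simps)
    qed
    then show ?thesis using True
     by (intro tendsto_eventually) (auto simp: eventually_sequentially)
   next
    case False
    then show ?thesis by (simp add: smooth_step_simps mult_nonneg_nonpos)
   qed
   have "(\<lambda>n. \<phi> n z) \<longlonglongrightarrow> (if z - x > 0 then 1 else 0) - (if z - y > 0 then 1 else 0)"
    unfolding \<phi>_def by (intro tendsto_diff step)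
   also have "(if z - x > 0 then 1 else 0) - (if z - y > 0 then 1 else 0) = indicat_real {x<..y} z"
    using xy by (auto simp: indicator_def)
   finally show ?thesis .
  qed
  then show "AE z in ?M. (\<lambda>n. g z * \<phi> n z) \<longlonglongrightarrow> g z * ind {x<..y} z"
   by (intro AE_I2 tendsto_intros)
  have "\<bar>\<phi> n z\<bar> <= 1" for n z
   unfolding \<phi>_def using smooth_step_bounds[of "real n * (z - x)"] smooth_step_bounds[of "real n * (z - y)"] by linarith
  then show "AE z in ?M. norm (g z * \<phi> n z) <= \<bar>g z\<bar>" for n
   by (auto simp: abs_mult mult_left_le)
 qed
 moreover have "(\<lambda>n. LINT z|?M. g z * \<phi> n z) \<longlonglongrightarrow> - (f x - f y)"
 proof -
  have "(\<lambda>n. - (integral {a..b} (\<lambda>z. f z * ?k n x z) - integral {a..b} (\<lambda>z. f z * ?k n y z))) \<longlonglongrightarrow> - (f x - f y)"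
   using xy by (intro tendsto_intros smooth_step_kernel_tendsto f) auto
  moreover have "(LINT z|?M. g z * \<phi> n z) = - (integral {a..b} (\<lambda>z. f z * ?k n x z) - integral {a..b} (\<lambda>z. f z * ?k n y z))"
   if "N <= n" for n
  proof -
   have "(LINT z|?M. g z * \<phi> n z) = - (LINT z|?M. f z * deriv (\<phi> n) z)"
    using weak[OF test[OF that]] by simp
   also have "(LINT z|?M. f z * deriv (\<phi> n) z) = (LINT z|?M. f z * ?k n x z - f z * ?k n y z)"
    using DERIV_imp_deriv[OF d\<phi>[of n]] by (simp add: right_diff_distrib)
   also have "... = integral {a..b} (\<lambda>z. f z * ?k n x z - f z * ?k n y z)"
    by (intro lebesgue_on_continuous_eq_integral continuous_on_diff continuous_on_mult f cont)
   also have "... = integral {a..b} (\<lambda>z. f z * ?k n x z) - integral {a..b} (\<lambda>z. f z * ?k n y z)"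
    by (intro Henstock_Kurzweil_Integration.integral_diff integrable_continuous_real continuous_on_mult f cont)
   finally show ?thesis .
  qed
  ultimately show ?thesis
   by (elim Lim_transform_eventually) (auto simp: eventually_sequentially intro!: exI[of _ N])
 qed
 ultimately have "- (f x - f y) = (LINT z|?M. g z * ind {x<..y} z)"
  using LIMSEQ_unique by blast
 also have "... = (LINT z|lebesgue_on {x<..<y}. g z)"
 proof -
  have "(LINT z|?M. g z * ind {x<..y} z) = (LINT z|lebesgue. ind {a<..<b} z *\<^sub>R (g z * ind {x<..y} z))"
   by (subst integral_restrict_space) auto
  also have "... = (LINT z|lebesgue. ind {x<..<y} z *\<^sub>R g z)"
  proof (rule integral_cong_AE)
   have gm: "(\<lambda>z. ind {a<..<b} z *\<^sub>R g z) \<in> borel_measurable lebesgue"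
    using borel_measurable_integrable[OF g] by (subst (asm) borel_measurable_restrict_space_iff) auto
   show "(\<lambda>z. ind {a<..<b} z *\<^sub>R (g z * ind {x<..y} z)) \<in> borel_measurable lebesgue"
    using borel_measurable_times[OF gm borel_measurable_indicator, of "{x<..y}"] by (simp add: mult.assoc)
   have "(\<lambda>z. ind {a<..<b} z *\<^sub>R g z * ind {x<..<y} z) \<in> borel_measurable lebesgue"
    using borel_measurable_times[OF gm borel_measurable_indicator, of "{x<..<y}"] by simp
   moreover have "(\<lambda>z. ind {a<..<b} z *\<^sub>R g z * ind {x<..<y} z) = (\<lambda>z. ind {x<..<y} z *\<^sub>R g z)"
    using xy by (auto simp: indicator_def fun_eq_iff)
   ultimately show "(\<lambda>z. ind {x<..<y} z *\<^sub>R g z) \<in> borel_measurable lebesgue" by simp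
   have "AE z in lebesgue. z \<noteq> y" by (simp add: AE_completion AE_lborel_singleton)
   then show "AE z in lebesgue. ind {a<..<b} z *\<^sub>R (g z * ind {x<..y} z) = ind {x<..<y} z *\<^sub>R g z"
    using xy by (auto simp: indicator_def elim!: eventually_mono)
  qed
  also have "... = (LINT z|lebesgue_on {x<..<y}. g z)"
   by (subst integral_restrict_space) auto
  finally show ?thesis .
 qed
 finally show ?thesis by simp
qed


lemma lebesgue_on_integral_indicator:
 fixes g :: "real => real"
 assumes "S \<in> sets lebesgue"
 shows "(LINT t|lebesgue_on S. g t) = (LINT t|lebesgue. ind S t * g t)"
 using integral_restrict_space[of S lebesgue g] assms by simp

text \<open>The interior case on the intervals \<open>x + d n\<close>, \<open>y - d n\<close>
  shrinking towards the closed one: continuity of \<open>f\<close> up to the end points handles the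
  left side, dominated convergence the right side. Reaching \<open>a\<close> and \<open>b\<close> is
  what later gives access to boundary traces.\<close>

lemma weak_deriv_imp_integral:
 assumes f: "continuous_on {a..b} f" and g: "integrable (lebesgue_on {a<..<b}) g"
  and weak: "\<And>\<phi>. test_function {a<..<b} \<phi> ==>
   (LINT x|lebesgue_on {a<..<b}. f x * deriv \<phi> x) = - (LINT x|lebesgue_on {a<..<b}. g x * \<phi> x)"
  and xy: "a <= x" "x <= y" "y <= b"
 shows "f y - f x = (LINT t|lebesgue_on {x<..<y}. g t)"
proof (cases "x = y")
 case False
 then have "x < y" using xy by simp
 \<comment> \<open>The offset 3 keeps \<open>2 * d n\<close> below \<open>y - x\<close> already for
   \<open>n = 0\<close>.\<close>
 define d where "d n = (y - x) / real (n + 3)" for n :: nat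
 have d: "0 < d n" "x + d n < y - d n" for n
 proof -
  show "0 < d n" using \<open>x < y\<close> by (simp add: d_def)
  have "(y - x) * (2 / real (n + 3)) < (y - x) * 1"
   using \<open>x < y\<close> by (intro mult_strict_left_mono) (auto simp: field_simps)
  then have "2 * d n < y - x" by (simp add: d_def mult.commute)
  then show "x + d n < y - d n" by simp
 qed
 have dlim: "d \<longlonglongrightarrow> 0"
 proof -
  have "(\<lambda>n. (y - x) * (1 / real (n + 3))) \<longlonglongrightarrow> (y - x) * 0"
   using LIMSEQ_ignore_initial_segment[OF lim_1_over_n, of 3] by (intro tendsto_intros) simp
  then show ?thesis by (simp add: d_def[abs_def])
 qed
 have gi: "integrable lebesgue (\<lambda>t. ind {a<..<b} t * g t)"
  using g by (subst (asm) integrable_restrict_space) auto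
 have gm: "(\<lambda>t. ind A t * g t) \<in> borel_measurable lebesgue"
  if "A \<subseteq> {a<..<b}" "A \<in> sets lebesgue" for A
 proof -
  have "(\<lambda>t. ind A t * (ind {a<..<b} t * g t)) \<in> borel_measurable lebesgue"
   by (rule borel_measurable_times[OF borel_measurable_indicator borel_measurable_integrable[OF gi]]) (use that in auto)
  moreover have "(\<lambda>t. ind A t * (ind {a<..<b} t * g t)) = (\<lambda>t. ind A t * g t)"
   using that by (auto simp: indicator_def fun_eq_iff)
  ultimately show ?thesis by simp
 qed
 have "(\<lambda>n. LINT t|lebesgue. ind {x + d n<..<y - d n} t * g t) \<longlonglongrightarrow> (LINT t|lebesgue. ind {x<..<y} t * g t)"
 proof (rule integral_dominated_convergence[where w="\<lambda>t. \<bar>ind {a<..<b} t * g t\<bar>"])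
  show "integrable lebesgue (\<lambda>t. \<bar>ind {a<..<b} t * g t\<bar>)" using gi by auto
  show "(\<lambda>t. ind {x<..<y} t * g t) \<in> borel_measurable lebesgue"
   using xy by (intro gm) auto
  show "(\<lambda>t. ind {x + d n<..<y - d n} t * g t) \<in> borel_measurable lebesgue" for n
   using xy d[of n] by (intro gm) auto
  have "(\<lambda>n. ind {x + d n<..<y - d n} t) \<longlonglongrightarrow> indicat_real {x<..<y} t" for t
  proof (cases "t \<in> {x<..<y}")
   case True
   then have "0 < min (t - x) (y - t)" by auto
   from order_tendstoD(2)[OF dlim this]
   have "eventually (\<lambda>n. ind {x + d n<..<y - d n} t = indicat_real {x<..<y} t) sequentially"
    by eventually_elim (use True in \<open>auto simp: indicator_def\<close>)
   then show ?thesis by (rule tendsto_eventually)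
  next
   case False
   have "ind {x + d n<..<y - d n} t = indicat_real {x<..<y} t" for n
    using d(1)[of n] False by (auto simp: indicator_def)
   then show ?thesis by simp
  qed
  then show "AE t in lebesgue. (\<lambda>n. ind {x + d n<..<y - d n} t * g t) \<longlonglongrightarrow> ind {x<..<y} t * g t"
   by (auto intro!: tendsto_mult)
  show "AE t in lebesgue. norm (ind {x + d n<..<y - d n} t * g t) <= \<bar>ind {a<..<b} t * g t\<bar>" for n
   using xy d(1)[of n] by (auto simp: indicator_def)
 qed
 moreover have "(LINT t|lebesgue. ind {x + d n<..<y - d n} t * g t) = f (y - d n) - f (x + d n)" for n
  using weak_deriv_imp_integral_interior[OF f g weak, of "x + d n" "y - d n"] d[of n] xy
  by (simp add: lebesgue_on_integral_indicator)
 moreover have "(\<lambda>n. f (y - d n) - f (x + d n)) \<longlonglongrightarrow> f (y - 0) - f (x + 0)"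
 proof -
  have "y - d n \<in> {a..b}" "x + d n \<in> {a..b}" for n
   using d(1)[of n] d(2)[of n] xy by auto
  then show ?thesis
   using xy by (intro tendsto_diff continuous_on_tendsto_compose[OF f] tendsto_intros dlim) (auto intro!: always_eventually)
 qed
 ultimately have "f y - f x = (LINT t|lebesgue. ind {x<..<y} t * g t)"
  using LIMSEQ_unique by fastforce
 then show ?thesis by (simp add: lebesgue_on_integral_indicator)
qed (simp add: lebesgue_on_integral_indicator)

text \<open>The positive and the negative part of \<open>h\<close> are densities of two finite
  measures. By exhaustion they agree on every half-line \<open>{x<..}\<close>, hence everywhere, and
  densities are unique almost everywhere.\<close>

lemma AE_zero_if_interval_integrals_zero:
 fixes h :: "real => real"
 assumes h: "integrable lborel h" and 0: "\<And>x y. x < y ==> (LBINT t. ind {x<..<y} t * h t) = 0"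
 shows "AEL t. h t = 0"
proof -
 have hm[measurable]: "borel_fun h" using h by auto
 have Ioi: "(LBINT t. ind {x<..} t * h t) = 0" for x
 proof -
  have "(\<lambda>n. LBINT t. ind {x<..<x + real (Suc n)} t * h t) \<longlonglongrightarrow> (LBINT t. ind {x<..} t * h t)"
  proof (rule integral_dominated_convergence[where w="\<lambda>t. \<bar>h t\<bar>"])
   have "(\<lambda>n. ind {x<..<x + real (Suc n)} t) \<longlonglongrightarrow> indicat_real {x<..} t" for t
   proof -
    obtain m :: nat where "t - x < m" using reals_Archimedean2 by blast
    then have "eventually (\<lambda>n. ind {x<..<x + real (Suc n)} t = indicat_real {x<..} t) sequentially"
     unfolding eventually_sequentially by (intro exI[of _ m]) (auto simp: indicator_def)
    then show ?thesis by (rule tendsto_eventually)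
   qed
   then show "AEL t. (\<lambda>n. ind {x<..<x + real (Suc n)} t * h t) \<longlonglongrightarrow> ind {x<..} t * h t"
    by (auto intro!: tendsto_mult)
  qed (use h in \<open>auto simp: indicator_def\<close>)
  then show ?thesis using 0 by (simp add: LIMSEQ_const_iff)
 qed
 have hi: "integrable lborel (\<lambda>t. ind A t * max 0 (h t))" "integrable lborel (\<lambda>t. ind A t * max 0 (- h t))"
  if [measurable]: "A \<in> sets borel" for A
  by (rule integrable_bound[OF h]; auto simp: indicator_def)+
 have "density lborel (\<lambda>t. ennreal (max 0 (h t))) = density lborel (\<lambda>t. ennreal (max 0 (- h t)))"
 proof (rule measure_eqI_lessThan)
  fix x :: real
  have e: "emeasure (density lborel (\<lambda>t. ennreal (max 0 (s * h t)))) {x<..} = ennreal (LBINT t. ind {x<..} t * max 0 (s * h t))"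
   if "s = 1 \<or> s = -1" for s
   using hi[of "{x<..}"] that
   by (subst emeasure_density) (auto simp: nn_integral_eq_integral[symmetric] ennreal_mult' ennreal_indicator[symmetric] indicator_def
    intro!: nn_integral_cong)
  show "emeasure (density lborel (\<lambda>t. ennreal (max 0 (h t)))) {x<..} < \<infinity>" using e[of 1] by simp
  have "(LBINT t. ind {x<..} t * max 0 (h t)) - (LBINT t. ind {x<..} t * max 0 (- h t)) =
   (LBINT t. ind {x<..} t * h t)"
   by (subst integral_diff[symmetric, OF hi])
    (auto intro!: integral_cong split: split_indicator)
  then show "emeasure (density lborel (\<lambda>t. ennreal (max 0 (h t)))) {x<..} = emeasure (density lborel (\<lambda>t. ennreal (max 0 (- h t)))) {x<..}"
   using e[of 1] e[of "-1"] Ioi[of x] by simp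
 qed auto
 then have "AEL t. ennreal (max 0 (h t)) = ennreal (max 0 (- h t))"
  by (subst (asm) sigma_finite_measure.density_unique_iff[OF sigma_finite_lborel]) auto
 then show ?thesis
  by eventually_elim (auto simp: max_def split: if_splits)
qed

text \<open>Both terms on the right are the parts of the product integral over a triangle.\<close>

lemma integral_product_triangles:
 fixes g h :: "real => real"
 assumes g: "integrable lborel g" and h: "integrable lborel h"
 shows "(LBINT x. g x) * (LBINT x. h x) =
   (LBINT x. g x * (LBINT y. ind {..x} y * h y)) +
   (LBINT x. h x * (LBINT y. ind {..x} y * g y))"
proof -
 have [measurable]: "borel_fun g" "borel_fun h" using g h by auto
 let ?P = "\<lambda>(x, y). g x * h y"
 have P: "integrable lborel2 ?P"
  using lborel_pair.integrable_product_swap_iff lborel_pair.Fubini_integrable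
  by (intro lborel_pair.Fubini_integrable) (use g h in \<open>auto simp: abs_mult\<close>)
 have P1: "integrable lborel2 (\<lambda>(x, y). ind {..x} y * (g x * h y))"
  by (rule integrable_bound[OF P]) (auto simp: indicator_def)
 have P2: "integrable lborel2 (\<lambda>(x, y). ind {..<y} x * (g x * h y))"
  by (rule integrable_bound[OF P]) (auto simp: indicator_def)
 have "(LBINT x. g x) * (LBINT x. h x) = (LBINT x. LBINT y. g x * h y)" by simp
 also have "... = (LBINT x. (LBINT y. ind {..x} y * (g x * h y)) + (LBINT y. ind {..<y} x * (g x * h y)))"
 proof (rule integral_cong_AE)
  have "AEL x. integrable lborel (\<lambda>y. ind {..x} y * (g x * h y))"
   using lborel_pair.AE_integrable_fst[OF P1] by simp
  moreover have "AEL x. integrable lborel (\<lambda>y. ind {..<y} x * (g x * h y))"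
   using lborel_pair.AE_integrable_fst[OF P2] by simp
  ultimately show "AEL x. (LBINT y. g x * h y) =
   (LBINT y. ind {..x} y * (g x * h y)) + (LBINT y. ind {..<y} x * (g x * h y))"
   by eventually_elim
    (subst integral_add[symmetric], assumption, assumption,
     rule integral_cong, auto split: split_indicator)
  show "(\<lambda>x. LBINT y. g x * h y) \<in> borel_measurable lborel" by simp
  show "(\<lambda>x. (LBINT y. ind {..x} y * (g x * h y)) + (LBINT y. ind {..<y} x * (g x * h y)))
   \<in> borel_measurable lborel"
   using lborel_pair.integrable_fst[OF P1] lborel_pair.integrable_fst[OF P2] by (intro borel_measurable_add) auto
 qed
 also have "... = (LBINT x. LBINT y. ind {..x} y * (g x * h y)) +
   (LBINT x. LBINT y. ind {..<y} x * (g x * h y))"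
  using lborel_pair.integrable_fst[OF P1] lborel_pair.integrable_fst[OF P2] by (intro integral_add) auto
 also have "(LBINT x. LBINT y. ind {..<y} x * (g x * h y)) = (LBINT y. LBINT x. ind {..<y} x * (g x * h y))"
  using lborel_pair.Fubini_integral[OF P2] by simp
 also have "... = (LBINT y. h y * (LBINT x. ind {..y} x * g x))"
 proof (rule integral_cong[OF refl])
  fix y
  have "(LBINT x. ind {..<y} x * (g x * h y)) = (LBINT x. h y * (ind {..y} x * g x))"
  proof (rule integral_cong_AE)
   have "AEL x. x \<noteq> y" by (rule AE_lborel_singleton)
   then show "AEL x. ind {..<y} x * (g x * h y) = h y * (ind {..y} x * g x)"
    by eventually_elim (auto simp: indicator_def)
  qed auto
  then show "(LBINT x. ind {..<y} x * (g x * h y)) = h y * (LBINT x. ind {..y} x * g x)"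
   by simp
 qed
 also have "(LBINT x. LBINT y. ind {..x} y * (g x * h y)) = (LBINT x. g x * (LBINT y. ind {..x} y * h y))"
 proof (rule integral_cong[OF refl])
  fix x
  have "(LBINT y. ind {..x} y * (g x * h y)) = (LBINT y. g x * (ind {..x} y * h y))"
   by (rule integral_cong) auto
  then show "(LBINT y. ind {..x} y * (g x * h y)) = g x * (LBINT y. ind {..x} y * h y)"
   by simp
 qed
 finally show ?thesis .
qed

section \<open>Integrals in slanted coordinates\<close>

lemma measurable_curried2:
 assumes "(\<lambda>z. \<phi> (fst z) (snd z)) \<in> M1 \<Otimes>\<^sub>M M2 \<rightarrow>\<^sub>M M" "g \<in> N \<rightarrow>\<^sub>M M1" "h \<in> N \<rightarrow>\<^sub>M M2"
 shows "(\<lambda>x. \<phi> (g x) (h x)) \<in> N \<rightarrow>\<^sub>M M"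
 using measurable_compose[OF measurable_Pair[OF assms(2,3)] assms(1)] by simp

text \<open>On each line of constant \<open>y\<close> the shear is a translation, which preserves
  null sets; Fubini is applied before and after. With \<open>c = -1\<close> the new coordinate
  \<open>s = t + y\<close> labels the characteristics travelling to the left.\<close>

lemma AE_shear:
 fixes c :: real
 assumes Pm: "Measurable.pred (borel \<Otimes>\<^sub>M borel) (\<lambda>z. P (fst z) (snd z))"
  and P: "AEL t. AEL x. P t x"
 shows "AEL s. AEL y. P (s + c * y) (y::real)"
proof -
 note [measurable (raw)] = measurable_curried2[OF Pm]
 have meas: "{z \<in> space lborel2. P (fst z) (snd z)} \<in> sets lborel2"
  by measurable
 have "AEL y. AEL t. P t y"
  using P lborel_pair.AE_commute[OF meas] by simp
 then have "AEL y. AEL s. P (s + c * y) y"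
 proof eventually_elim
  fix y assume *: "AEL t. P t y"
  have Py: "{t \<in> space borel. P t y} \<in> sets borel" by measurable
  have "AE t in distr lborel borel ((+) (c * y)). P t y"
   unfolding lborel_distr_plus by (rule *)
  then have "AEL s. P (c * y + s) y"
   by (subst (asm) AE_distr_iff) (use Py in auto)
  then show "AEL s. P (s + c * y) y" by (simp add: add.commute)
 qed
 moreover have "{z \<in> space lborel2. P (fst z + c * snd z) (snd z)} \<in> sets lborel2"
  by measurable
 ultimately show ?thesis
  using lborel_pair.AE_commute[of "\<lambda>s y. P (s + c * y) y"] by simp
qed

lemma nn_integral_translate:
 fixes \<phi> :: "real => ennreal"
 assumes [measurable]: "borel_fun \<phi>"
 shows "(NBINT s. \<phi> (s + c)) = (NBINT s. \<phi> s)"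
 using nn_integral_real_affine[of \<phi> 1 c] by (simp add: add.commute)

lemma nn_integral_shear:
 fixes \<phi> :: "real => real => ennreal"
 assumes \<phi>: "joint_borel \<phi>"
 shows "(NBINT s y. \<phi> (s + c * y) y) = (NBINT t y. \<phi> t y)"
proof -
 note [measurable (raw)] = measurable_curried2[OF \<phi>]
 have "(NBINT s y. \<phi> (s + c * y) y) = (NBINT y s. \<phi> (s + c * y) y)"
  using lborel_pair.Fubini'[of "\<lambda>s y. \<phi> (s + c * y) y"] by (simp add: split_beta')
 also have "... = (NBINT y s. \<phi> s y)"
  by (intro nn_integral_cong nn_integral_translate) measurable
 also have "... = (NBINT t y. \<phi> t y)"
  using lborel_pair.Fubini'[of \<phi>] by (simp add: split_beta')
 finally show ?thesis .
qed

text \<open>As for null sets: in the order of integration with \<open>y\<close> outside, the shear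
  is a translation of the inner variable and so has unit Jacobian.\<close>

lemma integral_shear:
 fixes \<phi> :: "real => real => real"
 assumes \<phi>: "integrable lborel2 (\<lambda>z. \<phi> (fst z) (snd z))"
 shows "integrable lborel2 (\<lambda>z. \<phi> (fst z + c * snd z) (snd z))"
  and "(LBINT s. LBINT y. \<phi> (s + c * y) y) = (LBINT t. LBINT y. \<phi> t y)"
proof -
 have meas[measurable]: "joint_borel \<phi>"
  using borel_measurable_integrable[OF \<phi>] by (simp add: measurable_lborel1 measurable_cong_sets[OF sets_pair_measure_cong[OF sets_lborel sets_lborel] refl])
 note [measurable (raw)] = measurable_curried2[OF meas]
 have fin: "(NBINT t y. ennreal (norm (\<phi> t y))) < \<infinity>"
  using \<phi> by (simp add: integrable_iff_bounded lborel.nn_integral_fst[symmetric] split_beta')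
 show int: "integrable lborel2 (\<lambda>z. \<phi> (fst z + c * snd z) (snd z))"
  using fin nn_integral_shear[of "\<lambda>t y. ennreal (norm (\<phi> t y))" c]
  by (simp add: integrable_iff_bounded lborel.nn_integral_fst[symmetric] split_beta')
 have "(LBINT s. LBINT y. \<phi> (s + c * y) y) = (LBINT y. LBINT s. \<phi> (s + c * y) y)"
  using lborel_pair.Fubini_integral[of "\<lambda>s y. \<phi> (s + c * y) y"] int by (simp add: split_beta')
 also have "... = (LBINT y. LBINT s. \<phi> s y)"
  using lborel_integral_real_affine[of 1 "\<lambda>s. \<phi> s y" "c * y" for y] by (simp add: add.commute)
 also have "... = (LBINT t. LBINT y. \<phi> t y)"
  using lborel_pair.Fubini_integral[of \<phi>] \<phi> by (simp add: split_beta')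
 finally show "(LBINT s. LBINT y. \<phi> (s + c * y) y) = (LBINT t. LBINT y. \<phi> t y)" .
qed

lemma integrable_of_square:
 fixes \<phi> :: "real => real"
 assumes [measurable]: "borel_fun \<phi>" "A \<in> sets borel"
  and A: "emeasure lborel A < \<infinity>" "\<And>y. y \<notin> A ==> \<phi> y = 0"
  and fin: "(NBINT y. ennreal ((\<phi> y)^2)) < \<infinity>"
 shows "integrable lborel \<phi>" "integrable lborel (\<lambda>y. (\<phi> y)^2)"
proof -
 show sq: "integrable lborel (\<lambda>y. (\<phi> y)^2)"
  using fin by (simp add: integrable_iff_bounded)
 have "integrable lborel (\<lambda>y. (\<phi> y)^2 + ind A y)"
  using sq A by (intro integrable_add integrable_real_indicator) auto
 then show "integrable lborel \<phi>"
 proof (rule integrable_bound)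
  have "\<bar>\<phi> y\<bar> <= (\<phi> y)^2 + ind A y" for y
  proof (cases "y \<in> A")
   case True
   have "0 <= (\<bar>\<phi> y\<bar> - 1)^2" by simp
   then show ?thesis using True by (simp add: power2_diff)
  qed (use A in auto)
  then show "AEL y. norm (\<phi> y) <= norm ((\<phi> y)^2 + ind A y)" by (auto intro!: AE_I2 order_trans[OF _ abs_ge_self])
 qed auto
qed

text \<open>With \<open>m\<close> the integral of \<open>\<phi>\<close>, expanding the integral of
  \<open>(\<phi> - m)^2\<close> over \<open>A\<close> gives \<open>m^2 * (2 - |A|)\<close> as a
  lower bound for the integral of \<open>\<phi>^2\<close>, and \<open>|A|\<close> is at most 1. The
  \<open>ennreal\<close> form also covers an infinite right side, so it can be applied on every
  characteristic.\<close>

lemma Cauchy_Schwarz_unit: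
 fixes \<phi> :: "real => real"
 assumes [measurable]: "borel_fun \<phi>" "A \<in> sets borel"
  and A: "emeasure lborel A <= 1" "\<And>y. y \<notin> A ==> \<phi> y = 0"
 shows "ennreal ((LBINT y. \<phi> y)^2) <= (NBINT y. ennreal ((\<phi> y)^2))"
proof (cases "(NBINT y. ennreal ((\<phi> y)^2)) < \<infinity>")
 case True
 have Afin: "emeasure lborel A < \<infinity>" using A(1) by (auto intro: le_less_trans)
 note int = integrable_of_square[OF assms(1,2) Afin A(2) True]
 define m where "m = (LBINT y. \<phi> y)"
 have Am: "integrable lborel (\<lambda>y. m^2 * indicat_real A y)" using Afin by auto
 have "0 <= (LBINT y. (\<phi> y)^2 - 2 * m * \<phi> y + m^2 * ind A y)"
 proof (rule integral_nonneg_AE[OF AE_I2])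
  fix y
  have "0 <= (\<phi> y - m)^2" by simp
  then show "0 <= (\<phi> y)^2 - 2 * m * \<phi> y + m^2 * ind A y"
   using A(2)[of y] by (cases "y \<in> A") (auto simp: power2_diff algebra_simps)
 qed
 also have "... = (LBINT y. (\<phi> y)^2) - 2 * m * m + m^2 * measure lborel A"
  using int Am Afin by (subst integral_add integral_diff; simp add: m_def)+
 finally have "m^2 * (2 - measure lborel A) <= (LBINT y. (\<phi> y)^2)"
  by (simp add: power2_eq_square algebra_simps)
 moreover have "measure lborel A <= 1" using A(1) by (simp add: measure_def enn2real_leI)
 then have "m^2 * 1 <= m^2 * (2 - measure lborel A)" by (intro mult_left_mono) auto
 ultimately have "m^2 <= (LBINT y. (\<phi> y)^2)" by simp
 then show ?thesis using int by (simp add: nn_integral_eq_integral m_def)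
qed (auto simp: not_less top_unique)

lemma primitive_diff:
 fixes G :: "real => real"
 assumes G: "integrable lborel G" and y: "0 <= y1" "y1 <= y2"
 shows "(LBINT y. ind {0<..<y2} y * G y) - (LBINT y. ind {0<..<y1} y * G y) =
  (LBINT y. ind {y1<..<y2} y * G y)"
proof -
 have i: "integrable lborel (\<lambda>y. ind A y * G y)" if "A \<in> sets borel" for A
  using integrable_mult_indicator[OF _ G, of A] that by simp
 have "(LBINT y. ind {0<..<y2} y * G y) - (LBINT y. ind {0<..<y1} y * G y)
  = (LBINT y. ind {0<..<y2} y * G y - ind {0<..<y1} y * G y)"
  by (intro integral_diff[symmetric] i) auto
 also have "... = (LBINT y. ind {y1<..<y2} y * G y)"
 proof (rule integral_cong_AE)
  have "AEL y. y \<noteq> y1" "AEL y. y \<noteq> 0" by (rule AE_lborel_singleton)+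
  then show "AEL y. ind {0<..<y2} y * G y - ind {0<..<y1} y * G y = ind {y1<..<y2} y * G y"
   by eventually_elim (use y in \<open>auto simp: indicator_def\<close>)
 qed (use borel_measurable_integrable[OF G] in auto)
 finally show ?thesis .
qed

text \<open>Integration by parts for primitives of integrable functions. The product of the
  increments of \<open>A\<close> and \<open>B\<close> is a product of two integrals; its two
  triangles have the inner integrals \<open>B u - B y1\<close> and \<open>A u - A y1\<close>, and
  rearranging gives the product rule.\<close>

lemma primitive_product:
 fixes G H :: "real => real"
 assumes G: "integrable lborel G" and H: "integrable lborel H"
  and A: "\<And>y. A y = A0 + (LBINT u. ind {0<..<y} u * G u)"
  and B: "\<And>y. B y = B0 + (LBINT u. ind {0<..<y} u * H u)"
  and y: "0 <= y1" "y1 <= y2"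
 shows "A y2 * B y2 - A y1 * B y1 = (LBINT u. ind {y1<..<y2} u * (G u * B u + H u * A u))"
  and "integrable lborel (\<lambda>u. ind {y1<..<y2} u * (G u * B u + H u * A u))"
proof -
 have prim: "integrable lborel (\<lambda>u. ind S u * X u)" if "integrable lborel X" "S \<in> sets borel" for S and X :: "real => real"
  using integrable_mult_indicator[OF _ that(1), of S] that(2) by simp
 let ?g = "\<lambda>u. ind {y1<..<y2} u * G u" and ?h = "\<lambda>u. ind {y1<..<y2} u * H u"
 have part: "ind {y1<..<y2} u * G u * (LBINT v. ind {..u} v * (ind {y1<..<y2} v * X v)) =
   ind {y1<..<y2} u * (G u * ((LBINT v. ind {0<..<u} v * X v) - (LBINT v. ind {0<..<y1} v * X v)))"
  if X: "integrable lborel X" for u and G X :: "real => real"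
 proof (cases "u \<in> {y1<..<y2}")
  case True
  have "(LBINT v. ind {..u} v * (ind {y1<..<y2} v * X v)) = (LBINT v. ind {y1<..<u} v * X v)"
  proof (rule integral_cong_AE)
   have "AEL v. v \<noteq> u" by (rule AE_lborel_singleton)
   then show "AEL v. ind {..u} v * (ind {y1<..<y2} v * X v) = ind {y1<..<u} v * X v"
    by eventually_elim (use True in \<open>auto simp: indicator_def\<close>)
  qed (use borel_measurable_integrable[OF X] in auto)
  then show ?thesis using primitive_diff[OF X y(1), of u] True by simp
 qed simp
 have bnd: "\<bar>LBINT v. ind {0<..<u} v * X v\<bar> <= (LBINT v. \<bar>X v\<bar>)" if X: "integrable lborel X" for u and X :: "real => real"
 proof -
  have "\<bar>LBINT v. ind {0<..<u} v * X v\<bar> <= (LBINT v. \<bar>ind {0<..<u} v * X v\<bar>)"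
   by (rule integral_abs_bound)
  also have "... <= (LBINT v. \<bar>X v\<bar>)"
   by (intro integral_mono integrable_abs prim X) (auto simp: indicator_def)
  finally show ?thesis .
 qed
 have [measurable]: "borel_fun G" "borel_fun H" using G H by auto
 \<comment> \<open>The inner primitive is bounded by the \<open>L^1\<close> norm of
   \<open>X\<close>, so multiplying by it preserves integrability.\<close>
 have ineq: "integrable lborel (\<lambda>u. ind {y1<..<y2} u * (G u * (LBINT v. ind {0<..<u} v * X v)))"
  if X: "integrable lborel X" and G: "integrable lborel G" for X G :: "real => real"
 proof (rule integrable_bound)
  have [measurable]: "borel_fun G" "borel_fun X" using X G by auto
  show "integrable lborel (\<lambda>u. G u * (LBINT v. \<bar>X v\<bar>))" using G by auto
  show "(\<lambda>u. ind {y1<..<y2} u * (G u * (LBINT v. ind {0<..<u} v * X v))) \<in> borel_measurable lborel"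
  proof -
   have "(\<lambda>u. LBINT v. (if 0 < v \<and> v < u then X v else 0)) \<in> borel_measurable borel" by measurable
   moreover have "(\<lambda>u. LBINT v. (if 0 < v \<and> v < u then X v else 0)) = (\<lambda>u. LBINT v. ind {0<..<u} v * X v)"
    by (intro ext integral_cong) (auto simp: indicator_def)
   ultimately have [measurable]: "(\<lambda>u. LBINT v. ind {0<..<u} v * X v) \<in> borel_measurable borel" by simp
   show ?thesis by measurable
  qed
  show "AEL u. norm (ind {y1<..<y2} u * (G u * (LBINT v. ind {0<..<u} v * X v))) <= norm (G u * (LBINT v. \<bar>X v\<bar>))"
  proof (intro AE_I2)
   fix u
   have "\<bar>G u\<bar> * \<bar>LBINT v. ind {0<..<u} v * X v\<bar> <= \<bar>G u\<bar> * \<bar>LBINT v. \<bar>X v\<bar>\<bar>"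
    using order_trans[OF bnd[OF X] abs_ge_self] by (intro mult_left_mono) auto
   then show "norm (ind {y1<..<y2} u * (G u * (LBINT v. ind {0<..<u} v * X v))) <= norm (G u * (LBINT v. \<bar>X v\<bar>))"
    by (cases "u \<in> {y1<..<y2}") (auto simp: abs_mult)
  qed
 qed
 have i1: "integrable lborel (\<lambda>u. ind {y1<..<y2} u * (G u * B u))" "integrable lborel (\<lambda>u. ind {y1<..<y2} u * (H u * A u))"
  using ineq[OF H G] ineq[OF G H] prim[OF G, of "{y1<..<y2}"] prim[OF H, of "{y1<..<y2}"] unfolding A B
  by (auto simp: algebra_simps)
 then show int: "integrable lborel (\<lambda>u. ind {y1<..<y2} u * (G u * B u + H u * A u))"
  using integrable_add[OF i1] by (simp add: algebra_simps)
 have Ad: "A y2 - A y1 = (LBINT u. ?g u)" and Bd: "B y2 - B y1 = (LBINT u. ?h u)"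
  using primitive_diff[OF G y] primitive_diff[OF H y] by (auto simp: A B)
 have "(A y2 - A y1) * (B y2 - B y1) =
   (LBINT u. ?g u * (LBINT v. ind {..u} v * ?h v)) + (LBINT u. ?h u * (LBINT v. ind {..u} v * ?g v))"
  unfolding Ad Bd by (rule integral_product_triangles) (auto intro: prim G H)
 also have "... = (LBINT u. ind {y1<..<y2} u * (G u * (B u - B y1))) + (LBINT u. ind {y1<..<y2} u * (H u * (A u - A y1)))"
  unfolding part[OF H] part[OF G] A B by simp
 also have "(LBINT u. ind {y1<..<y2} u * (G u * (B u - B y1))) =
   (LBINT u. ind {y1<..<y2} u * (G u * B u) - B y1 * ?g u)"
  by (rule integral_cong) (auto simp: algebra_simps)
 also have "... = (LBINT u. ind {y1<..<y2} u * (G u * B u)) - B y1 * (A y2 - A y1)"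
  using i1 prim[OF G, of "{y1<..<y2}"] by (subst integral_diff) (auto simp: Ad)
 also have "(LBINT u. ind {y1<..<y2} u * (H u * (A u - A y1))) =
   (LBINT u. ind {y1<..<y2} u * (H u * A u) - A y1 * ?h u)"
  by (rule integral_cong) (auto simp: algebra_simps)
 also have "... = (LBINT u. ind {y1<..<y2} u * (H u * A u)) - A y1 * (B y2 - B y1)"
  using i1 prim[OF H, of "{y1<..<y2}"] by (subst integral_diff) (auto simp: Bd)
 finally have "A y2 * B y2 - A y1 * B y1 = (LBINT u. ind {y1<..<y2} u * (G u * B u)) + (LBINT u. ind {y1<..<y2} u * (H u * A u))"
  by (simp add: algebra_simps)
 also have "... = (LBINT u. ind {y1<..<y2} u * (G u * B u + H u * A u))"
  using integral_add[OF i1] by (simp add: algebra_simps)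
 finally show "A y2 * B y2 - A y1 * B y1 = (LBINT u. ind {y1<..<y2} u * (G u * B u + H u * A u))" .
qed

section \<open>Transport along characteristics\<close>

lemma measurable_lborel_pair: "measurable lborel2 M = measurable (borel \<Otimes>\<^sub>M borel) M"
 by (intro measurable_cong_sets sets_pair_measure_cong) auto

text \<open>
 \<open>r\<close> solves \<open>r\<^sub>t - r\<^sub>x = - g\<close> on \<open>t > 0\<close>, \<open>0 < x < 1\<close> and has the trace \<open>F\<close> at \<open>x = 0\<close>, where the
 characteristics leave the strip.
\<close>

locale transport =
 fixes r g :: "real => real => real" and F :: "real => real"
 assumes r_meas: "joint_borel r"
  and g_meas: "joint_borel g"
  and F_meas[measurable]: "borel_fun F"
  and r_supp: "\<And>t x. \<not> (0 < t \<and> 0 < x \<and> x < 1) ==> r t x = 0"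
  and g_supp: "\<And>t x. \<not> (0 < t \<and> 0 < x \<and> x < 1) ==> g t x = 0"
  and F_supp: "\<And>t. t <= 0 ==> F t = 0"
  and r_sq: "\<And>T. (NBINT t x. ind {..T} t * ennreal ((r t x)^2)) < \<infinity>"
  and g_sq: "\<And>T. (NBINT t x. ind {..T} t * ennreal ((g t x)^2)) < \<infinity>"
  and F_sq: "\<And>T. (NBINT t. ind {..T} t * ennreal ((F t)^2)) < \<infinity>"
  and char: "AEL t. AEL x. 0 < t --> 0 < x --> x < 1 -->
   r t x = F (t + x) + (LBINT y. ind {0<..<x} y * g (t + x - y) y)"
begin

lemmas r_meas2[measurable (raw)] = measurable_curried2[OF r_meas]
lemmas g_meas2[measurable (raw)] = measurable_curried2[OF g_meas]

text \<open>A characteristic is labelled by \<open>s = t + x\<close> and parametrised by its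
  abscissa \<open>y\<close>, reached at time \<open>s - y\<close>; moving forward in time means
  decreasing \<open>y\<close>. Unlike \<open>r (s - y) y\<close>, which is determined only almost
  everywhere, this version can be evaluated at every \<open>y\<close>, in particular at
  \<open>y = 1\<close>.\<close>

definition R :: "real => real => real" where
 "R s y = F s + (LBINT u. ind {0<..<y} u * g (s - u) u)"

lemma R_meas: "joint_borel R"
proof -
 have "(\<lambda>z. F (fst z) + (LBINT u. (if 0 < u \<and> u < snd z then g (fst z - u) u else 0))) \<in> borel_measurable (borel \<Otimes>\<^sub>M borel)"
  by measurable
 moreover have "(LBINT u. (if 0 < u \<and> u < y then g (s - u) u else 0)) = (LBINT u. ind {0<..<y} u * g (s - u) u)" for s y
  by (intro integral_cong) (auto simp: indicator_def)
 ultimately show ?thesis by (simp add: R_def)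
qed

lemmas R_meas2[measurable (raw)] = measurable_curried2[OF R_meas]

lemma R_0: "R s 0 = F s" by (simp add: R_def)

definition regular :: "real => bool" where
 "regular s \<longleftrightarrow> (NBINT y. ennreal ((g (s - y) y)^2)) < \<infinity>"

lemma AE_regular: "AEL s. regular s"
proof -
 have "AEL s. (NBINT y. ind {..real n} (s - y) * ennreal ((g (s - y) y)^2)) \<noteq> \<infinity>" for n
  using nn_integral_shear[of "\<lambda>t y. ind {..real n} t * ennreal ((g t y)^2)" "-1"] g_sq[of n]
  by (intro nn_integral_noteq_infinite) auto
 then have "AEL s. \<forall>n. (NBINT y. ind {..real n} (s - y) * ennreal ((g (s - y) y)^2)) \<noteq> \<infinity>"
  by (subst AE_all_countable) auto
 then show ?thesis
 proof eventually_elim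
  case (elim s)
  obtain n :: nat where "s <= n" using real_arch_simple by blast
  then have "(NBINT y. ind {..real n} (s - y) * ennreal ((g (s - y) y)^2)) = (NBINT y. ennreal ((g (s - y) y)^2))"
   using g_supp[of "s - y" y for y] by (intro nn_integral_cong) (force simp: indicator_def)
  then show ?case using elim[rule_format, of n] by (simp add: regular_def less_top)
 qed
qed

lemma regular_integrable:
 assumes "regular s"
 shows "integrable lborel (\<lambda>y. g (s - y) y)" "integrable lborel (\<lambda>y. (g (s - y) y)^2)"
 using integrable_of_square[of "\<lambda>y. g (s - y) y" "{0<..<1}"] assms g_supp by (auto simp: regular_def)

lemma R_diff:
 assumes "regular s" "0 <= y1" "y1 <= y2"
 shows "R s y2 - R s y1 = (LBINT u. ind {y1<..<y2} u * g (s - u) u)"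
 using primitive_diff[OF regular_integrable(1)] assms by (simp add: R_def)

lemma R_square_diff:
 assumes "regular s" "0 <= y1" "y1 <= y2"
 shows "(R s y2)^2 - (R s y1)^2 = (LBINT u. ind {y1<..<y2} u * (2 * (g (s - u) u * R s u)))"
 using primitive_product(1)[OF regular_integrable(1)[OF assms(1)] regular_integrable(1)[OF assms(1)] R_def R_def assms(2,3)]
 by (simp add: power2_eq_square mult.commute)

lemma R_square_le:
 "ennreal ((R s y)^2) <= 2 * ennreal ((F s)^2) + 2 * (NBINT u. ind {0<..<y} u * ennreal ((g (s - u) u)^2))"
proof -
 let ?I = "LBINT u. ind {0<..<y} u * g (s - u) u"
 have "ennreal (?I\<^sup>2) <= (NBINT u. ennreal ((ind {0<..<y} u * g (s - u) u)^2))"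
  by (rule Cauchy_Schwarz_unit[of _ "{0<..<1}"]) (auto simp: g_supp)
 also have "... = (NBINT u. ind {0<..<y} u * ennreal ((g (s - u) u)^2))"
  by (intro nn_integral_cong) (auto simp: indicator_def)
 finally have I: "ennreal (?I\<^sup>2) <= (NBINT u. ind {0<..<y} u * ennreal ((g (s - u) u)^2))" .
 have "(F s + ?I)^2 <= 2 * (F s)^2 + 2 * ?I\<^sup>2"
  using sum_squares_bound[of "F s" ?I] by (simp add: power2_sum)
 then have "ennreal ((R s y)^2) <= ennreal (2 * (F s)^2 + 2 * ?I\<^sup>2)"
  unfolding R_def by (rule ennreal_leI)
 also have "... = 2 * ennreal ((F s)^2) + 2 * ennreal (?I\<^sup>2)" by (simp add: ennreal_mult)
 also have "... <= 2 * ennreal ((F s)^2) + 2 * (NBINT u. ind {0<..<y} u * ennreal ((g (s - u) u)^2))"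
  by (intro add_left_mono mult_left_mono I) auto
 finally show ?thesis .
qed

text \<open>The times at which the energy may be evaluated: the formula \<open>char\<close> holds
  only for almost every time, so every statement on a time slice has to avoid a null set of
  times.\<close>

definition good :: "real => bool" where
 "good t \<longleftrightarrow> 0 < t \<and> (NBINT x. ennreal ((r t x)^2)) < \<infinity> \<and>
  (AEL x. 0 < x --> x < 1 --> r t x = R (t + x) x)"

lemma AE_good: "AEL t. 0 < t --> good t"
proof -
 have "AEL t. (NBINT x. ind {..real n} t * ennreal ((r t x)^2)) \<noteq> \<infinity>" for n
  using r_sq[of n] by (intro nn_integral_noteq_infinite) auto
 then have "AEL t. \<forall>n. (NBINT x. ind {..real n} t * ennreal ((r t x)^2)) \<noteq> \<infinity>"
  by (subst AE_all_countable) auto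
 with char show ?thesis
 proof eventually_elim
  case (elim t)
  obtain n :: nat where "t <= n" using real_arch_simple by blast
  then have "(NBINT x. ennreal ((r t x)^2)) < \<infinity>"
   using elim(2) by (auto simp: less_top dest: spec[of _ n])
  then show ?case using elim(1) by (auto simp: good_def R_def)
 qed
qed

lemma AE_char: "AEL s. AEL y. 0 < y --> y < 1 --> y < s --> r (s - y) y = R s y"
proof -
 have "AEL s. AEL y. 0 < s + (-1) * y --> 0 < y --> y < 1 --> r (s + (-1) * y) y = R (s + (-1) * y + y) y"
 proof (rule AE_shear[where P="\<lambda>t x. 0 < t --> 0 < x --> x < 1 --> r t x = R (t + x) x"])
  show "AEL t. AEL x. 0 < t --> 0 < x --> x < 1 --> r t x = R (t + x) x"
   using char by (simp add: R_def)
 qed measurable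
 then show ?thesis by (rule AE_mp) (auto intro!: AE_I2 elim!: eventually_mono)
qed

lemma good_integrable:
 assumes "good t"
 shows "integrable lborel (r t)" "integrable lborel (\<lambda>x. (r t x)^2)"
 using integrable_of_square[of "r t" "{0<..<1}"] assms r_supp by (auto simp: good_def)

lemma good_integral_square:
 assumes "good t"
 shows "(LBINT x. (r t x)^2) = (LBINT s. ind {t<..<t + 1} s * (R s (s - t))^2)"
  and "integrable lborel (\<lambda>s. ind {t<..<t + 1} s * (R s (s - t))^2)"
proof -
 have ae: "AEL x. (r t x)^2 = ind {t<..<t + 1} (t + x) * (R (t + x) ((t + x) - t))^2"
  using assms unfolding good_def
  by (auto elim!: eventually_mono simp: indicator_def r_supp)
 have "(LBINT x. (r t x)^2) = (LBINT x. ind {t<..<t + 1} (t + x) * (R (t + x) ((t + x) - t))^2)"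
  by (rule integral_cong_AE[OF _ _ ae]) measurable
 also have "... = (LBINT s. ind {t<..<t + 1} s * (R s (s - t))^2)"
  using lborel_integral_real_affine[of 1 "\<lambda>s. ind {t<..<t + 1} s * (R s (s - t))^2" t] by simp
 finally show "(LBINT x. (r t x)^2) = (LBINT s. ind {t<..<t + 1} s * (R s (s - t))^2)" .
 have "integrable lborel (\<lambda>x. ind {t<..<t + 1} (t + x) * (R (t + x) ((t + x) - t))^2)"
  by (rule integrable_cong_AE_imp[OF good_integrable(2)[OF assms] _ ]) (measurable, use ae in \<open>auto elim: eventually_mono\<close>)
 then show "integrable lborel (\<lambda>s. ind {t<..<t + 1} s * (R s (s - t))^2)"
  using lborel_integrable_real_affine_iff[of 1 "\<lambda>s. ind {t<..<t + 1} s * (R s (s - t))^2" t] by simp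
qed

lemma F_square_integrable: "integrable lborel (\<lambda>s. ind {a<..<b} s * (F s)^2)"
proof -
 have "(NBINT s. ennreal (norm (ind {a<..<b} s * (F s)^2))) <= (NBINT t. ind {..b} t * ennreal ((F t)^2))"
  by (intro nn_integral_mono) (auto simp: indicator_def)
 also have "... < \<infinity>" by (rule F_sq)
 finally show ?thesis by (simp add: integrable_iff_bounded)
qed

text \<open>The characteristic with label \<open>t + 1\<close> is at \<open>x = 1\<close> at time
  \<open>t\<close> and at \<open>x = 0\<close> one unit later. Hence the window for \<open>F\<close>
  is shifted by one, and the source is seen over the union of both windows.\<close>

lemma exit_square_le:
 "(NBINT t. ind {a<..<b} t * ennreal ((R (t + 1) 1)^2)) <=
  2 * (NBINT t. ind {a + 1<..<b + 1} t * ennreal ((F t)^2)) +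
  2 * (NBINT t x. ind {a<..<b + 1} t * ennreal ((g t x)^2))"
proof -
 have "(NBINT t. ind {a<..<b} t * ennreal ((R (t + 1) 1)^2)) =
  (NBINT t. ind {a + 1<..<b + 1} (t + 1) * ennreal ((R (t + 1) 1)^2))"
  by (intro nn_integral_cong) (auto simp: indicator_def)
 also have "... = (NBINT s. ind {a + 1<..<b + 1} s * ennreal ((R s 1)^2))"
  by (rule nn_integral_translate[of "\<lambda>s. ind {a + 1<..<b + 1} s * ennreal ((R s 1)^2)"]) measurable
 also have "... <= (NBINT s. 2 * (ind {a + 1<..<b + 1} s * ennreal ((F s)^2)) +
   2 * (NBINT u. ind {a<..<b + 1} (s + (-1) * u) * ennreal ((g (s + (-1) * u) u)^2)))"
 proof (rule nn_integral_mono)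
  fix s :: real
  show "ind {a + 1<..<b + 1} s * ennreal ((R s 1)^2) <= 2 * (ind {a + 1<..<b + 1} s * ennreal ((F s)^2)) +
   2 * (NBINT u. ind {a<..<b + 1} (s + (-1) * u) * ennreal ((g (s + (-1) * u) u)^2))"
  proof (cases "s \<in> {a + 1<..<b + 1}")
   case True
   have "(NBINT u. ind {0<..<1} u * ennreal ((g (s - u) u)^2)) <=
    (NBINT u. ind {a<..<b + 1} (s + (-1) * u) * ennreal ((g (s + (-1) * u) u)^2))"
    using True by (intro nn_integral_mono) (auto simp: indicator_def)
   then have "2 * ennreal ((F s)^2) + 2 * (NBINT u. ind {0<..<1} u * ennreal ((g (s - u) u)^2)) <=
    2 * ennreal ((F s)^2) + 2 * (NBINT u. ind {a<..<b + 1} (s + (-1) * u) * ennreal ((g (s + (-1) * u) u)^2))"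
    by (intro add_left_mono mult_left_mono) auto
   with R_square_le[of s 1] show ?thesis using True by (auto intro: order_trans)
  qed simp
 qed
 also have "... = 2 * (NBINT t. ind {a + 1<..<b + 1} t * ennreal ((F t)^2)) +
   2 * (NBINT s u. ind {a<..<b + 1} (s + (-1) * u) * ennreal ((g (s + (-1) * u) u)^2))"
  by (subst nn_integral_add) (auto simp: nn_integral_cmult)
 also have "(NBINT s u. ind {a<..<b + 1} (s + (-1) * u) * ennreal ((g (s + (-1) * u) u)^2))
  = (NBINT t x. ind {a<..<b + 1} t * ennreal ((g t x)^2))"
  by (rule nn_integral_shear) measurable
 finally show ?thesis .
qed

lemma g_strip_finite: "(NBINT t x. ind {a<..<b} t * ennreal ((g t x)^2)) < \<infinity>"
 by (rule le_less_trans[OF _ g_sq[of b]]) (intro nn_integral_mono, auto simp: indicator_def)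

lemma r_strip_finite: "(NBINT t x. ind {a<..<b} t * ennreal ((r t x)^2)) < \<infinity>"
 by (rule le_less_trans[OF _ r_sq[of b]]) (intro nn_integral_mono, auto simp: indicator_def)

lemma F_strip_finite: "(NBINT t. ind {a<..<b} t * ennreal ((F t)^2)) < \<infinity>"
 by (rule le_less_trans[OF _ F_sq[of b]]) (intro nn_integral_mono, auto simp: indicator_def)

lemma exit_square_integrable: "integrable lborel (\<lambda>t. ind {a<..<b} t * (R (t + 1) 1)^2)"
proof -
 have "(NBINT t. ennreal (norm (ind {a<..<b} t * (R (t + 1) 1)^2))) = (NBINT t. ind {a<..<b} t * ennreal ((R (t + 1) 1)^2))"
  by (intro nn_integral_cong) (auto simp: indicator_def)
 also have "... < \<infinity>"
  using g_strip_finite[of a "b + 1"] F_strip_finite[of "a + 1" "b + 1"]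
  by (intro le_less_trans[OF exit_square_le]) (auto simp: ennreal_mult_less_top)
 finally show ?thesis by (simp add: integrable_iff_bounded)
qed

lemma integrable_strip_square:
 fixes w :: "real => real => real"
 assumes w: "joint_borel w"
  and fin: "(NBINT t x. ind {a<..<b} t * ennreal ((w t x)^2)) < \<infinity>"
 shows "integrable lborel2 (\<lambda>z. ind {a<..<b} (fst z) * (w (fst z) (snd z))^2)"
proof -
 note w[measurable]
 have meas: "(\<lambda>z. ind {a<..<b} (fst z) * (w (fst z) (snd z))^2) \<in> borel_measurable lborel2"
  unfolding measurable_lborel_pair by measurable
 have "(\<integral>\<^sup>+z. ennreal (norm (ind {a<..<b} (fst z) * (w (fst z) (snd z))^2)) \<partial>lborel2) =
  (NBINT t x. ind {a<..<b} t * ennreal ((w t x)^2))"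
  by (subst lborel.nn_integral_fst[symmetric]) (auto intro!: nn_integral_cong simp: indicator_def)
 then show ?thesis using fin meas by (simp add: integrable_iff_bounded)
qed

lemma rg_integrable: "integrable lborel2 (\<lambda>z. ind {a<..<b} (fst z) * (r (fst z) (snd z) * g (fst z) (snd z)))"
proof (rule integrable_bound)
 show "integrable lborel2 (\<lambda>z. ind {a<..<b} (fst z) * (r (fst z) (snd z))^2 + ind {a<..<b} (fst z) * (g (fst z) (snd z))^2)"
  by (intro integrable_add integrable_strip_square r_meas g_meas r_strip_finite g_strip_finite)
 have "\<bar>x * y\<bar> <= x^2 + y^2" for x y :: real
  using sum_squares_bound[of "\<bar>x\<bar>" "\<bar>y\<bar>"] abs_ge_zero[of "x * y"] by (simp only: abs_mult power2_abs)
 then show "AE z in lborel2. norm (ind {a<..<b} (fst z) * (r (fst z) (snd z) * g (fst z) (snd z)))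
  <= norm (ind {a<..<b} (fst z) * (r (fst z) (snd z))^2 + ind {a<..<b} (fst z) * (g (fst z) (snd z))^2)"
  by (intro AE_I2) (simp add: indicator_def)
qed measurable

text \<open>The increment of \<open>(R s)^2\<close> over the piece of each characteristic inside the
  rectangle between \<open>t1\<close> and \<open>t2\<close> is integrated over the labels
  \<open>s\<close>. The end points of these pieces sweep the four sides of the rectangle, and the
  shear turns the integral of \<open>2 * g * R\<close> into the space-time integral of
  \<open>2 * r * g\<close>.\<close>

lemma energy_identity:
 assumes t1: "good t1" and t2: "good t2" and "t1 < t2"
 shows "(LBINT x. (r t1 x)^2) + (LBINT t. ind {t1<..<t2} t * (R (t + 1) 1)^2) =
  (LBINT x. (r t2 x)^2) + (LBINT t. ind {t1<..<t2} t * (F t)^2) +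
  2 * (LBINT t. LBINT x. ind {t1<..<t2} t * (r t x * g t x))"
proof -
 have "0 < t1" using t1 by (simp add: good_def)
 define \<phi> where "\<phi> t x = 2 * (ind {t1<..<t2} t * (r t x * g t x))" for t x
 have \<phi>: "integrable lborel2 (\<lambda>z. \<phi> (fst z) (snd z))"
  unfolding \<phi>_def by (intro integrable_mult_right rg_integrable)
 define X where "X s = ind {t1<..<t1 + 1} s * (R s (s - t1))^2 + ind {t1 + 1<..<t2 + 1} s * (R s 1)^2
  - (ind {t1<..<t2} s * (F s)^2 + ind {t2<..<t2 + 1} s * (R s (s - t2))^2)" for s
 have "AEL s. s \<noteq> t1 + 1" "AEL s. s \<noteq> t2" "AEL s. s \<noteq> t1" "AEL s. s \<noteq> t2 + 1"
  by (rule AE_lborel_singleton)+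
 with AE_regular AE_char have ae: "AEL s. X s = (LBINT u. \<phi> (s + (-1) * u) u)"
 proof eventually_elim
  case (elim s)
  show ?case
  proof (cases "s \<in> {t1<..<t2 + 1}")
   case True
   \<comment> \<open>For abscissas in the unit interval, \<open>s - u\<close> lies between
     \<open>t1\<close> and \<open>t2\<close> exactly when \<open>u\<close> lies between
     \<open>a\<close> and \<open>b\<close>. So \<open>b\<close> is on the side \<open>t = t1\<close>
     or \<open>x = 1\<close>, and \<open>a\<close> on the side \<open>x = 0\<close> or
     \<open>t = t2\<close>; the labels of the corners were excluded as a null set.\<close>
   define a b where "a = max 0 (s - t2)" and "b = min 1 (s - t1)"
   have ab: "0 <= a" "a <= b" using True \<open>t1 < t2\<close> by (auto simp: a_def b_def)
   have "X s = (R s b)^2 - (R s a)^2"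
    using True elim \<open>t1 < t2\<close> by (auto simp: X_def a_def b_def indicator_def R_0 max_def min_def split: if_splits)
   also have "... = (LBINT u. ind {a<..<b} u * (2 * (g (s - u) u * R s u)))"
    by (rule R_square_diff[OF elim(1) ab])
   also have "... = (LBINT u. \<phi> (s + (-1) * u) u)"
   proof (rule integral_cong_AE)
    show "AEL u. ind {a<..<b} u * (2 * (g (s - u) u * R s u)) = \<phi> (s + (-1) * u) u"
     using elim(2)
    proof eventually_elim
     case (elim u)
     show ?case
     proof (cases "0 < u \<and> u < 1")
      case True
      then have "u \<in> {a<..<b} \<longleftrightarrow> s - u \<in> {t1<..<t2}" by (auto simp: a_def b_def)
      then show ?thesis using elim True \<open>0 < t1\<close> by (auto simp: \<phi>_def indicator_def)
     next
      case False
      then show ?thesis by (auto simp: \<phi>_def g_supp)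
     qed
    qed
    show "(\<lambda>u. \<phi> (s + (-1) * u) u) \<in> borel_measurable lborel" unfolding \<phi>_def by measurable
   qed measurable
   finally show ?thesis .
  next
   case False
   have "\<phi> (s + (-1) * u) u = 0" for u
    using False by (cases "0 < u \<and> u < 1") (auto simp: \<phi>_def indicator_def g_supp)
   moreover have "X s = 0" using False \<open>t1 < t2\<close> by (auto simp: X_def indicator_def)
   ultimately show ?thesis by simp
  qed
 qed
 have exit: "ind {t1 + 1<..<t2 + 1} (1 + 1 * t) * (R (1 + 1 * t) 1)^2 = ind {t1<..<t2} t * (R (t + 1) 1)^2" for t
  by (simp add: indicator_def add.commute)
 have i2: "integrable lborel (\<lambda>s. ind {t1 + 1<..<t2 + 1} s * (R s 1)^2)"
  using lborel_integrable_real_affine_iff[of 1 "\<lambda>s. ind {t1 + 1<..<t2 + 1} s * (R s 1)^2" 1]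
   exit_square_integrable[of t1 t2] by (simp only: exit, simp?)
 have e2: "(LBINT s. ind {t1 + 1<..<t2 + 1} s * (R s 1)^2) = (LBINT t. ind {t1<..<t2} t * (R (t + 1) 1)^2)"
  using lborel_integral_real_affine[of 1 "\<lambda>s. ind {t1 + 1<..<t2 + 1} s * (R s 1)^2" 1] by (simp only: exit, simp?)
 have "(LBINT s. X s) = (LBINT x. (r t1 x)^2) + (LBINT t. ind {t1<..<t2} t * (R (t + 1) 1)^2)
  - ((LBINT t. ind {t1<..<t2} t * (F t)^2) + (LBINT x. (r t2 x)^2))"
  unfolding X_def
  using good_integral_square[OF t1] good_integral_square[OF t2] i2 e2 F_square_integrable[of t1 t2]
  by (subst integral_diff integral_add; simp)+
 moreover have "(LBINT s. X s) = (LBINT s. LBINT u. \<phi> (s + (-1) * u) u)"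
  by (rule integral_cong_AE[OF _ _ ae]) (unfold X_def \<phi>_def, measurable)
 moreover have "(LBINT s. LBINT u. \<phi> (s + (-1) * u) u) = (LBINT t. LBINT x. \<phi> t x)"
  by (rule integral_shear(2)[OF \<phi>])
 moreover have "(LBINT t. LBINT x. \<phi> t x) = 2 * (LBINT t. LBINT x. ind {t1<..<t2} t * (r t x * g t x))"
  by (simp add: \<phi>_def)
 ultimately show ?thesis by simp
qed

text \<open>A point of the slab with abscissa \<open>y\<close> lies on the characteristic
  \<open>s = t + y\<close> with \<open>a < s < b + 1\<close>. Its value is bounded by
  \<open>F s\<close> and the source on that characteristic, and integrating over \<open>y\<close>
  costs only the unit length of the strip.\<close>

lemma interior_square_le:
 assumes "0 <= a"
 shows "(NBINT t x. ind {a<..<b} t * ennreal ((r t x)^2)) <=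
  2 * (NBINT t. ind {a<..<b + 1} t * ennreal ((F t)^2)) +
  2 * (NBINT t x. ind {a<..<b + 1} t * ennreal ((g t x)^2))"
proof -
 have "(NBINT t x. ind {a<..<b} t * ennreal ((r t x)^2)) =
   (NBINT s y. ind {a<..<b} (s + (-1) * y) * ennreal ((r (s + (-1) * y) y)^2))"
  by (rule nn_integral_shear[symmetric]) measurable
 also have "... <= (NBINT s. 2 * (ind {a<..<b + 1} s * ennreal ((F s)^2)) +
   2 * (NBINT u. ind {a<..<b + 1} (s + (-1) * u) * ennreal ((g (s + (-1) * u) u)^2)))"
 proof (rule nn_integral_mono_AE)
  show "AEL s. (NBINT y. ind {a<..<b} (s + (-1) * y) * ennreal ((r (s + (-1) * y) y)^2)) <=
   2 * (ind {a<..<b + 1} s * ennreal ((F s)^2)) +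
   2 * (NBINT u. ind {a<..<b + 1} (s + (-1) * u) * ennreal ((g (s + (-1) * u) u)^2))"
   (is "AEL s. ?l s <= ?r s")
   using AE_char
  proof eventually_elim
   case (elim s)
   have "AEL y. ind {a<..<b} (s + (-1) * y) * ennreal ((r (s + (-1) * y) y)^2) <= ind {0<..<1} y * ?r s"
     using elim
    proof eventually_elim
     case (elim y)
     show ?case
     proof (cases "0 < y \<and> y < 1 \<and> s - y \<in> {a<..<b}")
      case True
      have "(NBINT u. ind {0<..<y} u * ennreal ((g (s - u) u)^2)) <=
       (NBINT u. ind {a<..<b + 1} (s + (-1) * u) * ennreal ((g (s + (-1) * u) u)^2))"
       using True by (intro nn_integral_mono) (auto simp: indicator_def)
      then have "2 * ennreal ((F s)^2) + 2 * (NBINT u. ind {0<..<y} u * ennreal ((g (s - u) u)^2)) <= ?r s"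
       using True by (intro add_mono mult_left_mono) (auto simp: indicator_def)
      then show ?thesis using True elim assms R_square_le[of s y] by (auto intro: order_trans)
     next
      case False
      then show ?thesis by (auto simp: indicator_def r_supp)
     qed
    qed
   then have "?l s <= (NBINT (y::real). ind {0<..<1} y * ?r s)" by (rule nn_integral_mono_AE)
   also have "... = ?r s" by (simp add: nn_integral_multc)
   finally show ?case .
  qed
 qed
 also have "... = 2 * (NBINT t. ind {a<..<b + 1} t * ennreal ((F t)^2)) +
   2 * (NBINT s u. ind {a<..<b + 1} (s + (-1) * u) * ennreal ((g (s + (-1) * u) u)^2))"
  by (subst nn_integral_add) (auto simp: nn_integral_cmult)
 also have "(NBINT s u. ind {a<..<b + 1} (s + (-1) * u) * ennreal ((g (s + (-1) * u) u)^2))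
  = (NBINT t x. ind {a<..<b + 1} t * ennreal ((g t x)^2))"
  by (rule nn_integral_shear) measurable
 finally show ?thesis .
qed

end

section \<open>Energy identity and observability in mean square\<close>

text \<open>A single \<open>K\<close> bounds the coefficients, their inverses, the damping, and from
  below the length of the damped interval and the damping on it. Tracking powers of \<open>K\<close>
  then keeps the constants of the estimates explicit and independent of the solution.\<close>

locale string_parameters =
 fixes k :: "real => real" and a b K \<alpha>1 \<alpha>2 \<beta>1 \<gamma>1 \<mu>1 :: real
 assumes k_meas[measurable]: "borel_fun k"
  and k_nonneg: "\<And>x. 0 <= k x" and k_le: "\<And>x. k x <= K" and K1: "1 <= K"
  and omega: "0 <= a" "a < b" "b <= 1" "1 <= K * (b - a)"
  and k_omega: "\<And>x. a < x ==> x < b ==> 1 <= K * k x"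
  and coeff_pos: "0 < \<alpha>1" "0 < \<alpha>2" "0 < \<beta>1" "0 < \<gamma>1" "0 < \<mu>1"
  and coeff_le: "\<alpha>1 <= K" "\<alpha>2 <= K" "\<beta>1 <= K" "\<gamma>1 <= K" "\<mu>1 <= K"
  and coeff_ge: "1 <= K * \<alpha>1" "1 <= K * \<alpha>2" "1 <= K * \<beta>1" "1 <= K * \<gamma>1" "1 <= K * \<mu>1"

text \<open>
 \<open>r\<close> is \<open>u\<^sub>x + u\<^sub>t\<close>, and \<open>v\<close> is \<open>u\<^sub>x - u\<^sub>t\<close> reflected at \<open>x = 1/2\<close>, so that both travel to the left;
 \<open>k\<close> is \<open>q/2\<close>.
\<close>

locale damped_string = string_parameters k a b K \<alpha>1 \<alpha>2 \<beta>1 \<gamma>1 \<mu>1 +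
  rt: transport r g F + vt: transport v h H
 for k a b K \<alpha>1 \<alpha>2 \<beta>1 \<gamma>1 \<mu>1 r g F v h H +
 fixes \<eta>1 \<eta>2 \<zeta> :: "real => real"
 assumes g_def: "\<And>t x. g t x = k x * (r t x - v t (1 - x))"
  and h_def: "\<And>t x. h t x = k (1 - x) * (v t x - r t (1 - x))"
  and eta_meas[measurable]: "\<eta>1 \<in> borel_measurable borel" "\<eta>2 \<in> borel_measurable borel" "borel_fun \<zeta>"
  and eta_cont: "continuous_on {0..} \<eta>1" "continuous_on {0..} \<eta>2" "continuous_on {0..} \<zeta>"
  and bdry1: "AEL t. 0 < t --> rt.R (t + 1) 1 = H t + 2 * \<eta>1 t"
  and bdry0: "AEL t. 0 < t --> vt.R (t + 1) 1 = F t - 2 * \<zeta> t"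
  and ode_eta1: "\<And>s t. 0 <= s ==> s <= t ==> \<eta>1 t = \<eta>1 s +
   (LBINT \<tau>. ind {s<..<t} \<tau> * (- (\<alpha>1 + \<beta>1) * \<eta>1 \<tau> - \<alpha>2 * \<eta>2 \<tau> - \<beta>1 * H \<tau>))"
  and ode_eta2: "\<And>s t. 0 <= s ==> s <= t ==> \<eta>2 t = \<eta>2 s + (LBINT \<tau>. ind {s<..<t} \<tau> * \<eta>1 \<tau>)"
  and ode_zeta: "\<And>s t. 0 <= s ==> s <= t ==> \<zeta> t = \<zeta> s +
   (LBINT \<tau>. ind {s<..<t} \<tau> * (- (\<gamma>1 + \<mu>1) * \<zeta> \<tau> + \<mu>1 * F \<tau>))"
begin

text \<open>This is \<open>E_p\<close> for p = 2, because
  \<open>(u_x + u_t)^2 + (u_x - u_t)^2 = 2 * (u_x^2 + u_t^2)\<close>.\<close>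

definition e :: "real => real" where
 "e t = 1 / 4 * ((LBINT x. (r t x)^2) + (LBINT x. (v t x)^2)) +
  (\<eta>1 t)\<^sup>2 / (2 * \<beta>1) + \<alpha>2 * (\<eta>2 t)^2 / (2 * \<beta>1) + (\<zeta> t)^2 / (2 * \<mu>1)"

definition good :: "real => bool" where "good t \<longleftrightarrow> rt.good t \<and> vt.good t"

lemma AE_good: "AEL t. 0 < t --> good t"
 using rt.AE_good vt.AE_good by eventually_elim (auto simp: good_def)

lemma e_nonneg: "0 <= e t"
 using coeff_pos by (auto simp: e_def intro!: add_nonneg_nonneg divide_nonneg_pos)

end

lemma continuous_integrable_interval:
 fixes f :: "real => real"
 assumes "continuous_on {0..} f" "0 <= a"
 shows "integrable lborel (\<lambda>t. ind {a<..<b} t * f t)"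
proof -
 have "integrable lborel (\<lambda>t. ind {a..b} t *\<^sub>R f t)"
  by (rule borel_integrable_compact) (use assms continuous_on_subset in \<open>auto intro: continuous_on_subset\<close>)
 from integrable_mult_indicator[OF _ this, of "{a<..<b}"]
 have "integrable lborel (\<lambda>t. ind {a<..<b} t *\<^sub>R (ind {a..b} t *\<^sub>R f t))" by simp
 also have "(\<lambda>t. ind {a<..<b} t *\<^sub>R (ind {a..b} t *\<^sub>R f t)) = (\<lambda>t. ind {a<..<b} t * f t)"
  by (auto simp: indicator_def)
 finally show ?thesis .
qed

lemma square_integrable_interval:
 fixes f :: "real => real"
 assumes f[measurable]: "borel_fun f"
  and fin: "(NBINT t. ind {a<..<b} t * ennreal ((f t)^2)) < \<infinity>"
 shows "integrable lborel (\<lambda>t. ind {a<..<b} t * f t)" "integrable lborel (\<lambda>t. ind {a<..<b} t * (f t)^2)"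
proof -
 have eq: "(NBINT t. ennreal ((ind {a<..<b} t * f t)^2)) = (NBINT t. ind {a<..<b} t * ennreal ((f t)^2))"
  by (intro nn_integral_cong) (auto simp: indicator_def)
 have "integrable lborel (\<lambda>t. ind {a<..<b} t * f t)" "integrable lborel (\<lambda>t. (ind {a<..<b} t * f t)^2)"
  using integrable_of_square[of "\<lambda>t. ind {a<..<b} t * f t" "{a<..<b}"] fin
   emeasure_bounded_finite[of "{a<..<b}"] by (auto simp: eq)
 moreover have "(\<lambda>t. (ind {a<..<b} t * f t)^2) = (\<lambda>t. ind {a<..<b} t * (f t)^2)"
  by (auto simp: indicator_def)
 ultimately show "integrable lborel (\<lambda>t. ind {a<..<b} t * f t)" "integrable lborel (\<lambda>t. ind {a<..<b} t * (f t)^2)"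
  by auto
qed

lemma primitive_square_diff:
 fixes G \<eta> :: "real => real"
 assumes G: "integrable lborel (\<lambda>\<tau>. ind {t1<..<t2} \<tau> * G \<tau>)" and t: "0 <= t1" "t1 <= t2"
  and \<eta>: "\<And>t. t1 <= t ==> t <= t2 ==> \<eta> t = \<eta> t1 + (LBINT \<tau>. ind {t1<..<t} \<tau> * G \<tau>)"
 shows "(\<eta> t2)^2 - (\<eta> t1)^2 = (LBINT \<tau>. ind {t1<..<t2} \<tau> * (2 * (G \<tau> * \<eta> \<tau>)))"
proof -
 let ?G = "\<lambda>\<tau>. ind {t1<..<t2} \<tau> * G \<tau>"
 define A where "A y = \<eta> t1 + (LBINT u. ind {0<..<y} u * ?G u)" for y
 have A: "A y = \<eta> y" if "t1 <= y" "y <= t2" for y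
 proof -
  have "(\<lambda>u. ind {0<..<y} u * ?G u) = (\<lambda>\<tau>. ind {t1<..<y} \<tau> * G \<tau>)"
   using that t by (auto simp: indicator_def)
  then show ?thesis using \<eta>[OF that] by (simp add: A_def)
 qed
 have "A t2 * A t2 - A t1 * A t1 = (LBINT u. ind {t1<..<t2} u * (?G u * A u + ?G u * A u))"
  by (rule primitive_product(1)[OF G G A_def A_def t])
 also have "... = (LBINT \<tau>. ind {t1<..<t2} \<tau> * (2 * (G \<tau> * \<eta> \<tau>)))"
  by (intro integral_cong refl) (auto simp: indicator_def A)
 finally show ?thesis using A t by (simp add: power2_eq_square)
qed

lemma integral_reflect_unit:
 fixes \<phi> :: "real => real"
 shows "(LBINT x. \<phi> (1 - x)) = (LBINT x. \<phi> x)"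
 using lborel_integral_real_affine[of "-1" \<phi> 1] by simp

lemma nn_integral_reflect_unit:
 fixes \<phi> :: "real => ennreal"
 assumes "borel_fun \<phi>"
 shows "(NBINT x. \<phi> (1 - x)) = (NBINT x. \<phi> x)"
 using nn_integral_real_affine[OF assms, of "-1" 1] by simp

context damped_string
begin

lemma ode_rhs_integrable:
 assumes "0 <= t1"
 shows "integrable lborel (\<lambda>\<tau>. ind {t1<..<t2} \<tau> * (- (\<alpha>1 + \<beta>1) * \<eta>1 \<tau> - \<alpha>2 * \<eta>2 \<tau> - \<beta>1 * H \<tau>))"
  and "integrable lborel (\<lambda>\<tau>. ind {t1<..<t2} \<tau> * (- (\<gamma>1 + \<mu>1) * \<zeta> \<tau> + \<mu>1 * F \<tau>))"
  and "integrable lborel (\<lambda>\<tau>. ind {t1<..<t2} \<tau> * \<eta>1 \<tau>)"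
proof -
 note i = continuous_integrable_interval[OF eta_cont(1) assms, of t2] continuous_integrable_interval[OF eta_cont(2) assms, of t2]
  continuous_integrable_interval[OF eta_cont(3) assms, of t2]
  square_integrable_interval(1)[OF rt.F_meas rt.F_strip_finite, of t1 t2]
  square_integrable_interval(1)[OF vt.F_meas vt.F_strip_finite, of t1 t2]
 have "integrable lborel (\<lambda>\<tau>. - (\<alpha>1 + \<beta>1) * (ind {t1<..<t2} \<tau> * \<eta>1 \<tau>) - \<alpha>2 * (ind {t1<..<t2} \<tau> * \<eta>2 \<tau>)
   - \<beta>1 * (ind {t1<..<t2} \<tau> * H \<tau>))"
  by (intro integrable_diff integrable_mult_right i)
 then show "integrable lborel (\<lambda>\<tau>. ind {t1<..<t2} \<tau> * (- (\<alpha>1 + \<beta>1) * \<eta>1 \<tau> - \<alpha>2 * \<eta>2 \<tau> - \<beta>1 * H \<tau>))"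
  by (simp add: algebra_simps)
 have "integrable lborel (\<lambda>\<tau>. - (\<gamma>1 + \<mu>1) * (ind {t1<..<t2} \<tau> * \<zeta> \<tau>) + \<mu>1 * (ind {t1<..<t2} \<tau> * F \<tau>))"
  by (intro integrable_add integrable_mult_right i)
 then show "integrable lborel (\<lambda>\<tau>. ind {t1<..<t2} \<tau> * (- (\<gamma>1 + \<mu>1) * \<zeta> \<tau> + \<mu>1 * F \<tau>))"
  by (simp add: algebra_simps)
 show "integrable lborel (\<lambda>\<tau>. ind {t1<..<t2} \<tau> * \<eta>1 \<tau>)" by (rule i)
qed

text \<open>With \<open>k = q / 2\<close> and the difference of the families equal to
  \<open>2 * u_t\<close>, this is twice the space-time integral of \<open>q * u_t^2\<close>.\<close>

definition W :: "real => real => real" where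
 "W t1 t2 = (LBINT t. LBINT x. ind {t1<..<t2} t * (k x * (r t x - v t (1 - x))^2))"

text \<open>After reflecting \<open>x\<close> in the second integral both sources carry the factor
  \<open>k x\<close>, and \<open>r * (r - z) + z * (z - r)\<close> with
  \<open>z = v t (1 - x)\<close> is a complete square.\<close>

lemma rg_vh_sum:
 "(LBINT t. LBINT x. ind {t1<..<t2} t * (r t x * g t x)) +
 (LBINT t. LBINT x. ind {t1<..<t2} t * (v t x * h t x)) = W t1 t2"
proof -
 let ?A = "\<lambda>t x. ind {t1<..<t2} t * (r t x * g t x)" and ?B = "\<lambda>t x. ind {t1<..<t2} t * (v t x * h t x)"
 note iA = rt.rg_integrable[of t1 t2] and iB = vt.rg_integrable[of t1 t2]
 have "(LBINT t. LBINT x. ?A t x) + (LBINT t. LBINT x. ?B t x) =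
   (LBINT t. (LBINT x. ?A t x) + (LBINT x. ?B t x))"
  using lborel_pair.integrable_fst'[OF iA] lborel_pair.integrable_fst'[OF iB]
  by (intro integral_add[symmetric]) auto
 also have "... = W t1 t2"
  unfolding W_def
 proof (rule integral_cong_AE)
  show "AEL t. (LBINT x. ?A t x) + (LBINT x. ?B t x) =
   (LBINT x. ind {t1<..<t2} t * (k x * (r t x - v t (1 - x))^2))"
   using lborel_pair.AE_integrable_fst'[OF iA] lborel_pair.AE_integrable_fst'[OF iB]
  proof eventually_elim
   case (elim t)
   have B: "integrable lborel (\<lambda>x. ?B t (1 - x))"
    using elim(2) lborel_integrable_real_affine_iff[of "-1" "?B t" 1] by simp
   have "(LBINT x. ?A t x) + (LBINT x. ?B t x) = (LBINT x. ?A t x) + (LBINT x. ?B t (1 - x))"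
    by (simp only: integral_reflect_unit[of "?B t"])
   also have "... = (LBINT x. ?A t x + ?B t (1 - x))"
    using elim(1) B by (intro integral_add[symmetric]) auto
   also have "... = (LBINT x. ind {t1<..<t2} t * (k x * (r t x - v t (1 - x))^2))"
    by (intro integral_cong refl) (simp add: g_def h_def power2_eq_square algebra_simps)
   finally show ?case .
  qed
 qed measurable
 finally show ?thesis .
qed

text \<open>The two transport identities are added to the product rules for \<eta>1, \<eta>2 and
  \<zeta>. The weights in \<open>e\<close> are those for which the mixed integrals cancel:
  \<open>\<eta>1 * H\<close> between the boundary at \<open>x = 1\<close> and the equation of
  \<eta>1, \<open>\<eta>1 * \<eta>2\<close> between the two equations, and
  \<open>\<zeta> * F\<close> at \<open>x = 0\<close>.\<close>

lemma energy_dissipation: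
 assumes t1: "good t1" and t2: "good t2" and "t1 < t2"
 shows "e t1 - e t2 = W t1 t2 / 2 + \<alpha>1 / \<beta>1 * (LBINT t. ind {t1<..<t2} t * (\<eta>1 t)^2) +
  \<gamma>1 / \<mu>1 * (LBINT t. ind {t1<..<t2} t * (\<zeta> t)^2)"
proof -
 have g1: "rt.good t1" "vt.good t1" and g2: "rt.good t2" "vt.good t2" using t1 t2 by (auto simp: good_def)
 have "0 < t1" using g1 by (simp add: rt.good_def)
 let ?I = "\<lambda>f. LBINT t. ind {t1<..<t2} t * f t"
 note cont = eta_cont
 have i1: "integrable lborel (\<lambda>t. ind {t1<..<t2} t * (\<eta>1 t * \<eta>1 t))" 
  "integrable lborel (\<lambda>t. ind {t1<..<t2} t * (\<eta>1 t * \<eta>2 t))"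
  "integrable lborel (\<lambda>t. ind {t1<..<t2} t * (\<zeta> t * \<zeta> t))"
  using \<open>0 < t1\<close> by (auto intro!: continuous_integrable_interval continuous_intros cont)
 have prod: "integrable lborel (\<lambda>t. ind {t1<..<t2} t * (p t * q t))"
  if [measurable]: "borel_fun p" "borel_fun q"
   and p: "integrable lborel (\<lambda>t. ind {t1<..<t2} t * (p t)^2)" and q: "integrable lborel (\<lambda>t. ind {t1<..<t2} t * (q t)^2)" for p q :: "real => real"
 proof (rule integrable_bound[OF integrable_add[OF p q]])
  have "\<bar>x * y\<bar> <= x^2 + y^2" for x y :: real
   using sum_squares_bound[of "\<bar>x\<bar>" "\<bar>y\<bar>"] abs_ge_zero[of "x * y"] by (simp only: abs_mult power2_abs)
  then show "AEL t. norm (ind {t1<..<t2} t * (p t * q t)) <= norm (ind {t1<..<t2} t * (p t)^2 + ind {t1<..<t2} t * (q t)^2)"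
   by (intro AE_I2) (simp add: indicator_def)
 qed measurable
 have i2: "integrable lborel (\<lambda>t. ind {t1<..<t2} t * (\<eta>1 t * H t))" "integrable lborel (\<lambda>t. ind {t1<..<t2} t * (\<zeta> t * F t))"
  using i1 vt.F_square_integrable rt.F_square_integrable by (auto intro!: prod simp: power2_eq_square)
 have i3: "integrable lborel (\<lambda>t. ind {t1<..<t2} t * (H t * H t))" "integrable lborel (\<lambda>t. ind {t1<..<t2} t * (F t * F t))"
  using vt.F_square_integrable rt.F_square_integrable by (auto simp: power2_eq_square)
 have lin: "?I (\<lambda>t. c1 * p1 t + c2 * p2 t + c3 * p3 t) = c1 * ?I p1 + c2 * ?I p2 + c3 * ?I p3"
  if "integrable lborel (\<lambda>t. ind {t1<..<t2} t * p1 t)" "integrable lborel (\<lambda>t. ind {t1<..<t2} t * p2 t)"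
   "integrable lborel (\<lambda>t. ind {t1<..<t2} t * p3 t)" for c1 c2 c3 and p1 p2 p3 :: "real => real"
 proof -
  have "?I (\<lambda>t. c1 * p1 t + c2 * p2 t + c3 * p3 t) =
   (LBINT t. c1 * (ind {t1<..<t2} t * p1 t) + c2 * (ind {t1<..<t2} t * p2 t) + c3 * (ind {t1<..<t2} t * p3 t))"
   by (intro integral_cong) (auto simp: algebra_simps)
  also have "... = c1 * ?I p1 + c2 * ?I p2 + c3 * ?I p3"
   using that by (subst integral_add integral_mult_right; auto)+
  finally show ?thesis .
 qed
 have ex1: "?I (\<lambda>t. (rt.R (t + 1) 1)^2) = ?I (\<lambda>t. 1 * (H t * H t) + 4 * (\<eta>1 t * H t) + 4 * (\<eta>1 t * \<eta>1 t))"
 proof (rule integral_cong_AE)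
  show "AEL t. ind {t1<..<t2} t * (rt.R (t + 1) 1)^2 = ind {t1<..<t2} t * (1 * (H t * H t) + 4 * (\<eta>1 t * H t) + 4 * (\<eta>1 t * \<eta>1 t))"
   using bdry1 by eventually_elim (use \<open>0 < t1\<close> in \<open>auto simp: indicator_def power2_eq_square algebra_simps\<close>)
 qed measurable
 have ex0: "?I (\<lambda>t. (vt.R (t + 1) 1)^2) = ?I (\<lambda>t. 1 * (F t * F t) + (-4) * (\<zeta> t * F t) + 4 * (\<zeta> t * \<zeta> t))"
 proof (rule integral_cong_AE)
  show "AEL t. ind {t1<..<t2} t * (vt.R (t + 1) 1)^2 = ind {t1<..<t2} t * (1 * (F t * F t) + (-4) * (\<zeta> t * F t) + 4 * (\<zeta> t * \<zeta> t))"
   using bdry0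
  proof eventually_elim
   case (elim t)
   show ?case
   proof (cases "t \<in> {t1<..<t2}")
    case True
    then have eq: "vt.R (t + 1) 1 = F t - 2 * \<zeta> t" using elim \<open>0 < t1\<close> by auto
    show ?thesis unfolding eq by (simp add: power2_eq_square algebra_simps)
   qed simp
  qed
 qed measurable
 have ode1: "(\<eta>1 t2)^2 - (\<eta>1 t1)^2 = ?I (\<lambda>t. 2 * ((- (\<alpha>1 + \<beta>1) * \<eta>1 t - \<alpha>2 * \<eta>2 t - \<beta>1 * H t) * \<eta>1 t))"
  using \<open>0 < t1\<close> \<open>t1 < t2\<close> by (intro primitive_square_diff ode_rhs_integrable ode_eta1) auto
 have ode1': "(\<eta>1 t2)^2 - (\<eta>1 t1)^2 = ?I (\<lambda>t. (-2 * (\<alpha>1 + \<beta>1)) * (\<eta>1 t * \<eta>1 t) + (-2 * \<alpha>2) * (\<eta>1 t * \<eta>2 t) + (-2 * \<beta>1) * (\<eta>1 t * H t))"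
  unfolding ode1 by (intro integral_cong refl) (simp add: algebra_simps)
 have ode2: "(\<eta>2 t2)^2 - (\<eta>2 t1)^2 = ?I (\<lambda>t. 2 * (\<eta>1 t * \<eta>2 t))"
  using \<open>0 < t1\<close> \<open>t1 < t2\<close> by (intro primitive_square_diff ode_rhs_integrable ode_eta2) auto
 \<comment> \<open>Padded with zero terms so that the three-term linearity rule \<open>lin\<close>
   applies; likewise for \<zeta> below.\<close>
 have ode2': "(\<eta>2 t2)^2 - (\<eta>2 t1)^2 = ?I (\<lambda>t. 2 * (\<eta>1 t * \<eta>2 t) + 0 * (\<eta>1 t * \<eta>2 t) + 0 * (\<eta>1 t * \<eta>2 t))"
  unfolding ode2 by (intro integral_cong refl) (simp add: algebra_simps)
 have ode0: "(\<zeta> t2)^2 - (\<zeta> t1)^2 = ?I (\<lambda>t. 2 * ((- (\<gamma>1 + \<mu>1) * \<zeta> t + \<mu>1 * F t) * \<zeta> t))"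
  using \<open>0 < t1\<close> \<open>t1 < t2\<close> by (intro primitive_square_diff ode_rhs_integrable ode_zeta) auto
 have ode0': "(\<zeta> t2)^2 - (\<zeta> t1)^2 = ?I (\<lambda>t. (-2 * (\<gamma>1 + \<mu>1)) * (\<zeta> t * \<zeta> t) + 2 * \<mu>1 * (\<zeta> t * F t) + 0 * (\<zeta> t * F t))"
  unfolding ode0 by (intro integral_cong refl) (simp add: algebra_simps)
 have FH: "?I (\<lambda>t. (F t)^2) = ?I (\<lambda>t. F t * F t)" "?I (\<lambda>t. (H t)^2) = ?I (\<lambda>t. H t * H t)"
  by (simp_all add: power2_eq_square)
 note E = rt.energy_identity[OF g1(1) g2(1) \<open>t1 < t2\<close>] vt.energy_identity[OF g1(2) g2(2) \<open>t1 < t2\<close>]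
 define HH FF HE FZ EE E2 ZZ where "HH = ?I (\<lambda>t. H t * H t)" and "FF = ?I (\<lambda>t. F t * F t)" and "HE = ?I (\<lambda>t. \<eta>1 t * H t)"
  and "FZ = ?I (\<lambda>t. \<zeta> t * F t)" and "EE = ?I (\<lambda>t. \<eta>1 t * \<eta>1 t)" and "E2 = ?I (\<lambda>t. \<eta>1 t * \<eta>2 t)" and "ZZ = ?I (\<lambda>t. \<zeta> t * \<zeta> t)"
 note defs = HH_def[symmetric] FF_def[symmetric] HE_def[symmetric] FZ_def[symmetric] EE_def[symmetric] E2_def[symmetric] ZZ_def[symmetric]
 have q1: "(\<eta>1 t2)^2 - (\<eta>1 t1)^2 = -2 * (\<alpha>1 + \<beta>1) * EE + (-2 * \<alpha>2) * E2 + (-2 * \<beta>1) * HE"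
  unfolding ode1' lin[OF i1(1,2) i2(1)] defs ..
 have q2: "(\<eta>2 t2)^2 - (\<eta>2 t1)^2 = 2 * E2"
  unfolding ode2' lin[OF i1(2,2,2)] defs by simp
 have q0: "(\<zeta> t2)^2 - (\<zeta> t1)^2 = -2 * (\<gamma>1 + \<mu>1) * ZZ + 2 * \<mu>1 * FZ"
  unfolding ode0' lin[OF i1(3) i2(2,2)] defs by simp
 have x1: "?I (\<lambda>t. (rt.R (t + 1) 1)^2) = HH + 4 * HE + 4 * EE"
  unfolding ex1 lin[OF i3(1) i2(1) i1(1)] defs by simp
 have x0: "?I (\<lambda>t. (vt.R (t + 1) 1)^2) = FF - 4 * FZ + 4 * ZZ"
  unfolding ex0 lin[OF i3(2) i2(2) i1(3)] defs by simp
 let ?r = "\<lambda>t. LBINT x. (r t x)^2" and ?v = "\<lambda>t. LBINT x. (v t x)^2"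
 have w: "?r t1 + ?v t1 - (?r t2 + ?v t2) = 2 * W t1 t2 - 4 * HE - 4 * EE + 4 * FZ - 4 * ZZ"
  using E rg_vh_sum[of t1 t2] unfolding x1 x0 FH defs by (simp add: algebra_simps)
 have p1: "((\<eta>1 t1)^2 - (\<eta>1 t2)^2) / (2 * \<beta>1) = (\<alpha>1 / \<beta>1) * EE + EE + (\<alpha>2 / \<beta>1) * E2 + HE"
 proof -
  have eq: "(\<eta>1 t1)^2 - (\<eta>1 t2)^2 = 2 * \<alpha>1 * EE + 2 * \<beta>1 * EE + 2 * \<alpha>2 * E2 + 2 * \<beta>1 * HE"
   using q1 by (simp add: algebra_simps)
  show ?thesis unfolding eq using coeff_pos by (simp add: field_simps)
 qed
 have p2: "(\<alpha>2 * (\<eta>2 t1)^2 - \<alpha>2 * (\<eta>2 t2)^2) / (2 * \<beta>1) = - (\<alpha>2 / \<beta>1) * E2"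
 proof -
  have "\<alpha>2 * (\<eta>2 t1)^2 - \<alpha>2 * (\<eta>2 t2)^2 = - (2 * \<alpha>2 * E2)" using q2 by (simp add: algebra_simps)
  then show ?thesis using coeff_pos by (simp only:) (simp add: field_simps)
 qed
 have p0: "((\<zeta> t1)^2 - (\<zeta> t2)^2) / (2 * \<mu>1) = (\<gamma>1 / \<mu>1) * ZZ + ZZ - FZ"
 proof -
  have eq: "(\<zeta> t1)^2 - (\<zeta> t2)^2 = 2 * \<gamma>1 * ZZ + 2 * \<mu>1 * ZZ - 2 * \<mu>1 * FZ"
   using q0 by (simp add: algebra_simps)
  show ?thesis unfolding eq using coeff_pos by (simp add: field_simps)
 qed
 have "e t1 - e t2 = 1 / 4 * (?r t1 + ?v t1 - (?r t2 + ?v t2)) + ((\<eta>1 t1)^2 - (\<eta>1 t2)^2) / (2 * \<beta>1) +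
   (\<alpha>2 * (\<eta>2 t1)^2 - \<alpha>2 * (\<eta>2 t2)^2) / (2 * \<beta>1) + ((\<zeta> t1)^2 - (\<zeta> t2)^2) / (2 * \<mu>1)"
  by (simp add: e_def diff_divide_distrib algebra_simps)
 also have "... = W t1 t2 / 2 + \<alpha>1 / \<beta>1 * EE + \<gamma>1 / \<mu>1 * ZZ"
  unfolding w p1 p2 p0 by (simp add: algebra_simps)
 finally show ?thesis unfolding EE_def ZZ_def by (simp add: power2_eq_square)
qed

end

section \<open>Observability: the trace at x = 0 in terms of the dissipation\<close>

lemma square_sum4_le: "(x1 + x2 + x3 + x4)^2 <= 4 * (x1^2 + x2^2 + x3^2 + (x4::real)^2)"
proof -
 have "4 * (x1^2 + x2^2 + x3^2 + x4^2) - (x1 + x2 + x3 + x4)^2 =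
  (x1 - x2)\<^sup>2 + (x1 - x3)^2 + (x1 - x4)^2 + (x2 - x3)^2 + (x2 - x4)^2 + (x3 - x4)^2"
  by (simp add: power2_eq_square algebra_simps)
 also have "... \<ge> 0" by (intro add_nonneg_nonneg zero_le_power2)
 finally show ?thesis by simp
qed

lemma measurable_indicator_Ioo[measurable (raw)]:
 fixes p q w :: "'a => real"
 assumes [measurable]: "p \<in> borel_measurable M" "q \<in> borel_measurable M" "w \<in> borel_measurable M"
 shows "(\<lambda>x. ind {p x<..<q x} (w x) :: 'b::{zero_neq_one, topological_space}) \<in> borel_measurable M"
proof -
 have "(\<lambda>x. if p x < w x \<and> w x < q x then 1 else 0 :: 'b) \<in> borel_measurable M" by measurable
 moreover have "(\<lambda>x. if p x < w x \<and> w x < q x then 1 else 0 :: 'b) = (\<lambda>x. ind {p x<..<q x} (w x))"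
  by (auto simp: indicator_def)
 ultimately show ?thesis by simp
qed

text \<open>For fixed \<open>x\<close> the delay \<open>c x\<close> merely moves the window of times
  inside \<open>{t0<..<t1}\<close>. By Tonelli a delay depending on \<open>x\<close> is therefore
  harmless, so integrals along a family of rays reduce to a space-time integral.\<close>

lemma nn_integral_shift_window:
 fixes \<psi> :: "real => real => ennreal" and c :: "real => real"
 assumes \<psi>: "joint_borel \<psi>" and [measurable]: "borel_fun c"
  and c: "\<And>t x. \<psi> t x \<noteq> 0 ==> 0 <= c x \<and> t0 + L + c x <= t1"
 shows "(NBINT s. ind {t0<..<t0 + L} s * (NBINT x. \<psi> (s + c x) x)) <=
  (NBINT t x. ind {t0<..<t1} t * \<psi> t x)"
proof -
 note [measurable (raw)] = measurable_curried2[OF \<psi>]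
 have "(NBINT s. ind {t0<..<t0 + L} s * (NBINT x. \<psi> (s + c x) x)) =
  (NBINT s x. ind {t0<..<t0 + L} s * \<psi> (s + c x) x)"
  by (simp add: nn_integral_cmult)
 also have "... = (NBINT x s. ind {t0<..<t0 + L} s * \<psi> (s + c x) x)"
  by (rule lborel_pair.Fubini'[symmetric]) measurable
 also have "... <= (NBINT x s. ind {t0<..<t1} (s + c x) * \<psi> (s + c x) x)"
  using c by (intro nn_integral_mono) (force simp: indicator_def)
 also have "... = (NBINT x t. ind {t0<..<t1} t * \<psi> t x)"
  by (intro nn_integral_cong nn_integral_translate[of "\<lambda>t. ind {t0<..<t1} t * \<psi> t x" for x]) measurable
 also have "... = (NBINT t x. ind {t0<..<t1} t * \<psi> t x)"
  by (rule lborel_pair.Fubini') measurable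
 finally show ?thesis .
qed

lemma nn_integral_shift_window1:
 fixes \<psi> :: "real => ennreal"
 assumes [measurable]: "borel_fun \<psi>" and c: "0 <= c" "t0 + L + c <= t1"
 shows "(NBINT s. ind {t0<..<t0 + L} s * \<psi> (s + c)) <= (NBINT t. ind {t0<..<t1} t * \<psi> t)"
proof -
 have "(NBINT s. ind {t0<..<t0 + L} s * \<psi> (s + c)) <= (NBINT s. ind {t0<..<t1} (s + c) * \<psi> (s + c))"
  using c by (intro nn_integral_mono) (auto simp: indicator_def)
 also have "... = (NBINT t. ind {t0<..<t1} t * \<psi> t)"
  by (rule nn_integral_translate) measurable
 finally show ?thesis .
qed

context damped_string
begin

lemma coeff_inverse_le: "1 / \<beta>1 <= K" "1 / \<mu>1 <= K" "1 / \<alpha>1 <= K" "1 / \<alpha>2 <= K" "1 / \<gamma>1 <= K"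
 using coeff_ge coeff_pos by (simp_all add: divide_le_eq)

lemma reflected_strip_square:
 "(NBINT t x. ind {t1<..<t2} t * ennreal ((v t (1 - x))^2)) =
 (NBINT t x. ind {t1<..<t2} t * ennreal ((v t x)^2))"
 by (intro nn_integral_cong nn_integral_reflect_unit[of "\<lambda>x. ind {t1<..<t2} t * ennreal ((v t x)^2)" for t]) measurable

lemma h_reflect: "h t (1 - x) = - g t x"
 by (simp add: g_def h_def algebra_simps)

lemma h_strip_square:
 "(NBINT t x. ind {t1<..<t2} t * ennreal ((h t x)^2)) =
 (NBINT t x. ind {t1<..<t2} t * ennreal ((g t x)^2))"
 using nn_integral_reflect_unit[of "\<lambda>x. ind {t1<..<t2} t * ennreal ((h t x)^2)" for t]
 by (simp add: h_reflect)

lemma W_nn_integral: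
 "(NBINT t x. ind {t1<..<t2} t * ennreal (k x * (r t x - v t (1 - x))^2)) = ennreal (W t1 t2)"
proof -
 let ?d = "\<lambda>t x. r t x - v t (1 - x)"
 let ?A = "NBINT t x. ind {t1<..<t2} t * ennreal ((r t x)^2)"
  and ?B = "NBINT t x. ind {t1<..<t2} t * ennreal ((v t (1 - x))^2)"
 have "(NBINT t x. ind {t1<..<t2} t * ennreal ((?d t x)^2)) <=
  (NBINT t x. 2 * (ind {t1<..<t2} t * ennreal ((r t x)^2)) + 2 * (ind {t1<..<t2} t * ennreal ((v t (1 - x))^2)))"
 proof (intro nn_integral_mono)
  fix t x
  have "(?d t x)^2 <= 2 * (r t x)^2 + 2 * (v t (1 - x))^2"
   using sum_squares_bound[of "r t x" "- v t (1 - x)"] by (simp add: power2_diff)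
  then have "ennreal ((?d t x)^2) <= ennreal (2 * (r t x)^2 + 2 * (v t (1 - x))^2)" by (rule ennreal_leI)
  also have "... = 2 * ennreal ((r t x)^2) + 2 * ennreal ((v t (1 - x))^2)" by (simp add: ennreal_mult)
  finally show "ind {t1<..<t2} t * ennreal ((?d t x)^2) <=
   2 * (ind {t1<..<t2} t * ennreal ((r t x)^2)) + 2 * (ind {t1<..<t2} t * ennreal ((v t (1 - x))^2))"
   by (simp add: indicator_def)
 qed
 also have "... = 2 * ?A + 2 * ?B"
  by (simp add: nn_integral_add nn_integral_cmult)
 also have "... < \<infinity>"
  unfolding reflected_strip_square using rt.r_strip_finite[of t1 t2] vt.r_strip_finite[of t1 t2]
  by (auto simp: ennreal_mult_less_top)
 finally have "integrable lborel2 (\<lambda>z. ind {t1<..<t2} (fst z) * (?d (fst z) (snd z))^2)"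
  by (intro rt.integrable_strip_square) measurable
 then have "integrable lborel2 (\<lambda>z. K * (ind {t1<..<t2} (fst z) * (?d (fst z) (snd z))^2))" by simp
 then have int: "integrable lborel2 (\<lambda>z. ind {t1<..<t2} (fst z) * (k (snd z) * (?d (fst z) (snd z))^2))"
 proof (rule integrable_bound)
  show "AE z in lborel2. norm (ind {t1<..<t2} (fst z) * (k (snd z) * (?d (fst z) (snd z))^2))
   <= norm (K * (ind {t1<..<t2} (fst z) * (?d (fst z) (snd z))^2))"
   using k_nonneg k_le K1 by (intro AE_I2) (auto simp: indicator_def abs_mult intro!: mult_right_mono)
 qed measurable
 have "(NBINT t x. ind {t1<..<t2} t * ennreal (k x * (?d t x)^2)) =
   (NBINT t x. ennreal (ind {t1<..<t2} t * (k x * (?d t x)^2)))"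
  by (intro nn_integral_cong) (auto simp: indicator_def)
 also have "... = (\<integral>\<^sup>+z. ennreal (ind {t1<..<t2} (fst z) * (k (snd z) * (?d (fst z) (snd z))^2)) \<partial>lborel2)"
  by (subst lborel.nn_integral_fst[symmetric]) auto
 also have "... = ennreal (LINT z|lborel2. ind {t1<..<t2} (fst z) * (k (snd z) * (?d (fst z) (snd z))^2))"
  using k_nonneg by (intro nn_integral_eq_integral int) auto
 also have "(LINT z|lborel2. ind {t1<..<t2} (fst z) * (k (snd z) * (?d (fst z) (snd z))^2)) = W t1 t2"
  using lborel_pair.integral_fst'[OF int] by (simp add: W_def)
 finally show ?thesis .
qed

lemma W_nonneg: "0 <= W t1 t2"
 unfolding W_def using k_nonneg by (intro integral_nonneg_AE AE_I2) auto

text \<open>Everything that the dissipation controls, in the form used below. One factor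
  \<open>K\<close> in \<open>Q\<close> comes from \<open>k <= K\<close> for the sources and from
  \<open>1 <= K * k\<close> on the damped interval, the factor 2 from \<open>W / 2\<close>, and
  \<open>K^2\<close> from the quotients of coefficients in front of the boundary terms.\<close>

lemma dissipation_bounds:
 assumes "good t1" "good t2" "t1 < t2"
 defines "Q \<equiv> ennreal (2 * K^2 * (e t1 - e t2))"
 shows "0 <= e t1 - e t2"
  and "(NBINT t x. ind {t1<..<t2} t * ennreal ((g t x)^2)) <= Q"
  and "(NBINT t x. ind {t1<..<t2} t * ennreal ((h t x)^2)) <= Q"
  and "(NBINT t x. ind {t1<..<t2} t * (ind {a<..<b} x * ennreal ((r t x - v t (1 - x))^2))) <= Q"
  and "(NBINT t. ind {t1<..<t2} t * ennreal ((\<eta>1 t)^2)) <= Q"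
  and "(NBINT t. ind {t1<..<t2} t * ennreal ((\<zeta> t)^2)) <= Q"
proof -
 let ?E = "LBINT t. ind {t1<..<t2} t * (\<eta>1 t)^2" and ?Z = "LBINT t. ind {t1<..<t2} t * (\<zeta> t)^2"
 have "0 < t1" using assms by (simp add: good_def rt.good_def)
 have EZ: "0 <= ?E" "0 <= ?Z" by (auto intro!: integral_nonneg_AE AE_I2)
 have p: "0 <= \<alpha>1 / \<beta>1 * ?E" "0 <= \<gamma>1 / \<mu>1 * ?Z" using EZ coeff_pos by auto
 note d = energy_dissipation[OF assms(1-3)]
 show D: "0 <= e t1 - e t2" using d p W_nonneg[of t1 t2] by linarith
 have KK: "K <= K^2" "1 <= K^2" using K1 by (auto simp: power2_eq_square intro: order_trans[OF _ mult_left_mono, of _ _ 1])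
 have "W t1 t2 <= 2 * (e t1 - e t2)" using p unfolding d by argo
 then have "K * W t1 t2 <= K * (2 * (e t1 - e t2))" using K1 by (intro mult_left_mono) auto
 also have "... <= K^2 * (2 * (e t1 - e t2))" using D KK by (intro mult_right_mono) auto
 finally have "ennreal (K * W t1 t2) <= Q" unfolding Q_def by (intro ennreal_leI) (simp add: algebra_simps)
 then have KW: "ennreal K * ennreal (W t1 t2) <= Q" using K1 W_nonneg by (simp add: ennreal_mult)
 have from_W: "(NBINT t x. ind {t1<..<t2} t * w t x) <= Q"
  if "\<And>t x. w t x <= ennreal (K * (k x * (r t x - v t (1 - x))^2))" for w
 proof -
  have "(NBINT t x. ind {t1<..<t2} t * w t x) <=
   (NBINT t x. ennreal K * (ind {t1<..<t2} t * ennreal (k x * (r t x - v t (1 - x))^2)))"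
   using that K1 k_nonneg by (intro nn_integral_mono) (auto simp: indicator_def ennreal_mult'[symmetric])
  also have "... = ennreal K * ennreal (W t1 t2)"
   by (subst W_nn_integral[symmetric]) (simp add: nn_integral_cmult)
  finally show ?thesis using KW by simp
 qed
 have "(g t x)^2 <= K * (k x * (r t x - v t (1 - x))^2)" for t x
 proof -
  have "(g t x)^2 = k x * (k x * (r t x - v t (1 - x))^2)" by (simp add: g_def power2_eq_square)
  also have "... <= K * (k x * (r t x - v t (1 - x))^2)" using k_le k_nonneg by (intro mult_right_mono) auto
  finally show ?thesis .
 qed
 then show gQ: "(NBINT t x. ind {t1<..<t2} t * ennreal ((g t x)^2)) <= Q"
  by (intro from_W ennreal_leI)
 show "(NBINT t x. ind {t1<..<t2} t * ennreal ((h t x)^2)) <= Q"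
  using gQ by (simp add: h_strip_square)
 show "(NBINT t x. ind {t1<..<t2} t * (ind {a<..<b} x * ennreal ((r t x - v t (1 - x))^2))) <= Q"
 proof (rule from_W)
  fix t x
  show "ind {a<..<b} x * ennreal ((r t x - v t (1 - x))^2) <= ennreal (K * (k x * (r t x - v t (1 - x))^2))"
   using mult_right_mono[OF k_omega[of x], of "(r t x - v t (1 - x))^2"]
   by (auto simp: indicator_def algebra_simps intro!: ennreal_leI)
 qed
 have sq: "(NBINT t. ind {t1<..<t2} t * ennreal ((y t)^2)) <= Q"
  if y: "continuous_on {0..} y" and c: "0 < c" "1 / c <= K^2" and le: "c * (LBINT t. ind {t1<..<t2} t * (y t)^2) <= e t1 - e t2" for y and c :: real
 proof -
  have "(NBINT t. ind {t1<..<t2} t * ennreal ((y t)^2)) = (NBINT t. ennreal (ind {t1<..<t2} t * (y t)^2))"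
   by (intro nn_integral_cong) (auto simp: indicator_def)
  also have "... = ennreal (LBINT t. ind {t1<..<t2} t * (y t)^2)"
   using \<open>0 < t1\<close> y by (intro nn_integral_eq_integral continuous_integrable_interval continuous_intros) auto
  also have "... <= Q"
   unfolding Q_def
  proof (rule ennreal_leI)
   have "(LBINT t. ind {t1<..<t2} t * (y t)^2) <= 1 / c * (e t1 - e t2)"
    using le c by (simp add: field_simps)
   also have "... <= K^2 * (e t1 - e t2)" using c D by (intro mult_right_mono) auto
   also have "... <= 2 * K^2 * (e t1 - e t2)" using D KK by simp
   finally show "(LBINT t. ind {t1<..<t2} t * (y t)^2) <= 2 * K^2 * (e t1 - e t2)" .
  qed
  finally show ?thesis .
 qed
 have c: "1 / (\<alpha>1 / \<beta>1) <= K^2" "1 / (\<gamma>1 / \<mu>1) <= K^2"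
  using mult_mono[OF coeff_le(3) coeff_inverse_le(3)] mult_mono[OF coeff_le(5) coeff_inverse_le(5)] K1 coeff_pos
  by (auto simp: power2_eq_square)
 show "(NBINT t. ind {t1<..<t2} t * ennreal ((\<eta>1 t)^2)) <= Q"
  by (rule sq[OF eta_cont(1) _ c(1)]) (use d p W_nonneg[of t1 t2] coeff_pos in auto)
 show "(NBINT t. ind {t1<..<t2} t * ennreal ((\<zeta> t)^2)) <= Q"
  by (rule sq[OF eta_cont(3) _ c(2)]) (use d p W_nonneg[of t1 t2] coeff_pos in auto)
qed

text \<open>
 The average of \<open>F\<close> over a window is read off from the equation for \<open>\<zeta>\<close>.
\<close>

lemma F_window_average:
 assumes "0 < s"
 shows "\<mu>1 * (LBINT x. ind {a<..<b} x * F (s + 2 * x)) =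
  (\<zeta> (s + 2 * b) - \<zeta> (s + 2 * a)) / 2 + (\<gamma>1 + \<mu>1) * (LBINT x. ind {a<..<b} x * \<zeta> (s + 2 * x))"
  and "integrable lborel (\<lambda>x. ind {a<..<b} x * F (s + 2 * x))"
proof -
 have ind: "ind {s + 2 * a<..<s + 2 * b} (s + 2 * x) = indicat_real {a<..<b} x" for x
  by (simp add: indicator_def)
 have aff: "(LBINT \<tau>. ind {s + 2 * a<..<s + 2 * b} \<tau> * w \<tau>) = 2 * (LBINT x. ind {a<..<b} x * w (s + 2 * x))" for w :: "real => real"
  using lborel_integral_real_affine[of 2 "\<lambda>\<tau>. ind {s + 2 * a<..<s + 2 * b} \<tau> * w \<tau>" s] by (simp add: ind)
 have affi: "integrable lborel (\<lambda>x. ind {a<..<b} x * w (s + 2 * x))"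
  if "integrable lborel (\<lambda>\<tau>. ind {s + 2 * a<..<s + 2 * b} \<tau> * w \<tau>)" for w :: "real => real"
  using that lborel_integrable_real_affine_iff[of 2 "\<lambda>\<tau>. ind {s + 2 * a<..<s + 2 * b} \<tau> * w \<tau>" s] by (simp add: ind)
 show iF: "integrable lborel (\<lambda>x. ind {a<..<b} x * F (s + 2 * x))"
  by (rule affi, rule square_integrable_interval(1)[OF rt.F_meas rt.F_strip_finite])
 have iZ: "integrable lborel (\<lambda>x. ind {a<..<b} x * \<zeta> (s + 2 * x))"
  using assms omega by (intro affi continuous_integrable_interval[OF eta_cont(3)]) auto
 have "\<zeta> (s + 2 * b) = \<zeta> (s + 2 * a) + 2 * (LBINT x. ind {a<..<b} x * (- (\<gamma>1 + \<mu>1) * \<zeta> (s + 2 * x) + \<mu>1 * F (s + 2 * x)))"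
  using ode_zeta[of "s + 2 * a" "s + 2 * b"] assms omega aff[of "\<lambda>\<tau>. - (\<gamma>1 + \<mu>1) * \<zeta> \<tau> + \<mu>1 * F \<tau>"] by simp
 also have "(LBINT x. ind {a<..<b} x * (- (\<gamma>1 + \<mu>1) * \<zeta> (s + 2 * x) + \<mu>1 * F (s + 2 * x))) =
  (LBINT x. - (\<gamma>1 + \<mu>1) * (ind {a<..<b} x * \<zeta> (s + 2 * x)) + \<mu>1 * (ind {a<..<b} x * F (s + 2 * x)))"
  by (intro integral_cong refl) (simp add: algebra_simps)
 also have "... = - (\<gamma>1 + \<mu>1) * (LBINT x. ind {a<..<b} x * \<zeta> (s + 2 * x)) + \<mu>1 * (LBINT x. ind {a<..<b} x * F (s + 2 * x))"
  by (subst integral_add) (auto intro!: integrable_mult_right iF iZ)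
 finally show "\<mu>1 * (LBINT x. ind {a<..<b} x * F (s + 2 * x)) =
  (\<zeta> (s + 2 * b) - \<zeta> (s + 2 * a)) / 2 + (\<gamma>1 + \<mu>1) * (LBINT x. ind {a<..<b} x * \<zeta> (s + 2 * x))"
  by (simp add: distrib_right left_diff_distrib add_divide_distrib diff_divide_distrib)
qed

lemma F_window_average_square:
 assumes "0 < s"
 shows "(LBINT x. ind {a<..<b} x * F (s + 2 * x))^2 <=
  16 * K ^ 4 * ((\<zeta> (s + 2 * b))^2 + (\<zeta> (s + 2 * a))^2 + (LBINT x. ind {a<..<b} x * \<zeta> (s + 2 * x))^2)"
proof -
 define m zb za z where "m = (LBINT x. ind {a<..<b} x * F (s + 2 * x))" and "zb = \<zeta> (s + 2 * b)"
  and "za = \<zeta> (s + 2 * a)" and "z = (LBINT x. ind {a<..<b} x * \<zeta> (s + 2 * x))"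
 have "m = (1 / \<mu>1) * (zb / 2 + - za / 2 + (\<gamma>1 + \<mu>1) * z + 0)"
  using F_window_average(1)[OF assms] coeff_pos unfolding m_def[symmetric] zb_def[symmetric] za_def[symmetric] z_def[symmetric]
  by (simp add: field_simps)
 then have "m^2 = (1 / \<mu>1)^2 * (zb / 2 + - za / 2 + (\<gamma>1 + \<mu>1) * z + 0)^2" by (simp only: power_mult_distrib)
 also have "... <= K^2 * (4 * ((zb / 2)^2 + (- za / 2)^2 + ((\<gamma>1 + \<mu>1) * z)^2 + 0^2))"
  using coeff_inverse_le(2) coeff_pos by (intro mult_mono square_sum4_le power_mono) auto
 also have "... = K^2 * (zb^2 + za^2 + 4 * ((\<gamma>1 + \<mu>1)^2 * z^2))" by (simp add: power2_eq_square algebra_simps)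
 also have "... <= K^2 * (16 * K^2 * zb^2 + 16 * K^2 * za^2 + 4 * ((2 * K)^2 * z^2))"
 proof (intro mult_left_mono add_mono)
  have "1 <= 16 * K^2" using K1 one_le_power[of K 2] by linarith
  then show "zb^2 <= 16 * K^2 * zb^2" "za^2 <= 16 * K^2 * za^2"
   using mult_right_mono[of 1 "16 * K^2" "zb^2"] mult_right_mono[of 1 "16 * K^2" "za^2"] by auto
  show "(\<gamma>1 + \<mu>1)^2 * z^2 <= (2 * K)^2 * z^2"
   using coeff_le coeff_pos by (intro mult_right_mono power_mono) auto
 qed auto
 also have "... = 16 * K ^ 4 * (zb^2 + za^2 + z^2)"
  by (simp add: power2_eq_square power4_eq_xxxx algebra_simps)
 finally show ?thesis unfolding m_def zb_def za_def z_def .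
qed

text \<open>The ray \<open>t = s + x\<close> is a characteristic of the other family. Along it the
  label \<open>t + x = s + 2 * x\<close> of the crossing characteristics of \<open>r\<close> varies,
  so the ray samples \<open>F\<close> over a whole window of times.\<close>

lemma AE_ray: "AEL s. AEL x. 0 < s --> 0 < x --> x < 1 -->
 r (s + x) x = F (s + 2 * x) + (LBINT u. ind {0<..<x} u * g (s + 2 * x - u) u)"
proof -
 have "AEL s. AEL x. 0 < s + 1 * x --> 0 < x --> x < 1 --> r (s + 1 * x) x = rt.R (s + 1 * x + x) x"
 proof (rule AE_shear[where P="\<lambda>t x. 0 < t --> 0 < x --> x < 1 --> r t x = rt.R (t + x) x"])
  show "AEL t. AEL x. 0 < t --> 0 < x --> x < 1 --> r t x = rt.R (t + x) x"
   using rt.char by (simp add: rt.R_def)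
 qed measurable
 then show ?thesis
 proof eventually_elim
  case (elim s)
  then show ?case by eventually_elim (auto simp: rt.R_def algebra_simps)
 qed
qed

lemma AE_shift1:
 assumes "AEL s. P (s::real)" shows "AEL s. P (s + 1)"
proof -
 have "AE s in distr lborel borel ((+) 1). P s" unfolding lborel_distr_plus by (rule assms)
 from AE_distrD[OF _ this] show ?thesis by (simp add: add.commute)
qed

lemma AE_ray_reflected: "AEL s. AEL x. 0 < s --> 0 < x --> x < 1 --> v (s + x) (1 - x) = vt.R (s + 1) (1 - x)"
proof -
 have "AEL s. AEL y. 0 < y --> y < 1 --> y < s + 1 --> v ((s + 1) - y) y = vt.R (s + 1) y"
  by (rule AE_shift1[OF vt.AE_char])
 then show ?thesis
 proof eventually_elim
  case (elim s)
  have "AEL x. 0 < 1 + (-1) * x --> 1 + (-1) * x < 1 --> 1 + (-1) * x < s + 1 -->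
   v ((s + 1) - (1 + (-1) * x)) (1 + (-1) * x) = vt.R (s + 1) (1 + (-1) * x)"
   by (rule AE_borel_affine) (use elim in auto)
  then show ?case by eventually_elim (auto simp: add.commute)
 qed
qed

text \<open>At the point \<open>(s + x, x)\<close> the first family equals
  \<open>F (s + 2 * x)\<close> up to its source. The second family, followed back along the ray to
  \<open>x = 0\<close>, equals \<open>F s - 2 * \<zeta> s\<close> up to its source. Their difference
  is what the damping sees for \<open>x\<close> in the damped interval, so increments of
  \<open>F\<close> consist of dissipated quantities only.\<close>

lemma F_minus_shift:
 "AEL s. 0 < s --> (AEL x. a < x --> x < b -->
  F s - F (s + 2 * x) = (LBINT u. ind {0<..<x} u * g (s + 2 * x - u) u) +
   (LBINT u. ind {1 - x<..<1} u * h (s + 1 - u) u) + 2 * \<zeta> s + - (r (s + x) x - v (s + x) (1 - x)))"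
proof -
 have "AEL s. vt.regular (s + 1)"
  by (rule AE_shift1[OF vt.AE_regular])
 with AE_ray AE_ray_reflected bdry0 show ?thesis
 proof eventually_elim
  case (elim s)
  show ?case
  proof (rule impI)
   assume s: "0 < s"
   show "AEL x. a < x --> x < b -->
    F s - F (s + 2 * x) = (LBINT u. ind {0<..<x} u * g (s + 2 * x - u) u) +
    (LBINT u. ind {1 - x<..<1} u * h (s + 1 - u) u) + 2 * \<zeta> s + - (r (s + x) x - v (s + x) (1 - x))"
    using elim(1,2)
   proof eventually_elim
    fix x assume 1: "0 < s --> 0 < x --> x < 1 --> r (s + x) x = F (s + 2 * x) + (LBINT u. ind {0<..<x} u * g (s + 2 * x - u) u)"
     and 2: "0 < s --> 0 < x --> x < 1 --> v (s + x) (1 - x) = vt.R (s + 1) (1 - x)"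
    show "a < x --> x < b --> F s - F (s + 2 * x) = (LBINT u. ind {0<..<x} u * g (s + 2 * x - u) u) +
     (LBINT u. ind {1 - x<..<1} u * h (s + 1 - u) u) + 2 * \<zeta> s + - (r (s + x) x - v (s + x) (1 - x))"
    proof (intro impI)
     assume x: "a < x" "x < b"
     then have x01: "0 < x" "x < 1" using omega by auto
     show "F s - F (s + 2 * x) = (LBINT u. ind {0<..<x} u * g (s + 2 * x - u) u) +
      (LBINT u. ind {1 - x<..<1} u * h (s + 1 - u) u) + 2 * \<zeta> s + - (r (s + x) x - v (s + x) (1 - x))"
      using 1 2 elim(3) s x01 vt.R_diff[OF elim(4), of "1 - x" 1] by simp
    qed
   qed
  qed
 qed
qed

text \<open>Averaging \<open>F_minus_shift\<close> over the damped interval gives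
  \<open>(b - a) * F s = m + I\<close>, where \<open>m\<close> is the window mean of
  \<open>F\<close>, controlled by \<zeta> alone, and \<open>I\<close> collects the increments. The
  constants are those of \<open>F_window_average_square\<close> and of the square of a sum of four
  terms, multiplied by the \<open>K^2\<close> that inverts \<open>b - a\<close>.\<close>

lemma F_square_pointwise:
 "AEL s. 0 < s --> ennreal ((F s)^2) <=
  ennreal (32 * K ^ 6) * (ennreal ((\<zeta> (s + 2 * b))^2) + ennreal ((\<zeta> (s + 2 * a))^2) +
   (NBINT x. ind {a<..<b} x * ennreal ((\<zeta> (s + 2 * x))^2))) +
  ennreal (8 * K^2) * ((NBINT x. ind {a<..<b} x * (NBINT u. ind {0<..<x} u * ennreal ((g (s + (2 * x - u)) u)^2))) +
   (NBINT u. ennreal ((h (s + (1 - u)) u)^2)) + 4 * ennreal ((\<zeta> s)^2) +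
   (NBINT x. ind {a<..<b} x * ennreal ((r (s + x) x - v (s + x) (1 - x))^2)))"
 using F_minus_shift
proof eventually_elim
 case (elim s)
 show ?case
 proof (rule impI)
  assume s: "0 < s"
  let ?G = "\<lambda>x. LBINT u. ind {0<..<x} u * g (s + 2 * x - u) u"
  let ?H = "\<lambda>x. LBINT u. ind {1 - x<..<1} u * h (s + 1 - u) u"
  let ?d = "\<lambda>x. r (s + x) x - v (s + x) (1 - x)"
  let ?T1 = "NBINT x. ind {a<..<b} x * (NBINT u. ind {0<..<x} u * ennreal ((g (s + (2 * x - u)) u)^2))"
  let ?T2 = "NBINT u. ennreal ((h (s + (1 - u)) u)^2)"
  let ?T3 = "NBINT x. ind {a<..<b} x * ennreal ((?d x)^2)"
  let ?S3 = "NBINT x. ind {a<..<b} x * ennreal ((\<zeta> (s + 2 * x))^2)"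
  define m where "m = (LBINT x. ind {a<..<b} x * F (s + 2 * x))"
  define z where "z = (LBINT x. ind {a<..<b} x * \<zeta> (s + 2 * x))"
  define \<phi> where "\<phi> x = ind {a<..<b} x * (F s - F (s + 2 * x))" for x
  define I where "I = (LBINT x. \<phi> x)"
  have ab1: "emeasure lborel {a<..<b} <= 1" using omega by (simp add: ennreal_leI)
  have "I = (LBINT x. F s * ind {a<..<b} x - ind {a<..<b} x * F (s + 2 * x))"
   unfolding I_def \<phi>_def by (intro integral_cong) (auto simp: algebra_simps)
  also have "... = F s * (b - a) - m"
   using F_window_average(2)[OF s] omega unfolding m_def
   by (subst integral_diff) auto
  finally have mI: "(b - a) * F s = m + I" by simp
  have "borel_fun \<phi>" unfolding \<phi>_def by measurable
  then have "ennreal (I^2) <= (NBINT x. ennreal ((\<phi> x)^2))"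
   unfolding I_def using ab1 by (intro Cauchy_Schwarz_unit[of _ "{a<..<b}"]) (auto simp: \<phi>_def)
  also have "... <= (NBINT x. 4 * (ind {a<..<b} x * (NBINT u. ind {0<..<x} u * ennreal ((g (s + (2 * x - u)) u)^2)) +
    ind {a<..<b} x * ?T2 + ind {a<..<b} x * (4 * ennreal ((\<zeta> s)^2)) + ind {a<..<b} x * ennreal ((?d x)^2)))"
  proof (rule nn_integral_mono_AE)
   show "AEL x. ennreal ((\<phi> x)^2) <= 4 * (ind {a<..<b} x * (NBINT u. ind {0<..<x} u * ennreal ((g (s + (2 * x - u)) u)^2)) +
    ind {a<..<b} x * ?T2 + ind {a<..<b} x * (4 * ennreal ((\<zeta> s)^2)) + ind {a<..<b} x * ennreal ((?d x)^2))"
    using elim[rule_format, OF s]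
   proof eventually_elim
    case (elim x)
    show ?case
    proof (cases "x \<in> {a<..<b}")
     case True
     have x: "0 < x" "x < 1" using True omega by auto
     have "\<phi> x = ?G x + ?H x + 2 * \<zeta> s + - ?d x" using elim True by (simp add: \<phi>_def)
     then have "(\<phi> x)^2 <= 4 * ((?G x)^2 + (?H x)^2 + (2 * \<zeta> s)^2 + (?d x)^2)"
      using square_sum4_le[of "?G x" "?H x" "2 * \<zeta> s" "- ?d x"] by (simp only: power2_minus)
     then have "ennreal ((\<phi> x)^2) <= ennreal (4 * ((?G x)^2 + (?H x)^2 + (2 * \<zeta> s)^2 + (?d x)^2))" by (rule ennreal_leI)
     also have "... = 4 * (ennreal ((?G x)^2) + ennreal ((?H x)^2) + 4 * ennreal ((\<zeta> s)^2) + ennreal ((?d x)^2))"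
      by (simp add: ennreal_mult power_mult_distrib)
     also have "... <= 4 * ((NBINT u. ind {0<..<x} u * ennreal ((g (s + (2 * x - u)) u)^2)) + ?T2 + 4 * ennreal ((\<zeta> s)^2) + ennreal ((?d x)^2))"
     proof (intro mult_left_mono add_mono order_refl)
      have "ennreal ((?G x)^2) <= (NBINT u. ennreal ((ind {0<..<x} u * g (s + 2 * x - u) u)^2))"
       by (rule Cauchy_Schwarz_unit[of _ "{0<..<1}"]) (auto simp: rt.g_supp)
      also have "... = (NBINT u. ind {0<..<x} u * ennreal ((g (s + (2 * x - u)) u)^2))"
       by (intro nn_integral_cong) (auto simp: indicator_def algebra_simps)
      finally show "ennreal ((?G x)^2) <= (NBINT u. ind {0<..<x} u * ennreal ((g (s + (2 * x - u)) u)^2))" .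
      have "ennreal ((?H x)^2) <= (NBINT u. ennreal ((ind {1 - x<..<1} u * h (s + 1 - u) u)^2))"
       by (rule Cauchy_Schwarz_unit[of _ "{0<..<1}"]) (auto simp: vt.g_supp)
      also have "... <= ?T2"
       by (intro nn_integral_mono) (auto simp: indicator_def algebra_simps)
      finally show "ennreal ((?H x)^2) <= ?T2" .
     qed auto
     finally show ?thesis using True by simp
    qed (simp add: \<phi>_def)
   qed
  qed
  also have "... = 4 * (?T1 + ?T2 * emeasure lborel {a<..<b} + 4 * ennreal ((\<zeta> s)^2) * emeasure lborel {a<..<b} + ?T3)"
   by (simp add: nn_integral_add nn_integral_cmult nn_integral_multc mult.commute)
  also have "... <= 4 * (?T1 + ?T2 * 1 + 4 * ennreal ((\<zeta> s)^2) * 1 + ?T3)"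
   using ab1 by (intro mult_left_mono add_mono order_refl) auto
  finally have I2: "ennreal (I^2) <= 4 * (?T1 + ?T2 + 4 * ennreal ((\<zeta> s)^2) + ?T3)" by simp
  have "ennreal (z^2) <= (NBINT x. ennreal ((ind {a<..<b} x * \<zeta> (s + 2 * x))^2))"
   unfolding z_def using ab1 by (intro Cauchy_Schwarz_unit[of _ "{a<..<b}"]) auto
  also have "... = ?S3" by (intro nn_integral_cong) (auto simp: indicator_def)
  finally have z2: "ennreal (z^2) <= ?S3" .
  \<comment> \<open>The bound \<open>1 <= K * (b - a)\<close> pays for dividing by the length of the
    damped interval.\<close>
  have "(F s)^2 <= (K * (b - a))^2 * (F s)^2"
   using omega mult_right_mono[of 1 "(K * (b - a))^2" "(F s)^2"] one_le_power[of "K * (b - a)" 2] by simp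
  also have "... = K^2 * (m + I)^2" unfolding mI[symmetric] by (simp add: power_mult_distrib)
  also have "... <= K^2 * (2 * m^2 + 2 * I^2)"
   using sum_squares_bound[of m I] by (intro mult_left_mono) (auto simp: power2_sum)
  also have "... <= K^2 * (2 * (16 * K ^ 4 * ((\<zeta> (s + 2 * b))^2 + (\<zeta> (s + 2 * a))^2 + z^2)) + 2 * I^2)"
   using F_window_average_square[OF s] unfolding m_def[symmetric] z_def[symmetric] by (intro mult_left_mono add_mono) auto
  also have "... = 32 * K ^ 6 * ((\<zeta> (s + 2 * b))^2 + (\<zeta> (s + 2 * a))^2 + z^2) + 2 * K^2 * I^2"
   by (simp add: eval_nat_numeral algebra_simps)
  finally have "ennreal ((F s)^2) <= ennreal (32 * K ^ 6 * ((\<zeta> (s + 2 * b))^2 + (\<zeta> (s + 2 * a))^2 + z^2) + 2 * K^2 * I^2)"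
   by (rule ennreal_leI)
  also have "... = ennreal (32 * K ^ 6) * (ennreal ((\<zeta> (s + 2 * b))^2) + ennreal ((\<zeta> (s + 2 * a))^2) + ennreal (z^2)) + ennreal (2 * K^2) * ennreal (I^2)"
   using K1 by (simp only: ennreal_plus ennreal_mult zero_le_power2 add_nonneg_nonneg mult_nonneg_nonneg
     zero_le_numeral zero_le_power order_trans[OF zero_le_one])
  also have "... <= ennreal (32 * K ^ 6) * (ennreal ((\<zeta> (s + 2 * b))^2) + ennreal ((\<zeta> (s + 2 * a))^2) + ?S3) +
   ennreal (2 * K^2) * (4 * (?T1 + ?T2 + 4 * ennreal ((\<zeta> s)^2) + ?T3))"
   by (intro add_mono mult_left_mono order_refl z2 I2) auto
  also have "ennreal (2 * K^2) * (4 * (?T1 + ?T2 + 4 * ennreal ((\<zeta> s)^2) + ?T3)) = ennreal (8 * K^2) * (?T1 + ?T2 + 4 * ennreal ((\<zeta> s)^2) + ?T3)"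
  proof -
   have "ennreal (8 * K^2) = ennreal (2 * K^2) * 4" by (subst ennreal_numeral[symmetric], subst ennreal_mult[symmetric]) auto
   then show ?thesis by (simp add: mult.assoc)
  qed
  finally show "ennreal ((F s)^2) <= ennreal (32 * K ^ 6) * (ennreal ((\<zeta> (s + 2 * b))^2) + ennreal ((\<zeta> (s + 2 * a))^2) + ?S3) +
   ennreal (8 * K^2) * (?T1 + ?T2 + 4 * ennreal ((\<zeta> s)^2) + ?T3)" .
 qed
qed

lemma nn_integral_indicator_const_le:
 assumes "emeasure lborel {p<..<q::real} <= 1" "\<And>x. x \<in> {p<..<q} ==> f x <= c"
 shows "(NBINT x. ind {p<..<q} x * f x) <= c"
proof -
 have "(NBINT x. ind {p<..<q} x * f x) <= (NBINT x. c * ind {p<..<q} x)"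
  using assms(2) by (intro nn_integral_mono) (auto simp: indicator_def)
 also have "... = c * emeasure lborel {p<..<q}" by (simp add: nn_integral_cmult_indicator)
 also have "... <= c * 1" using assms(1) by (intro mult_left_mono) auto
 finally show ?thesis by simp
qed

text \<open>All delays in the pointwise estimate are at most 2, so for times in a window of length 4
  the whole estimate stays inside an interval of length 6. The length 4 is what the reconstruction
  in \<open>observability\<close> consumes.\<close>

lemma F_square_window:
 assumes good: "good t0" "good t1" and t: "t0 + 6 <= t1"
 defines "Q \<equiv> ennreal (2 * K^2 * (e t0 - e t1))"
 shows "(NBINT t. ind {t0<..<t0 + 4} t * ennreal ((F t)^2)) <= ennreal (200 * K ^ 6) * Q"
proof -
 have "0 < t0" using good by (simp add: good_def rt.good_def)
 have lt: "t0 < t1" using t by simp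
 note D = dissipation_bounds[OF good lt, folded Q_def]
 let ?J = "ind {t0<..<t0 + 4} :: real => ennreal"
 let ?S1 = "\<lambda>s. ennreal ((\<zeta> (s + 2 * b))^2)" and ?S2 = "\<lambda>s. ennreal ((\<zeta> (s + 2 * a))^2)"
  and ?S3 = "\<lambda>s. NBINT x. ind {a<..<b} x * ennreal ((\<zeta> (s + 2 * x))^2)"
  and ?T1 = "\<lambda>s. NBINT x. ind {a<..<b} x * (NBINT u. ind {0<..<x} u * ennreal ((g (s + (2 * x - u)) u)^2))"
  and ?T2 = "\<lambda>s. NBINT u. ennreal ((h (s + (1 - u)) u)^2)"
  and ?T3 = "\<lambda>s. NBINT x. ind {a<..<b} x * ennreal ((r (s + x) x - v (s + x) (1 - x))^2)"
 have ab1: "emeasure lborel {a<..<b} <= 1" using omega by (simp add: ennreal_leI)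
 have S1: "(NBINT s. ?J s * ?S1 s) <= Q"
  by (rule order_trans[OF nn_integral_shift_window1[of "\<lambda>t. ennreal ((\<zeta> t)^2)" "2 * b" t0 4 t1] D(6)]) (use omega t in auto)
 have S2: "(NBINT s. ?J s * ?S2 s) <= Q"
  by (rule order_trans[OF nn_integral_shift_window1[of "\<lambda>t. ennreal ((\<zeta> t)^2)" "2 * a" t0 4 t1] D(6)]) (use omega t in auto)
 have S0: "(NBINT s. ?J s * ennreal ((\<zeta> s)^2)) <= Q"
  using order_trans[OF nn_integral_shift_window1[of "\<lambda>t. ennreal ((\<zeta> t)^2)" 0 t0 4 t1] D(6)] omega t by auto
 have S3: "(NBINT s. ?J s * ?S3 s) <= Q"
 proof -
  have "(NBINT s. ?J s * ?S3 s) <= (NBINT t x. ind {t0<..<t1} t * (ind {a<..<b} x * ennreal ((\<zeta> t)^2)))"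
   by (rule nn_integral_shift_window[of "\<lambda>t x. ind {a<..<b} x * ennreal ((\<zeta> t)^2)" "\<lambda>x. 2 * x"])
    (use omega t in \<open>auto simp: indicator_def split: if_splits\<close>)
  also have "... <= (NBINT t. ind {t0<..<t1} t * ennreal ((\<zeta> t)^2))"
  proof (rule nn_integral_mono)
   fix t
   have "(NBINT x. ind {t0<..<t1} t * (ind {a<..<b} x * ennreal ((\<zeta> t)^2))) =
    (NBINT x. ind {a<..<b} x * (ind {t0<..<t1} t * ennreal ((\<zeta> t)^2)))"
    by (simp add: mult.left_commute)
   also have "... <= ind {t0<..<t1} t * ennreal ((\<zeta> t)^2)"
    by (rule nn_integral_indicator_const_le[OF ab1]) simp
   finally show "(NBINT x. ind {t0<..<t1} t * (ind {a<..<b} x * ennreal ((\<zeta> t)^2))) <= ind {t0<..<t1} t * ennreal ((\<zeta> t)^2)" .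
  qed
  finally show ?thesis using D(6) by (rule order_trans)
 qed
 have T2: "(NBINT s. ?J s * ?T2 s) <= Q"
 proof -
  have "(NBINT s. ?J s * ?T2 s) <= (NBINT t x. ind {t0<..<t1} t * ennreal ((h t x)^2))"
  proof (rule nn_integral_shift_window[of "\<lambda>t x. ennreal ((h t x)^2)" "\<lambda>u. 1 - u"])
   fix \<tau> x assume "ennreal ((h \<tau> x)^2) \<noteq> 0"
   then have "0 < x \<and> x < 1" using vt.g_supp[of \<tau> x] by auto
   then show "0 <= 1 - x \<and> t0 + 4 + (1 - x) <= t1" using t by auto
  qed measurable
  then show ?thesis using D(3) by (rule order_trans)
 qed
 have T3: "(NBINT s. ?J s * ?T3 s) <= Q"
 proof -
  have "(NBINT s. ?J s * ?T3 s) <= (NBINT t x. ind {t0<..<t1} t * (ind {a<..<b} x * ennreal ((r t x - v t (1 - x))^2)))"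
   by (rule nn_integral_shift_window[of "\<lambda>t x. ind {a<..<b} x * ennreal ((r t x - v t (1 - x))^2)" "\<lambda>u. u"])
   (use omega t in \<open>auto simp: indicator_def split: if_splits\<close>)
  then show ?thesis using D(4) by (rule order_trans)
 qed
 have T1: "(NBINT s. ?J s * ?T1 s) <= Q"
 proof -
  let ?w = "\<lambda>s x. NBINT u. ind {0<..<x} u * ennreal ((g (s + (2 * x - u)) u)^2)"
  have "(NBINT s. ?J s * ?T1 s) = (NBINT s x. ?J s * (ind {a<..<b} x * ?w s x))"
   by (simp add: nn_integral_cmult)
  also have "... = (NBINT x s. ?J s * (ind {a<..<b} x * ?w s x))"
   by (rule lborel_pair.Fubini'[symmetric]) measurable
  also have "... = (NBINT x. ind {a<..<b} x * (NBINT s. ?J s * ?w s x))"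
  proof (intro nn_integral_cong)
   fix x
   have "(NBINT s. ?J s * (ind {a<..<b} x * ?w s x)) = (NBINT s. ind {a<..<b} x * (?J s * ?w s x))"
    by (intro nn_integral_cong) (simp only: ac_simps)
   also have "... = ind {a<..<b} x * (NBINT s. ?J s * ?w s x)"
    by (rule nn_integral_cmult) measurable
   finally show "(NBINT s. ?J s * (ind {a<..<b} x * ?w s x)) = ind {a<..<b} x * (NBINT s. ?J s * ?w s x)" .
  qed
  also have "... <= Q"
  proof (rule nn_integral_indicator_const_le[OF ab1])
   fix x assume x: "x \<in> {a<..<b}"
   have "(NBINT s. ?J s * ?w s x) <= (NBINT t u. ind {t0<..<t1} t * (ind {0<..<x} u * ennreal ((g t u)^2)))"
    by (rule nn_integral_shift_window[of "\<lambda>t u. ind {0<..<x} u * ennreal ((g t u)^2)" "\<lambda>u. 2 * x - u"])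
     (use omega t x in \<open>auto simp: indicator_def split: if_splits\<close>)
   also have "... <= (NBINT t u. ind {t0<..<t1} t * ennreal ((g t u)^2))"
    by (intro nn_integral_mono) (auto simp: indicator_def)
   finally show "(NBINT s. ?J s * ?w s x) <= Q" using D(2) by (rule order_trans)
  qed
  finally show ?thesis .
 qed
 define p1 where "p1 s = ?J s * ?S1 s" for s
 define p2 where "p2 s = ?J s * ?S2 s" for s
 define p3 where "p3 s = ?J s * ?S3 s" for s
 define q1 where "q1 s = ?J s * ?T1 s" for s
 define q2 where "q2 s = ?J s * ?T2 s" for s
 define q3 where "q3 s = ?J s * ennreal ((\<zeta> s)^2)" for s
 define q4 where "q4 s = ?J s * ?T3 s" for s
 have p1[measurable]: "p1 \<in> borel_measurable lborel" "(NBINT s. p1 s) <= Q"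
  unfolding p1_def by (measurable, rule S1)
 have p2[measurable]: "p2 \<in> borel_measurable lborel" "(NBINT s. p2 s) <= Q"
  unfolding p2_def by (measurable, rule S2)
 have p3[measurable]: "p3 \<in> borel_measurable lborel" "(NBINT s. p3 s) <= Q"
  unfolding p3_def by (measurable, rule S3)
 have q1[measurable]: "q1 \<in> borel_measurable lborel" "(NBINT s. q1 s) <= Q"
  unfolding q1_def by (measurable, rule T1)
 have q2[measurable]: "q2 \<in> borel_measurable lborel" "(NBINT s. q2 s) <= Q"
  unfolding q2_def by (measurable, rule T2)
 have q3[measurable]: "q3 \<in> borel_measurable lborel" "(NBINT s. q3 s) <= Q"
  unfolding q3_def by (measurable, rule S0)
 have q4[measurable]: "q4 \<in> borel_measurable lborel" "(NBINT s. q4 s) <= Q"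
  unfolding q4_def by (measurable, rule T3)
 have "AEL s. ?J s * ennreal ((F s)^2) <= ennreal (32 * K ^ 6) * (p1 s + p2 s + p3 s) +
   ennreal (8 * K^2) * (q1 s + q2 s + 4 * q3 s + q4 s)"
  using F_square_pointwise
 proof eventually_elim
  case (elim s)
  show ?case
  proof (cases "s \<in> {t0<..<t0 + 4}")
   case True
   then have J: "?J s = 1" by simp
   from True have "0 < s" using \<open>0 < t0\<close> by simp
   then show ?thesis unfolding p1_def p2_def p3_def q1_def q2_def q3_def q4_def J mult_1 by (rule elim[rule_format])
  qed simp
 qed
 then have "(NBINT t. ?J t * ennreal ((F t)^2)) <=
  (NBINT s. ennreal (32 * K ^ 6) * (p1 s + p2 s + p3 s) + ennreal (8 * K^2) * (q1 s + q2 s + 4 * q3 s + q4 s))"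
  by (rule nn_integral_mono_AE)
 also have "... = ennreal (32 * K ^ 6) * ((NBINT s. p1 s) + (NBINT s. p2 s) + (NBINT s. p3 s)) +
   ennreal (8 * K^2) * ((NBINT s. q1 s) + (NBINT s. q2 s) + 4 * (NBINT s. q3 s) + (NBINT s. q4 s))"
  by (simp add: nn_integral_add nn_integral_cmult)
 \<comment> \<open>Each of the integrals is at most \<open>Q\<close>: three with the weight
   \<open>32 * K ^ 6\<close> and, since \<zeta> counts four times, seven with the weight
   \<open>8 * K^2\<close>. This gives \<open>96 + 56\<close>, rounded up to 200.\<close>
 also have "... <= ennreal (32 * K ^ 6) * (Q + Q + Q) + ennreal (8 * K^2) * (Q + Q + 4 * Q + Q)"
  by (intro add_mono mult_left_mono p1 p2 p3 q1 q2 q3 q4) auto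
 also have "... = ennreal (96 * K ^ 6 + 56 * K^2) * Q"
 proof -
  define q where "q = 2 * K^2 * (e t0 - e t1)"
  have q: "0 <= q" "Q = ennreal q" using D(1) K1 by (auto simp: q_def Q_def)
  have "4 * Q = ennreal (4 * q)" using q by (simp add: ennreal_mult)
  then have "Q + Q + Q = ennreal (3 * q)" "Q + Q + 4 * Q + Q = ennreal (7 * q)"
   using q by (simp_all add: ennreal_plus[symmetric] del: ennreal_plus)
  then have "ennreal (32 * K ^ 6) * (Q + Q + Q) + ennreal (8 * K^2) * (Q + Q + 4 * Q + Q) =
   ennreal (32 * K ^ 6 * (3 * q) + 8 * K^2 * (7 * q))"
   using K1 q by (simp only: ennreal_plus ennreal_mult zero_le_power2 add_nonneg_nonneg mult_nonneg_nonneg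
     zero_le_numeral zero_le_power order_trans[OF zero_le_one])
  also have "32 * K ^ 6 * (3 * q) + 8 * K^2 * (7 * q) = (96 * K ^ 6 + 56 * K^2) * q" by (simp add: algebra_simps)
  also have "ennreal ((96 * K ^ 6 + 56 * K^2) * q) = ennreal (96 * K ^ 6 + 56 * K^2) * Q"
   using K1 q by (simp only: ennreal_mult zero_le_power2 add_nonneg_nonneg mult_nonneg_nonneg
     zero_le_numeral zero_le_power order_trans[OF zero_le_one])
  finally show ?thesis .
 qed
 also have "... <= ennreal (200 * K ^ 6) * Q"
 proof (intro mult_right_mono ennreal_leI)
  have "K^2 <= K ^ 6" using K1 by (intro power_increasing) auto
  then show "96 * K ^ 6 + 56 * K^2 <= 200 * K ^ 6" using K1 one_le_power[of K 6] by linarith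
 qed auto
 finally show ?thesis .
qed

end

section \<open>Observability: reconstruction of the full state\<close>

lemma nn_integral_window_mono:
 fixes \<phi> :: "real => ennreal"
 assumes "a <= a'" "b' <= b" "(NBINT t. ind {a<..<b} t * \<phi> t) <= L"
 shows "(NBINT t. ind {a'<..<b'} t * \<phi> t) <= L"
 by (rule order_trans[OF _ assms(3)]) (intro nn_integral_mono, use assms(1,2) in \<open>auto simp: indicator_def\<close>)

lemma nn_integral_window_mono2:
 fixes \<phi> :: "real => real => ennreal"
 assumes "a <= a'" "b' <= b" "(NBINT t x. ind {a<..<b} t * \<phi> t x) <= L"
 shows "(NBINT t x. ind {a'<..<b'} t * \<phi> t x) <= L"
 by (rule order_trans[OF _ assms(3)]) (intro nn_integral_mono, use assms(1,2) in \<open>auto simp: indicator_def\<close>)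

lemma AE_exists_between:
 assumes "AEL t. P t" "a < (b::real)"
 shows "\<exists>t. a < t \<and> t < b \<and> P t"
proof (rule ccontr)
 assume "\<not> ?thesis"
 with assms(1) have "AEL t. t \<notin> {a<..<b}" by (auto elim!: eventually_mono)
 moreover have "{t \<in> space lborel. \<not> t \<notin> {a<..<b}} = {a<..<b}" by auto
 ultimately have "emeasure lborel {a<..<b} = 0"
  using AE_iff_measurable[of "{a<..<b}" lborel "\<lambda>t. t \<notin> {a<..<b}"] by simp
 then show False using assms(2) by simp
qed

lemma square_sum_le_twice: "((x::real) + y)^2 <= 2 * x^2 + 2 * y^2"
 using sum_squares_bound[of x y] by (simp add: power2_sum)

context damped_string
begin

text \<open>\<eta>2 does not occur in the dissipation. Its mean \<open>N\<close> over one unit of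
  time is read off from the integrated equation of \<eta>1, where it appears with the factor
  \<alpha>2. Its deviation \<open>D\<close> from the mean is controlled by \<eta>1, because \<eta>1
  is its derivative.\<close>

lemma eta2_square_pointwise:
 assumes "0 < t"
 shows "ennreal ((\<eta>2 t)^2) <= ennreal (64 * K ^ 4) * (ennreal ((\<eta>1 (t + 1))^2) + ennreal ((\<eta>1 t)^2) +
  (NBINT y. ind {0<..<1} y * ennreal ((\<eta>1 (t + y))^2)) + (NBINT y. ind {0<..<1} y * ennreal ((H (t + y))^2)))"
proof -
 let ?P = "NBINT y. ind {0<..<1} y * ennreal ((\<eta>1 (t + y))^2)"
 let ?PH = "NBINT y. ind {0<..<1} y * ennreal ((H (t + y))^2)"
 have ind: "ind {t<..<t + 1} (t + y) = indicat_real {0<..<1} y" for y by (simp add: indicator_def)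
 have aff: "(LBINT \<tau>. ind {t<..<t + 1} \<tau> * w \<tau>) = (LBINT y. ind {0<..<1} y * w (t + y))" for w :: "real => real"
  using lborel_integral_real_affine[of 1 "\<lambda>\<tau>. ind {t<..<t + 1} \<tau> * w \<tau>" t] by (simp add: ind)
 have affi: "integrable lborel (\<lambda>y. ind {0<..<1} y * w (t + y))"
  if "integrable lborel (\<lambda>\<tau>. ind {t<..<t + 1} \<tau> * w \<tau>)" for w :: "real => real"
  using that lborel_integrable_real_affine_iff[of 1 "\<lambda>\<tau>. ind {t<..<t + 1} \<tau> * w \<tau>" t] by (simp add: ind)
 note ci = continuous_integrable_interval[OF eta_cont(1), of t "t + 1"] continuous_integrable_interval[OF eta_cont(2), of t "t + 1"]
  square_integrable_interval(1)[OF vt.F_meas vt.F_strip_finite, of t "t + 1"]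
 define A where "A = (LBINT y. ind {0<..<1} y * \<eta>1 (t + y))"
 define B where "B = (LBINT y. ind {0<..<1} y * H (t + y))"
 define N where "N = (LBINT y. ind {0<..<1} y * \<eta>2 (t + y))"
 define \<delta> where "\<delta> y = ind {0<..<1} y * (\<eta>2 (t + y) - \<eta>2 t)" for y
 define D where "D = (LBINT y. \<delta> y)"
 have i1: "integrable lborel (\<lambda>y. ind {0<..<1} y * \<eta>1 (t + y))" "integrable lborel (\<lambda>y. ind {0<..<1} y * \<eta>2 (t + y))"
  "integrable lborel (\<lambda>y. ind {0<..<1} y * H (t + y))"
  using assms ci by (auto intro!: affi)
 have e01: "emeasure lborel {0<..<1::real} <= 1" by simp
 have A2: "ennreal (A^2) <= ?P"
 proof -
  have "ennreal (A^2) <= (NBINT y. ennreal ((ind {0<..<1} y * \<eta>1 (t + y))^2))"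
   unfolding A_def by (intro Cauchy_Schwarz_unit[OF _ _ e01]) auto
  also have "... = ?P" by (intro nn_integral_cong) (auto simp: indicator_def)
  finally show ?thesis .
 qed
 have B2: "ennreal (B^2) <= ?PH"
 proof -
  have "ennreal (B^2) <= (NBINT y. ennreal ((ind {0<..<1} y * H (t + y))^2))"
   unfolding B_def by (intro Cauchy_Schwarz_unit[OF _ _ e01]) auto
  also have "... = ?PH" by (intro nn_integral_cong) (auto simp: indicator_def)
  finally show ?thesis .
 qed
 have "ennreal ((\<delta> y)^2) <= ind {0<..<1} y * ?P" for y
 proof (cases "y \<in> {0<..<1}")
  case True
  have "\<eta>2 (t + y) - \<eta>2 t = (LBINT \<tau>. ind {t<..<t + y} \<tau> * \<eta>1 \<tau>)"
   using ode_eta2[of t "t + y"] assms True by simp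
  also have "... = (LBINT y'. ind {0<..<y} y' * \<eta>1 (t + y'))"
  proof -
   have "ind {t<..<t + y} (t + y') = indicat_real {0<..<y} y'" for y' by (simp add: indicator_def)
   then show ?thesis
    using lborel_integral_real_affine[of 1 "\<lambda>\<tau>. ind {t<..<t + y} \<tau> * \<eta>1 \<tau>" t] by simp
  qed
  finally have eq: "\<eta>2 (t + y) - \<eta>2 t = (LBINT y'. ind {0<..<y} y' * \<eta>1 (t + y'))" .
  have "ennreal ((\<eta>2 (t + y) - \<eta>2 t)^2) <= (NBINT y'. ennreal ((ind {0<..<y} y' * \<eta>1 (t + y'))^2))"
   unfolding eq using True by (intro Cauchy_Schwarz_unit[OF _ _ e01]) auto
  also have "... <= ?P" using True by (intro nn_integral_mono) (auto simp: indicator_def)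
  finally show ?thesis using True by (simp add: \<delta>_def)
 qed (simp add: \<delta>_def)
 then have "(NBINT y. ennreal ((\<delta> y)^2)) <= (NBINT (y::real). ind {0<..<1} y * ?P)"
  by (intro nn_integral_mono)
 also have "... <= ?P" by (rule nn_integral_indicator_const_le) auto
 finally have "(NBINT y. ennreal ((\<delta> y)^2)) <= ?P" .
 moreover have "borel_fun \<delta>" unfolding \<delta>_def by measurable
 then have "ennreal (D^2) <= (NBINT y. ennreal ((\<delta> y)^2))"
  unfolding D_def by (intro Cauchy_Schwarz_unit[OF _ _ e01]) (auto simp: \<delta>_def)
 ultimately have D2: "ennreal (D^2) <= ?P" by simp
 have "D = (LBINT y. ind {0<..<1} y * \<eta>2 (t + y) - ind {0<..<1} y * \<eta>2 t)"
  unfolding D_def \<delta>_def by (intro integral_cong) (auto simp: algebra_simps)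
 also have "... = N - \<eta>2 t"
  unfolding N_def using i1 by (subst integral_diff) auto
 finally have DN: "\<eta>2 t = N - D" by simp
 have "\<eta>1 (t + 1) = \<eta>1 t + (LBINT y. ind {0<..<1} y * (- (\<alpha>1 + \<beta>1) * \<eta>1 (t + y) - \<alpha>2 * \<eta>2 (t + y) - \<beta>1 * H (t + y)))"
  using ode_eta1[of t "t + 1"] assms aff[of "\<lambda>\<tau>. - (\<alpha>1 + \<beta>1) * \<eta>1 \<tau> - \<alpha>2 * \<eta>2 \<tau> - \<beta>1 * H \<tau>"] by simp
 also have "(LBINT y. ind {0<..<1} y * (- (\<alpha>1 + \<beta>1) * \<eta>1 (t + y) - \<alpha>2 * \<eta>2 (t + y) - \<beta>1 * H (t + y))) =
  (LBINT y. - (\<alpha>1 + \<beta>1) * (ind {0<..<1} y * \<eta>1 (t + y)) - \<alpha>2 * (ind {0<..<1} y * \<eta>2 (t + y)) - \<beta>1 * (ind {0<..<1} y * H (t + y)))"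
  by (intro integral_cong refl) (simp add: algebra_simps)
 also have "... = - (\<alpha>1 + \<beta>1) * A - \<alpha>2 * N - \<beta>1 * B"
  unfolding A_def N_def B_def
  by (subst integral_diff; (subst integral_diff)?)
   (auto intro!: integrable_mult_right integrable_diff i1)
 finally have ode: "\<alpha>2 * N = - \<eta>1 (t + 1) + \<eta>1 t - (\<alpha>1 + \<beta>1) * A - \<beta>1 * B" by (simp add: algebra_simps)
 have "\<alpha>2 * \<eta>2 t = - \<eta>1 (t + 1) + \<eta>1 t + (- (\<alpha>1 + \<beta>1) * A + - \<beta>1 * B) + - \<alpha>2 * D"
  unfolding DN right_diff_distrib ode by (simp add: algebra_simps)
 then have "(\<alpha>2 * \<eta>2 t)^2 <= 4 * ((- \<eta>1 (t + 1))^2 + (\<eta>1 t)^2 + (- (\<alpha>1 + \<beta>1) * A + - \<beta>1 * B)^2 + (- \<alpha>2 * D)^2)"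
  using square_sum4_le[of "- \<eta>1 (t + 1)" "\<eta>1 t" "- (\<alpha>1 + \<beta>1) * A + - \<beta>1 * B" "- \<alpha>2 * D"] by (simp only:)
 also have "... <= 4 * (K^2 * 2 * (\<eta>1 (t + 1))^2 + K^2 * 2 * (\<eta>1 t)^2 + (8 * K^2 * A^2 + 2 * K^2 * B^2) + K^2 * D^2)"
 proof (intro mult_left_mono add_mono)
  have K2: "1 <= K^2 * 2" using one_le_power[OF K1, of 2] by simp
  show "(- \<eta>1 (t + 1))^2 <= K^2 * 2 * (\<eta>1 (t + 1))^2" "(\<eta>1 t)^2 <= K^2 * 2 * (\<eta>1 t)^2"
   using mult_right_mono[OF K2, of "(\<eta>1 (t + 1))^2"] mult_right_mono[OF K2, of "(\<eta>1 t)^2"] by auto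
  have "(\<alpha>1 + \<beta>1)^2 <= (2 * K)^2" "\<beta>1^2 <= K^2" "\<alpha>2^2 <= K^2"
   using coeff_le coeff_pos by (intro power_mono; simp)+
  then have c: "(\<alpha>1 + \<beta>1)^2 * A^2 <= 4 * K^2 * A^2" "\<beta>1^2 * B^2 <= K^2 * B^2" "\<alpha>2^2 * D^2 <= K^2 * D^2"
   by (auto intro!: mult_right_mono simp: power_mult_distrib)
  have "(- (\<alpha>1 + \<beta>1) * A + - \<beta>1 * B)^2 <= 2 * (- (\<alpha>1 + \<beta>1) * A)^2 + 2 * (- \<beta>1 * B)^2" by (rule square_sum_le_twice)
  also have "... = 2 * ((\<alpha>1 + \<beta>1)^2 * A^2) + 2 * (\<beta>1^2 * B^2)" by (simp only: power_mult_distrib power2_minus)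
  also have "... <= 8 * K^2 * A^2 + 2 * K^2 * B^2" using c by simp
  finally show "(- (\<alpha>1 + \<beta>1) * A + - \<beta>1 * B)^2 <= 8 * K^2 * A^2 + 2 * K^2 * B^2" .
  show "(- \<alpha>2 * D)^2 <= K^2 * D^2" using c by (simp add: power_mult_distrib)
 qed auto
 also have "... <= K^2 * (32 * ((\<eta>1 (t + 1))^2 + (\<eta>1 t)^2 + A^2 + B^2 + D^2))"
 proof -
  have "0 <= K^2 * (24 * (\<eta>1 (t + 1))^2 + 24 * (\<eta>1 t)^2 + 24 * B^2 + 28 * D^2)" by simp
  then show ?thesis by (simp add: algebra_simps)
 qed
 finally have step: "(\<alpha>2 * \<eta>2 t)^2 <= K^2 * (32 * ((\<eta>1 (t + 1))^2 + (\<eta>1 t)^2 + A^2 + B^2 + D^2))" .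
 have "(\<eta>2 t)^2 <= (K * \<alpha>2)^2 * (\<eta>2 t)^2"
  using mult_right_mono[OF one_le_power[OF coeff_ge(2), of 2], of "(\<eta>2 t)^2"] by simp
 also have "... = K^2 * (\<alpha>2 * \<eta>2 t)^2" by (simp add: power_mult_distrib)
 also have "... <= K^2 * (K^2 * (32 * ((\<eta>1 (t + 1))^2 + (\<eta>1 t)^2 + A^2 + B^2 + D^2)))"
  by (intro mult_left_mono step) auto
 also have "... = 32 * K ^ 4 * ((\<eta>1 (t + 1))^2 + (\<eta>1 t)^2 + A^2 + B^2 + D^2)"
  by (simp add: eval_nat_numeral algebra_simps)
 finally have "ennreal ((\<eta>2 t)^2) <= ennreal (32 * K ^ 4 * ((\<eta>1 (t + 1))^2 + (\<eta>1 t)^2 + A^2 + B^2 + D^2))" by (rule ennreal_leI)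
 also have "... = ennreal (32 * K ^ 4) * (ennreal ((\<eta>1 (t + 1))^2) + ennreal ((\<eta>1 t)^2) + ennreal (A^2) + ennreal (B^2) + ennreal (D^2))"
  using K1 by (simp only: ennreal_plus ennreal_mult zero_le_power2 add_nonneg_nonneg mult_nonneg_nonneg
     zero_le_numeral zero_le_power order_trans[OF zero_le_one])
 also have "... <= ennreal (32 * K ^ 4) * (2 * ennreal ((\<eta>1 (t + 1))^2) + 2 * ennreal ((\<eta>1 t)^2) + ?P + 2 * ?PH + ?P)"
  using mult_right_mono[of 1 "2::ennreal"]
  by (intro mult_left_mono add_mono A2 D2 order_trans[OF B2]) auto
 also have "... = ennreal (32 * K ^ 4) * (2 * (ennreal ((\<eta>1 (t + 1))^2) + ennreal ((\<eta>1 t)^2) + ?P + ?PH))"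
  by (simp add: distrib_left mult_2 ac_simps)
 also have "... = ennreal (64 * K ^ 4) * (ennreal ((\<eta>1 (t + 1))^2) + ennreal ((\<eta>1 t)^2) + ?P + ?PH)"
 proof -
  have "ennreal (64 * K ^ 4) = ennreal (32 * K ^ 4) * 2" by (subst ennreal_numeral[symmetric], subst ennreal_mult[symmetric]) auto
  then show ?thesis by (simp add: mult.assoc)
 qed
 finally show ?thesis .
qed

lemma e_le:
 assumes "good t"
 shows "ennreal (e t) <= (NBINT x. ennreal ((r t x)^2)) + (NBINT x. ennreal ((v t x)^2)) +
  ennreal (K^2) * (ennreal ((\<eta>1 t)^2) + ennreal ((\<eta>2 t)^2) + ennreal ((\<zeta> t)^2))"
proof -
 have gr: "rt.good t" "vt.good t" using assms by (auto simp: good_def)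
 let ?r = "LBINT x. (r t x)^2" and ?v = "LBINT x. (v t x)^2"
 have nn: "0 <= ?r" "0 <= ?v" by (auto intro: integral_nonneg_AE)
 have KK: "K <= K^2" using K1 by (simp add: power2_eq_square)
 have c: "1 / (2 * \<beta>1) <= K^2" "\<alpha>2 / (2 * \<beta>1) <= K^2" "1 / (2 * \<mu>1) <= K^2"
 proof -
  have "1 / (2 * \<beta>1) <= 1 / \<beta>1" "1 / (2 * \<mu>1) <= 1 / \<mu>1" "\<alpha>2 / (2 * \<beta>1) <= \<alpha>2 * (1 / \<beta>1)"
   using coeff_pos by (simp_all add: field_simps)
  moreover have "\<alpha>2 * (1 / \<beta>1) <= K * K" using coeff_le coeff_inverse_le coeff_pos K1 by (intro mult_mono) auto
  ultimately show "1 / (2 * \<beta>1) <= K^2" "\<alpha>2 / (2 * \<beta>1) <= K^2" "1 / (2 * \<mu>1) <= K^2"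
   using KK coeff_inverse_le by (auto simp: power2_eq_square)
 qed
 have "e t <= ?r + ?v + (K^2 * (\<eta>1 t)^2 + K^2 * (\<eta>2 t)^2 + K^2 * (\<zeta> t)^2)"
 proof -
  have "(\<eta>1 t)^2 / (2 * \<beta>1) <= K^2 * (\<eta>1 t)^2" "\<alpha>2 * (\<eta>2 t)^2 / (2 * \<beta>1) <= K^2 * (\<eta>2 t)^2" "(\<zeta> t)^2 / (2 * \<mu>1) <= K^2 * (\<zeta> t)^2"
   using mult_right_mono[OF c(1), of "(\<eta>1 t)^2"] mult_right_mono[OF c(2), of "(\<eta>2 t)^2"] mult_right_mono[OF c(3), of "(\<zeta> t)^2"] by simp_all
  then show ?thesis unfolding e_def using nn by argo
 qed
 then have "ennreal (e t) <= ennreal (?r + ?v + (K^2 * (\<eta>1 t)^2 + K^2 * (\<eta>2 t)^2 + K^2 * (\<zeta> t)^2))" by (rule ennreal_leI)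
 also have "... = ennreal ?r + ennreal ?v + ennreal (K^2) * (ennreal ((\<eta>1 t)^2) + ennreal ((\<eta>2 t)^2) + ennreal ((\<zeta> t)^2))"
  using nn by (simp only: ennreal_plus ennreal_mult zero_le_power2 add_nonneg_nonneg mult_nonneg_nonneg distrib_left)
 also have "ennreal ?r = (NBINT x. ennreal ((r t x)^2))"
  by (intro nn_integral_eq_integral[symmetric] rt.good_integrable gr) auto
 also have "ennreal ?v = (NBINT x. ennreal ((v t x)^2))"
  by (intro nn_integral_eq_integral[symmetric] vt.good_integrable gr) auto
 finally show ?thesis .
qed

text \<open>Windows shrink along the chain: \<open>F\<close> on length 4 gives the values of
  \<open>r\<close> at \<open>x = 1\<close>, hence \<open>H\<close>, on length 3, since a
  characteristic needs one unit to cross. From these follow both families and \<eta>2 on length 1.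
  As \<open>e\<close> decreases, its value at \<open>t1\<close> is at most its average over that
  last window.\<close>

lemma observability:
 assumes good: "good t0" "good t1" and t: "t0 + 6 <= t1"
 shows "e t1 <= 502400 * K ^ 14 * (e t0 - e t1)"
proof -
 have "0 < t0" using good by (simp add: good_def rt.good_def)
 have lt: "t0 < t1" using t by simp
 define q where "q = 2 * K^2 * (e t0 - e t1)"
 define L where "L = ennreal (200 * K ^ 6 * q)"
 note D0 = dissipation_bounds[OF good lt, folded q_def]
 have q: "0 <= q" using D0(1) by (simp add: q_def)
 have K6: "1 <= 200 * K ^ 6" using one_le_power[OF K1, of 6] by linarith
 have qL: "ennreal q <= L" unfolding L_def using mult_right_mono[OF K6 q] by (intro ennreal_leI) simp
 note D = D0(2-6)[THEN order_trans, OF qL]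
 have FL: "(NBINT t. ind {t0<..<t0 + 4} t * ennreal ((F t)^2)) <= L"
  using F_square_window[OF good t] q K1 by (simp add: L_def q_def[symmetric] ennreal_mult)
 have exit: "(NBINT t. ind {t0<..<t0 + 3} t * ennreal ((rt.R (t + 1) 1)^2)) <= 2 * L + 2 * L"
 proof (rule order_trans[OF rt.exit_square_le], intro add_mono mult_left_mono)
  show "(NBINT t. ind {t0 + 1<..<t0 + 3 + 1} t * ennreal ((F t)^2)) <= L"
   by (rule nn_integral_window_mono[OF _ _ FL]) auto
  show "(NBINT t x. ind {t0<..<t0 + 3 + 1} t * ennreal ((g t x)^2)) <= L"
   by (rule nn_integral_window_mono2[OF _ _ D(1)]) (use t in auto)
 qed auto
 have HL: "(NBINT t. ind {t0<..<t0 + 3} t * ennreal ((H t)^2)) <= 16 * L"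
 proof -
  have "(NBINT t. ind {t0<..<t0 + 3} t * ennreal ((H t)^2)) <=
   (NBINT t. 2 * (ind {t0<..<t0 + 3} t * ennreal ((rt.R (t + 1) 1)^2)) + 8 * (ind {t0<..<t0 + 3} t * ennreal ((\<eta>1 t)^2)))"
  proof (rule nn_integral_mono_AE)
   show "AEL t. ind {t0<..<t0 + 3} t * ennreal ((H t)^2) <=
    2 * (ind {t0<..<t0 + 3} t * ennreal ((rt.R (t + 1) 1)^2)) + 8 * (ind {t0<..<t0 + 3} t * ennreal ((\<eta>1 t)^2))"
    using bdry1
   proof eventually_elim
    case (elim t)
    show ?case
    proof (cases "t \<in> {t0<..<t0 + 3}")
     case True
     then have "H t = rt.R (t + 1) 1 + - 2 * \<eta>1 t" using elim \<open>0 < t0\<close> by simp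
     then have "(H t)^2 <= 2 * (rt.R (t + 1) 1)^2 + 8 * (\<eta>1 t)^2"
      using square_sum_le_twice[of "rt.R (t + 1) 1" "- 2 * \<eta>1 t"] by (simp add: power_mult_distrib)
     then have "ennreal ((H t)^2) <= ennreal (2 * (rt.R (t + 1) 1)^2 + 8 * (\<eta>1 t)^2)" by (rule ennreal_leI)
     then show ?thesis using True by (simp add: ennreal_mult)
    qed simp
   qed
  qed
  also have "... = 2 * (NBINT t. ind {t0<..<t0 + 3} t * ennreal ((rt.R (t + 1) 1)^2)) + 8 * (NBINT t. ind {t0<..<t0 + 3} t * ennreal ((\<eta>1 t)^2))"
   by (simp add: nn_integral_add nn_integral_cmult)
  also have "... <= 2 * (2 * L + 2 * L) + 8 * L"
   by (intro add_mono mult_left_mono exit nn_integral_window_mono[OF _ _ D(4)]) (use t in auto)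
  also have "... = 16 * L" by (simp add: distrib_right[symmetric] distrib_left mult.assoc[symmetric])
  finally show ?thesis .
 qed
 have rL: "(NBINT t x. ind {t0<..<t0 + 1} t * ennreal ((r t x)^2)) <= 4 * L"
 proof -
  have "(NBINT t x. ind {t0<..<t0 + 1} t * ennreal ((r t x)^2)) <= 2 * L + 2 * L"
  proof (rule order_trans[OF rt.interior_square_le], use \<open>0 < t0\<close> in simp, intro add_mono mult_left_mono)
   show "(NBINT t. ind {t0<..<t0 + 1 + 1} t * ennreal ((F t)^2)) <= L"
    by (rule nn_integral_window_mono[OF _ _ FL]) auto
   show "(NBINT t x. ind {t0<..<t0 + 1 + 1} t * ennreal ((g t x)^2)) <= L"
    by (rule nn_integral_window_mono2[OF _ _ D(1)]) (use t in auto)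
  qed auto
  then show ?thesis by (simp add: distrib_right[symmetric])
 qed
 have vL: "(NBINT t x. ind {t0<..<t0 + 1} t * ennreal ((v t x)^2)) <= 34 * L"
 proof -
  have "(NBINT t x. ind {t0<..<t0 + 1} t * ennreal ((v t x)^2)) <= 2 * (16 * L) + 2 * L"
  proof (rule order_trans[OF vt.interior_square_le], use \<open>0 < t0\<close> in simp, intro add_mono mult_left_mono)
   show "(NBINT t. ind {t0<..<t0 + 1 + 1} t * ennreal ((H t)^2)) <= 16 * L"
    by (rule nn_integral_window_mono[OF _ _ HL]) auto
   show "(NBINT t x. ind {t0<..<t0 + 1 + 1} t * ennreal ((h t x)^2)) <= L"
    by (rule nn_integral_window_mono2[OF _ _ D(2)]) (use t in auto)
  qed auto
  then show ?thesis by (simp add: distrib_right[symmetric] mult.assoc[symmetric])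
 qed
 let ?J = "ind {t0<..<t0 + 1} :: real => ennreal"
 have e1: "(NBINT t. ?J t * ennreal ((\<eta>1 t)^2)) <= L" and z1: "(NBINT t. ?J t * ennreal ((\<zeta> t)^2)) <= L"
  by (rule nn_integral_window_mono[OF _ _ D(4)] nn_integral_window_mono[OF _ _ D(5)]; use t in simp)+
 have e2: "(NBINT t. ?J t * ennreal ((\<eta>2 t)^2)) <= ennreal (64 * K ^ 4) * (19 * L)"
 proof -
  let ?P = "\<lambda>w t. NBINT y. ind {0<..<1} y * ennreal ((w (t + y))^2)"
  have P: "(NBINT t. ?J t * ?P w t) <= c"
   if [measurable]: "borel_fun w" and w: "(NBINT t. ind {t0<..<t0 + 2} t * ennreal ((w t)^2)) <= c" for w :: "real => real" and c
  proof -
   have "(NBINT t. ?J t * ?P w t) <= (NBINT t (y::real). ind {t0<..<t0 + 2} t * (ind {0<..<1} y * ennreal ((w t)^2)))"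
    by (rule nn_integral_shift_window[of "\<lambda>t y. ind {0<..<1} y * ennreal ((w t)^2)" "\<lambda>y. y"])
     (auto simp: indicator_def split: if_splits)
   also have "... <= (NBINT t. ind {t0<..<t0 + 2} t * ennreal ((w t)^2))"
   proof (rule nn_integral_mono)
    fix t
    have "(NBINT (y::real). ind {t0<..<t0 + 2} t * (ind {0<..<1} y * ennreal ((w t)^2))) =
     (NBINT (y::real). ind {0<..<1} y * (ind {t0<..<t0 + 2} t * ennreal ((w t)^2)))"
     by (intro nn_integral_cong) (simp only: ac_simps)
    also have "... <= ind {t0<..<t0 + 2} t * ennreal ((w t)^2)"
     by (rule nn_integral_indicator_const_le) auto
    finally show "(NBINT (y::real). ind {t0<..<t0 + 2} t * (ind {0<..<1} y * ennreal ((w t)^2))) <= ind {t0<..<t0 + 2} t * ennreal ((w t)^2)" .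
   qed
   finally show ?thesis using w by (rule order_trans)
  qed
  define p1 p2 p3 p4 where "p1 t = ?J t * ennreal ((\<eta>1 (t + 1))^2)" and "p2 t = ?J t * ennreal ((\<eta>1 t)^2)"
   and "p3 t = ?J t * ?P \<eta>1 t" and "p4 t = ?J t * ?P H t" for t
  have m[measurable]: "p1 \<in> borel_measurable lborel" "p2 \<in> borel_measurable lborel" "p3 \<in> borel_measurable lborel" "p4 \<in> borel_measurable lborel"
   unfolding p1_def p2_def p3_def p4_def by measurable
  have b1: "(NBINT t. p1 t) <= L"
   unfolding p1_def by (rule order_trans[OF nn_integral_shift_window1[of "\<lambda>t. ennreal ((\<eta>1 t)^2)" 1 t0 1 t1] D(4)]) (use t in auto)
  have b2: "(NBINT t. p2 t) <= L" unfolding p2_def by (rule e1)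
  have b3: "(NBINT t. p3 t) <= L" unfolding p3_def by (rule P, simp, rule nn_integral_window_mono[OF _ _ D(4)]) (use t in auto)
  have b4: "(NBINT t. p4 t) <= 16 * L" unfolding p4_def by (rule P, simp, rule nn_integral_window_mono[OF _ _ HL]) auto
  have "(NBINT t. ?J t * ennreal ((\<eta>2 t)^2)) <= (NBINT t. ennreal (64 * K ^ 4) * (p1 t + p2 t + p3 t + p4 t))"
  proof (rule nn_integral_mono)
   fix t
   show "?J t * ennreal ((\<eta>2 t)^2) <= ennreal (64 * K ^ 4) * (p1 t + p2 t + p3 t + p4 t)"
   proof (cases "t \<in> {t0<..<t0 + 1}")
    case True
    then have J: "?J t = 1" by simp
    have "0 < t" using True \<open>0 < t0\<close> by simp
    then show ?thesis unfolding p1_def p2_def p3_def p4_def J mult_1 by (rule eta2_square_pointwise)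
   qed simp
  qed
  also have "... = ennreal (64 * K ^ 4) * ((NBINT t. p1 t) + (NBINT t. p2 t) + (NBINT t. p3 t) + (NBINT t. p4 t))"
   by (simp add: nn_integral_add nn_integral_cmult)
  also have "... <= ennreal (64 * K ^ 4) * (L + L + L + 16 * L)"
   by (intro mult_left_mono add_mono b1 b2 b3 b4) auto
  also have "L + L + L + 16 * L = 19 * L"
   using distrib_right[of 1 1 L] distrib_right[of 2 1 L] distrib_right[of 3 16 L] by simp
  finally show ?thesis .
 qed
 \<comment> \<open>The window has length 1, so a bound for the integral of \<open>e\<close> over it
   bounds \<open>e t1\<close>.\<close>
 have "ennreal (e t1) = (NBINT t. ?J t * ennreal (e t1))" by (simp add: nn_integral_multc)
 also have "... <= (NBINT t. (NBINT x. ?J t * ennreal ((r t x)^2)) + (NBINT x. ?J t * ennreal ((v t x)^2)) +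
  ennreal (K^2) * (?J t * ennreal ((\<eta>1 t)^2) + ?J t * ennreal ((\<eta>2 t)^2) + ?J t * ennreal ((\<zeta> t)^2)))"
 proof (rule nn_integral_mono_AE)
  show "AEL t. ?J t * ennreal (e t1) <= (NBINT x. ?J t * ennreal ((r t x)^2)) + (NBINT x. ?J t * ennreal ((v t x)^2)) +
   ennreal (K^2) * (?J t * ennreal ((\<eta>1 t)^2) + ?J t * ennreal ((\<eta>2 t)^2) + ?J t * ennreal ((\<zeta> t)^2))"
   using AE_good
  proof eventually_elim
   case (elim s)
   show ?case
   proof (cases "s \<in> {t0<..<t0 + 1}")
    case True
    then have J: "?J s = 1" by simp
    have gs: "good s" using elim True \<open>0 < t0\<close> by simp
    have "e t1 <= e s" using dissipation_bounds(1)[OF gs good(2)] True t by simp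
    then have "ennreal (e t1) <= ennreal (e s)" by (rule ennreal_leI)
    also note e_le[OF gs]
    finally show ?thesis unfolding J mult_1 .
   qed simp
  qed
 qed
 also have "... = (NBINT t x. ?J t * ennreal ((r t x)^2)) + (NBINT t x. ?J t * ennreal ((v t x)^2)) +
  ennreal (K^2) * ((NBINT t. ?J t * ennreal ((\<eta>1 t)^2)) + (NBINT t. ?J t * ennreal ((\<eta>2 t)^2)) + (NBINT t. ?J t * ennreal ((\<zeta> t)^2)))"
 proof -
  define A B where "A t = (NBINT x. ?J t * ennreal ((r t x)^2))" and "B t = (NBINT x. ?J t * ennreal ((v t x)^2))" for t
  have [measurable]: "A \<in> borel_measurable lborel" "B \<in> borel_measurable lborel" unfolding A_def B_def by measurable
  show ?thesis unfolding A_def[symmetric] B_def[symmetric] by (simp add: nn_integral_add nn_integral_cmult)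
 qed
 also have "... <= 4 * L + 34 * L + ennreal (K^2) * (L + ennreal (64 * K ^ 4) * (19 * L) + L)"
  by (intro add_mono mult_left_mono rL vL e1 e2 z1) auto
 also have "... = ennreal ((38 + K^2 * (2 + 1216 * K ^ 4)) * (200 * K ^ 6 * q))"
 proof -
  define l where "l = 200 * K ^ 6 * q"
  have l: "0 <= l" "L = ennreal l" using q K1 by (auto simp: l_def L_def)
  have n: "4 * L = ennreal (4 * l)" "34 * L = ennreal (34 * l)" "19 * L = ennreal (19 * l)"
   using l by (simp_all add: ennreal_mult)
  have "4 * L + 34 * L + ennreal (K^2) * (L + ennreal (64 * K ^ 4) * (19 * L) + L) =
    ennreal (4 * l + 34 * l + K^2 * (l + 64 * K ^ 4 * (19 * l) + l))"
   unfolding n unfolding l(2) using K1 l(1)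
   by (simp only: ennreal_plus ennreal_mult zero_le_power2 add_nonneg_nonneg mult_nonneg_nonneg
     zero_le_numeral zero_le_power order_trans[OF zero_le_one])
  also have "4 * l + 34 * l + K^2 * (l + 64 * K ^ 4 * (19 * l) + l) = (38 + K^2 * (2 + 1216 * K ^ 4)) * l"
   by (simp add: algebra_simps)
  finally show ?thesis by (simp add: l_def)
 qed
 \<comment> \<open>\<open>1256 = 38 + 2 + 1216\<close> after raising every power of \<open>K\<close>
   to \<open>K ^ 6\<close>. Together with \<open>200 * K ^ 6\<close> in \<open>L\<close> and
   \<open>2 * K^2\<close> in \<open>q\<close> this produces \<open>502400 * K ^ 14\<close>.\<close>
 also have "... <= ennreal (1256 * K ^ 6 * (200 * K ^ 6 * q))"
 proof (intro ennreal_leI mult_right_mono)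
  have "K^2 <= K ^ 6" "1 <= K ^ 6" using K1 by (auto intro!: power_increasing one_le_power)
  moreover have "K^2 * K ^ 4 = K ^ 6" by (simp add: power_add[symmetric])
  moreover have "38 + K^2 * (2 + 1216 * K ^ 4) = 38 + 2 * K^2 + 1216 * (K^2 * K ^ 4)" by (simp add: algebra_simps)
  ultimately show "38 + K^2 * (2 + 1216 * K ^ 4) <= 1256 * K ^ 6" by linarith
 qed (use q K1 in auto)
 finally have "e t1 <= 1256 * K ^ 6 * (200 * K ^ 6 * q)"
  using q K1 by (subst (asm) ennreal_le_iff) auto
 also have "... = 502400 * K ^ 14 * (e t0 - e t1)"
  by (simp add: q_def eval_nat_numeral)
 finally show ?thesis .
qed

end

section \<open>Exponential decay of the quadratic energy\<close>

context string_parameters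
begin

text \<open>If \<open>e t1 <= C * (e t0 - e t1)\<close>, then
  \<open>e t1 <= C / (1 + C) * e t0\<close>; here \<open>C\<close> is the constant of
  \<open>observability\<close>.\<close>

definition contraction :: real where
 "contraction = 502400 * K ^ 14 / (1 + 502400 * K ^ 14)"

text \<open>One contraction takes 6 units of time. The seventh unit leaves an open interval in which
  a good intermediate time can be chosen.\<close>

definition rate :: real where "rate = - ln contraction / 7"

lemma contraction_bounds: "1 / 2 <= contraction" "contraction < 1"
proof -
 have "1 <= 502400 * K ^ 14" using one_le_power[OF K1, of 14] by linarith
 then show "1 / 2 <= contraction" "contraction < 1" by (auto simp: contraction_def field_simps)
qed

lemma rate_pos: "0 < rate" using contraction_bounds by (simp add: rate_def)

end

context damped_string
begin

lemma e_contraction: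
 assumes "good t0" "good t1" "t0 + 6 <= t1"
 shows "e t1 <= contraction * e t0"
proof -
 define C where "C = 502400 * K ^ 14"
 have "0 < C" using K1 by (simp add: C_def)
 have "e t1 * (1 + C) <= C * e t0"
  using observability[OF assms] unfolding C_def[symmetric] by (simp add: algebra_simps)
 then show ?thesis using \<open>0 < C\<close> unfolding contraction_def C_def[symmetric] by (simp add: field_simps)
qed

lemma e_decay_power:
 assumes "good t0" "good t1" "t0 + 7 * real n <= t1"
 shows "e t1 <= contraction ^ n * e t0"
 using assms(2,3)
proof (induction n arbitrary: t1)
 case 0
 then show ?case using dissipation_bounds(1)[OF assms(1), of t1] by (cases "t0 = t1") auto
next
 case (Suc n)
 have "0 < t0" using assms by (simp add: good_def rt.good_def)
 \<comment> \<open>A good time at distance more than 6 from \<open>t1\<close>, for the contraction,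
   and less than 7, so that the remaining \<open>n\<close> periods of length 7 still fit.\<close>
 obtain t where t: "t1 - 7 < t" "t < t1 - 6" "0 < t --> good t"
  using AE_exists_between[OF AE_good, of "t1 - 7" "t1 - 6"] by auto
 have "t0 + 7 * real n <= t" using Suc.prems t by simp
 moreover from this have "good t" using t(3) \<open>0 < t0\<close> by (smt (verit) of_nat_0_le_iff)
 ultimately have "e t <= contraction ^ n * e t0" by (rule Suc.IH[rotated])
 moreover have "e t1 <= contraction * e t" using e_contraction[OF \<open>good t\<close> Suc.prems(1)] t by simp
 ultimately have "e t1 <= contraction * (contraction ^ n * e t0)"
  using contraction_bounds by (meson mult_left_mono order_trans zero_le_divide_1_iff zero_le_numeral)
 then show ?case by simp
qed

text \<open>Rounding the number of periods down loses at most one factor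
  \<open>1 / contraction\<close>, which is at most 2.\<close>

lemma e_decay:
 assumes "good t0" "good t1" "t0 <= t1"
 shows "e t1 <= 2 * exp (- rate * (t1 - t0)) * e t0"
proof -
 define n where "n = nat \<lfloor>(t1 - t0) / 7\<rfloor>"
 have n: "real n <= (t1 - t0) / 7" "(t1 - t0) / 7 - 1 <= real n" 
 proof -
  have "real n = of_int \<lfloor>(t1 - t0) / 7\<rfloor>" using assms(3) by (simp add: n_def)
  then show "real n <= (t1 - t0) / 7" "(t1 - t0) / 7 - 1 <= real n" by linarith+
 qed
 have c: "0 < contraction" "ln contraction <= 0" "1 / contraction <= 2"
  using contraction_bounds by (auto simp: field_simps)
 have "contraction ^ n = exp (real n * ln contraction)" using c by (simp add: exp_of_nat_mult)
 also have "... <= exp (((t1 - t0) / 7 - 1) * ln contraction)"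
  using n c by (simp add: mult_right_mono_neg)
 also have "... = exp (- rate * (t1 - t0)) * (1 / contraction)"
 proof -
  have "((t1 - t0) / 7 - 1) * ln contraction = - rate * (t1 - t0) - ln contraction"
   by (simp add: rate_def algebra_simps)
  then show ?thesis using c by (simp only: exp_diff exp_ln) simp
 qed
 also have "... <= exp (- rate * (t1 - t0)) * 2" using c by (intro mult_left_mono) auto
 finally have "contraction ^ n * e t0 <= exp (- rate * (t1 - t0)) * 2 * e t0" by (intro mult_right_mono e_nonneg)
 then show ?thesis using e_decay_power[OF assms(1,2), of n] n by simp
qed

end

section \<open>Decay of p-th powers\<close>

lemma AE_shift:
 assumes "AEL s. P (s::real)" shows "AEL s. P (s + c)"
proof -
 have "AE s in distr lborel borel ((+) c). P s" unfolding lborel_distr_plus by (rule assms)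
 from AE_distrD[OF _ this] show ?thesis by (simp add: add.commute)
qed

section \<open>The integrating factor along characteristics\<close>

lemma exp_minus_second_order:
 fixes d :: real
 assumes "0 <= d"
 shows "\<bar>exp (- d) - 1 + d\<bar> <= d^2" "\<bar>exp (- d) - 1 + exp (- d) * d\<bar> <= d^2"
proof -
 have 1: "1 - d <= exp (- d)" using exp_ge_add_one_self[of "- d"] by simp
 have 2: "exp (- d) * (1 + d) <= 1"
  using exp_ge_add_one_self[of d] assms by (simp add: exp_minus field_simps)
 show "\<bar>exp (- d) - 1 + d\<bar> <= d^2"
 proof -
  have "exp (- d) <= 1 / (1 + d)" using 2 assms by (simp add: field_simps)
  then have "exp (- d) - 1 + d <= 1 / (1 + d) - 1 + d" by simp
  also have "... = d^2 / (1 + d)" using assms by (simp add: field_simps power2_eq_square)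
  also have "... <= d^2" using assms by (simp add: divide_le_eq mult_le_cancel_left1)
  finally show ?thesis using 1 by simp
 qed
 have "exp (- d) - 1 + exp (- d) * d = exp (- d) * (1 + d) - 1" by (simp add: algebra_simps)
 moreover have "(1 - d) * (1 + d) <= exp (- d) * (1 + d)" using 1 assms by (intro mult_right_mono) auto
 ultimately show "\<bar>exp (- d) - 1 + exp (- d) * d\<bar> <= d^2"
  using 2 by (simp add: power2_eq_square algebra_simps)
qed

text \<open>The chain rule for \<open>exp (- P)\<close> with \<open>P\<close> the primitive of a
  bounded function. Let \<Delta> be the sum of \<open>exp (- P)\<close> and the integral of
  \<open>\<kappa> * exp (- P)\<close>. Its increments are of second order: on each interval the
  integral lies between \<open>exp (- P y2) * d\<close> and \<open>exp (- P y1) * d\<close>, with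
  \<open>d\<close> the increment of \<open>P\<close>, and \<open>d\<close> is at most
  \<open>K\<close> times the length. So \<Delta> has derivative 0 everywhere and is
  constant.\<close>

lemma exp_primitive:
 fixes \<kappa> :: "real => real"
 assumes \<kappa>: "integrable lborel \<kappa>" and bd: "\<And>u. 0 <= \<kappa> u" "\<And>u. \<kappa> u <= K"
 defines "P \<equiv> \<lambda>y. LBINT u. ind {0<..<y} u * \<kappa> u"
 shows "exp (- P y) = 1 + (LBINT u. ind {0<..<y} u * (- (\<kappa> u * exp (- P u))))"
  and "integrable lborel (\<lambda>u. - (\<kappa> u * exp (- P u)))"
  and "0 <= P y" and "0 <= y1 ==> y1 <= y2 ==> P y2 - P y1 = (LBINT u. ind {y1<..<y2} u * \<kappa> u)"
  and "0 <= y1 ==> y1 <= y2 ==> P y1 <= P y2"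
proof -
 have [measurable]: "borel_fun \<kappa>" using \<kappa> by auto
 have Pm[measurable]: "borel_fun P" unfolding P_def by measurable
 have ii: "integrable lborel (\<lambda>u. ind A u * w u)" if "integrable lborel w" "A \<in> sets borel" for A and w :: "real => real"
  using integrable_mult_indicator[OF _ that(1), of A] that(2) by simp
 show P0: "0 <= P y" for y unfolding P_def using bd by (intro integral_nonneg_AE AE_I2) auto
 show diff: "P y2 - P y1 = (LBINT u. ind {y1<..<y2} u * \<kappa> u)" if "0 <= y1" "y1 <= y2" for y1 y2
  unfolding P_def by (rule primitive_diff[OF \<kappa> that])
 show mono: "P y1 <= P y2" if "0 <= y1" "y1 <= y2" for y1 y2
 proof -
  have "0 <= (LBINT u. ind {y1<..<y2} u * \<kappa> u)" using bd by (intro integral_nonneg_AE AE_I2) auto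
  then show ?thesis using diff[OF that] by simp
 qed
 let ?E = "\<lambda>u. \<kappa> u * exp (- P u)"
 have iE: "integrable lborel ?E"
 proof (rule integrable_bound[OF \<kappa>])
  show "AEL u. norm (?E u) <= norm (\<kappa> u)"
   using P0 bd by (intro AE_I2) (auto simp: abs_mult mult_left_le)
 qed measurable
 then show "integrable lborel (\<lambda>u. - ?E u)" by simp
 define \<Delta> where "\<Delta> y = exp (- P y) + (LBINT u. ind {0<..<y} u * ?E u)" for y
 have K0: "0 <= K" using bd order_trans by blast
 have step: "\<bar>\<Delta> y2 - \<Delta> y1\<bar> <= K^2 * (y2 - y1)^2" if y: "0 <= y1" "y1 <= y2" for y1 y2
 proof -
  define d where "d = P y2 - P y1"
  define I where "I = (LBINT u. ind {y1<..<y2} u * ?E u)"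
  have d0: "0 <= d" using mono[OF y] by (simp add: d_def)
  have "d <= (LBINT u. K * ind {y1<..<y2} u)"
   unfolding d_def diff[OF y] using bd y by (intro integral_mono ii[OF \<kappa>] integrable_mult_right integrable_real_indicator)
    (auto split: split_indicator)
  then have dK: "d <= K * (y2 - y1)" using y by simp
  have I1: "I <= exp (- P y1) * d"
  proof -
   have "I <= (LBINT u. exp (- P y1) * (ind {y1<..<y2} u * \<kappa> u))"
    unfolding I_def using bd mono[of y1] y
    by (intro integral_mono ii iE integrable_mult_right \<kappa>) (auto simp: indicator_def mult.commute[of "exp _"] intro!: mult_left_mono)
   then show ?thesis by (simp add: d_def diff[OF y])
  qed
  have I2: "exp (- P y2) * d <= I"
  proof -
   have "(LBINT u. exp (- P y2) * (ind {y1<..<y2} u * \<kappa> u)) <= I"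
    unfolding I_def using bd mono[of _ y2] y
    by (intro integral_mono ii iE integrable_mult_right \<kappa>) (auto simp: indicator_def mult.commute[of "exp _"] intro!: mult_left_mono)
   then show ?thesis by (simp add: d_def diff[OF y])
  qed
  have e2: "exp (- P y2) = exp (- P y1) * exp (- d)" by (simp add: d_def exp_add[symmetric])
  have "\<Delta> y2 - \<Delta> y1 = exp (- P y2) - exp (- P y1) + I"
   unfolding \<Delta>_def I_def using primitive_diff[OF iE y] by simp
  then have "\<Delta> y2 - \<Delta> y1 <= exp (- P y1) * (exp (- d) - 1 + d)" "exp (- P y1) * (exp (- d) - 1 + exp (- d) * d) <= \<Delta> y2 - \<Delta> y1"
   using I1 I2 by (auto simp: e2 algebra_simps)
  moreover have "\<bar>exp (- P y1) * X\<bar> <= d^2" if "\<bar>X\<bar> <= d^2" for X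
   using that P0[of y1] mult_mono[of "exp (- P y1)" 1 "\<bar>X\<bar>" "d^2"] by (simp add: abs_mult)
  note this[OF exp_minus_second_order(1)[OF d0]] this[OF exp_minus_second_order(2)[OF d0]]
  ultimately have "\<bar>\<Delta> y2 - \<Delta> y1\<bar> <= d^2" by linarith
  also have "... <= (K * (y2 - y1))^2" using d0 dK by (intro power_mono)
  finally show ?thesis by (simp add: power_mult_distrib)
 qed
 have step': "\<bar>\<Delta> z - \<Delta> y\<bar> <= K^2 * (z - y)^2" if "0 <= y" "0 <= z" for y z
  using step[of y z] step[of z y] that by (cases "y <= z") (auto simp: power2_commute abs_minus_commute)
 have "(\<Delta> has_field_derivative 0) (at y within {0..})" if "y \<in> {0..}" for y
  unfolding has_field_derivative_iff
 proof (rule Lim_null_comparison)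
  show "eventually (\<lambda>z. norm ((\<Delta> z - \<Delta> y) / (z - y)) <= K^2 * \<bar>z - y\<bar>) (at y within {0..})"
   unfolding eventually_at_filter
  proof (rule always_eventually, intro allI impI)
   fix z assume z: "z \<noteq> y" "z \<in> {0..}"
   then have "\<bar>\<Delta> z - \<Delta> y\<bar> / \<bar>z - y\<bar> <= K^2 * (z - y)^2 / \<bar>z - y\<bar>" using step'[of y z] that by (intro divide_right_mono) auto
   also have "... = K^2 * \<bar>z - y\<bar>" 
   proof -
    have sq: "(z - y)^2 = \<bar>z - y\<bar> * \<bar>z - y\<bar>" by (simp add: power2_eq_square)
    show ?thesis unfolding sq using z by (simp del: abs_mult_self_eq)
   qed
   finally show "norm ((\<Delta> z - \<Delta> y) / (z - y)) <= K^2 * \<bar>z - y\<bar>" by (simp add: abs_divide)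
  qed
  have "((\<lambda>z. K^2 * \<bar>z - y\<bar>) \<longlongrightarrow> K\<^sup>2 * \<bar>y - y\<bar>) (at y within {0..})" by (intro tendsto_intros)
  then show "((\<lambda>z. K^2 * \<bar>z - y\<bar>) \<longlongrightarrow> 0) (at y within {0..})" by simp
 qed
 then obtain c where c: "\<And>y. 0 <= y ==> \<Delta> y = c"
  using has_field_derivative_zero_constant[of "{0..}" \<Delta>] by (auto simp: convex_real_interval)
 have \<Delta>0: "\<Delta> y = 1" if "y <= 0" for y using that by (simp add: \<Delta>_def P_def)
 then have "\<Delta> y = 1" using c[of 0] c[of y] by (cases "0 <= y") auto
 then show "exp (- P y) = 1 + (LBINT u. ind {0<..<y} u * (- ?E u))"
  by (simp add: \<Delta>_def)
qed

context transport
begin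

text \<open>Multiplying \<open>R s\<close> by the exponential removes the part of \<open>g\<close>
  that contains \<open>r\<close> itself, so only \<open>\<kappa> * w\<close> remains as a source,
  with integral at most \<open>K * D\<close>. Forward in time, from \<open>y2\<close> down to
  \<open>y1\<close>, the damping attenuates, and this factor is kept. Backward in time it amplifies
  by at most \<open>exp K\<close>. The exceptional set of \<open>s\<close> is chosen before the end
  points and \<open>D\<close>.\<close>

lemma damped_char:
 fixes \<kappa> :: "real => real" and w :: "real => real => real"
 assumes \<kappa>m[measurable]: "borel_fun \<kappa>" and \<kappa>: "\<And>x. 0 <= \<kappa> x" "\<And>x. \<kappa> x <= K"
  and wm: "joint_borel w"
  and g: "\<And>t x. g t x = \<kappa> x * (r t x - w t x)"
 shows "AEL s. \<forall>y1 y2 D. 0 <= y1 --> y1 <= y2 --> y2 <= 1 --> y2 <= s --> 0 <= D -->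
  (NBINT y. ind {y1<..<y2} y * ennreal \<bar>w (s - y) y\<bar>) <= ennreal D -->
  \<bar>R s y1\<bar> <= exp (- (LBINT u. ind {y1<..<y2} u * \<kappa> u)) * \<bar>R s y2\<bar> + exp K * (K * D) \<and>
  \<bar>R s y2\<bar> <= exp K * \<bar>R s y1\<bar> + exp K * (K * D)"
 using AE_regular AE_char
proof eventually_elim
 case (elim s)
 note [measurable (raw)] = measurable_curried2[OF wm]
 define k0 where "k0 x = ind {0<..<1} x * \<kappa> x" for x
 have K0: "0 <= K" using \<kappa> order_trans by blast
 have "integrable lborel (\<lambda>x. K * ind {0<..<1::real} x)" by auto
 then have k0i: "integrable lborel k0"
  unfolding k0_def
  by (rule integrable_bound) (use \<kappa> K0 in \<open>auto simp: indicator_def\<close>)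
 have k0b: "0 <= k0 x" "k0 x <= K" for x using \<kappa> K0 by (auto simp: k0_def indicator_def)
 define P where "P y = (LBINT u. ind {0<..<y} u * k0 u)" for y
 note ep = exp_primitive[OF k0i k0b, folded P_def]
 have PK: "P y <= K" if "y <= 1" for y
 proof -
  have "P y <= (LBINT (u::real). K * ind {0<..<1} u)"
   unfolding P_def
  proof (rule integral_mono)
   show "integrable lborel (\<lambda>u. ind {0<..<y} u * k0 u)"
    using integrable_mult_indicator[OF _ k0i, of "{0<..<y}"] by simp
   show "ind {0<..<y} u * k0 u <= K * ind {0<..<1} u" for u
    using \<kappa>(2)[of u] K0 by (simp add: k0_def split: split_indicator)
  qed simp
  then show ?thesis by simp
 qed
 show ?case
 proof (intro allI impI)
  fix y1 y2 D :: real
  assume y: "0 <= y1" "y1 <= y2" "y2 <= 1" "y2 <= s" and D0: "0 <= D"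
   and D: "(NBINT y. ind {y1<..<y2} y * ennreal \<bar>w (s - y) y\<bar>) <= ennreal D"
  let ?B = "\<lambda>y. exp (- P y)"
  let ?G = "\<lambda>u. g (s - u) u"
  let ?X = "\<lambda>u. ind {y1<..<y2} u * (?G u * ?B u + - (k0 u * ?B u) * R s u)"
  have prod: "R s y2 * ?B y2 - R s y1 * ?B y1 = (LBINT u. ?X u)" and pi: "integrable lborel ?X"
   using primitive_product[OF regular_integrable(1)[OF elim(1)] ep(2) R_def ep(1) y(1,2)] by auto
  have "ennreal \<bar>R s y2 * ?B y2 - R s y1 * ?B y1\<bar> <= (NBINT u. ennreal \<bar>?X u\<bar>)"
   unfolding prod using integral_norm_bound_ennreal[OF pi] by simp
  also have "... <= (NBINT u. ennreal K * (ind {y1<..<y2} u * ennreal \<bar>w (s - u) u\<bar>))"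
  proof (rule nn_integral_mono_AE)
   show "AEL u. ennreal \<bar>?X u\<bar> <= ennreal K * (ind {y1<..<y2} u * ennreal \<bar>w (s - u) u\<bar>)"
    using elim(2)
   proof eventually_elim
    case (elim u)
    show ?case
    proof (cases "u \<in> {y1<..<y2}")
     case True
     then have u: "0 < u" "u < 1" "u < s" using y by auto
     \<comment> \<open>Almost everywhere on the characteristic \<open>r\<close> agrees with
       \<open>R\<close>, so the two terms containing it cancel.\<close>
     then have "?X u = - (\<kappa> u * ?B u * w (s - u) u)"
      using elim True by (simp add: g k0_def algebra_simps)
     then have "\<bar>?X u\<bar> = \<kappa> u * ?B u * \<bar>w (s - u) u\<bar>" using \<kappa> by (simp add: abs_mult)
     also have "... <= K * 1 * \<bar>w (s - u) u\<bar>"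
      using \<kappa> ep(3) K0 by (intro mult_right_mono mult_mono) auto
     finally show ?thesis using True K0 by (simp add: ennreal_mult[symmetric] ennreal_leI)
    qed simp
   qed
  qed
  also have "... = ennreal K * (NBINT u. ind {y1<..<y2} u * ennreal \<bar>w (s - u) u\<bar>)"
   by (rule nn_integral_cmult) measurable
  also have "... <= ennreal K * ennreal D" using D by (rule mult_left_mono) auto
  also have "... = ennreal (K * D)" using K0 D0 by (simp add: ennreal_mult)
  finally have main: "\<bar>R s y2 * ?B y2 - R s y1 * ?B y1\<bar> <= K * D"
   using K0 D0 by (subst (asm) ennreal_le_iff) auto
  have Bge: "1 <= exp K * ?B y1" "1 <= exp K * ?B y2" using PK[of y1] PK[of y2] y by (auto simp: exp_add[symmetric])
  have Ble: "?B y1 <= 1" using ep(3) by simp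
  have Bq: "?B y2 = ?B y1 * exp (- (LBINT u. ind {y1<..<y2} u * \<kappa> u))"
  proof -
   have "P y2 - P y1 = (LBINT u. ind {y1<..<y2} u * \<kappa> u)"
    unfolding ep(4)[OF y(1,2)] using y by (intro integral_cong) (auto simp: k0_def indicator_def)
   then show ?thesis by (simp add: exp_add[symmetric] algebra_simps)
  qed
  let ?q = "exp (- (LBINT u. ind {y1<..<y2} u * \<kappa> u))"
  have inv: "exp (P y1) <= exp K" "exp (P y2) <= exp K" using PK y by auto
  have e0: "exp (P y) * (x * ?B y) = x" for x y by (simp add: exp_minus)
  have e1: "exp (P y) * (x * (?B y * z)) = x * z" for x y z by (simp add: exp_minus)
  have KD: "0 <= K * D" using K0 D0 by simp
  have ab: "\<bar>R s y * ?B y\<bar> = \<bar>R s y\<bar> * ?B y" for y by (simp add: abs_mult)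
  have "\<bar>R s y1\<bar> * ?B y1 <= \<bar>R s y2\<bar> * ?B y2 + K * D"
   using main abs_triangle_ineq3[of "R s y2 * ?B y2" "R s y1 * ?B y1"] unfolding ab by linarith
  then have "exp (P y1) * (\<bar>R s y1\<bar> * ?B y1) <= exp (P y1) * (\<bar>R s y2\<bar> * ?B y2 + K * D)" by (intro mult_left_mono) auto
  then have "\<bar>R s y1\<bar> <= \<bar>R s y2\<bar> * ?q + exp (P y1) * (K * D)"
   unfolding Bq by (simp only: distrib_left e0 e1)
  also have "... <= \<bar>R s y2\<bar> * ?q + exp K * (K * D)" using inv KD by (intro add_left_mono mult_right_mono) auto
  finally have c1: "\<bar>R s y1\<bar> <= ?q * \<bar>R s y2\<bar> + exp K * (K * D)" by (simp add: mult.commute)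
  have "\<bar>R s y2\<bar> * ?B y2 <= \<bar>R s y1\<bar> * ?B y1 + K * D"
   using main abs_triangle_ineq2[of "R s y2 * ?B y2" "R s y1 * ?B y1"] unfolding ab by linarith
  also have "... <= \<bar>R s y1\<bar> * 1 + K * D" using Ble by (intro add_right_mono mult_left_mono) auto
  finally have "exp (P y2) * (\<bar>R s y2\<bar> * ?B y2) <= exp (P y2) * (\<bar>R s y1\<bar> + K * D)" by (intro mult_left_mono) auto
  then have "\<bar>R s y2\<bar> <= exp (P y2) * (\<bar>R s y1\<bar> + K * D)" by (simp only: e0)
  also have "... <= exp K * (\<bar>R s y1\<bar> + K * D)" using inv KD by (intro mult_right_mono) auto
  finally have c2: "\<bar>R s y2\<bar> <= exp K * \<bar>R s y1\<bar> + exp K * (K * D)" by (simp add: distrib_left)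
  show "\<bar>R s y1\<bar> <= ?q * \<bar>R s y2\<bar> + exp K * (K * D) \<and> \<bar>R s y2\<bar> <= exp K * \<bar>R s y1\<bar> + exp K * (K * D)"
   using c1 c2 by simp
 qed
qed

end

lemma ennreal_abs_add_le: "ennreal \<bar>x + y\<bar> <= ennreal \<bar>x\<bar> + ennreal \<bar>y\<bar>"
 using ennreal_leI[OF abs_triangle_ineq[of x y]] by simp

text \<open>The part of \<open>damped_string\<close> that is symmetric in the two families. The
  inputs \<open>p1\<close> and \<open>p0\<close> stand for \<open>2 * \<eta>1\<close> and
  \<open>- 2 * \<zeta>\<close>; their equations are forgotten, and only their size will enter. The
  symmetry allows each estimate to be proved for one family and transferred by
  \<open>coupled_transport_swap\<close>.\<close>

locale coupled_transport = rt: transport r g F + vt: transport v h H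
 for r g F v h H +
 fixes k p1 p0 :: "real => real" and K :: real
 assumes k_meas[measurable]: "borel_fun k"
  and k_nonneg: "\<And>x. 0 <= k x" and k_le: "\<And>x. k x <= K" and K1: "1 <= K"
  and k_mass: "1 / K^2 <= (LBINT x. ind {0<..<1} x * k x)"
  and g_def: "\<And>t x. g t x = k x * (r t x - v t (1 - x))"
  and h_def: "\<And>t x. h t x = k (1 - x) * (v t x - r t (1 - x))"
  and p_meas[measurable]: "borel_fun p1" "borel_fun p0"
  and bdry1: "AEL t. 0 < t --> rt.R (t + 1) 1 = H t + p1 t"
  and bdry0: "AEL t. 0 < t --> vt.R (t + 1) 1 = F t + p0 t"

lemma (in coupled_transport) coupled_transport_swap: "coupled_transport v h H r g F (\<lambda>x. k (1 - x)) p0 p1 K"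
proof unfold_locales
 have "(LBINT x. ind {0<..<1} x * k (1 - x)) = (LBINT x. ind {0<..<1} (1 - x) * k (1 - x))"
  by (intro integral_cong) (auto simp: indicator_def)
 then show "1 / K^2 <= (LBINT x. ind {0<..<1} x * k (1 - x))"
  using k_mass integral_reflect_unit[of "\<lambda>x. ind {0<..<1} x * k x"] by simp
qed (use k_nonneg k_le K1 g_def h_def bdry1 bdry0 p_meas in auto)

section \<open>Integrals of one family across the characteristics of the other\<close>

context coupled_transport
begin

text \<open>Invariant under the exchange of the two transport equations.\<close>

definition tail :: "real => real => bool" where
 "tail c G \<longleftrightarrow> 0 <= c \<and> 0 <= G \<and> (AEL t. c < t -->
  (NBINT x. ennreal ((r t x)^2)) <= ennreal (4 * G^2) \<and> (NBINT x. ennreal ((v t x)^2)) <= ennreal (4 * G^2) \<and>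
  \<bar>p1 t\<bar> <= 4 * K * G \<and> \<bar>p0 t\<bar> <= 4 * K * G)"

lemma tail_mono: "tail c G ==> c <= c' ==> tail c' G"
 unfolding tail_def by (auto elim!: eventually_mono)

lemma L1_le_L2:
 fixes w :: "real => real"
 assumes [measurable]: "borel_fun w" and supp: "\<And>x. \<not> (0 < x \<and> x < 1) ==> w x = 0"
  and sq: "(NBINT x. ennreal ((w x)^2)) <= ennreal (4 * G^2)" and "0 <= G"
 shows "(NBINT x. ennreal \<bar>w x\<bar>) <= ennreal (2 * G)"
proof -
 have fin: "(NBINT x. ennreal ((w x)^2)) < \<infinity>" using sq by (auto intro: le_less_trans)
 have i: "integrable lborel w" using integrable_of_square(1)[of w "{0<..<1}"] fin supp by auto
 have "ennreal ((LBINT x. \<bar>w x\<bar>)^2) <= (NBINT x. ennreal (\<bar>w x\<bar>\<^sup>2))"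
  by (rule Cauchy_Schwarz_unit[of _ "{0<..<1}"]) (auto simp: supp)
 also have "... <= ennreal ((2 * G)^2)" using sq by (simp add: power_mult_distrib)
 finally have "(LBINT x. \<bar>w x\<bar>)^2 <= (2 * G)^2" by (subst (asm) ennreal_le_iff) auto
 then have "(LBINT x. \<bar>w x\<bar>) <= 2 * G" by (rule power2_le_imp_le) (use \<open>0 <= G\<close> in auto)
 then have "ennreal (LBINT x. \<bar>w x\<bar>) <= ennreal (2 * G)" by (rule ennreal_leI)
 moreover have "(NBINT x. ennreal \<bar>w x\<bar>) = ennreal (LBINT x. \<bar>w x\<bar>)"
  by (rule nn_integral_eq_integral) (use i in auto)
 ultimately show ?thesis by simp
qed

lemma tail_L1:
 assumes "tail c G"
 shows "AEL t. c < t --> (NBINT x. ennreal \<bar>r t x\<bar>) <= ennreal (2 * G)"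
  and "AEL t. c < t --> (NBINT x. ennreal \<bar>g t x\<bar>) <= ennreal (4 * K * G)"
proof -
 have ae: "AEL t. c < t --> (NBINT x. ennreal \<bar>r t x\<bar>) <= ennreal (2 * G) \<and> (NBINT x. ennreal \<bar>v t x\<bar>) <= ennreal (2 * G)"
 proof -
  have supp: "\<not> (0 < x \<and> x < 1) ==> r t x = 0" "\<not> (0 < x \<and> x < 1) ==> v t x = 0" for t x
   using rt.r_supp[of t x] vt.r_supp[of t x] by auto
  show ?thesis
   using assms unfolding tail_def
  proof (elim conjE)
   assume G: "0 <= G" and ae: "AEL t. c < t -->
   (NBINT x. ennreal ((r t x)^2)) <= ennreal (4 * G^2) \<and> (NBINT x. ennreal ((v t x)^2)) <= ennreal (4 * G^2) \<and>
   \<bar>p1 t\<bar> <= 4 * K * G \<and> \<bar>p0 t\<bar> <= 4 * K * G"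
   from ae show ?thesis
   proof eventually_elim
    case (elim t)
    show ?case
     using L1_le_L2[of "r t" G, OF _ supp(1) _ G] L1_le_L2[of "v t" G, OF _ supp(2) _ G] elim by auto
   qed
  qed
 qed
 have G: "0 <= G" using assms by (simp add: tail_def)
 show "AEL t. c < t --> (NBINT x. ennreal \<bar>r t x\<bar>) <= ennreal (2 * G)"
  using ae by (auto elim!: eventually_mono)
 show "AEL t. c < t --> (NBINT x. ennreal \<bar>g t x\<bar>) <= ennreal (4 * K * G)"
  using ae
 proof eventually_elim
  case (elim t)
  show ?case
  proof
   assume "c < t"
   have "(NBINT x. ennreal \<bar>g t x\<bar>) <= (NBINT x. ennreal K * (ennreal \<bar>r t x\<bar> + ennreal \<bar>v t (1 - x)\<bar>))"
   proof (rule nn_integral_mono)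
    fix x
    have "\<bar>g t x\<bar> = k x * \<bar>r t x - v t (1 - x)\<bar>" using k_nonneg by (simp add: g_def abs_mult)
    also have "... <= K * (\<bar>r t x\<bar> + \<bar>v t (1 - x)\<bar>)" using k_le K1 by (intro mult_mono) auto
    finally have "ennreal \<bar>g t x\<bar> <= ennreal (K * (\<bar>r t x\<bar> + \<bar>v t (1 - x)\<bar>))" by (rule ennreal_leI)
    then show "ennreal \<bar>g t x\<bar> <= ennreal K * (ennreal \<bar>r t x\<bar> + ennreal \<bar>v t (1 - x)\<bar>)"
     using K1 by (simp add: ennreal_mult)
   qed
   also have "... = ennreal K * ((NBINT x. ennreal \<bar>r t x\<bar>) + (NBINT x. ennreal \<bar>v t (1 - x)\<bar>))"
    by (simp add: nn_integral_add nn_integral_cmult)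
   also have "(NBINT x. ennreal \<bar>v t (1 - x)\<bar>) = (NBINT x. ennreal \<bar>v t x\<bar>)"
    by (rule nn_integral_reflect_unit[of "\<lambda>x. ennreal \<bar>v t x\<bar>"]) measurable
   also have "ennreal K * ((NBINT x. ennreal \<bar>r t x\<bar>) + (NBINT x. ennreal \<bar>v t x\<bar>)) <= ennreal K * (ennreal (2 * G) + ennreal (2 * G))"
    using elim \<open>c < t\<close> by (intro mult_left_mono add_mono) auto
   also have "... = ennreal (4 * K * G)"
   proof -
    have "ennreal K * (ennreal (2 * G) + ennreal (2 * G)) = ennreal (K * (2 * G + 2 * G))"
     using G K1 by (simp only: ennreal_plus ennreal_mult add_nonneg_nonneg mult_nonneg_nonneg zero_le_numeral order_trans[OF zero_le_one])
    then show ?thesis by (simp add: algebra_simps)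
   qed
   finally show "(NBINT x. ennreal \<bar>g t x\<bar>) <= ennreal (4 * K * G)" .
  qed
 qed
qed

lemma window_L1:
 assumes [measurable]: "joint_borel w"
  and ae: "AEL t. c < t --> (NBINT x. w t x) <= ennreal B" and "0 <= B" "0 <= L"
 shows "(NBINT t x. ind {c<..<c + L} t * w t x) <= ennreal (L * B)"
proof -
 note [measurable (raw)] = measurable_curried2[OF assms(1)]
 have "(NBINT t x. ind {c<..<c + L} t * w t x) <= (NBINT t. ennreal B * ind {c<..<c + L} t)"
 proof (rule nn_integral_mono_AE)
  show "AEL t. (NBINT x. ind {c<..<c + L} t * w t x) <= ennreal B * ind {c<..<c + L} t"
   using ae by eventually_elim (auto simp: indicator_def nn_integral_cmult)
 qed
 also have "... = ennreal (L * B)" using assms(3,4) by (simp add: nn_integral_cmult_indicator ennreal_mult mult.commute)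
 finally show ?thesis .
qed

text \<open>On a characteristic the value at \<open>x = 1\<close> differs from the value at any
  \<open>y\<close> by an integral of the source. Averaging over \<open>y\<close> in the unit
  interval thus bounds a boundary value by interior integrals over later times, up to one unit
  later; this is the \<open>L + 1\<close>.\<close>

lemma exit_L1:
 assumes "tail c G" "0 <= L"
 shows "(NBINT t. ind {c<..<c + L} t * ennreal \<bar>H t\<bar>) <= ennreal ((L + 1) * (10 * K * G))"
proof -
 have G: "0 <= G" "0 <= c" using assms by (auto simp: tail_def)
 let ?J = "ind {c<..<c + L} :: real => ennreal"
 have "AEL s. rt.regular s \<and> (AEL y. 0 < y --> y < 1 --> y < s --> r (s - y) y = rt.R s y)"
  using rt.AE_regular rt.AE_char by eventually_elim auto
 from AE_shift[OF this, of 1]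
 have ae: "AEL t. rt.regular (t + 1) \<and> (AEL y. 0 < y --> y < 1 --> y < t + 1 --> r (t + 1 - y) y = rt.R (t + 1) y)" .
 have tl: "AEL t. c < t --> \<bar>p1 t\<bar> <= 4 * K * G" using assms(1) unfolding tail_def by (auto elim!: eventually_mono)
 have "(NBINT t. ?J t * (NBINT y. ennreal \<bar>r (t + (1 - y)) y\<bar>)) <= (NBINT t y. ind {c<..<c + (L + 1)} t * ennreal \<bar>r t y\<bar>)"
 proof (rule nn_integral_shift_window[of "\<lambda>t y. ennreal \<bar>r t y\<bar>" "\<lambda>y. 1 - y"])
  fix t y assume "ennreal \<bar>r t y\<bar> \<noteq> 0"
  then have "0 < y \<and> y < 1" using rt.r_supp[of t y] by auto
  then show "0 <= 1 - y \<and> c + L + (1 - y) <= c + (L + 1)" by auto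
 qed measurable
 also have "... <= ennreal ((L + 1) * (2 * G))"
  by (rule window_L1[OF _ tail_L1(1)[OF assms(1)]]) (use G assms(2) in auto)
 finally have i1: "(NBINT t. ?J t * (NBINT y. ennreal \<bar>r (t + (1 - y)) y\<bar>)) <= ennreal ((L + 1) * (2 * G))" .
 have "(NBINT t. ?J t * (NBINT y. ennreal \<bar>g (t + (1 - y)) y\<bar>)) <= (NBINT t y. ind {c<..<c + (L + 1)} t * ennreal \<bar>g t y\<bar>)"
 proof (rule nn_integral_shift_window[of "\<lambda>t y. ennreal \<bar>g t y\<bar>" "\<lambda>y. 1 - y"])
  fix t y assume "ennreal \<bar>g t y\<bar> \<noteq> 0"
  then have "0 < y \<and> y < 1" using rt.g_supp[of t y] by auto
  then show "0 <= 1 - y \<and> c + L + (1 - y) <= c + (L + 1)" by auto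
 qed measurable
 also have "... <= ennreal ((L + 1) * (4 * K * G))"
  by (rule window_L1[OF _ tail_L1(2)[OF assms(1)]]) (use G K1 assms(2) in auto)
 finally have i2: "(NBINT t. ?J t * (NBINT y. ennreal \<bar>g (t + (1 - y)) y\<bar>)) <= ennreal ((L + 1) * (4 * K * G))" .
 have i3: "emeasure lborel {c<..<c + L} <= ennreal L" using assms(2) by simp
 have "(NBINT t. ?J t * ennreal \<bar>H t\<bar>) <=
  (NBINT t. ?J t * (NBINT y. ennreal \<bar>r (t + (1 - y)) y\<bar>) + ?J t * (NBINT u. ennreal \<bar>g (t + (1 - u)) u\<bar>) + ennreal (4 * K * G) * ?J t)"
 proof (rule nn_integral_mono_AE)
  show "AEL t. ?J t * ennreal \<bar>H t\<bar> <=
   ?J t * (NBINT y. ennreal \<bar>r (t + (1 - y)) y\<bar>) + ?J t * (NBINT u. ennreal \<bar>g (t + (1 - u)) u\<bar>) + ennreal (4 * K * G) * ?J t"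
   using ae bdry1 tl
  proof eventually_elim
   case (elim t)
   show ?case
   proof (cases "t \<in> {c<..<c + L}")
    case True
    then have t: "0 < t" "c < t" using G by auto
    let ?I = "NBINT u. ennreal \<bar>g (t + (1 - u)) u\<bar>"
    have H: "H t = rt.R (t + 1) 1 - p1 t" using elim t by simp
    have R1: "ennreal \<bar>rt.R (t + 1) 1\<bar> <= ennreal \<bar>rt.R (t + 1) y\<bar> + ?I" if y: "0 < y" "y < 1" for y
    proof -
     let ?i = "\<lambda>u. ind {y<..<1} u * g (t + 1 - u) u"
     have reg: "rt.regular (t + 1)" using elim by simp
     have int: "integrable lborel ?i"
      using integrable_mult_indicator[OF _ rt.regular_integrable(1)[OF reg], of "{y<..<1}"] by simp
     have "rt.R (t + 1) 1 = rt.R (t + 1) y + (LBINT u. ?i u)"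
      using rt.R_diff[OF reg, of y 1] y by simp
     then have "ennreal \<bar>rt.R (t + 1) 1\<bar> <= ennreal \<bar>rt.R (t + 1) y\<bar> + ennreal \<bar>LBINT u. ?i u\<bar>"
      by (simp only: ennreal_abs_add_le)
     also have "ennreal \<bar>LBINT u. ?i u\<bar> <= (NBINT u. ennreal (norm (?i u)))"
      using integral_norm_bound_ennreal[OF int] by simp
     also have "... <= ?I" by (intro nn_integral_mono) (auto simp: indicator_def algebra_simps)
     finally show ?thesis by (simp add: add_left_mono)
    qed
    have "ennreal \<bar>rt.R (t + 1) 1\<bar> = (NBINT (y::real). ennreal \<bar>rt.R (t + 1) 1\<bar> * ind {0<..<1} y)"
     by (simp add: nn_integral_cmult_indicator)
    also have "... <= (NBINT y. ennreal \<bar>r (t + (1 - y)) y\<bar> + ?I * ind {0<..<1} y)"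
    proof (rule nn_integral_mono_AE)
     show "AEL y. ennreal \<bar>rt.R (t + 1) 1\<bar> * ind {0<..<1} y <= ennreal \<bar>r (t + (1 - y)) y\<bar> + ?I * ind {0<..<1} y"
      using conjunct2[OF elim(1)]
     proof eventually_elim
      case (elim y)
      show ?case
      proof (cases "0 < y \<and> y < 1")
       case True
       then have "r (t + (1 - y)) y = rt.R (t + 1) y" using elim t by (simp add: algebra_simps)
       then show ?thesis using R1[of y] True by simp
      qed auto
     qed
    qed
    also have "... = (NBINT y. ennreal \<bar>r (t + (1 - y)) y\<bar>) + ?I"
     by (simp add: nn_integral_add nn_integral_cmult_indicator)
    finally have R: "ennreal \<bar>rt.R (t + 1) 1\<bar> <= (NBINT y. ennreal \<bar>r (t + (1 - y)) y\<bar>) + ?I" .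
    have "\<bar>H t\<bar> <= \<bar>rt.R (t + 1) 1\<bar> + 4 * K * G" using H elim(3) t by simp
    then have "ennreal \<bar>H t\<bar> <= ennreal (\<bar>rt.R (t + 1) 1\<bar> + 4 * K * G)" by (rule ennreal_leI)
    also have "... = ennreal \<bar>rt.R (t + 1) 1\<bar> + ennreal (4 * K * G)"
     using G K1 by (subst ennreal_plus) auto
    also have "... <= (NBINT y. ennreal \<bar>r (t + (1 - y)) y\<bar>) + ?I + ennreal (4 * K * G)"
     by (intro add_right_mono R)
    finally show ?thesis using True by simp
   qed simp
  qed
 qed
 also have "... = (NBINT t. ?J t * (NBINT y. ennreal \<bar>r (t + (1 - y)) y\<bar>)) + (NBINT t. ?J t * (NBINT u. ennreal \<bar>g (t + (1 - u)) u\<bar>))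
   + ennreal (4 * K * G) * emeasure lborel {c<..<c + L}"
 proof -
  define a1 a2 where "a1 t = ?J t * (NBINT y. ennreal \<bar>r (t + (1 - y)) y\<bar>)" and "a2 t = ?J t * (NBINT u. ennreal \<bar>g (t + (1 - u)) u\<bar>)" for t
  have [measurable]: "a1 \<in> borel_measurable lborel" "a2 \<in> borel_measurable lborel" unfolding a1_def a2_def by measurable
  show ?thesis unfolding a1_def[symmetric] a2_def[symmetric] by (simp add: nn_integral_add nn_integral_cmult_indicator)
 qed
 also have "... <= ennreal ((L + 1) * (2 * G)) + ennreal ((L + 1) * (4 * K * G)) + ennreal (4 * K * G) * ennreal L"
  by (rule add_mono[OF add_mono[OF i1 i2] mult_left_mono[OF i3]]) simp
 also have "... = ennreal ((L + 1) * (2 * G) + (L + 1) * (4 * K * G) + 4 * K * G * L)"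
  using G K1 assms(2)
  by (simp only: ennreal_plus ennreal_mult add_nonneg_nonneg mult_nonneg_nonneg zero_le_numeral zero_le_one order_trans[OF zero_le_one])
 also have "... <= ennreal ((L + 1) * (10 * K * G))"
 proof (rule ennreal_leI)
  have "G <= K * G" "0 <= K * G" using G K1 by (auto simp: mult_le_cancel_right1)
  then have "2 * G <= 2 * K * G" by simp
  then have "(L + 1) * (2 * G) <= (L + 1) * (2 * K * G)" using assms(2) by (intro mult_left_mono) auto
  moreover have "4 * K * G * L <= (L + 1) * (4 * K * G)" using \<open>0 <= K * G\<close> by (simp add: algebra_simps)
  ultimately show "(L + 1) * (2 * G) + (L + 1) * (4 * K * G) + 4 * K * G * L <= (L + 1) * (10 * K * G)"
   by (simp add: algebra_simps)
 qed
 finally show ?thesis .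
qed

lemma nn_integral_affine_half:
 fixes \<phi> :: "real => ennreal"
 assumes [measurable]: "borel_fun \<phi>" and B: "(NBINT \<tau>. \<phi> \<tau>) <= ennreal (2 * B)"
 shows "(NBINT y. \<phi> (c - 2 * y)) <= ennreal B"
proof -
 have "2 * (NBINT y. \<phi> (c - 2 * y)) <= ennreal (2 * B)"
  using B nn_integral_real_affine[of \<phi> "-2" c] by simp
 then have "2 * (NBINT y. \<phi> (c - 2 * y)) <= 2 * ennreal B" by (simp add: ennreal_mult')
 then show ?thesis by (subst (asm) ennreal_mult_le_mult_iff) auto
qed

text \<open>
 A characteristic of one family crosses those of the other transversally, so that integrals
 along it are controlled by the \<open>L\<^sup>1\<close> norms of the data, without loss of regularity.
\<close>

lemma transversal:
 assumes tail: "tail c G" and tail': "coupled_transport.tail v r p0 p1 K c G"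
 shows "AEL s. s <= c + 3 -->
  (NBINT y. ind {0<..<1} y * (ind {c<..} (s - y) * ennreal \<bar>v (s - y) (1 - y)\<bar>)) <= ennreal (40 * K * G)"
proof -
 interpret swap: coupled_transport v h H r g F "\<lambda>x. k (1 - x)" p0 p1 K by (rule coupled_transport_swap)
 have G: "0 <= G" "0 <= c" using tail by (auto simp: tail_def)
 have "AEL t. AEL y. 0 < t --> 0 < y --> y < 1 --> v t (1 - y) = vt.R (t + (1 - y)) (1 - y)"
  using vt.char
 proof eventually_elim
  case (elim t)
  have "AEL y. 0 < t --> 0 < 1 + (-1) * y --> 1 + (-1) * y < 1 --> v t (1 + (-1) * y) = vt.R (t + (1 + (-1) * y)) (1 + (-1) * y)"
   by (rule AE_borel_affine) (use elim in \<open>auto simp: vt.R_def\<close>)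
  then show ?case by eventually_elim auto
 qed
 then have "AEL s. AEL y. 0 < s + (-1) * y --> 0 < y --> y < 1 -->
   v (s + (-1) * y) (1 - y) = vt.R (s + (-1) * y + (1 - y)) (1 - y)"
  by (rule AE_shear[rotated]) measurable
 then show ?thesis
 proof eventually_elim
  case (elim s)
  show ?case
  proof
   assume s: "s <= c + 3"
   \<comment> \<open>For \<open>s <= c + 3\<close> and \<open>s - y > c\<close> the time
     \<open>s + 1 - 2 * y\<close> at which the other family meets its outflow boundary lies between
     \<open>c\<close> and \<open>c + 4\<close>.\<close>
   let ?J = "ind {c<..<c + 4} :: real => ennreal"
   have "(NBINT y. ind {0<..<1} y * (ind {c<..} (s - y) * ennreal \<bar>v (s - y) (1 - y)\<bar>)) <=
    (NBINT y. ?J (s + 1 - 2 * y) * ennreal \<bar>H (s + 1 - 2 * y)\<bar> + (NBINT u. ?J (s + 1 - u - 2 * y) * ennreal \<bar>h (s + 1 - u - 2 * y) u\<bar>))"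
   proof (rule nn_integral_mono_AE)
    show "AEL y. ind {0<..<1} y * (ind {c<..} (s - y) * ennreal \<bar>v (s - y) (1 - y)\<bar>) <=
     ?J (s + 1 - 2 * y) * ennreal \<bar>H (s + 1 - 2 * y)\<bar> + (NBINT u. ?J (s + 1 - u - 2 * y) * ennreal \<bar>h (s + 1 - u - 2 * y) u\<bar>)"
     using elim
    proof eventually_elim
     case (elim y)
     show ?case
     proof (cases "0 < y \<and> y < 1 \<and> c < s - y")
      case True
      let ?i = "\<lambda>u. ind {0<..<1 - y} u * h (s + 1 - 2 * y - u) u"
      have "v (s - y) (1 - y) = H (s + 1 - 2 * y) + (LBINT u. ?i u)"
       using elim True G by (simp add: vt.R_def algebra_simps)
      then have "ennreal \<bar>v (s - y) (1 - y)\<bar> <= ennreal \<bar>H (s + 1 - 2 * y)\<bar> + ennreal \<bar>LBINT u. ?i u\<bar>"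
       by (simp only: ennreal_abs_add_le)
      also have "... <= ennreal \<bar>H (s + 1 - 2 * y)\<bar> + (NBINT u. ennreal (norm (?i u)))"
      proof (intro add_left_mono)
       show "ennreal \<bar>LBINT u. ?i u\<bar> <= (NBINT u. ennreal (norm (?i u)))"
        using integral_norm_bound_ennreal[of lborel ?i] not_integrable_integral_eq[of lborel ?i]
        by (cases "integrable lborel ?i") auto
      qed
      also have "... <= ennreal \<bar>H (s + 1 - 2 * y)\<bar> + (NBINT u. ?J (s + 1 - u - 2 * y) * ennreal \<bar>h (s + 1 - u - 2 * y) u\<bar>)"
       using True s by (intro add_left_mono nn_integral_mono) (auto simp: indicator_def algebra_simps)
      finally show ?thesis using True s by (simp add: indicator_def)
     qed (auto simp: indicator_def)
    qed
   qed
   also have "... = (NBINT y. ?J (s + 1 - 2 * y) * ennreal \<bar>H (s + 1 - 2 * y)\<bar>) +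
    (NBINT y u. ?J (s + 1 - u - 2 * y) * ennreal \<bar>h (s + 1 - u - 2 * y) u\<bar>)"
   proof -
    define A B where "A y = ?J (s + 1 - 2 * y) * ennreal \<bar>H (s + 1 - 2 * y)\<bar>"
     and "B y = (NBINT u. ?J (s + 1 - u - 2 * y) * ennreal \<bar>h (s + 1 - u - 2 * y) u\<bar>)" for y
    have [measurable]: "A \<in> borel_measurable lborel" "B \<in> borel_measurable lborel" unfolding A_def B_def by measurable
    show ?thesis unfolding A_def[symmetric] B_def[symmetric] by (rule nn_integral_add) simp_all
   qed
   also have "(NBINT y u. ?J (s + 1 - u - 2 * y) * ennreal \<bar>h (s + 1 - u - 2 * y) u\<bar>) =
    (NBINT u y. ?J (s + 1 - u - 2 * y) * ennreal \<bar>h (s + 1 - u - 2 * y) u\<bar>)"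
    by (rule lborel_pair.Fubini'[symmetric]) measurable
   \<comment> \<open>For fixed \<open>u\<close> the delay \<open>u\<close> is absorbed by
     translating \<open>y\<close> by \<open>u / 2\<close>, as the time argument depends on
     \<open>2 * y\<close>.\<close>
   also have "... = (NBINT u y. ?J (s + 1 - 2 * y) * ennreal \<bar>h (s + 1 - 2 * y) u\<bar>)"
   proof (rule nn_integral_cong)
    fix u
    have eq: "s + 1 - u - 2 * y = s + 1 - 2 * (y + u / 2)" for y by simp
    show "(NBINT y. ?J (s + 1 - u - 2 * y) * ennreal \<bar>h (s + 1 - u - 2 * y) u\<bar>) = (NBINT y. ?J (s + 1 - 2 * y) * ennreal \<bar>h (s + 1 - 2 * y) u\<bar>)"
     unfolding eq by (rule nn_integral_translate[of "\<lambda>y. ?J (s + 1 - 2 * y) * ennreal \<bar>h (s + 1 - 2 * y) u\<bar>"]) measurable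
   qed
   also have "... = (NBINT y u. ?J (s + 1 - 2 * y) * ennreal \<bar>h (s + 1 - 2 * y) u\<bar>)"
    by (rule lborel_pair.Fubini') measurable
   \<comment> \<open>The substitution \<open>2 * y\<close> halves both integrals:
     \<open>(4 + 1) * 10 / 2 = 25\<close> from \<open>exit_L1\<close> and
     \<open>4 * 4 / 2 = 8\<close> from the source, rounded up to 40.\<close>
   also have "(NBINT y. ?J (s + 1 - 2 * y) * ennreal \<bar>H (s + 1 - 2 * y)\<bar>) + ... <= ennreal (25 * K * G) + ennreal (8 * K * G)"
   proof (intro add_mono)
    show "(NBINT y. ?J (s + 1 - 2 * y) * ennreal \<bar>H (s + 1 - 2 * y)\<bar>) <= ennreal (25 * K * G)"
     using exit_L1[OF tail, of 4] by (intro nn_integral_affine_half[of "\<lambda>\<tau>. ?J \<tau> * ennreal \<bar>H \<tau>\<bar>"]) auto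
    have "(NBINT t x. ?J t * ennreal \<bar>h t x\<bar>) <= ennreal (4 * (4 * K * G))"
     by (rule window_L1[OF _ swap.tail_L1(2)[OF tail']]) (use G K1 in auto)
    then show "(NBINT y u. ?J (s + 1 - 2 * y) * ennreal \<bar>h (s + 1 - 2 * y) u\<bar>) <= ennreal (8 * K * G)"
     by (intro nn_integral_affine_half[of "\<lambda>\<tau>. NBINT u. ?J \<tau> * ennreal \<bar>h \<tau> u\<bar>"]) auto
   qed
   also have "... <= ennreal (40 * K * G)"
    using G K1 by (subst ennreal_plus[symmetric]) (auto intro!: ennreal_leI)
   finally show "(NBINT y. ind {0<..<1} y * (ind {c<..} (s - y) * ennreal \<bar>v (s - y) (1 - y)\<bar>)) <= ennreal (40 * K * G)" .
  qed
 qed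
qed

end

section \<open>Contraction of p-th powers over a round trip\<close>

lemma powr_add_le:
 fixes x y p :: real
 assumes "0 <= x" "0 <= y" "0 <= p"
 shows "(x + y) powr p <= 2 powr p * (x powr p + y powr p)"
proof -
 have "(x + y) powr p <= (2 * max x y) powr p" using assms by (intro powr_mono2) auto
 also have "... = 2 powr p * (max x y) powr p" using assms by (simp add: powr_mult)
 also have "(max x y) powr p <= x powr p + y powr p" by (simp add: max_def)
 finally show ?thesis by simp
qed

text \<open>Writing \<open>y = (1 - \<theta>) * z\<close> makes the sum a convex combination. In
  this way the contraction factor stays strictly below 1 for the p-th powers, and the whole loss is
  put on the source term. Convexity is used for positive arguments, so the zero cases are
  separate.\<close>

lemma powr_convex_combination:
 fixes x y p \<theta> :: real
 assumes p: "1 <= p" and \<theta>: "0 < \<theta>" "\<theta> < 1" and xy: "0 <= x" "0 <= y"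
 shows "(\<theta> * x + y) powr p <= \<theta> * x powr p + (y / (1 - \<theta>)) powr p"
proof -
 define z where "z = y / (1 - \<theta>)"
 have y: "y = (1 - \<theta>) * z" and z: "0 <= z" using \<theta> xy by (auto simp: z_def)
 have c: "c powr p <= c" if "0 < c" "c < 1" for c :: real
  using powr_mono'[of 1 p c] that p by simp
 have "(\<theta> * x + (1 - \<theta>) * z) powr p <= \<theta> * x powr p + (1 - \<theta>) * z powr p"
 proof -
  consider "x = 0" | "z = 0" | "0 < x" "0 < z" using xy z by linarith
  then show ?thesis
  proof cases
   case 1
   then show ?thesis using mult_right_mono[OF c[of "1 - \<theta>"], of "z powr p"] \<theta> z p by (simp add: powr_mult)
  next
   case 2
   then show ?thesis using mult_right_mono[OF c[of \<theta>], of "x powr p"] \<theta> xy p by (simp add: powr_mult)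
  next
   case 3
   then show ?thesis
    using convex_onD[OF powr_convex[OF p], of "1 - \<theta>" x z] \<theta> by simp
  qed
 qed
 also have "... <= \<theta> * x powr p + 1 * z powr p" using \<theta> by (intro add_left_mono mult_right_mono) auto
 finally show ?thesis unfolding y[symmetric] mult_1 unfolding z_def .
qed

context coupled_transport
begin

text \<open>\<open>A * G\<close> is the error \<open>exp K * (K * D)\<close> of
  \<open>damped_char\<close> with \<open>D = 40 * K * G\<close> from \<open>transversal\<close>. The
  factor \<theta> below is the attenuation over a full crossing of the strip that
  \<open>k_mass\<close> guarantees.\<close>

definition A :: real where "A = 40 * K^2 * exp K"
definition \<theta> :: real where "\<theta> = exp (- (1 / K^2))"

lemma \<theta>_bounds: "0 < \<theta>" "\<theta> < 1" using K1 by (auto simp: \<theta>_def)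

lemma A_ge: "4 * K <= A" "0 <= A"
proof -
 have "4 * K * 1 <= 40 * K^2 * exp K"
  using K1 by (intro mult_mono) (auto simp: power2_eq_square)
 then show "4 * K <= A" by (simp add: A_def)
 show "0 <= A" by (simp add: A_def)
qed

definition tails :: "real => real => bool" where
 "tails c G \<longleftrightarrow> tail c G \<and> coupled_transport.tail v r p0 p1 K c G"

lemma tailsD: "tails c G ==> 0 <= c" "tails c G ==> 0 <= G"
 "tails c G ==> AEL t. c < t --> \<bar>p1 t\<bar> <= A * G"
proof -
 assume t: "tails c G"
 then show G: "0 <= c" "0 <= G" by (auto simp: tails_def tail_def)
 have "4 * K * G <= A * G" using A_ge G by (intro mult_right_mono) auto
 moreover have "AEL t. c < t --> \<bar>p1 t\<bar> <= 4 * K * G"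
  using t unfolding tails_def tail_def by (auto elim!: eventually_mono)
 ultimately show "AEL t. c < t --> \<bar>p1 t\<bar> <= A * G" by (auto elim!: eventually_mono)
qed

lemma tails_mono: "tails c G ==> c <= c' ==> tails c' G"
 unfolding tails_def using tail_mono coupled_transport.tail_mono[OF coupled_transport_swap] by blast

lemma R_bounds:
 assumes "tails c G"
 shows "AEL s. s <= c + 3 --> (\<forall>y1 y2. 0 <= y1 --> y1 <= y2 --> y2 <= 1 --> c + y2 <= s -->
  \<bar>rt.R s y1\<bar> <= exp (- (LBINT u. ind {y1<..<y2} u * k u)) * \<bar>rt.R s y2\<bar> + A * G \<and>
  \<bar>rt.R s y2\<bar> <= exp K * \<bar>rt.R s y1\<bar> + A * G)"
proof -
 have t: "tail c G" "coupled_transport.tail v r p0 p1 K c G" using assms by (auto simp: tails_def)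
 have G: "0 <= G" "0 <= c" using assms tailsD by auto
 have AG: "exp K * (K * (40 * K * G)) = A * G" by (simp add: A_def power2_eq_square)
 have vm: "(\<lambda>z. v (fst z) (1 - snd z)) \<in> borel_measurable (borel \<Otimes>\<^sub>M borel)" by measurable
 show ?thesis
  using rt.damped_char[OF k_meas k_nonneg k_le vm g_def] transversal[OF t]
 proof eventually_elim
  case (elim s)
  show ?case
  proof (intro impI allI)
   fix y1 y2 assume s: "s <= c + 3" and y: "0 <= y1" "y1 <= y2" "y2 <= 1" "c + y2 <= s"
   have "(NBINT y. ind {y1<..<y2} y * ennreal \<bar>v (s - y) (1 - y)\<bar>) <=
    (NBINT y. ind {0<..<1} y * (ind {c<..} (s - y) * ennreal \<bar>v (s - y) (1 - y)\<bar>))"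
    using y by (intro nn_integral_mono) (auto simp: indicator_def)
   also have "... <= ennreal (40 * K * G)" using elim(2) s by simp
   finally show "\<bar>rt.R s y1\<bar> <= exp (- (LBINT u. ind {y1<..<y2} u * k u)) * \<bar>rt.R s y2\<bar> + A * G \<and>
    \<bar>rt.R s y2\<bar> <= exp K * \<bar>rt.R s y1\<bar> + A * G"
    using elim(1)[rule_format, of y1 y2 "40 * K * G"] y G K1 unfolding AG by auto
  qed
 qed
qed

lemma F_exit_bounds:
 assumes "tails c G"
 shows "AEL s. c + 1 <= s --> s <= c + 3 --> \<bar>F s\<bar> <= \<theta> * \<bar>rt.R s 1\<bar> + A * G \<and> \<bar>rt.R s 1\<bar> <= exp K * \<bar>F s\<bar> + A * G"
 using R_bounds[OF assms]
proof eventually_elim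
 case (elim s)
 have "exp (- (LBINT u. ind {0<..<1} u * k u)) <= \<theta>" using k_mass by (simp add: \<theta>_def)
 from mult_right_mono[OF this, of "\<bar>rt.R s 1\<bar>"] show ?case
  using elim[rule_format, of 0 1] tailsD(1)[OF assms] by (auto simp: rt.R_0)
qed

text \<open>Characteristics with label at most \<open>c + 1\<close> meet the time slice
  \<open>t = c\<close> inside the strip, at abscissa \<open>s - c\<close>. This links the trace to
  the state at time \<open>c\<close>, whereas \<open>F_exit_bounds\<close> treats the full crossings
  that follow.\<close>

lemma F_entry_bounds:
 assumes "tails c G"
 shows "AEL s. c < s --> s <= c + 1 --> \<bar>F s\<bar> <= \<bar>rt.R s (s - c)\<bar> + A * G \<and> \<bar>rt.R s (s - c)\<bar> <= exp K * \<bar>F s\<bar> + A * G"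
 using R_bounds[OF assms]
proof eventually_elim
 case (elim s)
 show ?case
 proof (intro impI)
  assume s: "c < s" "s <= c + 1"
  have "0 <= (LBINT u. ind {0<..<s - c} u * k u)" using k_nonneg by (intro integral_nonneg_AE AE_I2) auto
  then have "exp (- (LBINT u. ind {0<..<s - c} u * k u)) <= 1" by simp
  from mult_right_mono[OF this, of "\<bar>rt.R s (s - c)\<bar>"]
  show "\<bar>F s\<bar> <= \<bar>rt.R s (s - c)\<bar> + A * G \<and> \<bar>rt.R s (s - c)\<bar> <= exp K * \<bar>F s\<bar> + A * G"
   using elim[rule_format, of 0 "s - c"] s by (auto simp: rt.R_0)
 qed
qed

text \<open>Only the trace at \<open>x = 0\<close> is followed. A round trip takes 2 units of time,
  and \<open>H\<close> is expressed through \<open>F\<close> by one crossing and the boundary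
  condition.\<close>

definition \<Phi> :: "real => real => real => ennreal" where
 "\<Phi> p c d = (NBINT s. ind {c<..<d} s * ennreal (\<bar>F s\<bar> powr p))"

lemma H_bound:
 assumes "tails c G"
 shows "AEL t. c < t --> \<bar>H t\<bar> <= \<bar>rt.R (t + 1) 1\<bar> + A * G \<and> \<bar>rt.R (t + 1) 1\<bar> <= \<bar>H t\<bar> + A * G"
 using bdry1 tailsD(3)[OF assms] by eventually_elim (use tailsD(1)[OF assms] in auto)

lemma entry_power:
 assumes "rt.good t"
 shows "(NBINT s. ind {t<..<t + 1} s * ennreal (\<bar>rt.R s (s - t)\<bar> powr p)) = (NBINT x. ind {0<..<1} x * ennreal (\<bar>r t x\<bar> powr p))"
proof -
 have "(NBINT s. ind {t<..<t + 1} s * ennreal (\<bar>rt.R s (s - t)\<bar> powr p)) =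
  (NBINT x. ind {t<..<t + 1} (x + t) * ennreal (\<bar>rt.R (x + t) ((x + t) - t)\<bar> powr p))"
  by (rule nn_integral_translate[symmetric]) measurable
 also have "... = (NBINT x. ind {0<..<1} x * ennreal (\<bar>r t x\<bar> powr p))"
 proof (rule nn_integral_cong_AE)
  have "AEL x. 0 < x --> x < 1 --> r t x = rt.R (t + x) x" using assms by (simp add: rt.good_def)
  then show "AEL x. ind {t<..<t + 1} (x + t) * ennreal (\<bar>rt.R (x + t) ((x + t) - t)\<bar> powr p) =
   ind {0<..<1} x * ennreal (\<bar>r t x\<bar> powr p)"
   by eventually_elim (auto simp: indicator_def add.commute)
 qed
 finally show ?thesis .
qed

text \<open>The powers of the traces are recovered from the state at a time \<open>c\<close>, and conversely.\<close>

lemma \<Phi>_initial: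
 assumes T: "tails c G" and good: "rt.good c" "vt.good c" and p: "1 <= p"
 shows "\<Phi> p c (c + 2) <= ennreal (2 powr p) * ((NBINT x. ind {0<..<1} x * ennreal (\<bar>r c x\<bar> powr p)) +
  (NBINT x. ind {0<..<1} x * ennreal (\<bar>v c x\<bar> powr p)) + ennreal (2 * (3 * (A * G)) powr p))"
proof -
 interpret swap: coupled_transport v h H r g F "\<lambda>x. k (1 - x)" p0 p1 K by (rule coupled_transport_swap)
 have T': "swap.tails c G" using T by (simp add: tails_def swap.tails_def)
 have G: "0 <= G" "0 <= c" using T tailsD by auto
 have AG: "0 <= A * G" using A_ge G by simp
 define a1 a2 where "a1 s = ind {c<..<c + 1} s * ennreal (\<bar>rt.R s (s - c)\<bar> powr p)"
  and "a2 s = ind {c<..<c + 1} s * ennreal (\<bar>vt.R s (s - c)\<bar> powr p)" for s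
 have [measurable]: "borel_fun a1" "borel_fun a2" unfolding a1_def a2_def by measurable
 have sh: "AEL s. c < s + (-1) --> \<bar>H (s + (-1))\<bar> <= \<bar>rt.R (s + (-1) + 1) 1\<bar> + A * G \<and> \<bar>rt.R (s + (-1) + 1) 1\<bar> <= \<bar>H (s + (-1))\<bar> + A * G"
  by (rule AE_shift[OF H_bound[OF T]])
 have sv: "AEL s. c < s + (-1) --> s + (-1) <= c + 1 --> \<bar>H (s + (-1))\<bar> <= \<bar>vt.R (s + (-1)) (s + (-1) - c)\<bar> + A * G \<and> \<bar>vt.R (s + (-1)) (s + (-1) - c)\<bar> <= exp K * \<bar>H (s + (-1))\<bar> + A * G"
  by (rule AE_shift[OF swap.F_entry_bounds[OF T']])
 have "AEL s. s \<noteq> c + 1" by (rule AE_lborel_singleton)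
 with F_entry_bounds[OF T] F_exit_bounds[OF T] sh sv
 have "AEL s. ind {c<..<c + 2} s * ennreal (\<bar>F s\<bar> powr p) <=
  ennreal (2 powr p) * (a1 s + a2 (s + (-1)) + ennreal ((3 * (A * G)) powr p) * ind {c<..<c + 2} s)"
 proof eventually_elim
  case (elim s)
  have key: "ennreal (\<bar>F s\<bar> powr p) <= ennreal (2 powr p) * (ennreal (X powr p) + ennreal ((3 * (A * G)) powr p))"
   if "\<bar>F s\<bar> <= X + 3 * (A * G)" "0 <= X" for X
  proof -
   have "\<bar>F s\<bar> powr p <= (X + 3 * (A * G)) powr p" using that p by (intro powr_mono2) auto
   also have "... <= 2 powr p * (X powr p + (3 * (A * G)) powr p)" using that AG p by (intro powr_add_le) auto
   finally have "ennreal (\<bar>F s\<bar> powr p) <= ennreal (2 powr p * (X powr p + (3 * (A * G)) powr p))" by (rule ennreal_leI)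
   then show ?thesis by (simp add: ennreal_mult)
  qed
  have "s \<noteq> c + 1" using elim by simp
  \<comment> \<open>Labels below \<open>c + 1\<close> come from \<open>r\<close> at time
    \<open>c\<close>. The later ones have entered at \<open>x = 1\<close> at time
    \<open>s - 1\<close>, where the boundary condition leads to \<open>H (s - 1)\<close> and thence
    to \<open>v\<close> at time \<open>c\<close>.\<close>
  then consider "s \<notin> {c<..<c + 2}" | "c < s" "s < c + 1" | "c + 1 < s" "s < c + 2"
   by (cases "s < c + 1") auto
  then show ?case
  proof cases
   case 2
   then have "\<bar>F s\<bar> <= \<bar>rt.R s (s - c)\<bar> + 3 * (A * G)" using elim AG by auto
   from key[OF this] show ?thesis using 2 by (simp add: a1_def a2_def)
  next
   case 3
   have "\<theta> * \<bar>rt.R s 1\<bar> <= 1 * \<bar>rt.R s 1\<bar>" using \<theta>_bounds by (intro mult_right_mono) auto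
   then have "\<bar>F s\<bar> <= \<bar>vt.R (s - 1) (s - 1 - c)\<bar> + 3 * (A * G)" using elim 3 AG by auto
   from key[OF this] show ?thesis using 3 by (simp add: a1_def a2_def)
  qed simp
 qed
 then have "\<Phi> p c (c + 2) <= (NBINT s. ennreal (2 powr p) * (a1 s + a2 (s + (-1)) + ennreal ((3 * (A * G)) powr p) * ind {c<..<c + 2} s))"
  unfolding \<Phi>_def by (rule nn_integral_mono_AE)
 also have "... = ennreal (2 powr p) * ((NBINT s. a1 s) + (NBINT s. a2 (s + (-1))) + ennreal ((3 * (A * G)) powr p) * 2)"
  by (simp add: nn_integral_add nn_integral_cmult nn_integral_cmult_indicator)
 also have "(NBINT s. a2 (s + (-1))) = (NBINT s. a2 s)" by (rule nn_integral_translate) measurable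
 also have "(NBINT s. a1 s) = (NBINT x. ind {0<..<1} x * ennreal (\<bar>r c x\<bar> powr p))"
  unfolding a1_def by (rule entry_power[OF good(1)])
 also have "(NBINT s. a2 s) = (NBINT x. ind {0<..<1} x * ennreal (\<bar>v c x\<bar> powr p))"
  unfolding a2_def by (rule swap.entry_power[OF good(2)])
 also have "ennreal ((3 * (A * G)) powr p) * 2 = ennreal (2 * (3 * (A * G)) powr p)" by (simp add: ennreal_mult mult.commute)
 finally show ?thesis .
qed

text \<open>One round trip backwards from time \<open>s\<close>: a crossing to \<open>x = 1\<close>,
  the boundary condition there, a crossing to \<open>x = 0\<close>, and the boundary condition at
  time \<open>s - 2\<close>. Each of the four costs \<open>A * G\<close>. Both crossings contract,
  but one factor \<theta> is enough and the other is bounded by 1.\<close>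

lemma \<Phi>_step:
 assumes T: "tails c G" and p: "1 <= p"
 shows "\<Phi> p (c + 2) (c + 4) <= ennreal \<theta> * \<Phi> p c (c + 2) + ennreal (2 * (4 * (A * G) / (1 - \<theta>)) powr p)"
proof -
 interpret swap: coupled_transport v h H r g F "\<lambda>x. k (1 - x)" p0 p1 K by (rule coupled_transport_swap)
 have T': "swap.tails c G" using T by (simp add: tails_def swap.tails_def)
 have T1: "tails (c + 1) G" using T by (rule tails_mono) simp
 have G: "0 <= G" "0 <= c" using T tailsD by auto
 have AG: "0 <= A * G" using A_ge G by simp
 have s1: "AEL s. c < s + (-1) --> \<bar>H (s + (-1))\<bar> <= \<bar>rt.R (s + (-1) + 1) 1\<bar> + A * G \<and> \<bar>rt.R (s + (-1) + 1) 1\<bar> <= \<bar>H (s + (-1))\<bar> + A * G"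
  by (rule AE_shift[OF H_bound[OF T]])
 have s2: "AEL s. c + 1 <= s + (-1) --> s + (-1) <= c + 3 -->
   \<bar>H (s + (-1))\<bar> <= \<theta> * \<bar>vt.R (s + (-1)) 1\<bar> + A * G \<and> \<bar>vt.R (s + (-1)) 1\<bar> <= exp K * \<bar>H (s + (-1))\<bar> + A * G"
  by (rule AE_shift[OF swap.F_exit_bounds[OF T']])
 have s3: "AEL s. c < s + (-2) --> \<bar>F (s + (-2))\<bar> <= \<bar>vt.R (s + (-2) + 1) 1\<bar> + A * G \<and> \<bar>vt.R (s + (-2) + 1) 1\<bar> <= \<bar>F (s + (-2))\<bar> + A * G"
  by (rule AE_shift[OF swap.H_bound[OF T']])
 define a1 where "a1 s = ind {c<..<c + 2} s * ennreal (\<bar>F s\<bar> powr p)" for s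
 have [measurable]: "borel_fun a1" unfolding a1_def by measurable
 from F_exit_bounds[OF T1] s1 s2 s3
 have "AEL s. ind {c + 2<..<c + 4} s * ennreal (\<bar>F s\<bar> powr p) <=
  ennreal \<theta> * a1 (s + (-2)) + ennreal ((4 * (A * G) / (1 - \<theta>)) powr p) * ind {c + 2<..<c + 4} s"
 proof eventually_elim
  case (elim s)
  show ?case
  proof (cases "s \<in> {c + 2<..<c + 4}")
   case True
   have "\<theta> * X <= X" if "0 <= X" for X using mult_right_mono[of \<theta> 1 X] \<theta>_bounds that by simp
   note th = this
   have f: "\<bar>F s\<bar> <= \<theta> * \<bar>rt.R s 1\<bar> + A * G" using elim(1) True by auto
   have r1: "\<bar>rt.R s 1\<bar> <= \<bar>H (s + (-1))\<bar> + A * G" using elim(2) True by auto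
   have h1: "\<bar>H (s + (-1))\<bar> <= \<theta> * \<bar>vt.R (s + (-1)) 1\<bar> + A * G" using elim(3) True by auto
   have "s + (-2) + 1 = s + (-1)" by simp
   then have v1: "\<bar>vt.R (s + (-1)) 1\<bar> <= \<bar>F (s + (-2))\<bar> + A * G" using elim(4) True by auto
   have "\<bar>F s\<bar> <= \<theta> * (\<bar>H (s + (-1))\<bar> + A * G) + A * G"
    using f mult_left_mono[OF r1, of \<theta>] \<theta>_bounds by linarith
   also have "\<theta> * (\<bar>H (s + (-1))\<bar> + A * G) <= \<bar>H (s + (-1))\<bar> + A * G" using AG by (intro th add_nonneg_nonneg) auto
   finally have "\<bar>F s\<bar> <= \<bar>H (s + (-1))\<bar> + 2 * (A * G)" by linarith
   also have "\<bar>H (s + (-1))\<bar> <= \<theta> * (\<bar>F (s + (-2))\<bar> + A * G) + A * G"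
    using h1 mult_left_mono[OF v1, of \<theta>] \<theta>_bounds by linarith
   also have "\<theta> * (\<bar>F (s + (-2))\<bar> + A * G) + A * G <= \<theta> * \<bar>F (s + (-2))\<bar> + 2 * (A * G)"
    using th[OF AG] unfolding distrib_left by linarith
   finally have "\<bar>F s\<bar> <= \<theta> * \<bar>F (s + (-2))\<bar> + 4 * (A * G)" by linarith
   then have "\<bar>F s\<bar> powr p <= (\<theta> * \<bar>F (s + (-2))\<bar> + 4 * (A * G)) powr p" using p by (intro powr_mono2) auto
   also have "... <= \<theta> * \<bar>F (s + (-2))\<bar> powr p + (4 * (A * G) / (1 - \<theta>)) powr p"
    using AG \<theta>_bounds p by (intro powr_convex_combination) auto
   finally have "ennreal (\<bar>F s\<bar> powr p) <= ennreal (\<theta> * \<bar>F (s + (-2))\<bar> powr p + (4 * (A * G) / (1 - \<theta>)) powr p)" by (rule ennreal_leI)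
   also have "... = ennreal \<theta> * ennreal (\<bar>F (s + (-2))\<bar> powr p) + ennreal ((4 * (A * G) / (1 - \<theta>)) powr p)"
    using \<theta>_bounds by (simp add: ennreal_mult)
   finally show ?thesis using True by (simp add: a1_def)
  qed simp
 qed
 then have "\<Phi> p (c + 2) (c + 4) <= (NBINT s. ennreal \<theta> * a1 (s + (-2)) + ennreal ((4 * (A * G) / (1 - \<theta>)) powr p) * ind {c + 2<..<c + 4} s)"
  unfolding \<Phi>_def by (rule nn_integral_mono_AE)
 also have "... = ennreal \<theta> * (NBINT s. a1 (s + (-2))) + ennreal ((4 * (A * G) / (1 - \<theta>)) powr p) * 2"
  by (simp add: nn_integral_add nn_integral_cmult nn_integral_cmult_indicator)
 also have "(NBINT s. a1 (s + (-2))) = \<Phi> p c (c + 2)"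
  unfolding \<Phi>_def a1_def[symmetric] by (rule nn_integral_translate) measurable
 also have "ennreal ((4 * (A * G) / (1 - \<theta>)) powr p) * 2 = ennreal (2 * (4 * (A * G) / (1 - \<theta>)) powr p)" by (simp add: ennreal_mult mult.commute)
 finally show ?thesis .
qed

text \<open>Here the trace determines the earlier state, so the damping amplifies. For
  \<open>r\<close> at time \<open>c\<close> this happens once; for \<open>v\<close> twice, by way of
  \<open>H s\<close> and then \<open>F (s + 1)\<close>. Hence the factor
  \<open>exp (2 * K)\<close>.\<close>

lemma state_le_\<Phi>:
 assumes T: "tails c G" and good: "rt.good c" "vt.good c" and p: "1 <= p"
 shows "(NBINT x. ind {0<..<1} x * ennreal (\<bar>r c x\<bar> powr p)) + (NBINT x. ind {0<..<1} x * ennreal (\<bar>v c x\<bar> powr p)) <=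
  ennreal ((2 * exp (2 * K)) powr p) * (2 * \<Phi> p c (c + 2) + ennreal (2 * (3 * (A * G)) powr p))"
proof -
 interpret swap: coupled_transport v h H r g F "\<lambda>x. k (1 - x)" p0 p1 K by (rule coupled_transport_swap)
 have T': "swap.tails c G" using T by (simp add: tails_def swap.tails_def)
 have G: "0 <= G" "0 <= c" using T tailsD by auto
 have AG: "0 <= A * G" using A_ge G by simp
 have E1: "1 <= exp K" using K1 by simp
 have E2: "exp K * exp K = exp (2 * K)" by (simp add: exp_add[symmetric])
 have E12: "exp K <= exp (2 * K)" using K1 by simp
 have key: "ennreal (Y powr p) <= ennreal ((2 * exp (2 * K)) powr p) * (ennreal (X powr p) + ennreal ((3 * (A * G)) powr p))"
  if "Y <= exp (2 * K) * (X + 3 * (A * G))" "0 <= X" "0 <= Y" for X Y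
 proof -
  have "Y powr p <= (exp (2 * K) * (X + 3 * (A * G))) powr p" using that p by (intro powr_mono2) auto
  also have "... = exp (2 * K) powr p * (X + 3 * (A * G)) powr p" using that AG by (simp add: powr_mult)
  also have "... <= exp (2 * K) powr p * (2 powr p * (X powr p + (3 * (A * G)) powr p))" using that AG p by (intro mult_left_mono powr_add_le) auto
  also have "... = (2 * exp (2 * K)) powr p * (X powr p + (3 * (A * G)) powr p)" by (simp add: powr_mult)
  finally have "ennreal (Y powr p) <= ennreal ((2 * exp (2 * K)) powr p * (X powr p + (3 * (A * G)) powr p))" by (rule ennreal_leI)
  then show ?thesis by (simp add: ennreal_mult)
 qed
 have fin: "(NBINT s. ind {c<..<c + 1} s * ennreal (Y s powr p)) <= ennreal ((2 * exp (2 * K)) powr p) * (\<Phi> p c (c + 2) + ennreal ((3 * (A * G)) powr p))"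
  if ae: "AEL s. c < s --> s < c + 1 --> Y s <= exp (2 * K) * (\<bar>F (s + d)\<bar> + 3 * (A * G))" and Y: "\<And>s. 0 <= Y s" and d: "0 <= d" "d <= 1" for Y d
 proof -
  define a1 where "a1 s = ind {c<..<c + 2} s * ennreal (\<bar>F s\<bar> powr p)" for s
  have [measurable]: "borel_fun a1" unfolding a1_def by measurable
  have "(NBINT s. ind {c<..<c + 1} s * ennreal (Y s powr p)) <=
   (NBINT s. ennreal ((2 * exp (2 * K)) powr p) * (a1 (s + d) + ennreal ((3 * (A * G)) powr p) * ind {c<..<c + 1} s))"
  proof (rule nn_integral_mono_AE)
   show "AEL s. ind {c<..<c + 1} s * ennreal (Y s powr p) <= ennreal ((2 * exp (2 * K)) powr p) * (a1 (s + d) + ennreal ((3 * (A * G)) powr p) * ind {c<..<c + 1} s)"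
    using ae
   proof eventually_elim
    case (elim s)
    show ?case
    proof (cases "s \<in> {c<..<c + 1}")
     case True
     then have "a1 (s + d) = ennreal (\<bar>F (s + d)\<bar> powr p)" using d by (simp add: a1_def)
     then show ?thesis using key[of "Y s" "\<bar>F (s + d)\<bar>"] elim True Y by simp
    qed simp
   qed
  qed
  also have "... = ennreal ((2 * exp (2 * K)) powr p) * ((NBINT s. a1 (s + d)) + ennreal ((3 * (A * G)) powr p) * 1)"
   by (simp add: nn_integral_add nn_integral_cmult nn_integral_cmult_indicator)
  also have "(NBINT s. a1 (s + d)) = \<Phi> p c (c + 2)"
   unfolding \<Phi>_def a1_def[symmetric] by (rule nn_integral_translate) measurable
  finally show ?thesis by simp
 qed
 have r: "(NBINT s. ind {c<..<c + 1} s * ennreal (\<bar>rt.R s (s - c)\<bar> powr p)) <= ennreal ((2 * exp (2 * K)) powr p) * (\<Phi> p c (c + 2) + ennreal ((3 * (A * G)) powr p))"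
 proof (rule fin[of "\<lambda>s. \<bar>rt.R s (s - c)\<bar>" 0])
  show "AEL s. c < s --> s < c + 1 --> \<bar>rt.R s (s - c)\<bar> <= exp (2 * K) * (\<bar>F (s + 0)\<bar> + 3 * (A * G))"
   using F_entry_bounds[OF T]
  proof eventually_elim
   case (elim s)
   have "exp K * \<bar>F s\<bar> <= exp (2 * K) * \<bar>F s\<bar>" using E12 by (intro mult_right_mono) auto
   moreover have "A * G <= 3 * (A * G)" using AG by linarith
   then have "1 * (A * G) <= exp (2 * K) * (3 * (A * G))"
    using AG K1 mult_mono[of 1 "exp (2 * K)" "A * G" "3 * (A * G)"] by simp
   ultimately show ?case using elim by (auto simp: algebra_simps)
  qed
 qed auto
 have v: "(NBINT s. ind {c<..<c + 1} s * ennreal (\<bar>vt.R s (s - c)\<bar> powr p)) <= ennreal ((2 * exp (2 * K)) powr p) * (\<Phi> p c (c + 2) + ennreal ((3 * (A * G)) powr p))"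
 proof (rule fin[of "\<lambda>s. \<bar>vt.R s (s - c)\<bar>" 1])
  have "AEL s. c + 1 <= s + 1 --> s + 1 <= c + 3 --> \<bar>F (s + 1)\<bar> <= \<theta> * \<bar>rt.R (s + 1) 1\<bar> + A * G \<and> \<bar>rt.R (s + 1) 1\<bar> <= exp K * \<bar>F (s + 1)\<bar> + A * G"
   by (rule AE_shift[OF F_exit_bounds[OF T]])
  with swap.F_entry_bounds[OF T'] H_bound[OF T]
  show "AEL s. c < s --> s < c + 1 --> \<bar>vt.R s (s - c)\<bar> <= exp (2 * K) * (\<bar>F (s + 1)\<bar> + 3 * (A * G))"
  proof eventually_elim
   case (elim s)
   show ?case
   proof (intro impI)
    assume s: "c < s" "s < c + 1"
    have "\<bar>H s\<bar> <= exp K * \<bar>F (s + 1)\<bar> + 2 * (A * G)" using elim s by auto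
    from mult_left_mono[OF this, of "exp K"]
    have "exp K * \<bar>H s\<bar> <= exp (2 * K) * \<bar>F (s + 1)\<bar> + exp K * (2 * (A * G))" by (simp add: distrib_left mult.assoc[symmetric] E2)
    also have "... <= exp (2 * K) * \<bar>F (s + 1)\<bar> + exp (2 * K) * (2 * (A * G))" using AG E12 by (intro add_left_mono mult_right_mono) auto
    finally have 1: "exp K * \<bar>H s\<bar> <= exp (2 * K) * \<bar>F (s + 1)\<bar> + exp (2 * K) * (2 * (A * G))" .
    have 2: "1 * (A * G) <= exp (2 * K) * (A * G)" using AG K1 by (intro mult_right_mono) auto
    have "\<bar>vt.R s (s - c)\<bar> <= exp K * \<bar>H s\<bar> + A * G" using elim s by auto
    with 1 2 show "\<bar>vt.R s (s - c)\<bar> <= exp (2 * K) * (\<bar>F (s + 1)\<bar> + 3 * (A * G))" by (simp add: algebra_simps)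
   qed
  qed
 qed auto
 have "(NBINT x. ind {0<..<1} x * ennreal (\<bar>r c x\<bar> powr p)) + (NBINT x. ind {0<..<1} x * ennreal (\<bar>v c x\<bar> powr p)) <=
  ennreal ((2 * exp (2 * K)) powr p) * (\<Phi> p c (c + 2) + ennreal ((3 * (A * G)) powr p)) + ennreal ((2 * exp (2 * K)) powr p) * (\<Phi> p c (c + 2) + ennreal ((3 * (A * G)) powr p))"
  using r v unfolding entry_power[OF good(1)] swap.entry_power[OF good(2)] by (rule add_mono)
 also have "... = ennreal ((2 * exp (2 * K)) powr p) * (2 * \<Phi> p c (c + 2) + ennreal (2 * (3 * (A * G)) powr p))"
  by (simp add: ennreal_mult mult_2[symmetric] distrib_left mult.left_commute)
 finally show ?thesis .
qed

end

sublocale damped_string \<subseteq> ct: coupled_transport r g F v h H k "\<lambda>t. 2 * \<eta>1 t" "\<lambda>t. - 2 * \<zeta> t" K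
proof unfold_locales
 have ki: "integrable lborel (\<lambda>x. ind {0<..<1} x * k x)"
 proof (rule integrable_bound)
  show "integrable lborel (\<lambda>x. K * ind {0<..<1::real} x)" by simp
  show "AEL x. norm (ind {0<..<1} x * k x) <= norm (K * ind {0<..<1} x)"
   using k_nonneg k_le K1 by (intro AE_I2) (auto simp: indicator_def)
 qed measurable
 have "1 / K^2 <= (b - a) * (1 / K)"
  using omega(4) K1 by (simp add: power2_eq_square field_simps)
 also have "... = (LBINT x. 1 / K * ind {a<..<b} x)" using omega by simp
 also have "... <= (LBINT x. ind {0<..<1} x * k x)"
 proof (rule integral_mono[OF _ ki])
  show "integrable lborel (\<lambda>x. 1 / K * ind {a<..<b} x)"
   by (intro integrable_mult_right integrable_real_indicator) (use omega in auto)
  show "1 / K * ind {a<..<b} x <= ind {0<..<1} x * k x" for x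
   using k_omega[of x] omega K1 k_nonneg[of x] by (auto simp: indicator_def field_simps)
 qed
 finally show "1 / K^2 <= (LBINT x. ind {0<..<1} x * k x)" .
qed (use k_nonneg k_le K1 g_def h_def bdry1 bdry0 in auto)

section \<open>Iteration over round trips and the decay rate\<close>

context damped_string
begin

lemma state_le_energy:
 assumes "good t"
 shows "(NBINT x. ennreal ((r t x)^2)) <= ennreal (4 * e t)" "(NBINT x. ennreal ((v t x)^2)) <= ennreal (4 * e t)"
  "(\<eta>1 t)^2 <= 2 * K * e t" "(\<zeta> t)^2 <= 2 * K * e t"
proof -
 have gr: "rt.good t" "vt.good t" using assms by (auto simp: good_def)
 let ?r = "LBINT x. (r t x)^2" and ?v = "LBINT x. (v t x)^2"
 let ?a = "(\<eta>1 t)^2 / (2 * \<beta>1)" and ?b = "\<alpha>2 * (\<eta>2 t)^2 / (2 * \<beta>1)" and ?c = "(\<zeta> t)^2 / (2 * \<mu>1)"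
 have nn: "0 <= ?r" "0 <= ?v" "0 <= ?a" "0 <= ?b" "0 <= ?c" using coeff_pos by (auto intro: integral_nonneg_AE)
 have e: "e t = (?r + ?v) / 4 + ?a + ?b + ?c" by (simp add: e_def)
 have "?r <= 4 * e t" "?v <= 4 * e t" using nn unfolding e by argo+
 moreover have "(NBINT x. ennreal ((r t x)^2)) = ennreal ?r" "(NBINT x. ennreal ((v t x)^2)) = ennreal ?v"
  using gr by (auto intro!: nn_integral_eq_integral rt.good_integrable vt.good_integrable)
 ultimately show "(NBINT x. ennreal ((r t x)^2)) <= ennreal (4 * e t)" "(NBINT x. ennreal ((v t x)^2)) <= ennreal (4 * e t)"
  by (auto intro: ennreal_leI)
 have "?a <= e t" "?c <= e t" using nn unfolding e by argo+
 then have "(\<eta>1 t)^2 <= 2 * \<beta>1 * e t" "(\<zeta> t)^2 <= 2 * \<mu>1 * e t" using coeff_pos by (auto simp: field_simps)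
 moreover have "2 * \<beta>1 * e t <= 2 * K * e t" "2 * \<mu>1 * e t <= 2 * K * e t"
  using coeff_le e_nonneg by (auto intro!: mult_right_mono)
 ultimately show "(\<eta>1 t)^2 <= 2 * K * e t" "(\<zeta> t)^2 <= 2 * K * e t" by linarith+
qed

text \<open>The size \<open>G\<close> is the square root of the bound for the energy after time
  \<open>c\<close> given by \<open>e_decay\<close>. The numerical factors in \<open>tail\<close>
  were chosen to fit: the squares of the states are at most \<open>4 * e\<close>, and the boundary
  inputs are twice \<eta>1 and \<zeta>, whose squares are at most \<open>2 * K * e\<close>.\<close>

lemma energy_tails:
 assumes "good t0" "t0 <= c"
 shows "ct.tails c (sqrt (2 * exp (- rate * (c - t0)) * e t0))"
proof -
 define G where "G = sqrt (2 * exp (- rate * (c - t0)) * e t0)"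
 have G2: "G^2 = 2 * exp (- rate * (c - t0)) * e t0" and G0: "0 <= G" using e_nonneg by (auto simp: G_def)
 have "0 < t0" using assms by (simp add: good_def rt.good_def)
 have main: "AEL t. c < t --> (NBINT x. ennreal ((r t x)^2)) <= ennreal (4 * G^2) \<and>
  (NBINT x. ennreal ((v t x)^2)) <= ennreal (4 * G^2) \<and> \<bar>2 * \<eta>1 t\<bar> <= 4 * K * G \<and> \<bar>- 2 * \<zeta> t\<bar> <= 4 * K * G"
  using AE_good
 proof eventually_elim
  case (elim t)
  show ?case
  proof
   assume "c < t"
   then have g: "good t" using elim \<open>0 < t0\<close> assms by simp
   have "e t <= 2 * exp (- rate * (t - t0)) * e t0" using \<open>c < t\<close> assms by (intro e_decay g) auto
   also have "... <= G^2"
    unfolding G2 using \<open>c < t\<close> rate_pos e_nonneg by (intro mult_right_mono mult_left_mono) auto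
   finally have le: "e t <= G^2" .
   have "\<bar>2 * y\<bar> <= 4 * K * G" if "y^2 <= 2 * K * e t" for y
   proof (rule power2_le_imp_le)
    have "(2 * y)^2 <= 8 * K * e t" using that by (simp add: power_mult_distrib)
    also have "... <= 8 * K * G^2" using le K1 by (intro mult_left_mono) auto
    also have "... <= 16 * K^2 * G^2" using K1 by (intro mult_right_mono) (auto simp: power2_eq_square)
    finally show "\<bar>2 * y\<bar>^2 <= (4 * K * G)^2" by (simp add: power_mult_distrib)
    show "0 <= 4 * K * G" using G0 K1 by simp
   qed
   from this[OF state_le_energy(3)[OF g]] this[OF state_le_energy(4)[OF g]]
   have "\<bar>2 * \<eta>1 t\<bar> <= 4 * K * G" "\<bar>- 2 * \<zeta> t\<bar> <= 4 * K * G" by auto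
   moreover have "ennreal (4 * e t) <= ennreal (4 * G^2)" using le by (intro ennreal_leI) simp
   ultimately show "(NBINT x. ennreal ((r t x)^2)) <= ennreal (4 * G^2) \<and>
    (NBINT x. ennreal ((v t x)^2)) <= ennreal (4 * G^2) \<and> \<bar>2 * \<eta>1 t\<bar> <= 4 * K * G \<and> \<bar>- 2 * \<zeta> t\<bar> <= 4 * K * G"
    using state_le_energy(1,2)[OF g] by (auto intro: order_trans)
  qed
 qed
 have "ct.tail c G" unfolding ct.tail_def using main G0 \<open>0 < t0\<close> assms by auto
 moreover have "coupled_transport.tail v r (\<lambda>t. - 2 * \<zeta> t) (\<lambda>t. 2 * \<eta>1 t) K c G"
  unfolding coupled_transport.tail_def[OF ct.coupled_transport_swap]
  using main G0 \<open>0 < t0\<close> assms by (auto elim!: eventually_mono)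
 ultimately show ?thesis unfolding ct.tails_def G_def[symmetric] by simp
qed

definition state_power :: "real => real => ennreal" where
 "state_power p t = (NBINT x. ind {0<..<1} x * ennreal (\<bar>r t x\<bar> powr p)) +
  (NBINT x. ind {0<..<1} x * ennreal (\<bar>v t x\<bar> powr p))"

text \<open>During a round trip the trace contracts by \<open>ct.\<theta>\<close>, while
  \<open>G powr p\<close> decreases by \<open>exp (- rate * p)\<close>. The midpoint between 1 and
  the larger of the two is still below 1 and strictly exceeds \<open>ct.\<theta>\<close>, which
  makes the recursion with source solvable.\<close>

definition lam :: "real => real" where "lam p = (1 + max ct.\<theta> (exp (- rate * p))) / 2"

text \<open>\<open>c1\<close> and \<open>c2\<close> are the source constants of
  \<open>ct.\<Phi>_initial\<close> and \<open>ct.\<Phi>_step\<close>, \<open>c3\<close> is the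
  amplification in \<open>ct.state_le_\<Phi>\<close>, and \<open>c4\<close> bounds the start of the
  recursion. In \<open>c5\<close> the factor 2 pays for rounding down the number of round trips and
  \<open>2 powr (p / 2)\<close> for the factor 2 of \<open>e_decay\<close>; the half in
  \<open>nu\<close> is the length 2 of a round trip.\<close>

definition c1 :: "real => real" where "c1 p = 2 * (3 * ct.A) powr p"
definition c2 :: "real => real" where "c2 p = 2 * (4 * ct.A / (1 - ct.\<theta>)) powr p"
definition c3 :: "real => real" where "c3 p = (2 * exp (2 * K)) powr p"
definition c4 :: "real => real" where "c4 p = 2 powr p * (1 + c1 p) + c2 p / (lam p - ct.\<theta>)"
definition c5 :: "real => real" where "c5 p = 2 * (c3 p * (4 * c4 p + c1 p)) * 2 powr (p / 2)"
definition nu :: "real => real" where "nu p = - ln (lam p) / 2"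

lemma lam_bounds:
 assumes "1 <= p"
 shows "1 / 2 < lam p" "lam p < 1" "ct.\<theta> < lam p" "exp (- rate * p) <= lam p"
proof -
 have "exp (- rate * p) < 1" using rate_pos assms by simp
 then show "1 / 2 < lam p" "lam p < 1" "ct.\<theta> < lam p" "exp (- rate * p) <= lam p"
  using ct.\<theta>_bounds exp_gt_zero[of "- rate * p"] by (auto simp: lam_def max_def)
qed

lemma nu_pos: "1 <= p ==> 0 < nu p"
 using lam_bounds[of p] by (simp add: nu_def)

lemma constants_nonneg:
 assumes "1 <= p"
 shows "0 <= c1 p" "0 <= c2 p" "0 <= c3 p" "1 <= c4 p" "0 < c5 p" "0 < c3 p"
proof -
 show c: "0 <= c1 p" "0 <= c2 p" "0 <= c3 p" "0 < c3 p" by (simp_all add: c1_def c2_def c3_def)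
 have "1 * 1 <= 2 powr p * (1 + c1 p)" using assms c by (intro mult_mono) (auto simp: ge_one_powr_ge_zero)
 moreover have "0 <= c2 p / (lam p - ct.\<theta>)" using c lam_bounds[OF assms] by simp
 ultimately show c4: "1 <= c4 p" by (simp add: c4_def)
 show "0 < c5 p" using c c4 by (simp add: c5_def zero_less_mult_iff add_pos_nonneg)
qed

text \<open>A discrete Gronwall argument. \<open>X\<close> is the initial value enlarged by
  \<open>c2 p * g0 / (lam p - ct.\<theta>)\<close>, so that
  \<open>ct.\<theta> * X + c2 p * g0 <= lam p * X\<close>. As the sources decay at least like
  \<open>lam p ^ n\<close>, induction gives \<open>lam p ^ n * X\<close>.\<close>

lemma trace_power_decay:
 assumes t0: "good t0" and p: "1 <= p"
 defines "g0 \<equiv> sqrt (2 * e t0) powr p"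
 shows "ct.\<Phi> p (t0 + 2 * real n) (t0 + 2 * real n + 2) <= ennreal (lam p ^ n) * (ennreal (c4 p) * (state_power p t0 + ennreal g0))"
proof -
 let ?a = "\<lambda>n. ct.\<Phi> p (t0 + 2 * real n) (t0 + 2 * real n + 2)"
 let ?m = "exp (- rate * p)"
 note lb = lam_bounds[OF p] and cn = constants_nonneg[OF p]
 have g0: "0 <= g0" by (simp add: g0_def)
 have gd: "rt.good t0" "vt.good t0" using t0 by (auto simp: good_def)
 have sq: "sqrt (2 * exp (- rate * (t0 + 2 * real n - t0)) * e t0) = exp (- rate * real n) * sqrt (2 * e t0)" for n
 proof -
  have "exp (- rate * (t0 + 2 * real n - t0)) = (exp (- rate * real n))^2" by (simp add: power2_eq_square exp_add[symmetric])
  then have "sqrt (2 * exp (- rate * (t0 + 2 * real n - t0)) * e t0) = sqrt ((exp (- rate * real n))^2 * (2 * e t0))" by (simp add: mult_ac)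
  also have "... = exp (- rate * real n) * sqrt (2 * e t0)" by (simp only: real_sqrt_mult real_sqrt_abs abs_exp_cancel)
  finally show ?thesis .
 qed
 have Gp: "(C * (exp (- rate * real n) * sqrt (2 * e t0))) powr p = C powr p * (?m ^ n * g0)" if "0 <= C" for C n
 proof -
  have "exp (- rate * real n) powr p = ?m ^ n" by (simp add: powr_def exp_of_nat_mult[symmetric] mult_ac)
  then show ?thesis using that e_nonneg by (simp add: powr_mult g0_def)
 qed
 define X where "X = ?a 0 + ennreal (c2 p * g0 / (lam p - ct.\<theta>))"
 have A0: "0 <= ct.A" "0 <= ct.A / (1 - ct.\<theta>)" using ct.A_ge ct.\<theta>_bounds by auto
 have step: "?a (Suc n) <= ennreal ct.\<theta> * ?a n + ennreal (c2 p * (?m ^ n * g0))" for n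
 proof -
  have "ct.\<Phi> p (t0 + 2 * real n + 2) (t0 + 2 * real n + 4) <= ennreal ct.\<theta> * ?a n +
   ennreal (2 * (4 * (ct.A * (exp (- rate * real n) * sqrt (2 * e t0))) / (1 - ct.\<theta>)) powr p)"
   using ct.\<Phi>_step[OF energy_tails[OF t0, of "t0 + 2 * real n"] p] unfolding sq by simp
  also have "4 * (ct.A * (exp (- rate * real n) * sqrt (2 * e t0))) / (1 - ct.\<theta>) = (4 * ct.A / (1 - ct.\<theta>)) * (exp (- rate * real n) * sqrt (2 * e t0))" by simp
  also have "2 * ... powr p = c2 p * (?m ^ n * g0)" using A0 by (subst Gp) (auto simp: c2_def)
  finally show ?thesis by (simp add: algebra_simps)
 qed
 have X: "ennreal ct.\<theta> * X + ennreal (c2 p * g0) <= ennreal (lam p) * X"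
 proof -
  have "ennreal (c2 p * g0) = ennreal (lam p - ct.\<theta>) * ennreal (c2 p * g0 / (lam p - ct.\<theta>))"
   using lb cn g0 by (subst ennreal_mult[symmetric]) auto
  also have "... <= ennreal (lam p - ct.\<theta>) * X" unfolding X_def by (intro mult_left_mono) auto
  finally have "ennreal ct.\<theta> * X + ennreal (c2 p * g0) <= (ennreal ct.\<theta> + ennreal (lam p - ct.\<theta>)) * X"
   by (simp add: distrib_right add_left_mono)
  also have "ennreal ct.\<theta> + ennreal (lam p - ct.\<theta>) = ennreal (lam p)"
   using lb ct.\<theta>_bounds by (subst ennreal_plus[symmetric]) auto
  finally show ?thesis .
 qed
 have ind: "?a n <= ennreal (lam p ^ n) * X" for n
 proof (induction n)
  case 0
  show ?case by (simp add: X_def)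
 next
  case (Suc n)
  have "?m ^ n <= lam p ^ n" using lb by (intro power_mono) auto
  then have "ennreal (c2 p * (?m ^ n * g0)) <= ennreal (lam p ^ n * (c2 p * g0))"
   using cn g0 by (intro ennreal_leI) (simp add: mult.left_commute mult_left_mono mult_right_mono)
  also have "... = ennreal (lam p ^ n) * ennreal (c2 p * g0)" using lb cn g0 by (simp add: ennreal_mult)
  finally have 1: "ennreal (c2 p * (?m ^ n * g0)) <= ennreal (lam p ^ n) * ennreal (c2 p * g0)" .
  have "?a (Suc n) <= ennreal ct.\<theta> * (ennreal (lam p ^ n) * X) + ennreal (lam p ^ n) * ennreal (c2 p * g0)"
   by (rule order_trans[OF step add_mono[OF mult_left_mono[OF Suc] 1]]) simp
  also have "... = ennreal (lam p ^ n) * (ennreal ct.\<theta> * X + ennreal (c2 p * g0))" by (simp add: distrib_left mult.left_commute)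
  also have "... <= ennreal (lam p ^ n) * (ennreal (lam p) * X)" by (intro mult_left_mono X) auto
  also have "... = ennreal (lam p ^ Suc n) * X" using lb by (simp add: ennreal_mult mult_ac)
  finally show ?case .
 qed
 have "X <= ennreal (c4 p) * (state_power p t0 + ennreal g0)"
 proof -
  have "?a 0 <= ennreal (2 powr p) * (state_power p t0 + ennreal (2 * (3 * (ct.A * (exp (- rate * real 0) * sqrt (2 * e t0)))) powr p))"
   using ct.\<Phi>_initial[OF energy_tails[OF t0 order_refl] gd p] by (simp add: state_power_def)
  also have "3 * (ct.A * (exp (- rate * real 0) * sqrt (2 * e t0))) = (3 * ct.A) * (exp (- rate * real 0) * sqrt (2 * e t0))" by simp
  also have "2 * ... powr p = c1 p * g0" using A0 by (subst Gp) (auto simp: c1_def)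
  finally have a0: "?a 0 <= ennreal (2 powr p) * (state_power p t0 + ennreal (c1 p * g0))" .
  have le1: "ennreal (2 powr p) <= ennreal (c4 p)"
  proof (rule ennreal_leI)
   have "2 powr p * 1 <= 2 powr p * (1 + c1 p)" using cn by (intro mult_left_mono) auto
   moreover have "0 <= c2 p / (lam p - ct.\<theta>)" using cn lb by simp
   ultimately show "2 powr p <= c4 p" unfolding c4_def by linarith
  qed
  have "X <= ennreal (2 powr p) * state_power p t0 + (ennreal (2 powr p) * ennreal (c1 p * g0) + ennreal (c2 p * g0 / (lam p - ct.\<theta>)))"
   unfolding X_def using add_right_mono[OF a0, of "ennreal (c2 p * g0 / (lam p - ct.\<theta>))"] by (simp add: distrib_left add.assoc)
  also have "ennreal (2 powr p) * ennreal (c1 p * g0) + ennreal (c2 p * g0 / (lam p - ct.\<theta>)) = ennreal (2 powr p * (c1 p * g0) + c2 p * g0 / (lam p - ct.\<theta>))"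
   using cn g0 lb by (subst ennreal_plus) (auto simp: ennreal_mult)
  also have "... <= ennreal (c4 p * g0)"
  proof (rule ennreal_leI)
   have "c4 p * g0 = 2 powr p * g0 + (2 powr p * (c1 p * g0) + c2 p * g0 / (lam p - ct.\<theta>))" by (simp add: c4_def algebra_simps)
   then show "2 powr p * (c1 p * g0) + c2 p * g0 / (lam p - ct.\<theta>) <= c4 p * g0" using g0 by simp
  qed
  also have "ennreal (c4 p * g0) = ennreal (c4 p) * ennreal g0" using cn g0 by (simp add: ennreal_mult)
  finally have "X <= ennreal (2 powr p) * state_power p t0 + ennreal (c4 p) * ennreal g0" by (simp add: add_left_mono)
  also have "... <= ennreal (c4 p) * state_power p t0 + ennreal (c4 p) * ennreal g0"
   by (intro add_right_mono mult_right_mono le1) auto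
  finally show ?thesis by (simp add: distrib_left)
 qed
 then have "ennreal (lam p ^ n) * X <= ennreal (lam p ^ n) * (ennreal (c4 p) * (state_power p t0 + ennreal g0))" by (rule mult_left_mono) simp
 with ind[of n] show ?thesis by (rule order_trans)
qed

text \<open>The state at time \<open>t\<close> is recovered from the trace on
  \<open>{t<..<t + 2}\<close>, which up to a null set is covered by two consecutive windows of the
  grid \<open>t0 + 2 * n\<close>. Their decay and that of \<open>G\<close> at time \<open>t\<close>
  then combine.\<close>

lemma state_power_decay:
 assumes t0: "good t0" and t: "good t" "t0 <= t" and p: "1 <= p"
 shows "state_power p t <= ennreal (c5 p * exp (- nu p * (t - t0))) * (state_power p t0 + ennreal (e t0 powr (p / 2)))"
proof -
 note lb = lam_bounds[OF p] and cn = constants_nonneg[OF p]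
 define n where "n = nat \<lfloor>(t - t0) / 2\<rfloor>"
 have n: "real n <= (t - t0) / 2" "(t - t0) / 2 - 1 < real n"
 proof -
  have "real n = of_int \<lfloor>(t - t0) / 2\<rfloor>" using t by (simp add: n_def)
  then show "real n <= (t - t0) / 2" "(t - t0) / 2 - 1 < real n" by linarith+
 qed
 have n': "t0 + 2 * real n <= t" "t < t0 + 2 * real n + 2" using n by (auto simp: field_simps)
 define g0 where "g0 = sqrt (2 * e t0) powr p"
 define Y where "Y = state_power p t0 + ennreal g0"
 have g0: "0 <= g0" by (simp add: g0_def)
 let ?s = "t0 + 2 * real n"
 have "AEL s. s \<noteq> ?s + 2" by (rule AE_lborel_singleton)
 then have "AEL s. ind {t<..<t + 2} s * ennreal (\<bar>F s\<bar> powr p) <=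
  ind {?s<..<?s + 2} s * ennreal (\<bar>F s\<bar> powr p) + ind {t0 + 2 * real (Suc n)<..<t0 + 2 * real (Suc n) + 2} s * ennreal (\<bar>F s\<bar> powr p)"
  by eventually_elim (use n' in \<open>auto simp: indicator_def\<close>)
 then have "ct.\<Phi> p t (t + 2) <= (NBINT s. ind {?s<..<?s + 2} s * ennreal (\<bar>F s\<bar> powr p) +
   ind {t0 + 2 * real (Suc n)<..<t0 + 2 * real (Suc n) + 2} s * ennreal (\<bar>F s\<bar> powr p))"
  unfolding ct.\<Phi>_def by (rule nn_integral_mono_AE)
 also have "... = ct.\<Phi> p ?s (?s + 2) + ct.\<Phi> p (t0 + 2 * real (Suc n)) (t0 + 2 * real (Suc n) + 2)"
  unfolding ct.\<Phi>_def by (rule nn_integral_add) measurable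
 also have "... <= ennreal (lam p ^ n) * (ennreal (c4 p) * Y) + ennreal (lam p ^ Suc n) * (ennreal (c4 p) * Y)"
  unfolding Y_def g0_def by (intro add_mono trace_power_decay t0 p)
 also have "... <= ennreal (lam p ^ n) * (ennreal (c4 p) * Y) + ennreal (lam p ^ n) * (ennreal (c4 p) * Y)"
  using lb by (intro add_left_mono mult_right_mono ennreal_leI) (auto simp: mult_le_cancel_right1)
 also have "... = 2 * (ennreal (lam p ^ n) * (ennreal (c4 p) * Y))" by (simp add: mult_2)
 finally have \<Phi>: "ct.\<Phi> p t (t + 2) <= 2 * (ennreal (lam p ^ n) * (ennreal (c4 p) * Y))" .
 have gd: "rt.good t" "vt.good t" using t by (auto simp: good_def)
 let ?G = "sqrt (2 * exp (- rate * (t - t0)) * e t0)"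
 have "(3 * (ct.A * ?G)) powr p <= (3 * ct.A) powr p * (lam p ^ n * g0)"
 proof -
  have "?G = exp (- rate * (t - t0) / 2) * sqrt (2 * e t0)"
  proof -
   have "exp (- rate * (t - t0)) = (exp (- rate * (t - t0) / 2))^2" by (simp add: power2_eq_square exp_add[symmetric])
   then have "?G = sqrt ((exp (- rate * (t - t0) / 2))^2 * (2 * e t0))" by (simp add: mult_ac)
   also have "... = exp (- rate * (t - t0) / 2) * sqrt (2 * e t0)" by (simp only: real_sqrt_mult real_sqrt_abs abs_exp_cancel)
   finally show ?thesis .
  qed
  then have "(3 * (ct.A * ?G)) powr p = (3 * ct.A) powr p * (exp (- rate * (t - t0) / 2) powr p * g0)"
   using ct.A_ge e_nonneg by (simp add: powr_mult g0_def mult.assoc)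
  also have "... <= (3 * ct.A) powr p * (lam p ^ n * g0)"
  proof (intro mult_left_mono mult_right_mono)
   have "exp (- rate * (t - t0) / 2) powr p = exp (- rate * p * ((t - t0) / 2))" by (simp add: powr_def mult_ac)
   also have "... <= exp (- rate * p * real n)" using n rate_pos p by (simp add: mult_left_mono)
   also have "... = exp (- rate * p) ^ n" by (simp add: exp_of_nat_mult[symmetric] mult_ac)
   also have "... <= lam p ^ n" using lb by (intro power_mono) auto
   finally show "exp (- rate * (t - t0) / 2) powr p <= lam p ^ n" .
  qed (use g0 in auto)
  finally show ?thesis .
 qed
 then have "ennreal (2 * (3 * (ct.A * ?G)) powr p) <= ennreal (lam p ^ n * (c1 p * g0))"
  by (intro ennreal_leI) (simp add: c1_def algebra_simps)
 also have "... = ennreal (lam p ^ n) * (ennreal (c1 p) * ennreal g0)" using lb cn g0 by (simp add: ennreal_mult)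
 also have "... <= ennreal (lam p ^ n) * (ennreal (c1 p) * Y)" unfolding Y_def by (intro mult_left_mono) auto
 finally have GG: "ennreal (2 * (3 * (ct.A * ?G)) powr p) <= ennreal (lam p ^ n) * (ennreal (c1 p) * Y)" .
 have "state_power p t <= ennreal (c3 p) * (2 * ct.\<Phi> p t (t + 2) + ennreal (2 * (3 * (ct.A * ?G)) powr p))"
  using ct.state_le_\<Phi>[OF energy_tails[OF t0 t(2)] gd p] by (simp add: state_power_def c3_def)
 also have "... <= ennreal (c3 p) * (2 * (2 * (ennreal (lam p ^ n) * (ennreal (c4 p) * Y))) + ennreal (lam p ^ n) * (ennreal (c1 p) * Y))"
  by (intro mult_left_mono add_mono \<Phi> GG) auto
 also have "... = ennreal (c3 p * (4 * c4 p + c1 p) * lam p ^ n) * Y"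
 proof -
  have "ennreal (c3 p * (4 * c4 p + c1 p) * lam p ^ n) = ennreal (c3 p) * (4 * ennreal (c4 p) + ennreal (c1 p)) * ennreal (lam p ^ n)"
   using cn lb by (simp add: ennreal_mult)
  then show ?thesis by (simp add: distrib_left distrib_right mult_ac)
 qed
 also have "... <= ennreal (c3 p * (4 * c4 p + c1 p) * (2 * exp (- nu p * (t - t0)))) * Y"
 proof (intro mult_right_mono ennreal_leI mult_left_mono)
  have "lam p ^ n = exp (real n * ln (lam p))" using lb by (simp add: exp_of_nat_mult)
  also have "... <= exp (((t - t0) / 2 - 1) * ln (lam p))" using n lb by (simp add: mult_right_mono_neg)
  also have "... = exp (- nu p * (t - t0)) * (1 / lam p)"
  proof -
   have "((t - t0) / 2 - 1) * ln (lam p) = - nu p * (t - t0) - ln (lam p)" by (simp add: nu_def algebra_simps)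
   then show ?thesis using lb by (simp only: exp_diff exp_ln) simp
  qed
  also have "... <= exp (- nu p * (t - t0)) * 2" using lb by (intro mult_left_mono) (auto simp: field_simps)
  finally show "lam p ^ n <= 2 * exp (- nu p * (t - t0))" by simp
 qed (use cn in auto)
 also have "Y <= ennreal (2 powr (p / 2)) * (state_power p t0 + ennreal (e t0 powr (p / 2)))"
 proof -
  have "g0 = 2 powr (p / 2) * e t0 powr (p / 2)"
   unfolding g0_def using e_nonneg by (simp add: powr_half_sqrt[symmetric] powr_powr powr_mult)
  then have "ennreal g0 = ennreal (2 powr (p / 2)) * ennreal (e t0 powr (p / 2))" by (simp add: ennreal_mult)
  moreover have "1 * state_power p t0 <= ennreal (2 powr (p / 2)) * state_power p t0"
   using p by (intro mult_right_mono) (auto simp: ge_one_powr_ge_zero)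
  ultimately show ?thesis unfolding Y_def by (simp add: distrib_left add_right_mono)
 qed
 also have "ennreal (c3 p * (4 * c4 p + c1 p) * (2 * exp (- nu p * (t - t0)))) * (ennreal (2 powr (p / 2)) * (state_power p t0 + ennreal (e t0 powr (p / 2)))) =
  ennreal (c5 p * exp (- nu p * (t - t0))) * (state_power p t0 + ennreal (e t0 powr (p / 2)))"
 proof -
  have "c5 p * exp (- nu p * (t - t0)) = (c3 p * (4 * c4 p + c1 p) * (2 * exp (- nu p * (t - t0)))) * 2 powr (p / 2)" by (simp add: c5_def)
  then have "ennreal (c5 p * exp (- nu p * (t - t0))) = ennreal (c3 p * (4 * c4 p + c1 p) * (2 * exp (- nu p * (t - t0)))) * ennreal (2 powr (p / 2))"
   using cn by (subst ennreal_mult[symmetric]) (auto simp: algebra_simps)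
  then show ?thesis by (simp add: mult.assoc)
 qed
 finally show ?thesis by (simp add: mult_left_mono)
qed

lemma e_power_decay:
 assumes t0: "good t0" and t: "good t" "t0 <= t" and p: "1 <= p"
 shows "e t powr (p / 2) <= 2 powr (p / 2) * exp (- nu p * (t - t0)) * e t0 powr (p / 2)"
proof -
 have "e t powr (p / 2) <= (2 * exp (- rate * (t - t0)) * e t0) powr (p / 2)"
  using e_decay[OF t0 t] e_nonneg p by (intro powr_mono2) auto
 also have "... = 2 powr (p / 2) * exp (- rate * (t - t0)) powr (p / 2) * e t0 powr (p / 2)"
  using e_nonneg by (simp add: powr_mult)
 also have "... <= 2 powr (p / 2) * exp (- nu p * (t - t0)) * e t0 powr (p / 2)"
 proof (intro mult_right_mono mult_left_mono)
  \<comment> \<open>By its definition \<open>lam p\<close> also dominates the decay of the quadratic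
    energy, so \<open>nu p\<close> does not exceed \<open>rate * p / 2\<close>.\<close>
  have "ln (exp (- rate * p)) <= ln (lam p)" using lam_bounds[OF p] by (subst ln_le_cancel_iff) auto
  then have "nu p <= rate * p / 2" by (simp add: nu_def)
  then have "nu p * (t - t0) <= rate * p / 2 * (t - t0)" using t by (intro mult_right_mono) auto
  then show "exp (- rate * (t - t0)) powr (p / 2) <= exp (- nu p * (t - t0))" by (simp add: powr_def algebra_simps)
 qed auto
 finally show ?thesis .
qed

end

section \<open>Curves in Lp and their traces\<close>

text \<open>The bridge from the completed measure in the definitions to Borel functions on
  \<open>lborel\<close>, where product measures and shears are at hand. Extension by zero matches
  the support conditions of \<open>transport\<close>.\<close>

lemma lebesgue_on_borel_representative:
 fixes f :: "'a::euclidean_space => real"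
 assumes f: "f \<in> borel_measurable (lebesgue_on S)" and S[measurable]: "S \<in> sets borel"
 obtains f' where "borel_fun f'" "\<And>x. x \<notin> S ==> f' x = 0" "AEL x. x \<in> S --> f x = f' x"
proof -
 have S': "S \<inter> space lebesgue \<in> sets lebesgue" using S by simp
 have "(\<lambda>x. ind S x *\<^sub>R f x) \<in> borel_measurable lebesgue"
  using f by (subst (asm) borel_measurable_restrict_space_iff[OF S'])
 from completion_ex_borel_measurable_real[OF this]
 obtain g where g: "g \<in> borel_measurable lborel" "AEL x. ind S x *\<^sub>R f x = g x" by auto
 show ?thesis
 proof (rule that[of "\<lambda>x. ind S x * g x"])
  show "(\<lambda>x. ind S x * g x) \<in> borel_measurable borel" using g(1) by measurable
  show "AEL x. x \<in> S --> f x = ind S x * g x" using g(2) by eventually_elim auto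
 qed auto
qed

lemma lebesgue_on_AE_eq:
 fixes f :: "'a::euclidean_space => real"
 assumes f: "f \<in> borel_measurable (lebesgue_on S)" and S[measurable]: "S \<in> sets borel"
  and f'[measurable]: "borel_fun f'" and ae: "AEL x. x \<in> S --> f x = f' x"
 shows "(LINT x|lebesgue_on S. f x) = (LBINT x. ind S x * f' x)"
  and "integrable (lebesgue_on S) f \<longleftrightarrow> integrable lborel (\<lambda>x. ind S x * f' x)"
proof -
 have S': "S \<inter> space lebesgue \<in> sets lebesgue" using S by simp
 have m: "(\<lambda>x. ind S x *\<^sub>R f x) \<in> borel_measurable lebesgue"
  using f by (subst (asm) borel_measurable_restrict_space_iff[OF S'])
 have m'l: "(\<lambda>x. ind S x * f' x) \<in> borel_measurable lborel" by measurable
 then have m': "(\<lambda>x. ind S x * f' x) \<in> borel_measurable lebesgue" by (rule measurable_completion)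
 have ae': "AE x in lebesgue. ind S x *\<^sub>R f x = ind S x * f' x"
  by (rule AE_completion) (use ae in \<open>eventually_elim, auto simp: indicator_def\<close>)
 have "(LINT x|lebesgue_on S. f x) = (LINT x|lebesgue. ind S x *\<^sub>R f x)" by (rule integral_restrict_space[OF S'])
 also have "... = (LINT x|lebesgue. ind S x * f' x)" by (rule integral_cong_AE[OF m m' ae'])
 also have "... = (LBINT x. ind S x * f' x)" by (rule integral_completion[OF m'l])
 finally show "(LINT x|lebesgue_on S. f x) = (LBINT x. ind S x * f' x)" .
 have "integrable (lebesgue_on S) f \<longleftrightarrow> integrable lebesgue (\<lambda>x. ind S x *\<^sub>R f x)" by (rule integrable_restrict_space[OF S'])
 also have "... \<longleftrightarrow> integrable lebesgue (\<lambda>x. ind S x * f' x)" by (rule integrable_cong_AE[OF m m' ae'])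
 also have "... \<longleftrightarrow> integrable lborel (\<lambda>x. ind S x * f' x)" by (rule integrable_completion[OF m'l])
 finally show "integrable (lebesgue_on S) f \<longleftrightarrow> integrable lborel (\<lambda>x. ind S x * f' x)" .
qed

lemma lebesgue_on_borel_measurable:
 fixes f :: "'a::euclidean_space => real"
 assumes "borel_fun f"
 shows "f \<in> borel_measurable (lebesgue_on S)"
 by (rule measurable_restrict_space1[OF measurable_completion]) (use assms in simp)

lemma lebesgue_on_borel_eq:
 fixes f :: "'a::euclidean_space => real"
 assumes "borel_fun f" "S \<in> sets borel"
 shows "(LINT x|lebesgue_on S. f x) = (LBINT x. ind S x * f x)"
  and "integrable (lebesgue_on S) f \<longleftrightarrow> integrable lborel (\<lambda>x. ind S x * f x)"
 using lebesgue_on_AE_eq[OF lebesgue_on_borel_measurable[OF assms(1)] assms(2,1)] by auto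

lemma AE_lebesgue_on_iff:
 assumes "S \<in> sets borel"
 shows "(AE x in lebesgue_on S. P x) \<longleftrightarrow> (AEL x. x \<in> S --> P x)"
 using assms by (simp add: AE_restrict_space_iff AE_completion_iff)

lemma abs_le_one_plus_powr: "1 <= p ==> \<bar>x::real\<bar> <= 1 + \<bar>x\<bar> powr p"
 using powr_mono[of 1 p "\<bar>x\<bar>"] by (cases "\<bar>x\<bar> <= 1") (auto intro: order_trans)

lemma square_le_one_plus_powr: "2 <= p ==> (x::real)\<^sup>2 <= 1 + \<bar>x\<bar> powr p"
proof (cases "\<bar>x\<bar> <= 1")
 case True
 then have "x^2 <= 1" by (simp add: abs_square_le_1)
 then show ?thesis by (auto intro: order_trans)
next
 case False
 assume "2 <= p"
 have "x^2 = \<bar>x\<bar> powr 2" using False by simp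
 also have "... <= \<bar>x\<bar> powr p" using False \<open>2 <= p\<close> by (intro powr_mono) auto
 finally show ?thesis by simp
qed

lemma Lp_integrable:
 assumes "Lp p S f" "1 <= p" and S: "S \<in> sets borel" "emeasure lborel S < \<infinity>"
 shows "integrable (lebesgue_on S) f"
proof (rule integrable_bound)
 have "finite_measure (lebesgue_on S)"
  using S by (intro finite_measureI) (simp add: emeasure_restrict_space)
 then show "integrable (lebesgue_on S) (\<lambda>x. 1 + \<bar>f x\<bar> powr p)"
  using assms(1) by (intro integrable_add finite_measure.integrable_const) (auto simp: Lp_def)
 show "AE x in lebesgue_on S. norm (f x) <= norm (1 + \<bar>f x\<bar> powr p)"
  using abs_le_one_plus_powr[OF assms(2)] by (intro AE_I2) simp
qed (use assms in \<open>simp add: Lp_def\<close>)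

lemma Lp_diff:
 assumes "Lp p S f" "Lp p S g" "0 <= p"
 shows "Lp p S (\<lambda>x. f x - g x)"
 unfolding Lp_def
proof
 show m: "(\<lambda>x. f x - g x) \<in> borel_measurable (lebesgue_on S)" using assms by (auto simp: Lp_def)
 show "integrable (lebesgue_on S) (\<lambda>x. \<bar>f x - g x\<bar> powr p)"
 proof (rule integrable_bound)
  show "integrable (lebesgue_on S) (\<lambda>x. 2 powr p * (\<bar>f x\<bar> powr p + \<bar>g x\<bar> powr p))"
   using assms by (auto simp: Lp_def)
  have "\<bar>x - y\<bar> powr p <= 2 powr p * (\<bar>x\<bar> powr p + \<bar>y\<bar> powr p)" for x y :: real
   using powr_add_le[of "\<bar>x\<bar>" "\<bar>y\<bar>" p] powr_mono2[OF assms(3) _ abs_triangle_ineq4[of x y]] assms(3) by simp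
  then show "AE x in lebesgue_on S. norm (\<bar>f x - g x\<bar> powr p) <= norm (2 powr p * (\<bar>f x\<bar> powr p + \<bar>g x\<bar> powr p))"
   by (intro AE_I2) simp
 qed (use m in measurable)
qed

lemma Lp_cmult:
 assumes "Lp p S f"
 shows "Lp p S (\<lambda>x. c * f x)"
 using assms by (auto simp: Lp_def abs_mult powr_mult)

text \<open>A triangle inequality for p-th powers with the crude constant \<open>2 powr p\<close>.
  Used once near time 0 and once near time \<open>t\<close>, it causes the loss in passing from
  almost every time to every time.\<close>

lemma Lp_power_le_shift:
 assumes "Lp p S f" "Lp p S g" "0 <= p"
 shows "(LINT x|lebesgue_on S. \<bar>f x\<bar> powr p) <= 2 powr p * ((LINT x|lebesgue_on S. \<bar>g x\<bar> powr p) + (LINT x|lebesgue_on S. \<bar>f x - g x\<bar> powr p))"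
proof -
 have d: "Lp p S (\<lambda>x. f x - g x)" by (rule Lp_diff[OF assms])
 have le: "\<bar>x\<bar> powr p <= 2 powr p * (\<bar>y\<bar> powr p + \<bar>x - y\<bar> powr p)" for x y :: real
  using powr_add_le[of "\<bar>y\<bar>" "\<bar>x - y\<bar>" p] powr_mono2[OF assms(3) abs_ge_zero, of x "\<bar>y\<bar> + \<bar>x - y\<bar>"] abs_triangle_ineq[of y "x - y"] assms(3) by simp
 have "(LINT x|lebesgue_on S. \<bar>f x\<bar> powr p) <= (LINT x|lebesgue_on S. 2 powr p * (\<bar>g x\<bar> powr p + \<bar>f x - g x\<bar> powr p))"
  using assms d le by (intro integral_mono) (auto simp: Lp_def)
 also have "... = 2 powr p * ((LINT x|lebesgue_on S. \<bar>g x\<bar> powr p) + (LINT x|lebesgue_on S. \<bar>f x - g x\<bar> powr p))"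
  using assms d by (subst integral_mult_right_zero, subst integral_add) (auto simp: Lp_def)
 finally show ?thesis .
qed

lemma Lp_norm_power:
 assumes "0 < p"
 shows "(LINT x|lebesgue_on S. \<bar>f x\<bar> powr p) = Lp_norm p S f powr p"
proof -
 have "0 <= (LINT x|lebesgue_on S. \<bar>f x\<bar> powr p)" by (intro integral_nonneg_AE AE_I2) auto
 then show ?thesis using assms by (simp add: Lp_norm_def powr_powr)
qed

lemma Lp_norm_tendsto_power:
 assumes "0 < p" "((\<lambda>s. Lp_norm p S (f s)) \<longlongrightarrow> 0) X"
 shows "((\<lambda>s. LINT x|lebesgue_on S. \<bar>f s x\<bar> powr p) \<longlongrightarrow> 0) X"
 unfolding Lp_norm_power[OF assms(1)]
 by (rule tendsto_zero_powrI[OF assms(2) tendsto_const]) (auto simp: Lp_norm_def assms(1))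

text \<open>Convergence in \<open>L\<^sup>p\<close> implies convergence in \<open>L\<^sup>1\<close> on sets of finite measure, from \<open>y <= d + d\<^sup>1\<^sup>-\<^sup>p y\<^sup>p\<close>.\<close>

lemma Lp_norm_tendsto_L1:
 assumes p: "1 <= p" and S: "S \<in> sets borel" "emeasure lborel S < \<infinity>" and f: "eventually (\<lambda>s. Lp p S (f s)) X"
  and lim: "((\<lambda>s. Lp_norm p S (f s)) \<longlongrightarrow> 0) X"
 shows "((\<lambda>s. LINT x|lebesgue_on S. \<bar>f s x\<bar>) \<longlongrightarrow> 0) X"
proof (rule tendstoI)
 fix e :: real assume e: "0 < e"
 define m where "m = measure lborel S"
 define d where "d = e / (2 * (m + 1))"
 have m: "0 <= m" by (simp add: m_def)
 have d: "0 < d" using e m by (simp add: d_def)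
 have fin: "finite_measure (lebesgue_on S)"
  using S by (intro finite_measureI) (simp add: emeasure_restrict_space)
 have mS: "measure (lebesgue_on S) (space (lebesgue_on S)) = m"
  using S by (simp add: m_def measure_restrict_space)
 have ptw: "y <= d + d powr (1 - p) * y powr p" if "0 <= y" for y
 proof (cases "y <= d")
  case False
  have "y = y powr (1 - p) * y powr p" using False d by (simp add: powr_add[symmetric])
  also have "... <= d powr (1 - p) * y powr p" using False d p by (intro mult_right_mono powr_mono2') auto
  finally show ?thesis using d by simp
 qed (use d in \<open>auto intro: add_increasing2\<close>)
 have "((\<lambda>s. d powr (1 - p) * (LINT x|lebesgue_on S. \<bar>f s x\<bar> powr p)) \<longlongrightarrow> d powr (1 - p) * 0) X"
  using p by (intro tendsto_mult tendsto_const Lp_norm_tendsto_power[OF _ lim]) auto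
 then have "eventually (\<lambda>s. d powr (1 - p) * (LINT x|lebesgue_on S. \<bar>f s x\<bar> powr p) < e / 2) X"
  by (rule order_tendstoD) (use e in auto)
 with f show "eventually (\<lambda>s. dist (LINT x|lebesgue_on S. \<bar>f s x\<bar>) 0 < e) X"
 proof eventually_elim
  case (elim s)
  note int = Lp_integrable[OF elim(1) p S]
  have "(LINT x|lebesgue_on S. \<bar>f s x\<bar>) <= (LINT x|lebesgue_on S. d + d powr (1 - p) * \<bar>f s x\<bar> powr p)"
   using int elim(1) ptw fin by (intro integral_mono) (auto simp: Lp_def finite_measure.integrable_const)
  also have "... = d * m + d powr (1 - p) * (LINT x|lebesgue_on S. \<bar>f s x\<bar> powr p)"
   using elim(1) fin mS by (subst integral_add) (auto simp: Lp_def finite_measure.integrable_const)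
  also have "d * m <= e / 2"
   using e m by (simp add: d_def field_simps)
  finally have "(LINT x|lebesgue_on S. \<bar>f s x\<bar>) < e" using elim(2) by simp
  moreover have "0 <= (LINT x|lebesgue_on S. \<bar>f s x\<bar>)" by (intro integral_nonneg_AE AE_I2) auto
  ultimately show ?case by simp
 qed
qed

lemma locally_bounded_on_compact:
 fixes N :: "real => real"
 assumes "compact C" and loc: "\<And>t. t \<in> C ==> \<exists>B. eventually (\<lambda>s. N s <= B) (at t within C)"
 obtains B where "\<And>t. t \<in> C ==> N t <= B"
proof -
 have "\<exists>e B. 0 < e \<and> (\<forall>s\<in>C. dist s t < e --> N s <= B)" if tC: "t \<in> C" for t
 proof -
  obtain B d where d: "0 < d" "\<And>s. s \<in> C ==> s \<noteq> t ==> dist s t < d ==> N s <= B"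
   using loc[OF tC] unfolding eventually_at by auto
  then show ?thesis by (intro exI[of _ d] exI[of _ "max B (N t)"]) (auto simp: le_max_iff_disj)
 qed
 then obtain e B where eB: "\<And>t. t \<in> C ==> 0 < e t" "\<And>t s. t \<in> C ==> s \<in> C ==> dist s t < e t ==> N s <= B t" by metis
 have "C \<subseteq> (\<Union>t\<in>C. ball t (e t))" using eB(1) by fastforce
 then obtain D where D: "D \<subseteq> C" "finite D" "C \<subseteq> (\<Union>t\<in>D. ball t (e t))"
  using compactE_image[OF \<open>compact C\<close>, of C "\<lambda>t. ball t (e t)"] by auto
 show ?thesis
 proof (rule that[of "Max (insert 0 (B ` D))"])
  fix t assume "t \<in> C"
  then obtain t' where "t' \<in> D" "t \<in> ball t' (e t')" using D by auto
  then have "N t <= B t'" using eB(2)[of t' t] D \<open>t \<in> C\<close> by (auto simp: dist_commute)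
  also have "... <= Max (insert 0 (B ` D))" using D \<open>t' \<in> D\<close> by (intro Max_ge) auto
  finally show "N t <= Max (insert 0 (B ` D))" .
 qed
qed

lemma Lp_continuous_on_bounded:
 assumes c: "Lp_continuous_on p S I f" and p: "0 < p" and C: "compact C" "C \<subseteq> I"
 obtains B where "\<And>t. t \<in> C ==> (LINT x|lebesgue_on S. \<bar>f t x\<bar> powr p) <= B"
proof (rule locally_bounded_on_compact[OF C(1), of "\<lambda>t. LINT x|lebesgue_on S. \<bar>f t x\<bar> powr p"])
 fix t assume t: "t \<in> C"
 then have tI: "t \<in> I" using C by auto
 have "((\<lambda>s. Lp_norm p S (\<lambda>x. f s x - f t x)) \<longlongrightarrow> 0) (at t within C)"
  using c tI C(2) by (auto simp: Lp_continuous_on_def intro: tendsto_within_subset)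
 from Lp_norm_tendsto_power[OF p this]
 have "eventually (\<lambda>s. (LINT x|lebesgue_on S. \<bar>f s x - f t x\<bar> powr p) < 1) (at t within C)"
  by (rule order_tendstoD) simp
 moreover have "eventually (\<lambda>s. s \<in> C) (at t within C)" by (simp add: eventually_at_filter)
 ultimately have "eventually (\<lambda>s. (LINT x|lebesgue_on S. \<bar>f s x\<bar> powr p) <= 2 powr p * ((LINT x|lebesgue_on S. \<bar>f t x\<bar> powr p) + 1)) (at t within C)"
 proof eventually_elim
  case (elim s)
  have "Lp p S (f s)" "Lp p S (f t)" using c elim tI C by (auto simp: Lp_continuous_on_def)
  from Lp_power_le_shift[OF this] p
  have "(LINT x|lebesgue_on S. \<bar>f s x\<bar> powr p) <= 2 powr p * ((LINT x|lebesgue_on S. \<bar>f t x\<bar> powr p) + (LINT x|lebesgue_on S. \<bar>f s x - f t x\<bar> powr p))" by simp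
  also have "... <= 2 powr p * ((LINT x|lebesgue_on S. \<bar>f t x\<bar> powr p) + 1)" using elim by (intro mult_left_mono) auto
  finally show ?case .
 qed
 then show "\<exists>B. eventually (\<lambda>s. (LINT x|lebesgue_on S. \<bar>f s x\<bar> powr p) <= B) (at t within C)" by blast
qed (use that in blast)

lemma integrable_bounded_mult:
 fixes f w :: "'a => real"
 assumes "integrable M f" "w \<in> borel_measurable M" "\<And>x. x \<in> space M ==> \<bar>w x\<bar> <= B"
 shows "integrable M (\<lambda>x. f x * w x)"
proof (rule integrable_bound)
 show "integrable M (\<lambda>x. \<bar>f x\<bar> * B)" using assms by auto
 show "AE x in M. norm (f x * w x) <= norm (\<bar>f x\<bar> * B)"
 proof (rule AE_I2)
  fix x assume "x \<in> space M"
  then have "\<bar>w x\<bar> <= \<bar>B\<bar>" using assms(3)[of x] by linarith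
  then show "norm (f x * w x) <= norm (\<bar>f x\<bar> * B)" by (simp add: abs_mult mult_left_mono)
 qed
qed (use assms in auto)

lemma integral_bounded_mult_le:
 fixes f w :: "'a => real"
 assumes f: "integrable M f" and w: "w \<in> borel_measurable M" and B: "\<And>x. x \<in> space M ==> \<bar>w x\<bar> <= B"
 shows "\<bar>LINT x|M. f x * w x\<bar> <= B * (LINT x|M. \<bar>f x\<bar>)"
proof -
 note i = integrable_bounded_mult[OF f w B]
 have "\<bar>LINT x|M. f x * w x\<bar> <= (LINT x|M. \<bar>f x * w x\<bar>)" by (rule integral_abs_bound)
 also have "... <= (LINT x|M. B * \<bar>f x\<bar>)"
 proof (rule integral_mono)
  fix x assume "x \<in> space M"
  from mult_left_mono[OF B[OF this] abs_ge_zero[of "f x"]] show "\<bar>f x * w x\<bar> <= B * \<bar>f x\<bar>"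
   by (simp add: abs_mult mult.commute)
 qed (use f i in auto)
 finally show ?thesis by simp
qed

lemma Lp_continuous_on_L1:
 assumes "Lp_continuous_on p S I F" "1 <= p" "S \<in> sets borel" "emeasure lborel S < \<infinity>" "t \<in> I"
 shows "((\<lambda>s. LINT x|lebesgue_on S. \<bar>F s x - F t x\<bar>) \<longlongrightarrow> 0) (at t within I)"
proof (rule Lp_norm_tendsto_L1[OF assms(2-4)])
 have "eventually (\<lambda>s. s \<in> I) (at t within I)" by (simp add: eventually_at_filter)
 then show "eventually (\<lambda>s. Lp p S (\<lambda>x. F s x - F t x)) (at t within I)"
  by eventually_elim (use assms in \<open>auto intro!: Lp_diff simp: Lp_continuous_on_def\<close>)
qed (use assms in \<open>auto simp: Lp_continuous_on_def\<close>)

text \<open>The increment splits into a change of \<open>F\<close>, small in \<open>L^1\<close>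
  against a bounded weight, and a change of the weight, small by the Lipschitz condition against a
  fixed integrable function. The weight must be allowed to vary because traces are tested with
  \<open>\<psi> (t + \<sigma> * x)\<close>.\<close>

lemma Lp_continuous_weighted_integral:
 assumes F: "Lp_continuous_on p S I F" and p: "1 <= p" and S: "S \<in> sets borel" "emeasure lborel S < \<infinity>"
  and w: "\<And>x. x \<in> I ==> w x \<in> borel_measurable (lebesgue_on S)"
  and B: "\<And>x t. x \<in> I ==> t \<in> S ==> \<bar>w x t\<bar> <= B"
  and L: "\<And>x y t. x \<in> I ==> y \<in> I ==> t \<in> S ==> \<bar>w y t - w x t\<bar> <= L * \<bar>y - x\<bar>"
 shows "continuous_on I (\<lambda>x. LINT t|lebesgue_on S. F x t * w x t)"
 unfolding continuous_on_def
proof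
 fix x assume x: "x \<in> I"
 have sp: "space (lebesgue_on S) = S" by simp
 have Fi: "integrable (lebesgue_on S) (F y)" if "y \<in> I" for y
  using F that p S by (intro Lp_integrable) (auto simp: Lp_continuous_on_def)
 have "((\<lambda>y. (LINT t|lebesgue_on S. F y t * w y t) - (LINT t|lebesgue_on S. F x t * w x t)) \<longlongrightarrow> 0) (at x within I)"
 proof (rule Lim_null_comparison)
  have "eventually (\<lambda>y. y \<in> I) (at x within I)" by (simp add: eventually_at_filter)
  then show "eventually (\<lambda>y. norm ((LINT t|lebesgue_on S. F y t * w y t) - (LINT t|lebesgue_on S. F x t * w x t)) <=
    B * (LINT t|lebesgue_on S. \<bar>F y t - F x t\<bar>) + L * \<bar>y - x\<bar> * (LINT t|lebesgue_on S. \<bar>F x t\<bar>)) (at x within I)"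
  proof eventually_elim
   case (elim y)
   have bx: "\<And>t. t \<in> space (lebesgue_on S) ==> \<bar>w x t\<bar> <= B" and by': "\<And>t. t \<in> space (lebesgue_on S) ==> \<bar>w y t\<bar> <= B"
    and d: "\<And>t. t \<in> space (lebesgue_on S) ==> \<bar>w y t - w x t\<bar> <= L * \<bar>y - x\<bar>"
    using B L x elim by auto
   have dm: "(\<lambda>t. w y t - w x t) \<in> borel_measurable (lebesgue_on S)" using w[OF x] w[OF elim] by measurable
   have Fd: "integrable (lebesgue_on S) (\<lambda>t. F y t - F x t)" using Fi[OF x] Fi[OF elim] by simp
   note i1 = integrable_bounded_mult[OF Fd w[OF elim] by'] and i2 = integrable_bounded_mult[OF Fi[OF x] dm d]
    and i3 = integrable_bounded_mult[OF Fi[OF x] w[OF x] bx] and i4 = integrable_bounded_mult[OF Fi[OF elim] w[OF elim] by']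
   have "(LINT t|lebesgue_on S. F y t * w y t) - (LINT t|lebesgue_on S. F x t * w x t) =
     (LINT t|lebesgue_on S. F y t * w y t - F x t * w x t)"
    using i3 i4 by simp
   also have "... = (LINT t|lebesgue_on S. (F y t - F x t) * w y t + F x t * (w y t - w x t))"
    by (simp add: algebra_simps)
   also have "... = (LINT t|lebesgue_on S. (F y t - F x t) * w y t) + (LINT t|lebesgue_on S. F x t * (w y t - w x t))"
    using i1 i2 by simp
   finally show ?case
    using integral_bounded_mult_le[OF Fd w[OF elim] by'] integral_bounded_mult_le[OF Fi[OF x] dm d] by simp
  qed
  have "((\<lambda>y. B * (LINT t|lebesgue_on S. \<bar>F y t - F x t\<bar>) + L * \<bar>y - x\<bar> * (LINT t|lebesgue_on S. \<bar>F x t\<bar>)) \<longlongrightarrow>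
    B * 0 + L * \<bar>x - x\<bar> * (LINT t|lebesgue_on S. \<bar>F x t\<bar>)) (at x within I)"
   by (intro tendsto_intros Lp_continuous_on_L1[OF F p S x])
  then show "((\<lambda>y. B * (LINT t|lebesgue_on S. \<bar>F y t - F x t\<bar>) + L * \<bar>y - x\<bar> * (LINT t|lebesgue_on S. \<bar>F x t\<bar>)) \<longlongrightarrow> 0) (at x within I)"
   by simp
 qed
 then show "((\<lambda>y. LINT t|lebesgue_on S. F y t * w y t) \<longlongrightarrow> (LINT t|lebesgue_on S. F x t * w x t)) (at x within I)"
  by (subst (asm) LIM_zero_iff)
qed

lemma integrable_lebesgue_on_subset:
 fixes f :: "real => real"
 assumes "integrable (lebesgue_on S) f" "T \<subseteq> S" "S \<in> sets lebesgue" "T \<in> sets lebesgue"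
 shows "integrable (lebesgue_on T) f"
 using assms set_integrable_subset[of lebesgue S f T] by (simp add: set_integrable_def integrable_restrict_space)

lemma continuous_eq_zero_if_integrals_zero:
 fixes h :: "real => real"
 assumes h: "continuous_on {a..b} h" and "a < b" and 0: "\<And>x. a <= x ==> x <= b ==> integral {a..x} h = 0" and x: "x \<in> {a..b}"
 shows "h x = 0"
proof -
 have "((\<lambda>y. integral {a..y} h) has_vector_derivative h x) (at x within {a..b})"
  by (rule integral_has_vector_derivative[OF h x])
 then have "((\<lambda>y. 0) has_vector_derivative h x) (at x within {a..b})"
  by (rule has_vector_derivative_transform[rotated -1]) (use x 0 in auto)
 then show ?thesis
  using vector_derivative_unique_within_closed_interval[OF \<open>a < b\<close>, of x "\<lambda>y. 0" "h x" 0] x has_vector_derivative_const[of 0 "at x within {a..b}"]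
  by (simp add: cbox_interval)
qed

lemma AE_lborel_pair_swap:
 fixes P :: "real \<times> real => bool"
 assumes "AEL z. P z"
 shows "AEL t. AEL x. P (t, x)" "AEL x. AEL t. P (t, x)"
proof -
 have *: "AE z in lborel2. P z" using assms unfolding lborel_prod .
 then show "AEL t. AEL x. P (t, x)" by (rule lborel_pair.AE_pair)
 have "AE z in distr lborel2 lborel2 (\<lambda>(x, y). (y, x)). P z"
  using * by (rule subst[OF lborel_pair.distr_pair_swap])
 then have "AE z in lborel2. P ((\<lambda>(x, y). (y, x)) z)" by (rule AE_distrD[rotated]) measurable
 then have "AEL x. AEL t. P ((\<lambda>(x, y). (y, x)) (x, t))" by (rule lborel_pair.AE_pair)
 then show "AEL x. AEL t. P (t, x)" by simp
qed

section \<open>Pointwise regularity of the displacement\<close>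

locale wave_traces =
 fixes p :: real and u ut ux Ut Ux :: "real => real => real"
 assumes p: "2 < p" and regularity: "solution_regularity p u ut ux"
  and Ut: "sideways_version p ut Ut" and Ux: "sideways_version p ux Ux"
begin

lemma unit_interval: "{0<..<1::real} \<in> sets borel" "emeasure lborel {0<..<1::real} < \<infinity>" by auto

lemma p1: "1 <= p" "0 < p" "0 <= p" "2 <= p" using p by auto

lemma curves:
 "Lp_continuous_on p {0<..<1} {0..} u" "Lp_continuous_on p {0<..<1} {0..} ux" "Lp_continuous_on p {0<..<1} {0..} ut"
 "Lp_has_deriv_on p {0<..<1} {0..} u ut"
 using regularity by (auto simp: solution_regularity_def)

lemma curves_Lp:
 assumes "0 <= t"
 shows "Lp p {0<..<1} (u t)" "Lp p {0<..<1} (ut t)" "Lp p {0<..<1} (ux t)"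
 using assms curves by (auto simp: Lp_continuous_on_def)

lemma curves_integrable:
 assumes "0 <= t"
 shows "integrable (lebesgue_on {0<..<1}) (u t)" "integrable (lebesgue_on {0<..<1}) (ut t)" "integrable (lebesgue_on {0<..<1}) (ux t)"
 using curves_Lp[OF assms] p1(1) unit_interval by (auto intro: Lp_integrable)

lemma u_W1p:
 assumes "0 <= t"
 shows "continuous_on {0..1} (u t)" "has_weak_deriv {0<..<1} (u t) (ux t)"
 using assms regularity by (auto simp: solution_regularity_def W1p_deriv_def)

lemma u_diff:
 assumes "0 <= t" "0 <= x" "x <= y" "y <= 1"
 shows "u t y - u t x = (LINT s|lebesgue_on {x<..<y}. ux t s)"
 using u_W1p[OF assms(1)] curves_integrable(3)[OF assms(1)] assms(2-4)
 by (intro weak_deriv_imp_integral[of 0 1]) (auto simp: has_weak_deriv_def)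

lemma abs_integral_subinterval_le:
 fixes f :: "real => real"
 assumes f: "integrable (lebesgue_on {0<..<1}) f" and x: "0 <= x" "y <= 1"
 shows "\<bar>LINT s|lebesgue_on {x<..<y}. f s\<bar> <= (LINT s|lebesgue_on {0<..<1}. \<bar>f s\<bar>)"
proof -
 have sub: "{x<..<y} \<subseteq> {0<..<1}" using x by auto
 have *: "integrable (lebesgue_on {x<..<y}) f" using f sub by (rule integrable_lebesgue_on_subset) auto
 have i: "integrable lebesgue (\<lambda>s. ind {x<..<y} s * f s)" "integrable lebesgue (\<lambda>s. ind {0<..<1} s * f s)"
  using f * by (auto simp: integrable_restrict_space)
 have "\<bar>LINT s|lebesgue_on {x<..<y}. f s\<bar> <= (LINT s|lebesgue. \<bar>ind {x<..<y} s * f s\<bar>)"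
  by (subst lebesgue_on_integral_indicator) (auto intro: integral_abs_bound)
 also have "... <= (LINT s|lebesgue. \<bar>ind {0<..<1} s * f s\<bar>)"
  using i sub by (intro integral_mono integrable_abs) (auto simp: indicator_def abs_mult)
 also have "... = (LINT s|lebesgue_on {0<..<1}. \<bar>f s\<bar>)"
  by (subst lebesgue_on_integral_indicator) (auto simp: abs_mult)
 finally show ?thesis .
qed

lemma u_spatial_oscillation:
 assumes "0 <= t" "0 <= x" "x <= 1" "0 <= y" "y <= 1"
 shows "\<bar>u t y - u t x\<bar> <= (LINT s|lebesgue_on {0<..<1}. \<bar>ux t s\<bar>)"
proof -
 have *: "\<bar>u t y - u t x\<bar> <= (LINT s|lebesgue_on {0<..<1}. \<bar>ux t s\<bar>)" if "0 <= x" "x <= y" "y <= 1" for x y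
  using u_diff[OF assms(1) that] abs_integral_subinterval_le[OF curves_integrable(3)[OF assms(1)] that(1,3)] by simp
 show ?thesis using *[of x y] *[of y x] assms by (cases "x <= y") (auto simp: abs_minus_commute)
qed

text \<open>The difference of two time slices is a function of \<open>x\<close> whose oscillation is
  at most the \<open>L^1\<close> norm of the difference of the derivatives. Comparing the value at
  \<open>x\<close> with the average over the unit interval gives the embedding into continuous
  functions.\<close>

lemma u_time_oscillation:
 assumes t: "0 <= t" "0 <= s" and x: "0 <= x" "x <= 1"
 shows "\<bar>u s x - u t x\<bar> <= (LINT y|lebesgue_on {0<..<1}. \<bar>u s y - u t y\<bar>) + (LINT y|lebesgue_on {0<..<1}. \<bar>ux s y - ux t y\<bar>)"
proof -
 define D where "D = (LINT y|lebesgue_on {0<..<1}. \<bar>ux s y - ux t y\<bar>)"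
 have dx: "\<bar>(u s y - u t y) - (u s x - u t x)\<bar> <= D" if "0 <= x" "x <= y" "y <= 1" for x y
 proof -
  have "(u s y - u t y) - (u s x - u t x) = (LINT z|lebesgue_on {x<..<y}. ux s z) - (LINT z|lebesgue_on {x<..<y}. ux t z)"
   using u_diff[OF t(1) that] u_diff[OF t(2) that] by simp
  also have "... = (LINT z|lebesgue_on {x<..<y}. ux s z - ux t z)"
  proof (rule integral_diff[symmetric])
   show "integrable (lebesgue_on {x<..<y}) (ux s)" "integrable (lebesgue_on {x<..<y}) (ux t)"
    using that by (auto intro!: integrable_lebesgue_on_subset[OF curves_integrable(3)] t)
  qed
  finally have eq: "(u s y - u t y) - (u s x - u t x) = (LINT z|lebesgue_on {x<..<y}. ux s z - ux t z)" .
  have "integrable (lebesgue_on {0<..<1}) (\<lambda>z. ux s z - ux t z)" using curves_integrable(3) t by auto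
  from abs_integral_subinterval_le[OF this that(1,3)] show ?thesis unfolding eq D_def .
 qed
 have le: "\<bar>u s x - u t x\<bar> <= \<bar>u s y - u t y\<bar> + D" if "0 < y" "y < 1" for y
  using dx[of x y] dx[of y x] that x by (cases "x <= y") (auto simp: abs_le_iff)
 have i: "integrable (lebesgue_on {0<..<1}) (\<lambda>y. \<bar>u s y - u t y\<bar>)" using curves_integrable(1) t by auto
 have fin: "finite_measure (lebesgue_on {0<..<1::real})" by (intro finite_measureI) (simp add: emeasure_restrict_space)
 have m: "measure (lebesgue_on {0<..<1::real}) {0<..<1} = 1" by (simp add: measure_restrict_space)
 have "(LINT y|lebesgue_on {0<..<1::real}. \<bar>u s x - u t x\<bar>) <= (LINT y|lebesgue_on {0<..<1}. \<bar>u s y - u t y\<bar> + D)"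
  using i fin le by (intro integral_mono) (auto simp: finite_measure.integrable_const)
 also have "... = (LINT y|lebesgue_on {0<..<1}. \<bar>u s y - u t y\<bar>) + (LINT y|lebesgue_on {0<..<1::real}. D)"
  using i fin by (intro integral_add) (auto simp: finite_measure.integrable_const)
 finally show ?thesis using m by (simp add: D_def)
qed

text \<open>Uniform continuity in time from \<open>u_time_oscillation\<close> is combined with
  continuity of each slice. This makes \<open>u\<close> jointly measurable and bounded on bounded
  sets, as required for Fubini in the weak form of the equation.\<close>

lemma u_continuous: "continuous_on ({0..} \<times> {0..1}) (\<lambda>z. u (fst z) (snd z))"
 unfolding continuous_on_def
proof
 fix z :: "real \<times> real" assume z: "z \<in> {0..} \<times> {0..1}"
 define t x where "t = fst z" and "x = snd z"
 have t: "0 <= t" and x: "0 <= x" "x <= 1" using z by (auto simp: t_def x_def)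
 define N where "N s = (LINT y|lebesgue_on {0<..<1}. \<bar>u s y - u t y\<bar>) + (LINT y|lebesgue_on {0<..<1}. \<bar>ux s y - ux t y\<bar>)" for s
 let ?A = "at z within {0..} \<times> {0..1}"
 have "(N \<longlongrightarrow> 0 + 0) (at t within {0..})" unfolding N_def[abs_def]
  by (intro tendsto_add Lp_continuous_on_L1[OF curves(1) p1(1) unit_interval] Lp_continuous_on_L1[OF curves(2) p1(1) unit_interval]) (use t in auto)
 then have N: "continuous (at (fst z) within {0..}) N" by (simp add: continuous_within N_def t_def)
 have "continuous ?A (\<lambda>z. N (fst z))"
  by (rule continuous_within_compose2[of z "{0..} \<times> {0..1}" fst N]) (auto intro!: continuous_intros continuous_within_subset[OF N])
 then have N': "((\<lambda>z. N (fst z)) \<longlongrightarrow> 0) ?A" by (simp add: continuous_within N_def t_def)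
 have "continuous (at (snd z) within {0..1}) (u t)" using u_W1p(1)[OF t] x by (auto simp: continuous_on_eq_continuous_within x_def)
 then have "continuous ?A (\<lambda>z. u t (snd z))"
  by (intro continuous_within_compose2[of z "{0..} \<times> {0..1}" snd "u t"]) (auto intro!: continuous_intros continuous_within_subset)
 then have U: "((\<lambda>z. u t (snd z)) \<longlongrightarrow> u t x) ?A" by (simp add: continuous_within x_def)
 have "((\<lambda>z. u (fst z) (snd z) - u t (snd z)) \<longlongrightarrow> 0) ?A"
 proof (rule Lim_null_comparison[OF _ N'])
  have "eventually (\<lambda>z. z \<in> {0..} \<times> {0..1}) ?A" by (simp add: eventually_at_filter)
  then show "eventually (\<lambda>z. norm (u (fst z) (snd z) - u t (snd z)) <= N (fst z)) ?A"
   by eventually_elim (auto simp: N_def intro!: u_time_oscillation t)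
 qed
 from tendsto_add[OF this U] show "((\<lambda>z. u (fst z) (snd z)) \<longlongrightarrow> u (fst z) (snd z)) ?A" by (simp add: t_def x_def)
qed

end

section \<open>Borel versions of the two first derivatives\<close>

lemma spacetime_borel: "spacetime \<in> sets borel"
 unfolding spacetime_def by (intro borel_open open_Times) auto

lemma mem_spacetime: "z \<in> spacetime \<longleftrightarrow> 0 < fst z \<and> 0 < snd z \<and> snd z < 1"
 by (cases z) (auto simp: spacetime_def)

text \<open>One first derivative in three guises: the curve in time \<open>f\<close>, the curve in
  space \<open>G\<close>, and a joint Borel version \<open>w\<close> vanishing outside the open
  strip. The locale is instantiated for \<open>ut\<close> and for \<open>ux\<close>.\<close>

locale sideways_borel =
 fixes p :: real and f G w :: "real => real => real"
 assumes p: "2 < p" and curve: "Lp_continuous_on p {0<..<1} {0..} f" and side: "sideways_version p f G"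
  and w_meas: "(\<lambda>z. w (fst z) (snd z)) \<in> borel_measurable borel"
  and w_supp: "\<And>t x. \<not> (0 < t \<and> 0 < x \<and> x < 1) ==> w t x = 0"
  and w_AE: "AEL z. z \<in> spacetime --> f (fst z) (snd z) = w (fst z) (snd z)"
begin

lemma w_meas_pair: "joint_borel w"
 using w_meas by (simp add: borel_prod)

lemmas w_measurable[measurable (raw)] = measurable_curried2[OF w_meas_pair]

lemma f_AE: "AEL t. AEL x. 0 < t --> 0 < x --> x < 1 --> f t x = w t x"
 using AE_lborel_pair_swap(1)[OF w_AE] by (simp add: mem_spacetime imp_conjL)

lemma G_AE: "AEL x. AEL t. 0 < t --> 0 < x --> x < 1 --> G x t = w t x"
proof -
 have "AEL z. z \<in> spacetime --> G (snd z) (fst z) = f (fst z) (snd z)"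
  using side AE_lebesgue_on_iff[OF spacetime_borel] by (simp add: sideways_version_def)
 with w_AE have "AEL z. z \<in> spacetime --> G (snd z) (fst z) = w (fst z) (snd z)" by eventually_elim simp
 from AE_lborel_pair_swap(2)[OF this] show ?thesis by (simp add: mem_spacetime imp_conjL)
qed

lemma trace_curve: "0 < T ==> Lp_continuous_on p {0<..<T} {0..1} G"
 using side by (simp add: sideways_version_def)

lemma trace_Lp: "0 < T ==> 0 <= x ==> x <= 1 ==> Lp p {0<..<T} (G x)"
 using trace_curve by (simp add: Lp_continuous_on_def)

lemma trace_integrable:
 assumes "0 <= x" "x <= 1"
 shows "integrable (lebesgue_on {0<..<T}) (G x)"
proof (cases "0 < T")
 case True
 then show ?thesis using trace_Lp[OF True assms] p by (intro Lp_integrable) auto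
qed (simp add: integrable_restrict_space)

lemma power_slice:
 assumes "0 < t" "AEL x. 0 < x --> x < 1 --> f t x = w t x"
 shows "(NBINT x. ennreal (\<bar>w t x\<bar> powr p)) = ennreal (LINT x|lebesgue_on {0<..<1}. \<bar>f t x\<bar> powr p)"
  and "integrable lborel (\<lambda>x. \<bar>w t x\<bar> powr p)"
proof -
 have L: "Lp p {0<..<1} (f t)" using curve assms by (auto simp: Lp_continuous_on_def)
 have ae: "AEL x. x \<in> {0<..<1} --> \<bar>f t x\<bar> powr p = \<bar>w t x\<bar> powr p" using assms(2) by eventually_elim auto
 have m: "(\<lambda>x. \<bar>f t x\<bar> powr p) \<in> borel_measurable (lebesgue_on {0<..<1})" using L by (auto simp: Lp_def)
 have m': "(\<lambda>x. \<bar>w t x\<bar> powr p) \<in> borel_measurable borel" by measurable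
 have ind: "ind {0<..<1} x * \<bar>w t x\<bar> powr p = \<bar>w t x\<bar> powr p" for x
  using w_supp[of t x] by (cases "0 < x \<and> x < 1") auto
 have "{0<..<1::real} \<in> sets borel" by simp
 note eq = lebesgue_on_AE_eq[OF m this m' ae, unfolded ind]
 show i: "integrable lborel (\<lambda>x. \<bar>w t x\<bar> powr p)" using L eq(2) by (simp add: Lp_def)
 show "(NBINT x. ennreal (\<bar>w t x\<bar> powr p)) = ennreal (LINT x|lebesgue_on {0<..<1}. \<bar>f t x\<bar> powr p)"
  unfolding eq(1) by (rule nn_integral_eq_integral[OF i]) auto
qed

lemma strip_power: "(NBINT t x. ind {..T} t * ennreal (\<bar>w t x\<bar> powr p)) < \<infinity>"
proof -
 obtain B where B: "\<And>t. t \<in> {0..T} ==> (LINT x|lebesgue_on {0<..<1}. \<bar>f t x\<bar> powr p) <= B"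
  using Lp_continuous_on_bounded[OF curve, of "{0..T}"] p by auto
 have "(NBINT t x. ind {..T} t * ennreal (\<bar>w t x\<bar> powr p)) <= (NBINT (t::real). ennreal B * ind {0..T} t)"
 proof (rule nn_integral_mono_AE)
  show "AEL t. (NBINT x. ind {..T} t * ennreal (\<bar>w t x\<bar> powr p)) <= ennreal B * ind {0..T} t"
   using f_AE
  proof eventually_elim
   case (elim t)
   show ?case
   proof (cases "0 < t \<and> t <= T")
    case True
    with elim have "AEL x. 0 < x --> x < 1 --> f t x = w t x" by simp
    from power_slice(1)[OF _ this] True B[of t] show ?thesis by (auto simp: indicator_def intro: ennreal_leI)
   next
    case False
    then have "ind {..T} t * ennreal (\<bar>w t x\<bar> powr p) = 0" for x using w_supp[of t x] by (auto simp: indicator_def)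
    then have "(NBINT x. ind {..T} t * ennreal (\<bar>w t x\<bar> powr p)) = (NBINT (x::real). 0)"
     by (intro nn_integral_cong)
    then show ?thesis by simp
   qed
  qed
 qed
 also have "... = ennreal B * emeasure lborel {0..T}" by (subst nn_integral_cmult_indicator) auto
 also have "... < \<infinity>" by (cases "0 <= T") (auto simp: ennreal_mult_less_top)
 finally show ?thesis .
qed

lemma strip_lower_power:
 assumes c: "\<And>y. c y <= 1 + \<bar>y\<bar> powr p" "c 0 = (0::real)" and [measurable]: "borel_fun c"
 shows "(NBINT t x. ind {..T} t * ennreal (c (w t x))) < \<infinity>"
proof -
 have "(NBINT t x. ind {..T} t * ennreal (c (w t x))) <=
   (NBINT (t::real) (x::real). ind {0..T} t * ind {0..1} x + ind {..T} t * ennreal (\<bar>w t x\<bar> powr p))"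
 proof (intro nn_integral_mono)
  fix t x :: real
  show "ind {..T} t * ennreal (c (w t x)) <= ind {0..T} t * ind {0..1} x + ind {..T} t * ennreal (\<bar>w t x\<bar> powr p)"
   using w_supp[of t x] c(2) ennreal_leI[OF c(1)[of "w t x"]]
   by (cases "0 < t \<and> 0 < x \<and> x < 1") (auto simp: indicator_def ennreal_plus)
 qed
 also have "... = (NBINT (t::real) (x::real). ind {0..T} t * ind {0..1} x) +
   (NBINT t x. ind {..T} t * ennreal (\<bar>w t x\<bar> powr p))"
  by (subst nn_integral_add[symmetric]; (subst nn_integral_add)?) auto
 also have "(NBINT (t::real) (x::real). ind {0..T} t * ind {0..1} x) = emeasure lborel {0..T}"
  by (subst nn_integral_cmult) auto
 also have "emeasure lborel {0..T} + (NBINT t x. ind {..T} t * ennreal (\<bar>w t x\<bar> powr p)) < \<infinity>"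
  using strip_power[of T] by (cases "0 <= T") auto
 finally show ?thesis .
qed

lemma strip_sq: "(NBINT t x. ind {..T} t * ennreal ((w t x)^2)) < \<infinity>"
 using strip_lower_power[of power2] square_le_one_plus_powr p by auto

lemma strip_integrable: "integrable lborel2 (\<lambda>z. ind {..T} (fst z) * w (fst z) (snd z))"
proof (rule integrableI_bounded)
 have "(\<integral>\<^sup>+z. ennreal (norm (ind {..T} (fst z) * w (fst z) (snd z))) \<partial>lborel2) =
   (NBINT t x. ind {..T} t * ennreal \<bar>w t x\<bar>)"
  by (subst lborel.nn_integral_fst[symmetric]) (auto simp: abs_mult ennreal_mult ennreal_indicator intro!: nn_integral_cong split: split_indicator)
 also have "... < \<infinity>" using strip_lower_power[of abs] abs_le_one_plus_powr[of p] p by auto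
 finally show "(\<integral>\<^sup>+z. ennreal (norm (ind {..T} (fst z) * w (fst z) (snd z))) \<partial>lborel2) < \<infinity>" .
qed measurable

lemma strip_integrable_mult:
 assumes [measurable]: "joint_borel \<theta>" and B: "\<And>t x. \<bar>\<theta> t x :: real\<bar> <= B"
 shows "integrable lborel2 (\<lambda>z. ind {..T} (fst z) * w (fst z) (snd z) * \<theta> (fst z) (snd z))"
 by (rule integrable_bounded_mult[OF strip_integrable, of _ B]) (use B in auto)

lemma strip_Fubini:
 assumes \<theta>: "joint_borel \<theta>" and B: "\<And>t x. \<bar>\<theta> t x :: real\<bar> <= B"
 shows "(LBINT t. LBINT x. ind {..T} t * w t x * \<theta> t x) = (LBINT x. LBINT t. ind {..T} t * w t x * \<theta> t x)"
 using lborel_pair.Fubini_integral[of "\<lambda>t x. ind {..T} t * w t x * \<theta> t x"] strip_integrable_mult[OF \<theta> B, of T]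
 by (simp add: split_beta')

lemma trace_integral:
 assumes "AEL t. 0 < t --> 0 < x --> x < 1 --> G x t = w t x" "0 < x" "x < 1" "0 <= t1"
  and [measurable]: "borel_fun \<theta>"
 shows "(LINT t|lebesgue_on {t1<..<T}. G x t * \<theta> t) = (LBINT t. ind {t1<..<T} t * (w t x * \<theta> t))"
proof (rule lebesgue_on_AE_eq(1))
 have "{t1<..<T} \<subseteq> {0<..<T}" using assms by auto
 then have "G x \<in> borel_measurable (lebesgue_on {t1<..<T})"
  using integrable_lebesgue_on_subset[OF trace_integrable[of x T], of "{t1<..<T}"] assms by auto
 then show "(\<lambda>t. G x t * \<theta> t) \<in> borel_measurable (lebesgue_on {t1<..<T})"
  by (intro borel_measurable_times) (auto intro: lebesgue_on_borel_measurable)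
 show "AEL t. t \<in> {t1<..<T} --> G x t * \<theta> t = w t x * \<theta> t" using assms(1) by eventually_elim (use assms in auto)
qed auto

lemma slice_integral:
 assumes "AEL x. 0 < t --> 0 < x --> x < 1 --> f t x = w t x" "0 < t"
  and [measurable]: "borel_fun \<theta>"
 shows "(LINT x|lebesgue_on {0<..<1}. f t x * \<theta> x) = (LBINT x. w t x * \<theta> x)"
proof -
 have "Lp p {0<..<1} (f t)" using curve assms by (auto simp: Lp_continuous_on_def)
 then have m: "(\<lambda>x. f t x * \<theta> x) \<in> borel_measurable (lebesgue_on {0<..<1})"
  by (intro borel_measurable_times) (auto simp: Lp_def intro: lebesgue_on_borel_measurable)
 have "(LINT x|lebesgue_on {0<..<1}. f t x * \<theta> x) = (LBINT x. ind {0<..<1} x * (w t x * \<theta> x))"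
 proof (rule lebesgue_on_AE_eq(1)[OF m])
  show "AEL x. x \<in> {0<..<1} --> f t x * \<theta> x = w t x * \<theta> x" using assms(1) by eventually_elim (use assms in auto)
 qed auto
 also have "... = (LBINT x. w t x * \<theta> x)"
  using w_supp by (intro integral_cong) (auto simp: indicator_def)
 finally show ?thesis .
qed

end

locale wave_borel = wave_traces p u ut ux Ut Ux + t: sideways_borel p ut Ut v0 + x: sideways_borel p ux Ux vx
 for p u ut ux Ut Ux v0 vx

section \<open>The time derivative of the displacement at fixed abscissa\<close>

context wave_traces
begin

lemma u_weighted_deriv:
 assumes w: "w \<in> borel_measurable (lebesgue_on {0<..<1})" and B: "\<And>x. x \<in> {0<..<1} ==> \<bar>w x\<bar> <= B" and t: "0 <= t"
 shows "((\<lambda>s. LINT x|lebesgue_on {0<..<1}. u s x * w x) has_real_derivative (LINT x|lebesgue_on {0<..<1}. ut t x * w x)) (at t within {0..})"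
proof -
 let ?L = "lebesgue_on {0<..<1::real}"
 let ?q = "\<lambda>s x. (u s x - u t x) / (s - t) - ut t x"
 have B': "\<And>x. x \<in> space ?L ==> \<bar>w x\<bar> <= B" using B by simp
 have "((\<lambda>s. ((LINT x|?L. u s x * w x) - (LINT x|?L. u t x * w x)) / (s - t) - (LINT x|?L. ut t x * w x)) \<longlongrightarrow> 0) (at t within {0..})"
 proof (rule Lim_null_comparison)
  have ev: "eventually (\<lambda>s. s \<in> {0..}) (at t within {0..})" by (simp add: eventually_at_filter)
  then show "eventually (\<lambda>s. norm (((LINT x|?L. u s x * w x) - (LINT x|?L. u t x * w x)) / (s - t) - (LINT x|?L. ut t x * w x)) <=
    B * (LINT x|?L. \<bar>?q s x\<bar>)) (at t within {0..})"
  proof eventually_elim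
   case (elim s)
   then have s: "0 <= s" by simp
   note i = integrable_bounded_mult[OF curves_integrable(1)[OF s] w B'] integrable_bounded_mult[OF curves_integrable(1)[OF t] w B']
    integrable_bounded_mult[OF curves_integrable(2)[OF t] w B']
   have qi: "integrable ?L (?q s)" using curves_integrable[OF s] curves_integrable[OF t] by auto
   have "((LINT x|?L. u s x * w x) - (LINT x|?L. u t x * w x)) / (s - t) - (LINT x|?L. ut t x * w x) =
     (LINT x|?L. (u s x * w x - u t x * w x) / (s - t) - ut t x * w x)"
    using i by simp
   also have "... = (LINT x|?L. ?q s x * w x)" by (intro integral_cong) (auto simp: algebra_simps diff_divide_distrib)
   finally show ?case using integral_bounded_mult_le[OF qi w B'] by simp
  qed
  have "((\<lambda>s. LINT x|?L. \<bar>?q s x\<bar>) \<longlongrightarrow> 0) (at t within {0..})"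
  proof (rule Lp_norm_tendsto_L1[OF p1(1) unit_interval])
   show "eventually (\<lambda>s. Lp p {0<..<1} (?q s)) (at t within {0..})"
    using ev
   proof eventually_elim
    case (elim s)
    then have "Lp p {0<..<1} (\<lambda>x. (1 / (s - t)) * (u s x - u t x) - ut t x)"
     using curves_Lp t p1 by (intro Lp_diff Lp_cmult) auto
    then show ?case by simp
   qed
   show "((\<lambda>s. Lp_norm p {0<..<1} (?q s)) \<longlongrightarrow> 0) (at t within {0..})" using curves(4) t by (simp add: Lp_has_deriv_on_def)
  qed
  from tendsto_mult[OF tendsto_const this, of B] show "((\<lambda>s. B * (LINT x|?L. \<bar>?q s x\<bar>)) \<longlongrightarrow> 0) (at t within {0..})" by simp
 qed
 then show ?thesis unfolding has_field_derivative_iff by (simp add: LIM_zero_iff)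
qed

lemma u_weighted_diff:
 assumes w: "w \<in> borel_measurable (lebesgue_on {0<..<1})" and B: "\<And>x. x \<in> {0<..<1} ==> \<bar>w x\<bar> <= B" and t: "0 <= t1" "t1 <= t2"
 shows "(LINT x|lebesgue_on {0<..<1}. u t2 x * w x) - (LINT x|lebesgue_on {0<..<1}. u t1 x * w x) =
   (LINT t|lebesgue_on {t1<..<t2}. LINT x|lebesgue_on {0<..<1}. ut t x * w x)"
  and "(\<lambda>t. LINT x|lebesgue_on {0<..<1}. ut t x * w x) \<in> borel_measurable (lebesgue_on {t1<..<t2})"
proof -
 let ?D = "\<lambda>t. LINT x|lebesgue_on {0<..<1}. ut t x * w x"
 have "continuous_on {0..} ?D"
  by (rule Lp_continuous_weighted_integral[OF curves(3) p1(1) unit_interval, where B = B and L = 0]) (use w B in auto)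
 then have D: "continuous_on {t1..t2} ?D" by (rule continuous_on_subset) (use t in auto)
 show "?D \<in> borel_measurable (lebesgue_on {t1<..<t2})" using lebesgue_on_continuous_integrable[OF D] by auto
 have "(?D has_integral ((LINT x|lebesgue_on {0<..<1}. u t2 x * w x) - (LINT x|lebesgue_on {0<..<1}. u t1 x * w x))) {t1..t2}"
 proof (rule fundamental_theorem_of_calculus[OF t(2)])
  fix t assume "t \<in> {t1..t2}"
  then have "0 <= t" using t by simp
  from DERIV_subset[OF u_weighted_deriv[OF w B this], of "{t1..t2}"]
  show "((\<lambda>s. LINT x|lebesgue_on {0<..<1}. u s x * w x) has_vector_derivative ?D t) (at t within {t1..t2})"
   using t by (auto simp: has_real_derivative_iff_has_vector_derivative)
 qed
 then show "(LINT x|lebesgue_on {0<..<1}. u t2 x * w x) - (LINT x|lebesgue_on {0<..<1}. u t1 x * w x) = (LINT t|lebesgue_on {t1<..<t2}. ?D t)"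
  unfolding lebesgue_on_continuous_eq_integral[OF D] by (simp add: integral_unique)
qed

end

context wave_borel
begin

text \<open>\<open>ut\<close> is the derivative of \<open>u\<close> as a curve in
  \<open>L^p\<close>, hence after integration in \<open>x\<close> over \<open>{0<..<d}\<close>.
  Fubini exchanges the two integrals and shows that the difference of the two sides has zero
  integral over every \<open>{0<..<d}\<close>. It is continuous in \<open>x\<close>, by the sideways
  regularity, so it vanishes at every \<open>x\<close>, the boundary included.\<close>

lemma u_time:
 assumes t12: "0 <= t1" "t1 <= t2" and x: "0 <= x" "x <= 1"
 shows "u t2 x - u t1 x = (LINT t|lebesgue_on {t1<..<t2}. Ut x t)"
proof (cases "t1 = t2")
 case False
 then have t2: "0 < t2" using t12 by simp
 define M where "M x = (LINT t|lebesgue_on {t1<..<t2}. Ut x t)" for x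
 have M_eq: "M x = (LINT t|lebesgue_on {0<..<t2}. Ut x t * ind {t1<..<t2} t)" for x
  unfolding M_def using t12 by (subst (1 2) lebesgue_on_integral_indicator) (auto intro!: integral_cong simp: indicator_def)
 have "continuous_on {0..1} M" unfolding M_eq[abs_def]
  by (rule Lp_continuous_weighted_integral[OF t.trace_curve[OF t2] p1(1), where B = 1 and L = 0])
   (use t2 in \<open>auto intro!: lebesgue_on_borel_measurable simp: indicator_def\<close>)
 moreover have "continuous_on {0..1} (u t2)" "continuous_on {0..1} (u t1)" using u_W1p(1) t12 by auto
 ultimately have h: "continuous_on {0..1} (\<lambda>x. u t2 x - u t1 x - M x)" by (intro continuous_intros)
 have "u t2 x - u t1 x - M x = 0"
 proof (rule continuous_eq_zero_if_integrals_zero[OF h])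
  fix d :: real assume d: "0 <= d" "d <= 1"
  let ?i = "\<lambda>x. ind {0<..<d} x :: real"
  let ?\<theta> = "\<lambda>t x. ind {t1<..<t2} t * ind {0<..<d} x :: real"
  have im: "?i \<in> borel_measurable (lebesgue_on {0<..<1})" by (intro lebesgue_on_borel_measurable) auto
  have hd: "continuous_on {0..d} (\<lambda>x. u t2 x - u t1 x - M x)" "continuous_on {0..d} (\<lambda>x. u t2 x - u t1 x)"
    "continuous_on {0..d} M" "continuous_on {0..d} (u t2)" "continuous_on {0..d} (u t1)"
   using h \<open>continuous_on {0..1} M\<close> \<open>continuous_on {0..1} (u t2)\<close> \<open>continuous_on {0..1} (u t1)\<close> d
   by (auto intro!: continuous_intros elim!: continuous_on_subset)
  have restr: "(LINT x|lebesgue_on {0<..<1}. v x * ?i x) = (LINT x|lebesgue_on {0<..<d}. v x)" for v :: "real => real"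
   using d by (subst (1 2) lebesgue_on_integral_indicator) (auto intro!: integral_cong simp: indicator_def)
  note wd = u_weighted_diff[OF im _ t12, of 1]
  have "(LINT x|lebesgue_on {0<..<d}. u t2 x) - (LINT x|lebesgue_on {0<..<d}. u t1 x) =
    (LINT t|lebesgue_on {t1<..<t2}. LINT x|lebesgue_on {0<..<1}. ut t x * ?i x)"
   using wd(1) unfolding restr by simp
  also have "... = (LBINT t. ind {t1<..<t2} t * (LBINT x. v0 t x * ?i x))"
  proof (rule lebesgue_on_AE_eq(1)[OF wd(2)])
   show "AEL t. t \<in> {t1<..<t2} --> (LINT x|lebesgue_on {0<..<1}. ut t x * ?i x) = (LBINT x. v0 t x * ?i x)"
    using t.f_AE by eventually_elim (use t12 in \<open>auto intro!: t.slice_integral\<close>)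
  qed auto
  also have "... = (LBINT t. LBINT x. ind {..t2} t * v0 t x * ?\<theta> t x)"
   by (intro integral_cong) (auto simp: indicator_def)
  also have "... = (LBINT x. LBINT t. ind {..t2} t * v0 t x * ?\<theta> t x)"
   by (rule t.strip_Fubini[of _ 1]) (auto simp: indicator_def)
  also have "... = (LBINT x. ?i x * (LBINT t. ind {t1<..<t2} t * v0 t x))"
  proof (rule integral_cong[OF refl])
   fix x :: real
   have "(LBINT t. ind {..t2} t * v0 t x * ?\<theta> t x) = (LBINT t. ?i x * (ind {t1<..<t2} t * v0 t x))"
    by (intro integral_cong) (auto simp: indicator_def)
   then show "(LBINT t. ind {..t2} t * v0 t x * ?\<theta> t x) = ?i x * (LBINT t. ind {t1<..<t2} t * v0 t x)" by simp
  qed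
  also have "... = (LINT x|lebesgue_on {0<..<d}. M x)"
  proof (rule lebesgue_on_AE_eq(1)[symmetric])
   show "M \<in> borel_measurable (lebesgue_on {0<..<d})" using lebesgue_on_continuous_integrable[OF hd(3)] by auto
   show "AEL x. x \<in> {0<..<d} --> M x = (LBINT t. ind {t1<..<t2} t * v0 t x)"
    using t.G_AE
   proof eventually_elim
    case (elim x)
    show ?case using t.trace_integral[OF elim, of t1 "\<lambda>_. 1" t2] t12 d by (simp add: M_def)
   qed
  qed auto
  finally have "(LINT x|lebesgue_on {0<..<d}. u t2 x - u t1 x - M x) = 0"
   using lebesgue_on_continuous_integrable[OF hd(3)] lebesgue_on_continuous_integrable[OF hd(4)] lebesgue_on_continuous_integrable[OF hd(5)] by simp
  then show "integral {0..d} (\<lambda>x. u t2 x - u t1 x - M x) = 0"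
   using lebesgue_on_continuous_eq_integral[OF hd(1)] by simp
 qed (use x in auto)
 then show ?thesis by (simp add: M_def)
qed (simp add: lebesgue_on_integral_indicator)

end

section \<open>Characteristics of weak solutions\<close>

lemma lebesgue_on_integral_borel_AE:
 fixes f f' :: "'a::euclidean_space => real"
 assumes S[measurable]: "S \<in> sets borel" and f'[measurable]: "borel_fun f'"
  and ae: "AEL x. x \<in> S --> f x = f' x"
 shows "(LINT x|lebesgue_on S. f x) = (LBINT x. ind S x * f' x)"
proof (rule lebesgue_on_AE_eq(1)[OF _ S f' ae])
 have S': "S \<inter> space lebesgue \<in> sets lebesgue" using S by simp
 have m: "(\<lambda>x. ind S x *\<^sub>R f' x) \<in> borel_measurable lebesgue" by (rule measurable_completion) measurable
 have "(\<lambda>x. ind S x *\<^sub>R f x) \<in> borel_measurable lebesgue"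
  by (rule borel_measurable_AE[OF m], rule AE_completion) (use ae in \<open>eventually_elim, auto simp: indicator_def\<close>)
 then show "f \<in> borel_measurable (lebesgue_on S)" by (subst borel_measurable_restrict_space_iff[OF S'])
qed

section \<open>Test functions adapted to characteristics\<close>

lemma test_function_Ck: "test_function \<Omega> \<psi> ==> Ck k \<psi>"
 by (simp add: test_function_def)

lemma test_function_support:
 assumes "test_function \<Omega> \<psi>"
 obtains C where "compact C" "C \<subseteq> \<Omega>" "\<And>z. z \<notin> C ==> \<psi> z = 0"
proof (rule that[of "closure {z. \<psi> z \<noteq> 0}"])
 show "compact (closure {z. \<psi> z \<noteq> 0})" "closure {z. \<psi> z \<noteq> 0} \<subseteq> \<Omega>" using assms unfolding test_function_def by blast+
qed (use closure_subset[of "{z. \<psi> z \<noteq> 0}"] in blast)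

lemma test_function_zero: "test_function \<Omega> \<psi> ==> z \<notin> \<Omega> ==> \<psi> z = 0"
 by (erule test_function_support) blast

lemma test_function_has_deriv:
 fixes \<psi> :: "real => real"
 shows "test_function \<Omega> \<psi> ==> (\<psi> has_real_derivative deriv \<psi> x) (at x)"
 by (rule Ck_deriv_real(1)[of 0]) (rule test_function_Ck)

lemma test_function_deriv:
 fixes \<psi> :: "real => real"
 assumes \<psi>: "test_function \<Omega> \<psi>"
 shows "test_function \<Omega> (deriv \<psi>)"
proof -
 obtain C where C: "compact C" "C \<subseteq> \<Omega>" "\<And>z. z \<notin> C ==> \<psi> z = 0" by (rule test_function_support[OF \<psi>]) blast
 have "deriv \<psi> z = 0" if "z \<notin> C" for z
 proof -
  have "eventually (\<lambda>y. y \<in> - C) (nhds z)" using that C(1) by (intro eventually_nhds_in_open) (auto simp: compact_imp_closed)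
  then have "eventually (\<lambda>y. \<psi> y = 0) (nhds z)" by eventually_elim (simp add: C(3))
  then have "deriv \<psi> z = deriv (\<lambda>_. 0) z" by (intro deriv_cong_ev) simp_all
  then show ?thesis by simp
 qed
 then show ?thesis using C Ck_deriv_real(2)[OF test_function_Ck[OF \<psi>]] by (intro test_functionI[of _ C]) auto
qed

lemma test_function_continuous:
 fixes \<psi> :: "real => real"
 assumes "test_function \<Omega> \<psi>"
 shows "continuous_on A \<psi>" "borel_fun \<psi>"
proof -
 have c: "continuous_on UNIV \<psi>" using test_function_Ck[OF assms, of 0] by simp
 then show "continuous_on A \<psi>" by (rule continuous_on_subset) simp
 show "borel_fun \<psi>" using c by (rule borel_measurable_continuous_onI)
qed

lemma test_function_bounded:
 fixes \<psi> :: "real => real"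
 assumes "test_function \<Omega> \<psi>"
 obtains B where "0 <= B" "\<And>x. \<bar>\<psi> x\<bar> <= B"
proof -
 obtain C where C: "compact C" "\<And>z. z \<notin> C ==> \<psi> z = 0" by (rule test_function_support[OF assms]) blast
 have "bounded (\<psi> ` C)" using C(1) test_function_continuous(1)[OF assms] by (intro compact_imp_bounded compact_continuous_image)
 then obtain B where B: "\<And>x. x \<in> C ==> \<bar>\<psi> x\<bar> <= B" by (auto simp: bounded_iff)
 show ?thesis
 proof (rule that[of "max 0 B"])
  fix x show "\<bar>\<psi> x\<bar> <= max 0 B" using B[of x] C(2)[of x] by (cases "x \<in> C") auto
 qed simp
qed

lemma test_function_Lipschitz:
 fixes \<psi> :: "real => real"
 assumes "test_function \<Omega> \<psi>"
 obtains L where "0 <= L" "\<And>x y. \<bar>\<psi> y - \<psi> x\<bar> <= L * \<bar>y - x\<bar>"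
proof -
 obtain L where L: "0 <= L" "\<And>x. \<bar>deriv \<psi> x\<bar> <= L" by (rule test_function_bounded[OF test_function_deriv[OF assms]]) blast
 have "\<bar>\<psi> y - \<psi> x\<bar> <= L * \<bar>y - x\<bar>" for x y
  using field_differentiable_bound[of UNIV \<psi> "deriv \<psi>" L y x] test_function_has_deriv[OF assms] L by auto
 with L(1) show ?thesis by (rule that)
qed

lemma bounded_linear_characteristic: "bounded_linear (\<lambda>z::real \<times> real. fst z + \<sigma> * snd z)"
 by (intro bounded_linear_add bounded_linear_fst bounded_linear_mult_right[THEN bounded_linear_compose] bounded_linear_snd)

text \<open>On the support \<open>t = s - \<sigma> * x\<close> with \<open>s > s0\<close>, and
  \<open>s0\<close> dominates \<open>\<sigma> * x\<close>, so \<open>t\<close> is positive there.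
  The support is the image of a product of compact sets under the inverse shear.\<close>

lemma test_function_characteristic:
 assumes \<kappa>: "test_function {y1<..<y2} \<kappa>" and \<psi>: "test_function {s0<..} \<psi>"
  and y: "0 <= y1" "y2 <= 1" and s0: "\<And>x. y1 <= x ==> x <= y2 ==> \<sigma> * x <= s0"
 shows "test_function spacetime (\<lambda>z. \<kappa> (snd z) * \<psi> (fst z + \<sigma> * snd z))"
proof -
 obtain A where A: "compact A" "A \<subseteq> {y1<..<y2}" "\<And>z. z \<notin> A ==> \<kappa> z = 0" by (rule test_function_support[OF \<kappa>]) blast
 obtain B where B: "compact B" "B \<subseteq> {s0<..}" "\<And>z. z \<notin> B ==> \<psi> z = 0" by (rule test_function_support[OF \<psi>]) blast
 let ?S = "(\<lambda>z. (fst z - \<sigma> * snd z, snd z)) ` (B \<times> A)"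
 have "Ck k (\<lambda>z::real \<times> real. \<kappa> (snd z) * \<psi> (fst z + \<sigma> * snd z))" for k
  using Ck_mult[OF Ck_compose_affine[OF test_function_Ck[OF \<kappa>, of k] bounded_linear_snd[where ?'a=real], of 0]
   Ck_compose_affine[OF test_function_Ck[OF \<psi>, of k] bounded_linear_characteristic[of \<sigma>], of 0]] by simp
 moreover have "compact ?S" by (intro compact_continuous_image compact_Times A B continuous_intros)
 moreover have "?S \<subseteq> spacetime"
 proof
  fix z assume "z \<in> ?S"
  then obtain s x where "s \<in> B" "x \<in> A" "z = (s - \<sigma> * x, x)" by auto
  with A(2) B(2) s0[of x] y show "z \<in> spacetime" by (force simp: mem_spacetime)
 qed
 moreover have "\<kappa> (snd z) * \<psi> (fst z + \<sigma> * snd z) = 0" if "z \<notin> ?S" for z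
 proof -
  have "\<not> (fst z + \<sigma> * snd z \<in> B \<and> snd z \<in> A)"
  proof
   assume "fst z + \<sigma> * snd z \<in> B \<and> snd z \<in> A"
   then have "z \<in> ?S" by (intro image_eqI[of _ _ "(fst z + \<sigma> * snd z, snd z)"]) auto
   with that show False by simp
  qed
  then show ?thesis using A(3) B(3) by auto
 qed
 ultimately show ?thesis by (intro test_functionI[of _ ?S])
qed

lemma characteristic_has_derivative:
 fixes a b :: "real => real"
 assumes "\<And>x. (a has_real_derivative a' x) (at x)" "\<And>x. (b has_real_derivative b' x) (at x)"
 shows "((\<lambda>z::real \<times> real. a (snd z) * b (fst z + \<sigma> * snd z)) has_derivative
  (\<lambda>h. snd h * a' (snd z) * b (fst z + \<sigma> * snd z) + (fst h + \<sigma> * snd h) * a (snd z) * b' (fst z + \<sigma> * snd z))) (at z)"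
proof -
 have a: "(a has_derivative (\<lambda>h. h * a' x)) (at x)" and b: "(b has_derivative (\<lambda>h. h * b' x)) (at x)" for x
  by (rule has_derivative_eq_rhs[OF assms(1)[unfolded has_field_derivative_def]], simp add: fun_eq_iff mult.commute)
   (rule has_derivative_eq_rhs[OF assms(2)[unfolded has_field_derivative_def]], simp add: fun_eq_iff mult.commute)
 have "((\<lambda>z::real \<times> real. fst z + \<sigma> * snd z) has_derivative (\<lambda>h. fst h + \<sigma> * snd h)) (at z)"
  by (rule bounded_linear_imp_has_derivative[OF bounded_linear_characteristic])
 note bz = has_derivative_compose[OF this b]
 have "((\<lambda>z::real \<times> real. snd z) has_derivative (\<lambda>h. snd h)) (at z)"
  by (rule bounded_linear_imp_has_derivative[OF bounded_linear_snd])
 note az = has_derivative_compose[OF this a]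
 show ?thesis
  by (rule has_derivative_eq_rhs[OF has_derivative_mult[OF az bz]]) (auto simp: algebra_simps)
qed

text \<open>Since \<open>\<sigma>^2 = 1\<close>, the terms with two derivatives on \<psi> cancel.
  Only terms with a derivative on \<kappa> remain, which is why the identity obtained from the wave
  equation is a first-order one in \<open>x\<close>.\<close>

lemma wave_operator_characteristic:
 assumes \<kappa>: "test_function I \<kappa>" and \<psi>: "test_function J \<psi>" and \<sigma>: "\<sigma>^2 = 1"
 defines "\<phi> \<equiv> \<lambda>z::real \<times> real. \<kappa> (snd z) * \<psi> (fst z + \<sigma> * snd z)"
 shows "dir_deriv (1, 0) (dir_deriv (1, 0) \<phi>) z - dir_deriv (0, 1) (dir_deriv (0, 1) \<phi>) z =
  - (deriv (deriv \<kappa>) (snd z) * \<psi> (fst z + \<sigma> * snd z) + 2 * \<sigma> * deriv \<kappa> (snd z) * deriv \<psi> (fst z + \<sigma> * snd z))"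
proof -
 let ?\<chi> = "\<lambda>z::real \<times> real. fst z + \<sigma> * snd z"
 note k = test_function_has_deriv[OF \<kappa>] test_function_has_deriv[OF test_function_deriv[OF \<kappa>]]
 note s = test_function_has_deriv[OF \<psi>] test_function_has_deriv[OF test_function_deriv[OF \<psi>]]
 have t: "dir_deriv (1, 0) \<phi> = (\<lambda>z. \<kappa> (snd z) * deriv \<psi> (?\<chi> z))"
  unfolding \<phi>_def by (rule ext, subst dir_deriv_eqI[OF characteristic_has_derivative[OF k(1) s(1)]]) simp
 have tt: "dir_deriv (1, 0) (dir_deriv (1, 0) \<phi>) z = \<kappa> (snd z) * deriv (deriv \<psi>) (?\<chi> z)"
  unfolding t by (subst dir_deriv_eqI[OF characteristic_has_derivative[OF k(1) s(2)]]) simp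
 have x: "dir_deriv (0, 1) \<phi> = (\<lambda>z. deriv \<kappa> (snd z) * \<psi> (?\<chi> z) + \<sigma> * (\<kappa> (snd z) * deriv \<psi> (?\<chi> z)))"
  unfolding \<phi>_def by (rule ext, subst dir_deriv_eqI[OF characteristic_has_derivative[OF k(1) s(1)]]) simp
 have "dir_deriv (0, 1) (dir_deriv (0, 1) \<phi>) z =
   deriv (deriv \<kappa>) (snd z) * \<psi> (?\<chi> z) + \<sigma> * deriv \<kappa> (snd z) * deriv \<psi> (?\<chi> z) +
   \<sigma> * (deriv \<kappa> (snd z) * deriv \<psi> (?\<chi> z) + \<sigma> * \<kappa> (snd z) * deriv (deriv \<psi>) (?\<chi> z))"
  unfolding x
  by (subst dir_deriv_eqI[OF has_derivative_add[OF characteristic_has_derivative[OF k(2) s(1)]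
    has_derivative_mult_right[OF characteristic_has_derivative[OF k(1) s(2)]]]]) simp
 moreover have "\<sigma> * (\<sigma> * c) = c" for c using \<sigma> by (simp add: power2_eq_square flip: mult.assoc)
 ultimately show ?thesis unfolding tt by (simp add: algebra_simps)
qed

lemma integrable_test_mult:
 fixes \<psi> :: "real => real"
 assumes "integrable lborel f" "test_function \<Omega> \<psi>"
 shows "integrable lborel (\<lambda>x. f x * \<psi> (x + c))"
proof -
 obtain B where "\<And>x. \<bar>\<psi> x\<bar> <= B" by (rule test_function_bounded[OF assms(2)]) blast
 moreover note [measurable] = test_function_continuous(2)[OF assms(2)]
 ultimately show ?thesis using assms(1) by (intro integrable_bounded_mult) auto
qed

section \<open>The wave equation in weak form along one family\<close>

locale damped_wave_traces = wave_borel p u ut ux Ut Ux v0 vx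
 for p u ut ux Ut Ux v0 vx +
 fixes q k :: "real => real" and K :: real
 assumes equation: "damped_wave_eq q u ut"
  and k_meas[measurable]: "borel_fun k" and k_bound: "\<And>x. \<bar>k x\<bar> <= K"
  and q_eq: "AEL x. 0 < x --> x < 1 --> q x = 2 * k x"
begin

definition ub :: "real => real => real" where
 "ub t x = (if 0 < t \<and> 0 < x \<and> x < 1 then u t x else 0)"

lemma ub_meas_pair: "joint_borel ub"
proof -
 have "continuous_on spacetime (\<lambda>z. u (fst z) (snd z))"
  by (rule continuous_on_subset[OF u_continuous]) (auto simp: spacetime_def)
 then have "(\<lambda>z. ind spacetime z *\<^sub>R u (fst z) (snd z)) \<in> borel_measurable borel"
  using spacetime_borel by (rule borel_measurable_continuous_on_indicator[rotated])
 also have "(\<lambda>z. ind spacetime z *\<^sub>R u (fst z) (snd z)) = (\<lambda>z. ub (fst z) (snd z))"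
  by (auto simp: fun_eq_iff ub_def indicator_def mem_spacetime)
 finally show ?thesis by (simp add: borel_prod)
qed

lemmas ub_measurable[measurable (raw)] = measurable_curried2[OF ub_meas_pair]

lemma ub_bounded: obtains B where "\<And>t x. t <= T ==> \<bar>ub t x\<bar> <= B" "0 <= B"
proof -
 have "compact ((\<lambda>z. u (fst z) (snd z)) ` ({0..T} \<times> {0..1}))"
  by (intro compact_continuous_image compact_Times compact_Icc continuous_on_subset[OF u_continuous]) auto
 then obtain B where B: "\<And>t x. 0 <= t ==> t <= T ==> 0 <= x ==> x <= 1 ==> \<bar>u t x\<bar> <= B"
  by (force dest!: compact_imp_bounded simp: bounded_iff)
 show ?thesis
 proof (rule that[of "max 0 B"])
  fix t x assume "t <= T"
  then show "\<bar>ub t x\<bar> <= max 0 B" using B[of t x] by (auto simp: ub_def)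
 qed simp
qed

text \<open>For \<open>x\<close> in the unit interval the argument \<open>t + \<sigma> * x\<close>
  is at least \<open>t - 1\<close>, so the integrand vanishes for times after \<open>T0 + 1\<close>
  and is bounded on a bounded rectangle.\<close>

lemma ub_integrable:
 fixes c \<theta> :: "real => real"
 assumes c: "test_function I c" and \<theta>: "test_function J \<theta>" and late: "\<And>s. T0 <= s ==> \<theta> s = 0" and \<sigma>: "\<bar>\<sigma>\<bar> = 1"
 shows "integrable lborel2 (\<lambda>z. ub (fst z) (snd z) * (c (snd z) * \<theta> (fst z + \<sigma> * snd z)))"
proof -
 obtain Bc where Bc: "0 <= Bc" "\<And>x. \<bar>c x\<bar> <= Bc" by (rule test_function_bounded[OF c]) blast
 obtain B\<theta> where B\<theta>: "0 <= B\<theta>" "\<And>x. \<bar>\<theta> x\<bar> <= B\<theta>" by (rule test_function_bounded[OF \<theta>]) blast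
 obtain B where B: "\<And>t x. t <= T0 + 1 ==> \<bar>ub t x\<bar> <= B" "0 <= B" by (rule ub_bounded[of "T0 + 1"]) blast
 note [measurable] = test_function_continuous(2)[OF c] test_function_continuous(2)[OF \<theta>]
 show ?thesis
 proof (rule integrable_bound)
 have box: "{0..T0+1} \<times> {0..1} \<in> sets (lborel2 :: (real \<times> real) measure)" by (intro pair_measureI) auto
 have "emeasure lborel2 ({0..T0+1} \<times> {0..1::real}) < \<infinity>"
  by (subst lborel.emeasure_pair_measure_Times) (cases "0 <= T0 + 1"; auto simp: ennreal_mult_less_top)+
 with box have "integrable lborel2 (indicat_real ({0..T0+1} \<times> {0..1::real}))"
  by (rule integrable_real_indicator)
 then show "integrable lborel2 (\<lambda>z. B * (Bc * B\<theta>) * ind ({0..T0+1} \<times> {0..1::real}) z)"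
  by simp
 show "AE z in lborel2. norm (ub (fst z) (snd z) * (c (snd z) * \<theta> (fst z + \<sigma> * snd z))) <=
   norm (B * (Bc * B\<theta>) * ind ({0..T0+1} \<times> {0..1::real}) z)"
 proof (rule AE_I2)
  fix z :: "real \<times> real"
  show "norm (ub (fst z) (snd z) * (c (snd z) * \<theta> (fst z + \<sigma> * snd z))) <= norm (B * (Bc * B\<theta>) * ind ({0..T0+1} \<times> {0..1::real}) z)"
  proof (cases "0 < fst z \<and> fst z <= T0 + 1 \<and> 0 < snd z \<and> snd z < 1")
   case True
   have "\<bar>ub (fst z) (snd z)\<bar> * (\<bar>c (snd z)\<bar> * \<bar>\<theta> (fst z + \<sigma> * snd z)\<bar>) <= B * (Bc * B\<theta>)"
    using True Bc B\<theta> B by (intro mult_mono mult_nonneg_nonneg) auto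
   then show ?thesis using True Bc B\<theta> B(2) by (cases z) (auto simp: abs_mult)
  next
   case False
   have "ub (fst z) (snd z) * \<theta> (fst z + \<sigma> * snd z) = 0"
   proof (cases "0 < fst z \<and> 0 < snd z \<and> snd z < 1")
    case True
    with False have "T0 + 1 < fst z" by simp
    moreover have "- 1 <= \<sigma> * snd z" using \<sigma> True by (cases "0 <= \<sigma>") auto
    ultimately show ?thesis by (simp add: late)
   qed (auto simp: ub_def)
   then show ?thesis by auto
  qed
 qed
 qed measurable
qed

text \<open>At a fixed time the whole product \<open>\<kappa> x * \<psi> (t + \<sigma> * x)\<close>
  is a test function in \<open>x\<close>, and its derivative contains both terms on the
  left.\<close>

lemma slice_weak_deriv:
 assumes t: "0 < t" and ae: "AEL x. 0 < t --> 0 < x --> x < 1 --> ux t x = vx t x"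
  and \<kappa>: "test_function {y1<..<y2} \<kappa>" and y: "0 <= y1" "y2 <= 1" and \<psi>: "test_function J \<psi>"
 shows "(LBINT x. ub t x * (deriv \<kappa> x * \<psi> (t + \<sigma> * x) + \<sigma> * \<kappa> x * deriv \<psi> (t + \<sigma> * x))) =
  - (LBINT x. vx t x * (\<kappa> x * \<psi> (t + \<sigma> * x)))"
proof -
 let ?\<chi> = "\<lambda>x. \<kappa> x * \<psi> (t + \<sigma> * x)"
 let ?\<chi>' = "\<lambda>x. deriv \<kappa> x * \<psi> (t + \<sigma> * x) + \<sigma> * \<kappa> x * deriv \<psi> (t + \<sigma> * x)"
 note [measurable] = test_function_continuous(2)[OF \<kappa>] test_function_continuous(2)[OF \<psi>]
  test_function_continuous(2)[OF test_function_deriv[OF \<kappa>]] test_function_continuous(2)[OF test_function_deriv[OF \<psi>]]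
 obtain A where A: "compact A" "A \<subseteq> {y1<..<y2}" "\<And>z. z \<notin> A ==> \<kappa> z = 0" by (rule test_function_support[OF \<kappa>]) blast
 have "Ck n ?\<chi>" for n
  using Ck_mult[OF test_function_Ck[OF \<kappa>, of n] Ck_compose_affine[OF test_function_Ck[OF \<psi>, of n] bounded_linear_mult_right[of \<sigma>], of t]]
  by (simp add: add.commute)
 then have test: "test_function {0<..<1} ?\<chi>" using A y by (intro test_functionI[of _ A]) auto
 have "(?\<chi> has_real_derivative ?\<chi>' x) (at x)" for x
  by (auto intro!: derivative_eq_intros DERIV_compose_FDERIV test_function_has_deriv[OF \<kappa>]
    DERIV_chain2[OF test_function_has_deriv[OF \<psi>]] simp: algebra_simps)
 then have d: "deriv ?\<chi> = ?\<chi>'" by (auto intro: DERIV_imp_deriv)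
 have "(LBINT x. ub t x * ?\<chi>' x) = (LBINT x. ind {0<..<1} x * (ub t x * ?\<chi>' x))"
  by (intro integral_cong) (auto simp: indicator_def ub_def)
 also have "... = (LINT x|lebesgue_on {0<..<1}. u t x * ?\<chi>' x)"
 proof (rule lebesgue_on_integral_borel_AE[symmetric])
  show "(\<lambda>x. ub t x * ?\<chi>' x) \<in> borel_measurable borel" by measurable
 qed (use t in \<open>auto simp: ub_def\<close>)
 also have "... = - (LINT x|lebesgue_on {0<..<1}. ux t x * ?\<chi> x)"
 proof -
  have "(LINT x|lebesgue_on {0<..<1}. u t x * deriv ?\<chi> x) = - (LINT x|lebesgue_on {0<..<1}. ux t x * ?\<chi> x)"
   using u_W1p(2)[of t] t test by (auto simp: has_weak_deriv_def)
  then show ?thesis unfolding d .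
 qed
 also have "... = - (LBINT x. vx t x * ?\<chi> x)"
  by (subst x.slice_integral[OF ae t]) auto
 finally show ?thesis .
qed

text \<open>Integration by parts in time at a fixed interior abscissa, where \<open>u_time\<close>
  makes \<open>u\<close> a primitive of \<open>v0\<close>. The boundary terms vanish because
  \<open>\<psi> c = 0\<close> at time 0 and \<psi> vanishes after the time \<open>T\<close>.\<close>

lemma trace_weak_deriv:
 assumes ae: "AEL t. 0 < t --> 0 < x --> x < 1 --> Ut x t = v0 t x" and x: "0 < x" "x < 1"
  and int: "integrable lborel (\<lambda>t. ind {..T} t * v0 t x)" and T: "0 <= T"
  and \<psi>: "test_function J \<psi>" and \<psi>0: "\<psi> c = 0" and late: "\<And>t. T <= t ==> \<psi> (t + c) = 0" "\<And>t. T <= t ==> deriv \<psi> (t + c) = 0"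
 shows "(LBINT t. ub t x * deriv \<psi> (t + c)) = - (LBINT t. ind {..T} t * v0 t x * \<psi> (t + c))"
proof -
 define A where "A y = u 0 x + (LBINT s. ind {0<..<y} s * (ind {..T} s * v0 s x))" for y
 note \<psi>' = test_function_deriv[OF \<psi>]
 note [measurable] = test_function_continuous(2)[OF \<psi>] test_function_continuous(2)[OF \<psi>']
 obtain B where B: "\<And>x. \<bar>deriv \<psi> x\<bar> <= B" by (rule test_function_bounded[OF \<psi>']) blast
 have H: "integrable lborel (\<lambda>t. ind {0..T} t * deriv \<psi> (t + c))"
  by (rule integrable_bounded_mult[of _ _ _ B]) (use B T in auto)
 have A_eq: "A y = u y x" if "0 <= y" "y <= T" for y
 proof -
  have "u y x - u 0 x = (LINT t|lebesgue_on {0<..<y}. Ut x t * 1)" using u_time[of 0 y x] that x by simp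
  also have "... = (LBINT t. ind {0<..<y} t * (v0 t x * 1))"
   by (rule t.trace_integral[OF ae]) (use x in auto)
  also have "... = (LBINT s. ind {0<..<y} s * (ind {..T} s * v0 s x))"
   using that by (intro integral_cong) (auto simp: indicator_def)
  finally show ?thesis by (simp add: A_def)
 qed
 have prim: "\<psi> (y + c) = \<psi> c + (LBINT s. ind {0<..<y} s * (ind {0..T} s * deriv \<psi> (s + c)))" if "0 <= y" "y <= T" for y
 proof -
  have cont: "continuous_on {0..y} (\<lambda>s. deriv \<psi> (s + c))"
   by (intro continuous_on_compose2[OF test_function_continuous(1)[OF \<psi>', of UNIV]] continuous_intros) auto
  have "((\<lambda>s. deriv \<psi> (s + c)) has_integral \<psi> (y + c) - \<psi> (0 + c)) {0..y}"
   by (rule fundamental_theorem_of_calculus[OF that(1)])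
    (auto intro!: DERIV_subset[OF DERIV_chain2[OF test_function_has_deriv[OF \<psi>], of _ 1, simplified]] derivative_eq_intros
      simp flip: has_real_derivative_iff_has_vector_derivative)
  then have "\<psi> (y + c) - \<psi> c = (LINT s|lebesgue_on {0<..<y}. deriv \<psi> (s + c))"
   unfolding lebesgue_on_continuous_eq_integral[OF cont] by (simp add: integral_unique)
  also have "... = (LBINT s. ind {0<..<y} s * (ind {0..T} s * deriv \<psi> (s + c)))"
   by (rule lebesgue_on_integral_borel_AE) (use that in auto)
  finally show ?thesis by simp
 qed
 define \<Psi> where "\<Psi> y = \<psi> c + (LBINT s. ind {0<..<y} s * (ind {0..T} s * deriv \<psi> (s + c)))" for y
 have \<Psi>: "\<Psi> y = \<psi> (y + c)" if "0 <= y" "y <= T" for y using prim[OF that] by (simp add: \<Psi>_def)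
 have e: "\<Psi> 0 = 0" "\<Psi> T = 0" using \<psi>0 late(1)[of T] T \<Psi>[of 0] \<Psi>[of T] by auto
 note pp = primitive_product[OF int H A_def \<Psi>_def order_refl T]
 have i1: "integrable lborel (\<lambda>s. ind {..T} s * v0 s x * \<psi> (s + c))" by (rule integrable_test_mult[OF int \<psi>])
 have "(LBINT s. ind {0<..<T} s * (ind {..T} s * v0 s x * \<Psi> s + ind {0..T} s * deriv \<psi> (s + c) * A s)) =
   (LBINT s. ind {..T} s * v0 s x * \<psi> (s + c) + ub s x * deriv \<psi> (s + c))"
  using x t.w_supp[of _ x] late by (intro integral_cong) (auto simp: indicator_def ub_def A_eq \<Psi>)
 moreover have i2: "integrable lborel (\<lambda>s. ind {..T} s * v0 s x * \<psi> (s + c) + ub s x * deriv \<psi> (s + c))"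
  by (rule integrable_cong[THEN iffD1, OF refl _ pp(2)])
   (use x t.w_supp[of _ x] late in \<open>auto simp: indicator_def ub_def A_eq \<Psi>\<close>)
 ultimately have "(LBINT s. ind {..T} s * v0 s x * \<psi> (s + c) + ub s x * deriv \<psi> (s + c)) = 0"
  using pp(1) e by simp
 moreover have "integrable lborel (\<lambda>s. ub s x * deriv \<psi> (s + c))"
  using integrable_diff[OF i2 i1] by simp
 ultimately show ?thesis using i1 by simp
qed

end

lemma AE_integrable_slices:
 fixes f :: "real => real => real"
 assumes "integrable lborel2 (\<lambda>z. f (fst z) (snd z))"
 shows "AEL x. integrable lborel (\<lambda>t. f t x)" "integrable lborel (\<lambda>x. LBINT t. f t x)"
  "integrable lborel (\<lambda>t. LBINT x. f t x)"
  "(LINT z|lborel2. f (fst z) (snd z)) = (LBINT t. LBINT x. f t x)"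
  "(LINT z|lborel2. f (fst z) (snd z)) = (LBINT x. LBINT t. f t x)"
 using assms lborel_pair.AE_integrable_snd[of f] lborel_pair.integrable_snd[of f] lborel_pair.integrable_fst[of f]
  lborel_pair.integral_fst[of f] lborel_pair.integral_snd[of f]
 by (auto simp: split_beta' lborel_pair.integral_fst')

context damped_wave_traces
begin

text \<open>Testing with \<open>\<kappa>(x) \<psi>(t + \<sigma> x)\<close> turns the wave equation into a transport equation along one family of characteristics.\<close>

lemma characteristic_weak_deriv:
 assumes \<kappa>: "test_function {y1<..<y2} \<kappa>" and \<psi>: "test_function {s0<..} \<psi>"
  and y: "0 <= y1" "y2 <= 1" and s0: "\<And>x. y1 <= x ==> x <= y2 ==> \<sigma> * x <= s0" and \<sigma>: "\<sigma> = 1 \<or> \<sigma> = -1"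
  and late: "\<And>s. T <= s + 1 ==> \<psi> s = 0" "\<And>s. T <= s + 1 ==> deriv \<psi> s = 0" and T: "0 <= T"
 shows "(LBINT x. deriv \<kappa> x * (LBINT t. ind {..T} t * (vx t x + \<sigma> * v0 t x) * \<psi> (t + \<sigma> * x))) =
  - (LBINT x. \<kappa> x * (LBINT t. ind {..T} t * v0 t x * (2 * k x * \<psi> (t + \<sigma> * x))))"
proof -
 note \<kappa>1 = test_function_deriv[OF \<kappa>]
 note \<kappa>2 = test_function_deriv[OF \<kappa>1]
 note \<psi>1 = test_function_deriv[OF \<psi>]
 note meas = test_function_continuous(2)[OF \<kappa>] test_function_continuous(2)[OF \<kappa>1] test_function_continuous(2)[OF \<kappa>2]
  test_function_continuous(2)[OF \<psi>] test_function_continuous(2)[OF \<psi>1]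
 note [measurable] = meas
 have a\<sigma>: "\<bar>\<sigma>\<bar> = 1" and \<sigma>2: "\<sigma>^2 = 1" using \<sigma> by auto
 have l0: "\<And>s. T - 1 <= s ==> \<psi> s = 0" "\<And>s. T - 1 <= s ==> deriv \<psi> s = 0" using late by auto
 have late': "\<psi> (t + \<sigma> * x) = 0" "deriv \<psi> (t + \<sigma> * x) = 0" if "T <= t" "0 < x" "x < 1" for t x
  using that \<sigma> by (auto intro!: late)
 have \<kappa>0: "\<kappa> x = 0" "deriv \<kappa> x = 0" if "\<not> (y1 < x \<and> x < y2)" for x
  using that test_function_zero[OF \<kappa>, of x] test_function_zero[OF \<kappa>1, of x] by auto
 \<comment> \<open>The wave operator produces
   \<open>\<kappa>'' \<psi> + 2 \<sigma> \<kappa>' \<psi>'\<close>. In \<open>A\<close> the bracket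
   is the complete \<open>x\<close>-derivative of \<open>\<kappa>' \<psi>\<close>, so integration by
   parts in space brings in u_x. The remaining \<open>B\<close> has the \<open>t\<close>-derivative
   of \<psi>, so integration by parts in time brings in u_t.\<close>
 define A where "A t x = ub t x * (deriv (deriv \<kappa>) x * \<psi> (t + \<sigma> * x) + \<sigma> * deriv \<kappa> x * deriv \<psi> (t + \<sigma> * x))" for t x
 define B where "B t x = ub t x * (\<sigma> * deriv \<kappa> x * deriv \<psi> (t + \<sigma> * x))" for t x
 have i1: "integrable lborel2 (\<lambda>z. ub (fst z) (snd z) * (deriv (deriv \<kappa>) (snd z) * \<psi> (fst z + \<sigma> * snd z)))"
  by (rule ub_integrable[OF \<kappa>2 \<psi> _ a\<sigma>]) (rule l0(1))
 have i2: "integrable lborel2 (\<lambda>z. ub (fst z) (snd z) * (deriv \<kappa> (snd z) * deriv \<psi> (fst z + \<sigma> * snd z)))"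
  by (rule ub_integrable[OF \<kappa>1 \<psi>1 _ a\<sigma>]) (rule l0(2))
 have iB: "integrable lborel2 (\<lambda>z. B (fst z) (snd z))"
  using integrable_mult_right[OF i2, of \<sigma>] by (simp add: B_def mult_ac)
 have iA: "integrable lborel2 (\<lambda>z. A (fst z) (snd z))"
  using integrable_add[OF i1 iB] by (simp add: A_def B_def algebra_simps)
 obtain B1 where B1: "0 <= B1" "\<And>x. \<bar>\<kappa> x\<bar> <= B1" by (rule test_function_bounded[OF \<kappa>]) blast
 obtain B2 where B2: "0 <= B2" "\<And>x. \<bar>deriv \<kappa> x\<bar> <= B2" by (rule test_function_bounded[OF \<kappa>1]) blast
 obtain B3 where B3: "0 <= B3" "\<And>x. \<bar>\<psi> x\<bar> <= B3" by (rule test_function_bounded[OF \<psi>]) blast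
 have b1: "\<bar>deriv \<kappa> x * \<psi> s\<bar> <= B2 * B3" for x s using mult_mono[OF B2(2) B3(2) B2(1)] by (simp add: abs_mult)
 have b2: "\<bar>\<kappa> x * (2 * k x * \<psi> s)\<bar> <= B1 * (2 * K * B3)" for x s
  using mult_mono[OF B1(2)[of x] mult_mono[OF k_bound[of x] B3(2)[of s]] B1(1)] order_trans[OF abs_ge_zero k_bound[of x]] B3(1)
  by (simp add: abs_mult mult_ac)
 define Px where "Px t x = ind {..T} t * vx t x * (deriv \<kappa> x * \<psi> (t + \<sigma> * x))" for t x
 define P0 where "P0 t x = ind {..T} t * v0 t x * (deriv \<kappa> x * \<psi> (t + \<sigma> * x))" for t x
 define N where "N t x = ind {..T} t * v0 t x * (\<kappa> x * (2 * k x * \<psi> (t + \<sigma> * x)))" for t x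
 have iPx: "integrable lborel2 (\<lambda>z. Px (fst z) (snd z))"
  unfolding Px_def by (rule x.strip_integrable_mult[OF _ b1]) measurable
 have iP0: "integrable lborel2 (\<lambda>z. P0 (fst z) (snd z))"
  unfolding P0_def by (rule t.strip_integrable_mult[OF _ b1]) measurable
 have iN: "integrable lborel2 (\<lambda>z. N (fst z) (snd z))"
  unfolding N_def by (rule t.strip_integrable_mult[OF _ b2]) measurable
 have "(LINT z|lborel2. A (fst z) (snd z)) = (LBINT t. LBINT x. A t x)" by (rule AE_integrable_slices(4)[OF iA])
 also have "... = (LBINT t. - (LBINT x. Px t x))"
 proof (rule integral_cong_AE)
  show "AEL t. (LBINT x. A t x) = - (LBINT x. Px t x)"
   using x.f_AE
  proof eventually_elim
   case (elim t)
   show ?case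
   proof (cases "0 < t")
    case True
    have "(LBINT x. A t x) = - (LBINT x. vx t x * (deriv \<kappa> x * \<psi> (t + \<sigma> * x)))"
     unfolding A_def by (rule slice_weak_deriv[OF True elim \<kappa>1 y \<psi>])
    also have "(\<lambda>x. vx t x * (deriv \<kappa> x * \<psi> (t + \<sigma> * x))) = (\<lambda>x. Px t x)"
    proof (rule ext)
     fix x show "vx t x * (deriv \<kappa> x * \<psi> (t + \<sigma> * x)) = Px t x"
     using x.w_supp[of t x] late'(1)[of t x] by (cases "0 < x \<and> x < 1") (auto simp: Px_def indicator_def)
    qed
    finally show ?thesis .
   next
    case False
    then show ?thesis using x.w_supp[of t] by (simp add: A_def Px_def ub_def)
   qed
  qed
 qed (use AE_integrable_slices(3)[OF iA] AE_integrable_slices(3)[OF iPx] in auto)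
 also have "... = - (LBINT x. LBINT t. Px t x)"
  using AE_integrable_slices(4,5)[OF iPx] by simp
 finally have A: "(LINT z|lborel2. A (fst z) (snd z)) = - (LBINT x. LBINT t. Px t x)" .
 have "(LINT z|lborel2. B (fst z) (snd z)) = (LBINT x. LBINT t. B t x)" by (rule AE_integrable_slices(5)[OF iB])
 also have "... = (LBINT x. - \<sigma> * (LBINT t. P0 t x))"
 proof (rule integral_cong_AE)
  show "AEL x. (LBINT t. B t x) = - \<sigma> * (LBINT t. P0 t x)"
   using t.G_AE AE_integrable_slices(1)[OF t.strip_integrable[of T]]
  proof eventually_elim
   case (elim x)
   show ?case
   proof (cases "y1 < x \<and> x < y2")
    case True
    have x: "0 < x" "x < 1" using True y by auto
    \<comment> \<open>The boundary term at time 0: the argument does not exceed \<open>s0\<close>,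
      where the support of \<psi> begins.\<close>
    have "\<psi> (\<sigma> * x) = 0" by (rule test_function_zero[OF \<psi>]) (use s0[of x] True in auto)
    then have "(LBINT t. ub t x * deriv \<psi> (t + \<sigma> * x)) = - (LBINT t. ind {..T} t * v0 t x * \<psi> (t + \<sigma> * x))"
     using x late' T by (intro trace_weak_deriv[OF elim(1) x elim(2) T \<psi>]) auto
    moreover have "(LBINT t. B t x) = (LBINT t. (\<sigma> * deriv \<kappa> x) * (ub t x * deriv \<psi> (t + \<sigma> * x)))"
     unfolding B_def by (intro integral_cong) auto
    moreover have "(LBINT t. P0 t x) = (LBINT t. deriv \<kappa> x * (ind {..T} t * v0 t x * \<psi> (t + \<sigma> * x)))"
     unfolding P0_def by (intro integral_cong) auto
    ultimately show ?thesis by simp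
   next
    case False
    then show ?thesis by (simp add: B_def P0_def \<kappa>0)
   qed
  qed
 qed (use AE_integrable_slices(2)[OF iB] AE_integrable_slices(2)[OF iP0] in auto)
 also have "... = - \<sigma> * (LBINT x. LBINT t. P0 t x)" by simp
 finally have B: "(LINT z|lborel2. B (fst z) (snd z)) = - \<sigma> * (LBINT x. LBINT t. P0 t x)" .
 let ?\<phi> = "\<lambda>z::real \<times> real. \<kappa> (snd z) * \<psi> (fst z + \<sigma> * snd z)"
 have test: "test_function spacetime ?\<phi>" by (rule test_function_characteristic[OF \<kappa> \<psi> y s0])
 have AB: "(LINT z|lebesgue_on spacetime. u (fst z) (snd z) * (dir_deriv (1, 0) (dir_deriv (1, 0) ?\<phi>) z - dir_deriv (0, 1) (dir_deriv (0, 1) ?\<phi>) z)) =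
   (LBINT z. ind spacetime z * - (A (fst z) (snd z) + B (fst z) (snd z)))"
 proof (rule lebesgue_on_integral_borel_AE[OF spacetime_borel])
  show "(\<lambda>z. - (A (fst z) (snd z) + B (fst z) (snd z))) \<in> borel_measurable borel"
   using borel_measurable_integrable[OF iA] borel_measurable_integrable[OF iB] by (simp add: lborel_prod)
  show "AEL z. z \<in> spacetime --> u (fst z) (snd z) * (dir_deriv (1, 0) (dir_deriv (1, 0) ?\<phi>) z - dir_deriv (0, 1) (dir_deriv (0, 1) ?\<phi>) z) =
    - (A (fst z) (snd z) + B (fst z) (snd z))"
   unfolding wave_operator_characteristic[OF \<kappa> \<psi> \<sigma>2]
   by (intro AE_I2) (auto simp: mem_spacetime A_def B_def ub_def algebra_simps)
 qed
 \<comment> \<open>An exceptional null set of abscissas becomes a null set of the plane by taking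
   its product with the whole time axis.\<close>
 have qAE: "AEL z. z \<in> spacetime --> q (snd z) = 2 * k (snd z)"
 proof -
  obtain M where M: "M \<in> null_sets lborel" "{x. \<not> (0 < x --> x < 1 --> q x = 2 * k x)} \<subseteq> M" using q_eq by (auto elim!: AE_E3 simp: eventually_ae_filter)
  have "UNIV \<times> M \<in> null_sets (lborel2 :: (real \<times> real) measure)"
   using M(1) by (auto intro!: null_setsI simp: lborel.emeasure_pair_measure_Times null_sets_def)
  then have "AE z in lborel2. z \<notin> (UNIV::real set) \<times> M" by (rule AE_not_in)
  then have "AE z in lborel2. z \<in> spacetime --> q (snd z) = 2 * k (snd z)"
   by eventually_elim (use M(2) in \<open>auto simp: mem_spacetime\<close>)
  then show ?thesis unfolding lborel_prod .
 qed
 have NN: "(LINT z|lebesgue_on spacetime. - q (snd z) * ut (fst z) (snd z) * ?\<phi> z) = (LBINT z. ind spacetime z * - N (fst z) (snd z))"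
 proof (rule lebesgue_on_integral_borel_AE[OF spacetime_borel])
  show "(\<lambda>z. - N (fst z) (snd z)) \<in> borel_measurable borel"
   using borel_measurable_integrable[OF iN] by (simp add: lborel_prod)
  show "AEL z. z \<in> spacetime --> - q (snd z) * ut (fst z) (snd z) * ?\<phi> z = - N (fst z) (snd z)"
   using qAE t.w_AE by eventually_elim (auto simp: N_def mem_spacetime indicator_def late')
 qed
 have ind: "ind spacetime z * - (A (fst z) (snd z) + B (fst z) (snd z)) = - (A (fst z) (snd z) + B (fst z) (snd z))"
  "ind spacetime z * - N (fst z) (snd z) = - N (fst z) (snd z)" for z
  using t.w_supp[of "fst z" "snd z"] by (auto simp: indicator_def mem_spacetime A_def B_def ub_def N_def)
 have "(LINT z|lebesgue_on spacetime. u (fst z) (snd z) * (dir_deriv (1, 0) (dir_deriv (1, 0) ?\<phi>) z - dir_deriv (0, 1) (dir_deriv (0, 1) ?\<phi>) z)) =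
   (LINT z|lebesgue_on spacetime. - q (snd z) * ut (fst z) (snd z) * ?\<phi> z)"
  using equation test by (simp add: damped_wave_eq_def)
 then have "(LINT z|lborel2. A (fst z) (snd z) + B (fst z) (snd z)) = (LINT z|lborel2. N (fst z) (snd z))"
  unfolding AB NN ind lborel_prod by (simp only: integral_minus neg_equal_iff_equal)
 then have main: "(LBINT x. LBINT t. Px t x) + \<sigma> * (LBINT x. LBINT t. P0 t x) = - (LBINT x. LBINT t. N t x)"
  using iA iB A B AE_integrable_slices(5)[OF iN] by simp
 have "(LBINT x. deriv \<kappa> x * (LBINT t. ind {..T} t * (vx t x + \<sigma> * v0 t x) * \<psi> (t + \<sigma> * x))) =
   (LBINT x. (LBINT t. Px t x) + \<sigma> * (LBINT t. P0 t x))"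
 proof (rule integral_cong_AE)
  have "AEL x. (LBINT t. Px t x + \<sigma> * P0 t x) = (LBINT t. Px t x) + \<sigma> * (LBINT t. P0 t x)"
   using AE_integrable_slices(1)[OF iPx] AE_integrable_slices(1)[OF iP0] by eventually_elim simp
  moreover have "deriv \<kappa> x * (LBINT t. ind {..T} t * (vx t x + \<sigma> * v0 t x) * \<psi> (t + \<sigma> * x)) = (LBINT t. Px t x + \<sigma> * P0 t x)" for x
   unfolding Px_def P0_def by (subst integral_mult_right_zero[symmetric]) (auto intro!: integral_cong simp: algebra_simps)
  ultimately show "AEL x. deriv \<kappa> x * (LBINT t. ind {..T} t * (vx t x + \<sigma> * v0 t x) * \<psi> (t + \<sigma> * x)) =
    (LBINT t. Px t x) + \<sigma> * (LBINT t. P0 t x)" by simp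
  show "(\<lambda>x. (LBINT t. Px t x) + \<sigma> * (LBINT t. P0 t x)) \<in> borel_measurable lborel"
   using AE_integrable_slices(2)[OF iPx] AE_integrable_slices(2)[OF iP0] by auto
 qed measurable
 also have "... = (LBINT x. LBINT t. Px t x) + \<sigma> * (LBINT x. LBINT t. P0 t x)"
  using AE_integrable_slices(2)[OF iPx] AE_integrable_slices(2)[OF iP0] by simp
 also have "... = - (LBINT x. LBINT t. N t x)" by (rule main)
 also have "(\<lambda>x. LBINT t. N t x) = (\<lambda>x. \<kappa> x * (LBINT t. ind {..T} t * v0 t x * (2 * k x * \<psi> (t + \<sigma> * x))))"
  unfolding N_def by (rule ext, subst integral_mult_right_zero[symmetric]) (auto intro!: integral_cong simp: algebra_simps)
 finally show ?thesis .
qed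

end

section \<open>Borel versions of the traces at fixed abscissas\<close>

context sideways_borel
begin

lemma trace_representative:
 assumes x: "0 <= x" "x <= 1"
 shows "\<exists>G'. G' \<in> borel_measurable borel \<and> (\<forall>t\<le>0. G' t = 0) \<and> (AEL t. 0 < t --> G x t = G' t)"
proof -
 have "\<exists>g. g \<in> borel_measurable borel \<and> (AEL t. t \<in> {0<..<real (Suc n)} --> G x t = g t)" for n
 proof -
  have "G x \<in> borel_measurable (lebesgue_on {0<..<real (Suc n)})" using trace_Lp[OF _ x, of "real (Suc n)"] by (simp add: Lp_def)
  then obtain g where "borel_fun g" "AEL t. t \<in> {0<..<real (Suc n)} --> G x t = g t"
   by (rule lebesgue_on_borel_representative) auto
  then show ?thesis by blast
 qed
 then obtain g where g[measurable]: "\<And>n. g n \<in> borel_measurable borel"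
  and ae: "\<And>n. AEL t. t \<in> {0<..<real (Suc n)} --> G x t = g n t" by metis
 let ?G = "\<lambda>t. if 0 < t then g (nat \<lceil>t\<rceil>) t else 0"
 have [measurable]: "(\<lambda>t. g (nat \<lceil>t\<rceil>) t) \<in> borel_measurable borel"
  by (rule measurable_compose_countable[where f = g]) measurable
 have "?G \<in> borel_measurable borel" by measurable
 moreover have "AEL t. \<forall>n. t \<in> {0<..<real (Suc n)} --> G x t = g n t" using ae by (simp add: AE_all_countable)
 then have "AEL t. 0 < t --> G x t = ?G t"
 proof eventually_elim
  case (elim t)
  have "t < real (Suc (nat \<lceil>t\<rceil>))" by linarith
  with elim show ?case by auto
 qed
 ultimately show ?thesis by (intro exI[of _ ?G]) auto
qed

definition trace :: "real => real => real" where
 "trace x = (SOME G'. G' \<in> borel_measurable borel \<and> (\<forall>t\<le>0. G' t = 0) \<and> (AEL t. 0 < t --> G x t = G' t))"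

context
 fixes x :: real
 assumes x: "0 <= x" "x <= 1"
begin

lemma trace_props:
 shows trace_meas[measurable]: "trace x \<in> borel_measurable borel" and trace_zero: "t <= 0 ==> trace x t = 0"
  and trace_AE: "AEL t. 0 < t --> G x t = trace x t"
 using someI_ex[OF trace_representative[OF x]] unfolding trace_def[symmetric] by auto

lemma trace_lower_power:
 assumes c: "\<And>y. c y <= 1 + \<bar>y\<bar> powr p" "c 0 = (0::real)" and [measurable]: "borel_fun c"
 shows "(NBINT t. ind {..T} t * ennreal (c (trace x t))) < \<infinity>"
proof -
 define T' where "T' = max 1 (T + 1)"
 have T': "0 < T'" "T < T'" by (auto simp: T'_def)
 have "Lp p {0<..<T'} (G x)" by (rule trace_Lp[OF T'(1) x])
 moreover have "AEL t. t \<in> {0<..<T'} --> \<bar>G x t\<bar> powr p = \<bar>trace x t\<bar> powr p" using trace_AE by eventually_elim auto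
 ultimately have i: "integrable lborel (\<lambda>t. ind {0<..<T'} t * \<bar>trace x t\<bar> powr p)"
  by (subst lebesgue_on_AE_eq(2)[symmetric, of "\<lambda>t. \<bar>G x t\<bar> powr p"]) (auto simp: Lp_def)
 have i1: "integrable lborel (\<lambda>t. ind {0<..<T'} t * 1 :: real)" using T' by simp
 have "(NBINT t. ind {..T} t * ennreal (c (trace x t))) <= (NBINT t. ennreal (ind {0<..<T'} t * 1 + ind {0<..<T'} t * \<bar>trace x t\<bar> powr p))"
 proof (intro nn_integral_mono)
  fix t
  show "ind {..T} t * ennreal (c (trace x t)) <= ennreal (ind {0<..<T'} t * 1 + ind {0<..<T'} t * \<bar>trace x t\<bar> powr p)"
   using T' c(1)[of "trace x t"] trace_zero[of t] c(2) by (cases "0 < t") (auto simp: indicator_def simp del: ennreal_plus intro: ennreal_leI)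
 qed
 also have "... = ennreal (LBINT t. ind {0<..<T'} t * 1 + ind {0<..<T'} t * \<bar>trace x t\<bar> powr p)"
  by (rule nn_integral_eq_integral[OF integrable_add[OF i1 i]]) auto
 finally show ?thesis by (auto intro: le_less_trans)
qed

lemma trace_sq: "(NBINT t. ind {..T} t * ennreal ((trace x t)^2)) < \<infinity>"
 using trace_lower_power[of power2] square_le_one_plus_powr p by auto

lemma trace_strip_integrable: "integrable lborel (\<lambda>t. ind {..T} t * trace x t)"
proof (rule integrableI_bounded)
 have "(NBINT t. ennreal (norm (ind {..T} t * trace x t))) = (NBINT t. ind {..T} t * ennreal \<bar>trace x t\<bar>)"
  by (intro nn_integral_cong) (auto simp: indicator_def)
 also have "... < \<infinity>" using trace_lower_power[of abs] abs_le_one_plus_powr[of p] p by auto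
 finally show "(NBINT t. ennreal (norm (ind {..T} t * trace x t))) < \<infinity>" .
qed measurable

lemma trace_test_integral:
 assumes [measurable]: "borel_fun \<theta>"
 shows "(LINT t|lebesgue_on {0<..<T}. G x t * \<theta> t) = (LBINT t. ind {0<..<T} t * (trace x t * \<theta> t))"
 by (rule lebesgue_on_integral_borel_AE) (use trace_AE in \<open>auto elim!: eventually_mono\<close>)

lemma trace_shifted_integrable: "integrable lborel (\<lambda>s. ind {..T} (s + c) * trace x (s + c))"
 using lborel_integrable_real_affine[OF trace_strip_integrable[of T], of 1 c] by (simp add: add.commute)

text \<open>In the label \<open>s = t + c\<close> the bounds on the support of \<psi> make the
  cut-off at time 0 and at time \<open>T\<close> invisible, so the trace enters only through its
  zero extension.\<close>

lemma trace_test_shift: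
 assumes \<psi>: "test_function {s0<..<s1} \<psi>" and early: "c <= s0" and T: "s1 - c <= T"
 shows "(LINT t|lebesgue_on {0<..<T}. G x t * \<psi> (t + c)) = (LBINT s. ind {..T} (s - c) * trace x (s - c) * \<psi> s)"
proof -
 note [measurable] = test_function_continuous(2)[OF \<psi>]
 have "(LINT t|lebesgue_on {0<..<T}. G x t * \<psi> (t + c)) = (LBINT t. ind {0<..<T} t * (trace x t * \<psi> (t + c)))"
  by (rule trace_test_integral) measurable
 also have "... = (LBINT s. ind {0<..<T} (s - c) * (trace x (s - c) * \<psi> s))"
  by (subst lborel_integral_real_affine[where c = 1 and t = "- c"]) (auto simp: add.commute)
 also have "... = (LBINT s. ind {..T} (s - c) * trace x (s - c) * \<psi> s)"
 proof (rule integral_cong[OF refl])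
  fix s show "ind {0<..<T} (s - c) * (trace x (s - c) * \<psi> s) = ind {..T} (s - c) * trace x (s - c) * \<psi> s"
   using test_function_zero[OF \<psi>, of s] early T by (cases "s \<in> {s0<..<s1}") (auto simp: indicator_def)
 qed
 finally show ?thesis .
qed

end

end

text \<open>The hypothesis says that the zero function has weak derivative \<open>g\<close>. By the
  lemma of du Bois-Reymond all interval integrals of \<open>g\<close> vanish.\<close>

lemma AE_zero_if_test_integrals_zero:
 fixes g :: "real => real"
 assumes g: "integrable lborel g" and 0: "\<And>\<psi>. test_function {a<..<b} \<psi> ==> (LBINT s. g s * \<psi> s) = 0"
 shows "AEL s. a < s --> s < b --> g s = 0"
proof -
 have [measurable]: "borel_fun g" using g by auto
 have gab: "integrable lborel (\<lambda>s. ind {a<..<b} s * g s)" using integrable_mult_indicator[OF _ g, of "{a<..<b}"] by simp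
 have int0: "(LINT s|lebesgue_on {x<..<y}. g s) = 0" if "a <= x" "x <= y" "y <= b" for x y
 proof -
  have "(0::real) - 0 = (LINT s|lebesgue_on {x<..<y}. g s)"
  proof (rule weak_deriv_imp_integral[where f = "\<lambda>_. 0", OF _ _ _ that])
   show "integrable (lebesgue_on {a<..<b}) g" using gab by (subst lebesgue_on_borel_eq(2)) auto
   fix \<psi> assume \<psi>: "test_function {a<..<b} \<psi>"
   note [measurable] = test_function_continuous(2)[OF \<psi>]
   have "(LINT s|lebesgue_on {a<..<b}. g s * \<psi> s) = (LBINT s. ind {a<..<b} s * (g s * \<psi> s))"
    by (rule lebesgue_on_integral_borel_AE) auto
   also have "... = (LBINT s. g s * \<psi> s)"
    using test_function_zero[OF \<psi>] by (intro integral_cong) (auto simp: indicator_def)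
   finally show "(LINT x|lebesgue_on {a<..<b}. 0 * deriv \<psi> x) = - (LINT x|lebesgue_on {a<..<b}. g x * \<psi> x)" using 0[OF \<psi>] by simp
  qed auto
  then show ?thesis by simp
 qed
 have "AEL s. ind {a<..<b} s * g s = 0"
 proof (rule AE_zero_if_interval_integrals_zero[OF gab])
  fix x y :: real assume "x < y"
  have eq: "(LBINT t. ind {x<..<y} t * (ind {a<..<b} t * g t)) = (LINT t|lebesgue_on {max x a<..<min y b}. g t)"
   by (subst lebesgue_on_borel_eq(1)) (auto intro!: integral_cong simp: indicator_def)
  show "(LBINT t. ind {x<..<y} t * (ind {a<..<b} t * g t)) = 0"
  proof (cases "max x a <= min y b")
   case True
   then show ?thesis unfolding eq by (intro int0) auto
  next
   case False
   then have "{max x a<..<min y b} = {}" by auto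
   then show ?thesis unfolding eq by (simp add: lebesgue_on_integral_indicator)
  qed
 qed
 then show ?thesis by eventually_elim (auto simp: indicator_def)
qed

section \<open>Identities on almost every characteristic between two given abscissas\<close>

context damped_wave_traces
begin

definition W :: "real => real => real => real" where
 "W \<sigma> y t = x.trace y t + \<sigma> * t.trace y t"

text \<open>Du Bois-Reymond is used twice. For fixed \<psi> the pairing \<open>m x\<close> of the
  trace combination with \<open>\<psi> (t + \<sigma> * x)\<close> is continuous in \<open>x\<close>
  by the sideways regularity, and by \<open>characteristic_weak_deriv\<close> it has weak derivative
  \<open>n\<close>. So \<open>m y2 - m y1\<close> is an integral even when \<open>y1\<close> or
  \<open>y2\<close> lies on the boundary. Then \<psi> is arbitrary, which gives the identity for
  almost every label \<open>s\<close>.\<close>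

lemma characteristic_identity_bounded:
 assumes y: "0 <= y1" "y1 <= y2" "y2 <= 1" and s0: "\<And>x. y1 <= x ==> x <= y2 ==> \<sigma> * x <= s0" and \<sigma>: "\<sigma> = 1 \<or> \<sigma> = -1"
  and s1: "s0 + 1 <= s1"
 shows "AEL s. s0 < s --> s < s1 --> W \<sigma> y2 (s - \<sigma> * y2) - W \<sigma> y1 (s - \<sigma> * y1) =
   (LBINT x. ind {y1<..<y2} x * (2 * k x * v0 (s - \<sigma> * x) x))"
proof -
 have s0': "- 1 <= s0" using s0[of y1] y \<sigma> by auto
 \<comment> \<open>All points of characteristics with label below \<open>s1\<close> have times below
   \<open>T\<close>, as \<open>\<sigma> * x\<close> is at least \<open>-1\<close>.\<close>
 define T where "T = s1 + 1"
 have T: "0 < T" "0 <= T" using s0' s1 by (auto simp: T_def)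
 have y1: "0 <= y1" "y1 <= 1" and y2: "0 <= y2" "y2 <= 1" using y by auto
 have \<sigma>y: "\<sigma> * y1 <= s0" "\<sigma> * y2 <= s0" "s1 - \<sigma> * y1 <= T" "s1 - \<sigma> * y2 <= T" using s0[of y1] s0[of y2] y \<sigma> by (auto simp: T_def)
 define D where "D y s = ind {..T} (s - \<sigma> * y) * x.trace y (s - \<sigma> * y) + \<sigma> * (ind {..T} (s - \<sigma> * y) * t.trace y (s - \<sigma> * y))" for y s
 define c where "c x = ind {y1<..<y2} x * (2 * k x)" for x
 define \<Gamma> where "\<Gamma> s = (LBINT x. ind {..T} (s - \<sigma> * x) * v0 (s - \<sigma> * x) x * c x)" for s
 have [measurable]: "borel_fun c" unfolding c_def by measurable
 have cb: "\<bar>c x\<bar> <= 2 * K" for x using k_bound[of x] order_trans[OF abs_ge_zero k_bound[of x]] by (auto simp: c_def indicator_def abs_mult)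
 have Di: "integrable lborel (D y)" if "0 <= y" "y <= 1" for y
  using x.trace_shifted_integrable[OF that, of T "- \<sigma> * y"] t.trace_shifted_integrable[OF that, of T "- \<sigma> * y"] unfolding D_def[abs_def] by auto
 have pi: "integrable lborel2 (\<lambda>z. ind {..T} (fst z) * v0 (fst z) (snd z) * c (snd z))"
  by (rule t.strip_integrable_mult[of "\<lambda>t x. c x", OF _ cb]) measurable
 have \<Gamma>i: "integrable lborel \<Gamma>"
  using AE_integrable_slices(3)[OF integral_shear(1)[OF pi, of "- \<sigma>"]] by (simp add: \<Gamma>_def[abs_def])
 have "AEL s. s0 < s --> s < s1 --> D y2 s - D y1 s - \<Gamma> s = 0"
 proof (rule AE_zero_if_test_integrals_zero)
  show "integrable lborel (\<lambda>s. D y2 s - D y1 s - \<Gamma> s)" using Di[OF y1] Di[OF y2] \<Gamma>i by auto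
  fix \<psi> assume \<psi>: "test_function {s0<..<s1} \<psi>"
  have \<psi>': "test_function {s0<..} \<psi>" using \<psi> by (auto simp: test_function_def)
  note [measurable] = test_function_continuous(2)[OF \<psi>]
  obtain B where B: "0 <= B" "\<And>x. \<bar>\<psi> x\<bar> <= B" by (rule test_function_bounded[OF \<psi>]) blast
  obtain L where L: "0 <= L" "\<And>x y. \<bar>\<psi> y - \<psi> x\<bar> <= L * \<bar>y - x\<bar>" by (rule test_function_Lipschitz[OF \<psi>]) blast
  define m where "m x = (LINT t|lebesgue_on {0<..<T}. Ux x t * \<psi> (t + \<sigma> * x)) + \<sigma> * (LINT t|lebesgue_on {0<..<T}. Ut x t * \<psi> (t + \<sigma> * x))" for x
  define n where "n x = (LBINT t. ind {..T} t * v0 t x * (2 * k x * \<psi> (t + \<sigma> * x)))" for x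
  have m_trace: "m y = (LBINT s. D y s * \<psi> s)" if "0 <= y" "y <= 1" "\<sigma> * y <= s0" "s1 - \<sigma> * y <= T" for y
  proof -
   note i = integrable_test_mult[OF x.trace_shifted_integrable[OF that(1,2), of T "- \<sigma> * y"] \<psi>, of 0]
    integrable_test_mult[OF t.trace_shifted_integrable[OF that(1,2), of T "- \<sigma> * y"] \<psi>, of 0]
   have "m y = (LBINT s. ind {..T} (s - \<sigma> * y) * x.trace y (s - \<sigma> * y) * \<psi> s) +
     \<sigma> * (LBINT s. ind {..T} (s - \<sigma> * y) * t.trace y (s - \<sigma> * y) * \<psi> s)"
    unfolding m_def x.trace_test_shift[OF that(1,2) \<psi> that(3,4)] t.trace_test_shift[OF that(1,2) \<psi> that(3,4)] ..
   also have "... = (LBINT s. D y s * \<psi> s)"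
    using i by (simp add: D_def distrib_right mult.assoc)
   finally show ?thesis .
  qed
  have lip: "\<bar>\<psi> (t + \<sigma> * y) - \<psi> (t + \<sigma> * x)\<bar> <= L * \<bar>y - x\<bar>" for t x y
   using L(2)[of "t + \<sigma> * x" "t + \<sigma> * y"] \<sigma> by (auto simp: abs_minus_commute)
  have m_cont: "continuous_on {0..1} m" unfolding m_def[abs_def]
   by (intro continuous_intros Lp_continuous_weighted_integral[OF x.trace_curve[OF T(1)] p1(1), where B = B and L = L]
     Lp_continuous_weighted_integral[OF t.trace_curve[OF T(1)] p1(1), where B = B and L = L])
    (use T B lip in \<open>auto intro!: lebesgue_on_borel_measurable\<close>)
  have kb: "\<bar>2 * k x * \<psi> s\<bar> <= 2 * K * B" for x s
   using mult_mono[OF k_bound[of x] B(2)[of s]] order_trans[OF abs_ge_zero k_bound[of x]] by (simp add: abs_mult)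
  have ni: "integrable lborel n" unfolding n_def
   by (rule AE_integrable_slices(2)[of "\<lambda>t x. ind {..T} t * v0 t x * (2 * k x * \<psi> (t + \<sigma> * x))"],
     rule t.strip_integrable_mult[of "\<lambda>t x. 2 * k x * \<psi> (t + \<sigma> * x)", OF _ kb]) measurable
  have [measurable]: "borel_fun n" using ni by auto
  define m' where "m' x = (LBINT t. ind {..T} t * (vx t x + \<sigma> * v0 t x) * \<psi> (t + \<sigma> * x))" for x
  have [measurable]: "borel_fun m'" unfolding m'_def by measurable
  have m_m': "AEL x. 0 < x --> x < 1 --> m x = m' x"
   using x.G_AE t.G_AE AE_integrable_slices(1)[OF x.strip_integrable[of T]] AE_integrable_slices(1)[OF t.strip_integrable[of T]]
  proof eventually_elim
   case (elim x)
   show ?case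
   proof (intro impI)
    assume x: "0 < x" "x < 1"
    have ind: "ind {0<..<T} t * (f t x * \<psi> (t + \<sigma> * x)) = ind {..T} t * f t x * \<psi> (t + \<sigma> * x)"
     if "f = vx \<or> f = v0" for f t
    proof -
     have "\<psi> (t + \<sigma> * x) = 0" if "t = T" using that x \<sigma> by (intro test_function_zero[OF \<psi>]) (auto simp: T_def)
     then show ?thesis using that x.w_supp[of t x] t.w_supp[of t x] by (auto simp: indicator_def order_le_less)
    qed
    have "m x = (LBINT t. ind {..T} t * vx t x * \<psi> (t + \<sigma> * x)) + \<sigma> * (LBINT t. ind {..T} t * v0 t x * \<psi> (t + \<sigma> * x))"
     unfolding m_def x.trace_integral[OF elim(1) x order_refl, of "\<lambda>t. \<psi> (t + \<sigma> * x)" T, simplified]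
      t.trace_integral[OF elim(2) x order_refl, of "\<lambda>t. \<psi> (t + \<sigma> * x)" T, simplified]
     by (simp add: ind)
    also have "... = (LBINT t. ind {..T} t * vx t x * \<psi> (t + \<sigma> * x) + \<sigma> * (ind {..T} t * v0 t x * \<psi> (t + \<sigma> * x)))"
     using integrable_test_mult[OF elim(3) \<psi>, of "\<sigma> * x"] integrable_test_mult[OF elim(4) \<psi>, of "\<sigma> * x"] by simp
    also have "... = m' x"
     unfolding m'_def by (intro integral_cong) (auto simp: algebra_simps)
    finally show "m x = m' x" .
   qed
  qed
  have "m y2 - m y1 = (LINT x|lebesgue_on {y1<..<y2}. n x)"
  proof (rule weak_deriv_imp_integral[of y1 y2])
   show "continuous_on {y1..y2} m" using m_cont by (rule continuous_on_subset) (use y in auto)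
   show "integrable (lebesgue_on {y1<..<y2}) n"
    using integrable_mult_indicator[OF _ ni, of "{y1<..<y2}"] by (subst lebesgue_on_borel_eq(2)) auto
   fix \<kappa> assume \<kappa>: "test_function {y1<..<y2} \<kappa>"
   note \<kappa>1 = test_function_deriv[OF \<kappa>]
   note [measurable] = test_function_continuous(2)[OF \<kappa>] test_function_continuous(2)[OF \<kappa>1]
   have \<kappa>0: "ind {y1<..<y2} x * (f * \<kappa> x) = \<kappa> x * f" "ind {y1<..<y2} x * (f * deriv \<kappa> x) = deriv \<kappa> x * f" for x f
    using test_function_zero[OF \<kappa>, of x] test_function_zero[OF \<kappa>1, of x] by (auto simp: indicator_def)
   have "(LINT x|lebesgue_on {y1<..<y2}. m x * deriv \<kappa> x) = (LBINT x. ind {y1<..<y2} x * (m' x * deriv \<kappa> x))"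
    by (rule lebesgue_on_integral_borel_AE) (use m_m' y in \<open>auto elim!: eventually_mono\<close>)
   also have "... = - (LBINT x. \<kappa> x * n x)" unfolding \<kappa>0 m'_def n_def
   proof (rule characteristic_weak_deriv[OF \<kappa> \<psi>' y(1,3) s0 \<sigma> _ _ T(2)])
    fix s assume "T <= s + 1"
    then show "\<psi> s = 0" "deriv \<psi> s = 0"
     using test_function_zero[OF \<psi>, of s] test_function_zero[OF test_function_deriv[OF \<psi>], of s] by (auto simp: T_def)
   qed
   also have "(LBINT x. \<kappa> x * n x) = (LINT x|lebesgue_on {y1<..<y2}. n x * \<kappa> x)"
    by (subst lebesgue_on_integral_borel_AE[of _ "\<lambda>x. n x * \<kappa> x"]) (auto simp: \<kappa>0)
   finally show "(LINT x|lebesgue_on {y1<..<y2}. m x * deriv \<kappa> x) = - (LINT x|lebesgue_on {y1<..<y2}. n x * \<kappa> x)" .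
  qed (use y in auto)
  also have "... = (LBINT x. ind {y1<..<y2} x * n x)" by (rule lebesgue_on_integral_borel_AE) auto
  also have "... = (LBINT x. LBINT t. ind {..T} t * v0 t x * (c x * \<psi> (t + \<sigma> * x)))"
   unfolding n_def c_def
   by (subst integral_mult_right_zero[symmetric]) (simp add: mult_ac)
  also have "... = (LBINT t. LBINT x. ind {..T} t * v0 t x * (c x * \<psi> (t + \<sigma> * x)))"
  proof (rule t.strip_Fubini[symmetric])
   show "\<bar>c x * \<psi> (t + \<sigma> * x)\<bar> <= 2 * K * B" for t x
    using mult_mono[OF cb[of x] B(2)[of "t + \<sigma> * x"]] order_trans[OF abs_ge_zero cb[of x]] by (simp add: abs_mult)
  qed measurable
  also have "... = (LBINT s. LBINT x. ind {..T} (s - \<sigma> * x) * v0 (s - \<sigma> * x) x * (c x * \<psi> s))"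
  proof -
   have "\<bar>c x * \<psi> (t + \<sigma> * x)\<bar> <= 2 * K * B" for t x
    using mult_mono[OF cb[of x] B(2)[of "t + \<sigma> * x"]] order_trans[OF abs_ge_zero cb[of x]] by (simp add: abs_mult)
   then have "integrable lborel2 (\<lambda>z. ind {..T} (fst z) * v0 (fst z) (snd z) * (c (snd z) * \<psi> (fst z + \<sigma> * snd z)))"
    by (intro t.strip_integrable_mult[of "\<lambda>t x. c x * \<psi> (t + \<sigma> * x)"]) measurable
   from integral_shear(2)[OF this, of "- \<sigma>"] show ?thesis by simp
  qed
  also have "... = (LBINT s. \<Gamma> s * \<psi> s)"
   unfolding \<Gamma>_def by (subst integral_mult_left_zero[symmetric]) (simp add: mult_ac)
  finally have "(LBINT s. D y2 s * \<psi> s) - (LBINT s. D y1 s * \<psi> s) = (LBINT s. \<Gamma> s * \<psi> s)"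
   using m_trace[OF y1 \<sigma>y(1,3)] m_trace[OF y2 \<sigma>y(2,4)] by simp
  then show "(LBINT s. (D y2 s - D y1 s - \<Gamma> s) * \<psi> s) = 0"
   using integrable_test_mult[OF Di[OF y1] \<psi>, of 0] integrable_test_mult[OF Di[OF y2] \<psi>, of 0] integrable_test_mult[OF \<Gamma>i \<psi>, of 0]
   by (simp add: left_diff_distrib)
 qed
 then show ?thesis
 proof eventually_elim
  case (elim s)
  show ?case
  proof (intro impI)
   assume s: "s0 < s" "s < s1"
   have "\<Gamma> s = (LBINT x. ind {y1<..<y2} x * (2 * k x * v0 (s - \<sigma> * x) x))"
    unfolding \<Gamma>_def c_def using s y \<sigma> by (intro integral_cong) (auto simp: indicator_def T_def)
   moreover have "s - \<sigma> * y1 <= T" "s - \<sigma> * y2 <= T" using s \<sigma>y by auto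
   then have "D y1 s = W \<sigma> y1 (s - \<sigma> * y1)" "D y2 s = W \<sigma> y2 (s - \<sigma> * y2)" by (auto simp: D_def W_def)
   ultimately show "W \<sigma> y2 (s - \<sigma> * y2) - W \<sigma> y1 (s - \<sigma> * y1) = (LBINT x. ind {y1<..<y2} x * (2 * k x * v0 (s - \<sigma> * x) x))"
    using elim s by simp
  qed
 qed
qed

lemma characteristic_identity:
 assumes "0 <= y1" "y1 <= y2" "y2 <= 1" "\<And>x. y1 <= x ==> x <= y2 ==> \<sigma> * x <= s0" "\<sigma> = 1 \<or> \<sigma> = -1"
 shows "AEL s. s0 < s --> W \<sigma> y2 (s - \<sigma> * y2) - W \<sigma> y1 (s - \<sigma> * y1) =
   (LBINT x. ind {y1<..<y2} x * (2 * k x * v0 (s - \<sigma> * x) x))"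
proof -
 have "AEL s. \<forall>n::nat. s0 < s --> s < s0 + 1 + real n --> W \<sigma> y2 (s - \<sigma> * y2) - W \<sigma> y1 (s - \<sigma> * y1) =
   (LBINT x. ind {y1<..<y2} x * (2 * k x * v0 (s - \<sigma> * x) x))"
  unfolding AE_all_countable using characteristic_identity_bounded[OF assms] by simp
 then show ?thesis
 proof eventually_elim
  case (elim s)
  obtain n :: nat where "s - s0 - 1 < real n" using reals_Archimedean2 by blast
  with elim show ?case by (auto simp: algebra_simps)
 qed
qed

end

section \<open>Energy decay\<close>

lemma AE_reflect_unit:
 assumes "AEL x. P (x::real)"
 shows "AEL x. P (1 - x)"
proof -
 obtain N where N: "N \<in> null_sets lborel" "{x. \<not> P x} \<subseteq> N" using assms by (auto simp: eventually_ae_filter)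
 then have [measurable]: "N \<in> sets borel" by auto
 have "AEL x. x \<notin> N" using N(1) by (rule AE_not_in)
 from AE_borel_affine[of "- 1", OF _ _ this, of 1] have "AEL x. 1 + - 1 * x \<notin> N" by simp
 then show ?thesis by eventually_elim (use N(2) in auto)
qed

lemma AE_lborel_commute:
 assumes [measurable]: "Measurable.pred (borel \<Otimes>\<^sub>M borel) (\<lambda>z. P (fst z) (snd z :: real))"
  and "AEL x. AEL t. P (t::real) x"
 shows "AEL t. AEL x. P t x"
 using assms(2) by (subst lborel_pair.AE_commute) measurable

lemma characteristic_pred_measurable:
 assumes r: "joint_borel r"
  and g: "joint_borel g" and [measurable]: "borel_fun F"
 shows "Measurable.pred (borel \<Otimes>\<^sub>M borel) (\<lambda>z. 0 < fst z --> 0 < snd z --> snd z < 1 -->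
  r (fst z) (snd z :: real) = F (fst z + snd z) + (LBINT y. ind {0<..<snd z} y * g (fst z + snd z - y) y :: real))"
proof -
 note [measurable (raw)] = measurable_curried2[OF r] measurable_curried2[OF g]
 have "(\<lambda>z. (LBINT y. (if 0 < y \<and> y < snd z then g (fst z + snd z - y) y else 0)) :: real) \<in> borel_measurable (borel \<Otimes>\<^sub>M borel)"
  by measurable
 also have "(\<lambda>z. (LBINT y. (if 0 < y \<and> y < snd z then g (fst z + snd z - y) y else 0)) :: real) =
   (\<lambda>z. LBINT y. ind {0<..<snd z} y * g (fst z + snd z - y) y)"
  by (intro ext integral_cong) (auto simp: indicator_def)
 finally have [measurable]: "(\<lambda>z. LBINT y. ind {0<..<snd z} y * g (fst z + snd z - y) y) \<in> borel_measurable (borel \<Otimes>\<^sub>M borel)" .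
 show ?thesis by measurable
qed

section \<open>The weak solution as an instance of the damped string\<close>

locale string_solution = damped_wave_traces p u ut ux Ut Ux v0 vx q k K + sp: string_parameters k a b K \<alpha>1 \<alpha>2 \<beta>1 \<gamma>1 \<mu>1
 for p u ut ux Ut Ux v0 vx q k K a b \<alpha>1 \<alpha>2 \<beta>1 \<gamma>1 \<mu>1 +
 fixes \<eta>1 \<eta>2 \<zeta> :: "real => real"
 assumes eta_meas[measurable]: "\<eta>1 \<in> borel_measurable borel" "\<eta>2 \<in> borel_measurable borel" "borel_fun \<zeta>"
  and eta_cont: "continuous_on {0..} \<eta>1" "continuous_on {0..} \<eta>2" "continuous_on {0..} \<zeta>"
  and Ut1: "AEL t. 0 < t --> Ut 1 t = \<eta>1 t" and Ut0: "AEL t. 0 < t --> Ut 0 t = \<zeta> t"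
  and eta1: "\<And>t. 0 <= t ==> \<eta>1 t = \<eta>1 0 + (LINT s|lebesgue_on {0<..<t}. - \<alpha>1 * \<eta>1 s - \<alpha>2 * \<eta>2 s - \<beta>1 * Ux 1 s)"
  and eta2: "\<And>t. 0 <= t ==> (\<eta>2 has_real_derivative \<eta>1 t) (at t within {0..})"
  and zeta: "\<And>t. 0 <= t ==> \<zeta> t = \<zeta> 0 + (LINT s|lebesgue_on {0<..<t}. - \<gamma>1 * \<zeta> s + \<mu>1 * Ux 0 s)"
begin

definition r :: "real => real => real" where "r t x = vx t x + v0 t x"
definition v :: "real => real => real" where "v t x = vx t (1 - x) - v0 t (1 - x)"
definition g :: "real => real => real" where "g t x = k x * (r t x - v t (1 - x))"
definition h :: "real => real => real" where "h t x = k (1 - x) * (v t x - r t (1 - x))"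

lemma g_eq: "g t x = 2 * k x * v0 t x" and h_eq: "h t x = - (2 * k (1 - x) * v0 t (1 - x))"
 by (simp_all add: g_def h_def r_def v_def)

lemma supp: assumes "\<not> (0 < t \<and> 0 < x \<and> x < 1)"
 shows "r t x = 0" "v t x = 0" "g t x = 0" "h t x = 0"
 using assms t.w_supp[of t x] x.w_supp[of t x] t.w_supp[of t "1 - x"] x.w_supp[of t "1 - x"]
 by (auto simp: g_eq h_eq) (auto simp: r_def v_def)

lemma rv_meas:
 shows "joint_borel r" "joint_borel v"
  "joint_borel g" "joint_borel h"
 unfolding g_eq h_eq by (simp_all add: r_def v_def)

lemma W_props:
 assumes "0 <= y" "y <= 1"
 shows "W \<sigma> y \<in> borel_measurable borel" "t <= 0 ==> W \<sigma> y t = 0"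
  "(NBINT t. ind {..T} t * ennreal ((W \<sigma> y t)^2)) < \<infinity>"
proof -
 note [measurable] = t.trace_meas[OF assms] x.trace_meas[OF assms]
 show "W \<sigma> y \<in> borel_measurable borel" "t <= 0 ==> W \<sigma> y t = 0"
  using t.trace_zero[OF assms] x.trace_zero[OF assms] by (simp_all add: W_def[abs_def])
 have "(NBINT t. ind {..T} t * ennreal ((W \<sigma> y t)^2)) <=
   (NBINT t. 2 * (ind {..T} t * ennreal ((x.trace y t)^2)) + ennreal (2 * \<sigma>^2) * (ind {..T} t * ennreal ((t.trace y t)^2)))"
 proof (intro nn_integral_mono)
  fix t
  have "(W \<sigma> y t)^2 <= 2 * (x.trace y t)^2 + 2 * \<sigma>^2 * (t.trace y t)^2"
   using sum_squares_bound[of "x.trace y t" "\<sigma> * t.trace y t"] by (simp add: W_def power2_sum power_mult_distrib)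
  from ennreal_leI[OF this] show "ind {..T} t * ennreal ((W \<sigma> y t)^2) <=
    2 * (ind {..T} t * ennreal ((x.trace y t)^2)) + ennreal (2 * \<sigma>^2) * (ind {..T} t * ennreal ((t.trace y t)^2))"
   by (auto simp: indicator_def ennreal_mult)
 qed
 also have "... < \<infinity>"
  using t.trace_sq[OF assms, of T] x.trace_sq[OF assms, of T]
  by (subst nn_integral_add) (auto simp: nn_integral_cmult ennreal_mult_less_top)
 finally show "(NBINT t. ind {..T} t * ennreal ((W \<sigma> y t)^2)) < \<infinity>" .
qed

lemma strip_sq_bound:
 assumes f: "\<And>t x. (f t x)^2 <= C * ((vx t x)^2 + (v0 t x)^2)" "0 <= C"
  and [measurable]: "joint_borel f"
 shows "(NBINT t x. ind {..T} t * ennreal ((f t x)^2)) < \<infinity>"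
  "(NBINT t x. ind {..T} t * ennreal ((f t (1 - x))^2)) < \<infinity>"
proof -
 note [measurable (raw)] = measurable_curried2[OF assms(3)]
 have "(NBINT t x. ind {..T} t * ennreal ((f t x)^2)) <=
  (NBINT t x. ennreal C * (ind {..T} t * ennreal ((vx t x)^2)) + ennreal C * (ind {..T} t * ennreal ((v0 t x)^2)))"
 proof (intro nn_integral_mono)
  fix t x
  from ennreal_leI[OF f(1)[of t x]] show "ind {..T} t * ennreal ((f t x)^2) <=
    ennreal C * (ind {..T} t * ennreal ((vx t x)^2)) + ennreal C * (ind {..T} t * ennreal ((v0 t x)^2))"
   using f(2) by (auto simp: indicator_def ennreal_mult distrib_left)
 qed
 also have "... = ennreal C * (NBINT t x. ind {..T} t * ennreal ((vx t x)^2)) +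
   ennreal C * (NBINT t x. ind {..T} t * ennreal ((v0 t x)^2))"
  by (simp add: nn_integral_add nn_integral_cmult)
 also have "... < \<infinity>" using t.strip_sq[of T] x.strip_sq[of T] by (auto simp: ennreal_mult_less_top)
 finally show *: "(NBINT t x. ind {..T} t * ennreal ((f t x)^2)) < \<infinity>" .
 have "(NBINT x. ind {..T} t * ennreal ((f t (1 - x))^2)) = (NBINT x. ind {..T} t * ennreal ((f t x)^2))" for t
  by (rule nn_integral_reflect_unit[of "\<lambda>x. ind {..T} t * ennreal ((f t x)^2)"]) measurable
 with * show "(NBINT t x. ind {..T} t * ennreal ((f t (1 - x))^2)) < \<infinity>" by simp
qed

lemma sq_bounds:
 "(vx t x + v0 t x)^2 <= 2 * ((vx t x)^2 + (v0 t x)^2)" "(vx t x - v0 t x)^2 <= 2 * ((vx t x)^2 + (v0 t x)^2)"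
 "(2 * k x * v0 t x)^2 <= 4 * K^2 * ((vx t x)^2 + (v0 t x)^2)"
proof -
 show "(vx t x + v0 t x)^2 <= 2 * ((vx t x)^2 + (v0 t x)^2)" "(vx t x - v0 t x)^2 <= 2 * ((vx t x)^2 + (v0 t x)^2)"
  using sum_squares_bound[of "vx t x" "v0 t x"] sum_squares_bound[of "vx t x" "- v0 t x"] by (auto simp: power2_sum power2_diff)
 have "(k x)^2 <= K^2" using power_mono[OF k_bound abs_ge_zero, of x 2] by simp
 then show "(2 * k x * v0 t x)^2 <= 4 * K^2 * ((vx t x)^2 + (v0 t x)^2)"
  by (simp add: power_mult_distrib mult_mono)
qed

lemma trace_interior:
 "AEL x. 0 < x --> x < 1 --> (AEL t. 0 < t --> W \<sigma> x t = vx t x + \<sigma> * v0 t x)"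
 using t.G_AE x.G_AE
proof eventually_elim
 case (elim x)
 show ?case
 proof (intro impI)
  assume x: "0 < x" "x < 1"
  from elim t.trace_AE[OF less_imp_le less_imp_le, OF x] x.trace_AE[OF less_imp_le less_imp_le, OF x]
  show "AEL t. 0 < t --> W \<sigma> x t = vx t x + \<sigma> * v0 t x"
   by eventually_elim (use x in \<open>auto simp: W_def\<close>)
 qed
qed

text \<open>\<open>characteristic_identity\<close> holds for each fixed \<open>x\<close> and almost
  every label, while \<open>transport\<close> asks for almost every time first. Measurability of the
  relation permits the exchange.\<close>

lemma r_transport: "transport r g (W 1 0)"
proof
 show "AEL t. AEL x. 0 < t --> 0 < x --> x < 1 -->
   r t x = W 1 0 (t + x) + (LBINT y. ind {0<..<x} y * g (t + x - y) y)"
 proof (rule AE_lborel_commute[OF characteristic_pred_measurable[OF rv_meas(1,3) W_props(1)[OF order_refl zero_le_one]]])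
  show "AEL x. AEL t. 0 < t --> 0 < x --> x < 1 -->
    r t x = W 1 0 (t + x) + (LBINT y. ind {0<..<x} y * g (t + x - y) y)"
   using trace_interior[of 1]
  proof eventually_elim
   case (elim x)
   show ?case
   proof (cases "0 < x \<and> x < 1")
    case True
    \<comment> \<open>Between 0 and \<open>x\<close> the largest value of \<open>1 * y\<close> is
      \<open>x\<close>, so the identity holds for labels above \<open>x\<close>; with
      \<open>s = t + x\<close> this covers all positive times.\<close>
    have "AEL s. x < s --> W 1 x (s - 1 * x) - W 1 0 (s - 1 * 0) = (LBINT y. ind {0<..<x} y * (2 * k y * v0 (s - 1 * y) y))"
     by (rule characteristic_identity) (use True in auto)
    note AE_shift[OF this, of x]
    moreover have "AEL t. 0 < t --> W 1 x t = vx t x + 1 * v0 t x" using elim True by simp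
    ultimately show ?thesis
     by eventually_elim (auto simp: r_def g_eq mult.assoc)
   qed auto
  qed
 qed
 show "(NBINT t x. ind {..T} t * ennreal ((r t x)^2)) < \<infinity>" for T
  unfolding r_def by (rule strip_sq_bound(1)[OF sq_bounds(1)]) auto
 show "(NBINT t x. ind {..T} t * ennreal ((g t x)^2)) < \<infinity>" for T
  unfolding g_eq by (rule strip_sq_bound(1)[OF sq_bounds(3)]) auto
qed (use rv_meas W_props[where y = 0 and \<sigma> = 1] supp in auto)

text \<open>The characteristics with \<sigma> = -1 are followed from \<open>1 - x\<close> to 1.
  Reflecting the abscissa turns them into characteristics travelling to the left that leave the
  strip at 0, with the trace at \<open>x = 1\<close> as their outflow data.\<close>

lemma v_transport: "transport v h (W (- 1) 1)"
proof
 show "AEL t. AEL x. 0 < t --> 0 < x --> x < 1 -->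
   v t x = W (- 1) 1 (t + x) + (LBINT y. ind {0<..<x} y * h (t + x - y) y)"
 proof (rule AE_lborel_commute[OF characteristic_pred_measurable[OF rv_meas(2,4) W_props(1)[OF zero_le_one order_refl]]])
  show "AEL x. AEL t. 0 < t --> 0 < x --> x < 1 -->
    v t x = W (- 1) 1 (t + x) + (LBINT y. ind {0<..<x} y * h (t + x - y) y)"
   using AE_reflect_unit[OF trace_interior[of "- 1"]]
  proof eventually_elim
   case (elim x)
   show ?case
   proof (cases "0 < x \<and> x < 1")
    case True
    have i: "AEL s. x - 1 < s --> W (- 1) 1 (s - - 1 * 1) - W (- 1) (1 - x) (s - - 1 * (1 - x)) =
      (LBINT y. ind {1 - x<..<1} y * (2 * k y * v0 (s - - 1 * y) y))"
     by (rule characteristic_identity) (use True in auto)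
    have refl: "(LBINT y. ind {1 - x<..<1} y * (2 * k y * v0 (t + x - 1 + y) y)) = - (LBINT y. ind {0<..<x} y * h (t + x - y) y)" for t
    proof -
     have "(LBINT y. ind {1 - x<..<1} y * (2 * k y * v0 (t + x - 1 + y) y)) =
       (LBINT y. ind {1 - x<..<1} (1 - y) * (2 * k (1 - y) * v0 (t + x - 1 + (1 - y)) (1 - y)))"
      by (rule integral_reflect_unit[symmetric])
     also have "... = (LBINT y. - (ind {0<..<x} y * h (t + x - y) y))"
      by (intro integral_cong) (auto simp: indicator_def h_eq algebra_simps)
     finally show ?thesis by simp
    qed
    from AE_shift[OF i, of "x - 1"] have "AEL t. 0 < t --> W (- 1) 1 (t + x) - W (- 1) (1 - x) t =
      - (LBINT y. ind {0<..<x} y * h (t + x - y) y)"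
     by eventually_elim (simp add: refl[symmetric] algebra_simps)
    moreover have "AEL t. 0 < t --> W (- 1) (1 - x) t = v t x" using elim True by (simp add: v_def)
    ultimately show ?thesis by eventually_elim auto
   qed auto
  qed
 qed
 show "(NBINT t x. ind {..T} t * ennreal ((v t x)^2)) < \<infinity>" for T
  unfolding v_def by (rule strip_sq_bound(2)[OF sq_bounds(2)]) auto
 show "(NBINT t x. ind {..T} t * ennreal ((h t x)^2)) < \<infinity>" for T
  unfolding h_eq power2_minus by (rule strip_sq_bound(2)[OF sq_bounds(3)]) auto
qed (use rv_meas W_props[where y = 1 and \<sigma> = "- 1"] supp in auto)

lemma primitive_from:
 fixes \<eta> G :: "real => real"
 assumes \<eta>: "\<And>t. 0 <= t ==> \<eta> t = \<eta> 0 + (LBINT s. ind {0<..<t} s * G s)"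
  and G: "\<And>t. integrable lborel (\<lambda>s. ind {0<..<t} s * G s)" and st: "0 <= s" "s <= (t::real)"
 shows "\<eta> t = \<eta> s + (LBINT \<tau>. ind {s<..<t} \<tau> * G \<tau>)"
proof -
 have *: "(LBINT \<tau>. ind {c<..<d} \<tau> * (ind {0<..<t} \<tau> * G \<tau>)) = (LBINT \<tau>. ind {c<..<d} \<tau> * G \<tau>)" if "0 <= c" "d <= t" for c d
  using that by (intro integral_cong) (auto simp: indicator_def)
 show ?thesis using primitive_diff[OF G st, of t] \<eta>[of t] \<eta>[of s] st by (simp add: *)
qed

lemma boundary_trace_AE:
 shows "AEL t. 0 < t --> t.trace 1 t = \<eta>1 t" "AEL t. 0 < t --> t.trace 0 t = \<zeta> t"
proof -
 from Ut1 t.trace_AE[OF zero_le_one order_refl] show "AEL t. 0 < t --> t.trace 1 t = \<eta>1 t" by eventually_elim auto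
 from Ut0 t.trace_AE[OF order_refl zero_le_one] show "AEL t. 0 < t --> t.trace 0 t = \<zeta> t" by eventually_elim auto
qed

lemma strip_trace: "0 <= y ==> y <= 1 ==> integrable lborel (\<lambda>s. ind {0<..<t} s * x.trace y s)"
 using integrable_mult_indicator[OF _ x.trace_strip_integrable[of y t], of "{0<..<t}"]
 by (rule integrable_cong[THEN iffD1, rotated 2]) (auto simp: indicator_def)

text \<open>The traces of u_t are \<eta>1 and \<zeta>, so u_x equals
  \<open>W (- 1) 1 + \<eta>1\<close> at \<open>x = 1\<close> and \<open>W 1 0 - \<zeta>\<close> at
  \<open>x = 0\<close>. Substituting this produces the coefficients
  \<open>\<alpha>1 + \<beta>1\<close> and \<open>\<gamma>1 + \<mu>1\<close>.\<close>

lemma eta_diff: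
 assumes "0 <= s" "s <= t"
 shows "\<eta>1 t = \<eta>1 s + (LBINT \<tau>. ind {s<..<t} \<tau> * (- (\<alpha>1 + \<beta>1) * \<eta>1 \<tau> - \<alpha>2 * \<eta>2 \<tau> - \<beta>1 * W (- 1) 1 \<tau>))"
  and "\<eta>2 t = \<eta>2 s + (LBINT \<tau>. ind {s<..<t} \<tau> * \<eta>1 \<tau>)"
  and "\<zeta> t = \<zeta> s + (LBINT \<tau>. ind {s<..<t} \<tau> * (- (\<gamma>1 + \<mu>1) * \<zeta> \<tau> + \<mu>1 * W 1 0 \<tau>))"
proof -
 note [measurable] = x.trace_meas[of 0, simplified] x.trace_meas[of 1, simplified] t.trace_meas[of 0, simplified] t.trace_meas[of 1, simplified]
  W_props(1)[of 0 1, simplified] W_props(1)[of 1 "- 1", simplified]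
 note ci = continuous_integrable_interval[OF eta_cont(1) order_refl] continuous_integrable_interval[OF eta_cont(2) order_refl]
  continuous_integrable_interval[OF eta_cont(3) order_refl]
 let ?G1 = "\<lambda>s. - \<alpha>1 * \<eta>1 s - \<alpha>2 * \<eta>2 s - \<beta>1 * x.trace 1 s"
 let ?G3 = "\<lambda>s. - \<gamma>1 * \<zeta> s + \<mu>1 * x.trace 0 s"
 have "\<eta>1 t = \<eta>1 s + (LBINT \<tau>. ind {s<..<t} \<tau> * ?G1 \<tau>)"
 proof (rule primitive_from[OF _ _ assms])
  fix t :: real
  show "integrable lborel (\<lambda>s. ind {0<..<t} s * ?G1 s)"
   using integrable_mult_right[OF ci(1), of "- \<alpha>1" t] integrable_mult_right[OF ci(2), of "\<alpha>2" t] integrable_mult_right[OF strip_trace[of 1 t], of \<beta>1]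
   by (simp add: right_diff_distrib mult.left_commute)
  assume "0 <= t"
  have "(LINT s|lebesgue_on {0<..<t}. - \<alpha>1 * \<eta>1 s - \<alpha>2 * \<eta>2 s - \<beta>1 * Ux 1 s) = (LBINT s. ind {0<..<t} s * ?G1 s)"
   by (rule lebesgue_on_integral_borel_AE) (use x.trace_AE[of 1] in \<open>auto elim!: eventually_mono\<close>)
  with eta1[OF \<open>0 <= t\<close>] show "\<eta>1 t = \<eta>1 0 + (LBINT s. ind {0<..<t} s * ?G1 s)" by simp
 qed
 also have "(LBINT \<tau>. ind {s<..<t} \<tau> * ?G1 \<tau>) = (LBINT \<tau>. ind {s<..<t} \<tau> * (- (\<alpha>1 + \<beta>1) * \<eta>1 \<tau> - \<alpha>2 * \<eta>2 \<tau> - \<beta>1 * W (- 1) 1 \<tau>))"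
 proof (rule integral_cong_AE)
  show "AEL \<tau>. ind {s<..<t} \<tau> * ?G1 \<tau> = ind {s<..<t} \<tau> * (- (\<alpha>1 + \<beta>1) * \<eta>1 \<tau> - \<alpha>2 * \<eta>2 \<tau> - \<beta>1 * W (- 1) 1 \<tau>)"
   using boundary_trace_AE(1) by eventually_elim (use assms in \<open>auto simp: indicator_def W_def algebra_simps\<close>)
 qed measurable
 finally show "\<eta>1 t = \<eta>1 s + (LBINT \<tau>. ind {s<..<t} \<tau> * (- (\<alpha>1 + \<beta>1) * \<eta>1 \<tau> - \<alpha>2 * \<eta>2 \<tau> - \<beta>1 * W (- 1) 1 \<tau>))" .
 have "\<zeta> t = \<zeta> s + (LBINT \<tau>. ind {s<..<t} \<tau> * ?G3 \<tau>)"
 proof (rule primitive_from[OF _ _ assms])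
  fix t :: real
  show "integrable lborel (\<lambda>s. ind {0<..<t} s * ?G3 s)"
   using integrable_mult_right[OF ci(3), of "- \<gamma>1" t] integrable_mult_right[OF strip_trace[of 0 t], of \<mu>1]
   by (simp add: distrib_left right_diff_distrib mult.left_commute)
  assume "0 <= t"
  have "(LINT s|lebesgue_on {0<..<t}. - \<gamma>1 * \<zeta> s + \<mu>1 * Ux 0 s) = (LBINT s. ind {0<..<t} s * ?G3 s)"
   by (rule lebesgue_on_integral_borel_AE) (use x.trace_AE[of 0] in \<open>auto elim!: eventually_mono\<close>)
  with zeta[OF \<open>0 <= t\<close>] show "\<zeta> t = \<zeta> 0 + (LBINT s. ind {0<..<t} s * ?G3 s)" by simp
 qed
 also have "(LBINT \<tau>. ind {s<..<t} \<tau> * ?G3 \<tau>) = (LBINT \<tau>. ind {s<..<t} \<tau> * (- (\<gamma>1 + \<mu>1) * \<zeta> \<tau> + \<mu>1 * W 1 0 \<tau>))"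
 proof (rule integral_cong_AE)
  show "AEL \<tau>. ind {s<..<t} \<tau> * ?G3 \<tau> = ind {s<..<t} \<tau> * (- (\<gamma>1 + \<mu>1) * \<zeta> \<tau> + \<mu>1 * W 1 0 \<tau>)"
   using boundary_trace_AE(2) by eventually_elim (use assms in \<open>auto simp: indicator_def W_def algebra_simps\<close>)
 qed measurable
 finally show "\<zeta> t = \<zeta> s + (LBINT \<tau>. ind {s<..<t} \<tau> * (- (\<gamma>1 + \<mu>1) * \<zeta> \<tau> + \<mu>1 * W 1 0 \<tau>))" .
 have c: "continuous_on {s..t} \<eta>1" using eta_cont(1) by (rule continuous_on_subset) (use assms in auto)
 have "(\<eta>1 has_integral \<eta>2 t - \<eta>2 s) {s..t}"
  by (rule fundamental_theorem_of_calculus[OF assms(2)])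
   (use assms in \<open>auto intro!: DERIV_subset[OF eta2] simp flip: has_real_derivative_iff_has_vector_derivative\<close>)
 then have "\<eta>2 t - \<eta>2 s = (LINT \<tau>|lebesgue_on {s<..<t}. \<eta>1 \<tau>)" by (simp add: lebesgue_on_continuous_eq_integral[OF c] integral_unique)
 also have "... = (LBINT \<tau>. ind {s<..<t} \<tau> * \<eta>1 \<tau>)" by (rule lebesgue_on_integral_borel_AE) auto
 finally show "\<eta>2 t = \<eta>2 s + (LBINT \<tau>. ind {s<..<t} \<tau> * \<eta>1 \<tau>)" by simp
qed

sublocale ds: damped_string k a b K \<alpha>1 \<alpha>2 \<beta>1 \<gamma>1 \<mu>1 r g "W 1 0" v h "W (- 1) 1" \<eta>1 \<eta>2 \<zeta>
proof -
 interpret rt: transport r g "W 1 0" by (rule r_transport)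
 interpret vt: transport v h "W (- 1) 1" by (rule v_transport)
 \<comment> \<open>A full crossing. At \<open>x = 1\<close> the sum and the difference of u_x and
   u_t differ by twice the trace of u_t, which is \<eta>1.\<close>
 have "AEL s. 1 < s --> W 1 1 (s - 1 * 1) - W 1 0 (s - 1 * 0) = (LBINT y. ind {0<..<1} y * (2 * k y * v0 (s - 1 * y) y))"
  by (rule characteristic_identity) auto
 from AE_shift[OF this, of 1] boundary_trace_AE(1)
 have b1: "AEL t. 0 < t --> rt.R (t + 1) 1 = W (- 1) 1 t + 2 * \<eta>1 t"
  by eventually_elim (auto simp: rt.R_def g_eq W_def mult.assoc)
 have refl': "(LBINT y. ind {0<..<1} y * (2 * k y * v0 (t + y) y)) = - (LBINT y. ind {0<..<1} y * h (t + 1 - y) y)" for t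
 proof -
  have "(LBINT y. ind {0<..<1} y * (2 * k y * v0 (t + y) y)) =
    (LBINT y. ind {0<..<1} (1 - y) * (2 * k (1 - y) * v0 (t + (1 - y)) (1 - y)))"
   by (rule integral_reflect_unit[symmetric])
  also have "... = (LBINT y. - (ind {0<..<1} y * h (t + 1 - y) y))"
   by (intro integral_cong) (auto simp: indicator_def h_eq algebra_simps)
  finally show ?thesis by simp
 qed
 \<comment> \<open>The crossing for the other family, where the relation between sum and difference
   at \<open>x = 0\<close> brings in \<zeta> with the opposite sign.\<close>
 have "AEL s. 0 < s --> W (- 1) 1 (s - - 1 * 1) - W (- 1) 0 (s - - 1 * 0) = (LBINT y. ind {0<..<1} y * (2 * k y * v0 (s - - 1 * y) y))"
  by (rule characteristic_identity) auto
 then have "AEL s. 0 < s --> W (- 1) 1 (s + 1) - W (- 1) 0 s = - (LBINT y. ind {0<..<1} y * h (s + 1 - y) y)"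
  unfolding refl'[symmetric] by simp
 with boundary_trace_AE(2) have b0: "AEL t. 0 < t --> vt.R (t + 1) 1 = W 1 0 t - 2 * \<zeta> t"
 proof eventually_elim
  case (elim t)
  then show ?case by (simp only: vt.R_def W_def[of _ 0]) linarith
 qed
 show "damped_string k a b K \<alpha>1 \<alpha>2 \<beta>1 \<gamma>1 \<mu>1 r g (W 1 0) v h (W (- 1) 1) \<eta>1 \<eta>2 \<zeta>"
  by unfold_locales (rule g_def h_def eta_meas eta_cont b1 b0 | rule eta_diff; assumption)+
qed

end

text \<open>The two terms cover the cases of \<open>y\<close> below and above the level
  \<open>l\<close>. Leaving \<open>l\<close> free allows it to be matched to the energy, so that
  both terms scale alike.\<close>

lemma powr_interpolation:
 fixes y l m p :: real
 assumes l: "0 < l" and m: "0 < m" "m <= p"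
 shows "\<bar>y\<bar> powr m <= l powr m + l powr (m - p) * \<bar>y\<bar> powr p"
proof (cases "\<bar>y\<bar> <= l")
 case True
 then have "\<bar>y\<bar> powr m <= l powr m" using m by (intro powr_mono2) auto
 then show ?thesis by (auto intro: order_trans)
next
 case False
 have "\<bar>y\<bar> powr m = \<bar>y\<bar> powr (m - p) * \<bar>y\<bar> powr p" using False l by (simp add: powr_add[symmetric])
 also have "... <= l powr (m - p) * \<bar>y\<bar> powr p" using False l m by (intro mult_right_mono powr_mono2') auto
 finally show ?thesis by (auto intro: order_trans)
qed

text \<open>An interpolation level must be positive even when the energy vanishes. Estimates are
  therefore made at levels strictly above it and passed to the limit.\<close>

lemma le_mult_dense:
 fixes c x S :: real
 assumes "0 <= c" "0 <= S" "\<And>L. S < L ==> x <= c * L"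
 shows "x <= c * S"
proof (rule field_le_epsilon)
 fix d :: real assume d: "0 < d"
 have "x <= c * (S + d / (c + 1))" using assms(1) d by (intro assms(3)) simp
 also have "c * (d / (c + 1)) <= d" using assms(1) d by (simp add: field_simps)
 then have "c * (S + d / (c + 1)) <= c * S + d" by (simp add: distrib_left)
 finally show "x <= c * S + d" .
qed

section \<open>Transfer to the p-energy and to every time\<close>

context string_solution
begin

definition E :: "real => real" where "E t = energy p \<alpha>2 \<beta>1 \<mu>1 ut ux \<eta>1 \<eta>2 \<zeta> t"
definition I :: "real => real" where "I t = (LINT x|lebesgue_on {0<..<1}. \<bar>ut t x\<bar> powr p) + (LINT x|lebesgue_on {0<..<1}. \<bar>ux t x\<bar> powr p)"
definition B :: "real => real" where
 "B t = 1 / (p * \<beta>1) * \<bar>\<eta>1 t\<bar> powr p + \<alpha>2 / (p * \<beta>1) * \<bar>\<eta>2 t\<bar> powr p + 1 / (p * \<mu>1) * \<bar>\<zeta> t\<bar> powr p"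

lemma E_eq: assumes "0 <= t" shows "E t = I t / p + B t"
 using curves_Lp[OF assms] by (simp add: E_def energy_def I_def B_def Lp_def)

lemma I_nonneg: "0 <= I t" unfolding I_def by (intro add_nonneg_nonneg integral_nonneg_AE AE_I2) auto

lemma B_terms:
 shows "0 <= 1 / (p * \<beta>1) * \<bar>\<eta>1 t\<bar> powr p" "0 <= \<alpha>2 / (p * \<beta>1) * \<bar>\<eta>2 t\<bar> powr p" "0 <= 1 / (p * \<mu>1) * \<bar>\<zeta> t\<bar> powr p"
 using p1 sp.coeff_pos by auto

lemma B_nonneg: "0 <= B t" unfolding B_def using B_terms[of t] by simp

lemma E_nonneg: "0 <= t ==> 0 <= E t" using E_eq[of t] I_nonneg[of t] B_nonneg[of t] p1 by simp

lemma E_bounds: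
 assumes t: "0 <= t" and L: "E t <= L"
 shows "I t <= p * L" "\<bar>\<eta>1 t\<bar> powr p <= p * \<beta>1 * L" "\<alpha>2 * \<bar>\<eta>2 t\<bar> powr p <= p * \<beta>1 * L" "\<bar>\<zeta> t\<bar> powr p <= p * \<mu>1 * L"
proof -
 have "I t / p <= L" "1 / (p * \<beta>1) * \<bar>\<eta>1 t\<bar> powr p <= L" "\<alpha>2 / (p * \<beta>1) * \<bar>\<eta>2 t\<bar> powr p <= L" "1 / (p * \<mu>1) * \<bar>\<zeta> t\<bar> powr p <= L"
  using L E_eq[OF t] B_terms[of t] I_nonneg[of t] p1 by (auto simp: B_def intro: order_trans[rotated])
 then show "I t <= p * L" "\<bar>\<eta>1 t\<bar> powr p <= p * \<beta>1 * L" "\<alpha>2 * \<bar>\<eta>2 t\<bar> powr p <= p * \<beta>1 * L" "\<bar>\<zeta> t\<bar> powr p <= p * \<mu>1 * L"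
  using p1 sp.coeff_pos by (auto simp: field_simps)
qed

text \<open>The good times at which moreover the curves \<open>ut\<close> and \<open>ux\<close>
  agree almost everywhere in \<open>x\<close> with their joint Borel versions, so that the p-energy
  can be computed from the two families.\<close>

definition nice :: "real => bool" where
 "nice t \<longleftrightarrow> 0 < t \<and> ds.good t \<and> (AEL x. 0 < x --> x < 1 --> ut t x = v0 t x) \<and>
  (AEL x. 0 < x --> x < 1 --> ux t x = vx t x)"

lemma nice_between: assumes "0 <= c" "c < d" obtains t where "nice t" "c < t" "t < d"
proof -
 have "AEL t. 0 < t --> nice t"
  using ds.AE_good t.f_AE x.f_AE by eventually_elim (auto simp: nice_def)
 then have "AEL t. c < t --> nice t" by eventually_elim (use assms in auto)
 from AE_exists_between[OF this] show ?thesis using that assms by auto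
qed

lemma nice_integrals:
 assumes "nice t"
 shows "I t = (LBINT x. \<bar>v0 t x\<bar> powr p) + (LBINT x. \<bar>vx t x\<bar> powr p)"
  "integrable lborel (\<lambda>x. \<bar>v0 t x\<bar> powr p)" "integrable lborel (\<lambda>x. \<bar>vx t x\<bar> powr p)"
proof -
 have n: "0 < t" "AEL x. 0 < x --> x < 1 --> ut t x = v0 t x" "AEL x. 0 < x --> x < 1 --> ux t x = vx t x"
  using assms by (auto simp: nice_def)
 note a = t.power_slice[OF n(1,2)] and b = x.power_slice[OF n(1,3)]
 show "integrable lborel (\<lambda>x. \<bar>v0 t x\<bar> powr p)" "integrable lborel (\<lambda>x. \<bar>vx t x\<bar> powr p)" by (rule a(2), rule b(2))
 have nn: "0 <= (LBINT x. \<bar>v0 t x\<bar> powr p)" "0 <= (LBINT x. \<bar>vx t x\<bar> powr p)"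
  "0 <= (LINT x|lebesgue_on {0<..<1}. \<bar>ut t x\<bar> powr p)" "0 <= (LINT x|lebesgue_on {0<..<1}. \<bar>ux t x\<bar> powr p)"
  by (auto intro!: integral_nonneg_AE)
 have "(NBINT x. ennreal (\<bar>v0 t x\<bar> powr p)) = ennreal (LBINT x. \<bar>v0 t x\<bar> powr p)"
  "(NBINT x. ennreal (\<bar>vx t x\<bar> powr p)) = ennreal (LBINT x. \<bar>vx t x\<bar> powr p)"
  using a(2) b(2) by (auto intro!: nn_integral_eq_integral)
 with a(1) b(1) nn show "I t = (LBINT x. \<bar>v0 t x\<bar> powr p) + (LBINT x. \<bar>vx t x\<bar> powr p)" by (simp add: I_def)
qed

lemma nice_state_power:
 assumes "nice t"
 shows "ds.state_power p t <= ennreal (2 * 2 powr p * I t)" "ennreal (I t) <= 2 * ds.state_power p t"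
proof -
 note n = nice_integrals[OF assms] and [simp del] = ennreal_plus
 have half: "\<bar>y\<bar> powr p <= \<bar>c\<bar> powr p + \<bar>d\<bar> powr p" if "2 * y = c + d" for y c d :: real
 proof -
  have "\<bar>y\<bar> <= \<bar>c\<bar> / 2 + \<bar>d\<bar> / 2" using that by simp
  then have "\<bar>y\<bar> powr p <= (\<bar>c\<bar> / 2 + \<bar>d\<bar> / 2) powr p" using p1 by (intro powr_mono2) auto
  also have "... <= 2 powr p * ((\<bar>c\<bar> / 2) powr p + (\<bar>d\<bar> / 2) powr p)" using p1 by (intro powr_add_le) auto
  finally show ?thesis by (simp add: powr_divide distrib_left)
 qed
 have sum: "\<bar>y\<bar> powr p <= 2 powr p * (\<bar>c\<bar> powr p + \<bar>d\<bar> powr p)" if "y = c + d \<or> y = c - d" for y c d :: real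
 proof -
  have "\<bar>y\<bar> powr p <= (\<bar>c\<bar> + \<bar>d\<bar>) powr p" using p1 that by (intro powr_mono2) auto
  also have "... <= 2 powr p * (\<bar>c\<bar> powr p + \<bar>d\<bar> powr p)" using p1 by (intro powr_add_le) auto
  finally show ?thesis .
 qed
 have drop: "ind {0<..<1} x * ennreal (\<bar>r t x\<bar> powr p) = ennreal (\<bar>r t x\<bar> powr p)" "ind {0<..<1} x * ennreal (\<bar>v t x\<bar> powr p) = ennreal (\<bar>v t x\<bar> powr p)" for x
  using supp(1,2)[of t x] by (auto simp: indicator_def)
 note [measurable (raw)] = measurable_curried2[OF rv_meas(1)] measurable_curried2[OF rv_meas(2)]
 have SP: "ds.state_power p t = (NBINT x. ennreal (\<bar>r t x\<bar> powr p)) + (NBINT x. ennreal (\<bar>vx t x - v0 t x\<bar> powr p))"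
  unfolding ds.state_power_def drop using nn_integral_reflect_unit[of "\<lambda>x. ennreal (\<bar>vx t x - v0 t x\<bar> powr p)"] by (simp add: v_def)
 have I: "ennreal (I t) = (NBINT x. ennreal (\<bar>v0 t x\<bar> powr p + \<bar>vx t x\<bar> powr p))"
  unfolding n(1) using n(2,3) by (subst nn_integral_eq_integral) auto
 have "ds.state_power p t = (NBINT x. ennreal (\<bar>r t x\<bar> powr p + \<bar>vx t x - v0 t x\<bar> powr p))"
  unfolding SP by (subst nn_integral_add[symmetric]) (auto simp: ennreal_plus)
 note SP' = this
 also have "... <= (NBINT x. ennreal (2 * 2 powr p) * ennreal (\<bar>v0 t x\<bar> powr p + \<bar>vx t x\<bar> powr p))"
 proof (intro nn_integral_mono)
  fix x
  have "\<bar>r t x\<bar> powr p + \<bar>vx t x - v0 t x\<bar> powr p <= 2 * 2 powr p * (\<bar>v0 t x\<bar> powr p + \<bar>vx t x\<bar> powr p)"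
   using sum[of "r t x" "vx t x" "v0 t x"] sum[of "vx t x - v0 t x" "vx t x" "v0 t x"] by (simp add: r_def algebra_simps)
  then show "ennreal (\<bar>r t x\<bar> powr p + \<bar>vx t x - v0 t x\<bar> powr p) <= ennreal (2 * 2 powr p) * ennreal (\<bar>v0 t x\<bar> powr p + \<bar>vx t x\<bar> powr p)"
   by (subst ennreal_mult[symmetric]) (simp_all add: ennreal_leI)
 qed
 also have "... = ennreal (2 * 2 powr p * I t)" by (subst nn_integral_cmult) (auto simp: I[symmetric] ennreal_mult I_nonneg)
 finally show "ds.state_power p t <= ennreal (2 * 2 powr p * I t)" .
 have "ennreal (I t) <= (NBINT x. 2 * ennreal (\<bar>r t x\<bar> powr p + \<bar>vx t x - v0 t x\<bar> powr p))" unfolding I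
 proof (intro nn_integral_mono)
  fix x
  have "\<bar>v0 t x\<bar> powr p + \<bar>vx t x\<bar> powr p <= 2 * (\<bar>r t x\<bar> powr p + \<bar>vx t x - v0 t x\<bar> powr p)"
   using half[of "v0 t x" "r t x" "- (vx t x - v0 t x)"] half[of "vx t x" "r t x" "vx t x - v0 t x"] unfolding abs_minus_cancel by (simp add: r_def)
  from ennreal_leI[OF this] show "ennreal (\<bar>v0 t x\<bar> powr p + \<bar>vx t x\<bar> powr p) <= 2 * ennreal (\<bar>r t x\<bar> powr p + \<bar>vx t x - v0 t x\<bar> powr p)"
   by (simp only: ennreal_mult' zero_le_numeral ennreal_numeral)
 qed
 also have "... = 2 * ds.state_power p t" unfolding SP' by (subst nn_integral_cmult) auto
 finally show "ennreal (I t) <= 2 * ds.state_power p t" .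
qed

text \<open>The four summands bound, in units of \<open>l^2\<close>, the integral part of the
  quadratic energy and its three boundary terms in \<open>nice_e_le\<close>.\<close>

definition C0 :: real where
 "C0 = (2 + p) / 2 + (1 + p * \<beta>1) / (2 * \<beta>1) + (\<alpha>2 + p * \<beta>1) / (2 * \<beta>1) + (1 + p * \<mu>1) / (2 * \<mu>1)"

lemma C0_pos: "0 < C0" unfolding C0_def using p1 sp.coeff_pos by (intro add_pos_pos divide_pos_pos) auto

text \<open>Both sides scale like the energy; interpolating at the level \<open>l\<close> with \<open>l\<^sup>p > E t\<close> replaces Jensen's inequality.\<close>

lemma nice_e_le:
 assumes t: "nice t"
 shows "ds.e t powr (p / 2) <= C0 powr (p / 2) * E t"
proof (rule le_mult_dense)
 have t0: "0 <= t" using t by (simp add: nice_def)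
 then show "0 <= E t" by (rule E_nonneg)
 fix L assume L: "E t < L"
 then have Lpos: "0 < L" using \<open>0 <= E t\<close> by simp
 define l where "l = L powr (1 / p)"
 have l: "0 < l" "l powr p = L" using Lpos p1 by (auto simp: l_def powr_powr)
 have l2: "l powr (2 - p) * L = l^2" using l by (simp flip: l(2) powr_add)
 have sq: "y^2 <= l^2 + l powr (2 - p) * \<bar>y\<bar> powr p" for y
  using powr_interpolation[of l 2 p y] l p1 by simp
 have sqb: "c * y^2 <= l^2 * (c + d)" if "c * \<bar>y\<bar> powr p <= d * L" "0 <= c" for c d y
 proof -
  have "c * y^2 <= c * l^2 + l powr (2 - p) * (c * \<bar>y\<bar> powr p)" using mult_left_mono[OF sq that(2), of y] by (simp add: algebra_simps)
  also have "l powr (2 - p) * (c * \<bar>y\<bar> powr p) <= l powr (2 - p) * (d * L)" using that by (intro mult_left_mono) auto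
  also have "... = d * l^2" using l2 by (simp add: mult_ac)
  finally show ?thesis by (simp add: algebra_simps)
 qed
 note n = nice_integrals[OF t] and bd = E_bounds[OF t0 less_imp_le[OF L]]
 have sq1: "integrable lborel (\<lambda>x. ind {0<..<1} x * l^2 + l powr (2 - p) * (\<bar>v0 t x\<bar> powr p + \<bar>vx t x\<bar> powr p) + ind {0<..<1} x * l^2)"
  using n by (intro integrable_add integrable_mult_right integrable_mult_left) auto
 have pt: "(v0 t x)^2 + (vx t x)^2 <= ind {0<..<1} x * l^2 + l powr (2 - p) * (\<bar>v0 t x\<bar> powr p + \<bar>vx t x\<bar> powr p) + ind {0<..<1} x * l^2" for x
  using sq[of "v0 t x"] sq[of "vx t x"] t.w_supp[of t x] x.w_supp[of t x] by (cases "0 < x \<and> x < 1") (auto simp: indicator_def algebra_simps)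
 have i: "integrable lborel (\<lambda>x. (v0 t x)^2 + (vx t x)^2)"
  by (rule integrable_bound[OF sq1]) (use pt in \<open>auto intro!: AE_I2 order_trans[OF _ abs_ge_self]\<close>)
 have "(LBINT x. (v0 t x)^2 + (vx t x)^2) <= (LBINT x. ind {0<..<1} x * l^2 + l powr (2 - p) * (\<bar>v0 t x\<bar> powr p + \<bar>vx t x\<bar> powr p) + ind {0<..<1} x * l^2)"
  by (rule integral_mono[OF i sq1 pt])
 also have "... = 2 * l^2 + l powr (2 - p) * I t" using n by simp
 also have "l powr (2 - p) * I t <= l powr (2 - p) * (p * L)" using bd(1) by (intro mult_left_mono) auto
 also have "... = p * l^2" using l2 by (simp add: mult_ac)
 finally have sum2: "(LBINT x. (v0 t x)^2 + (vx t x)^2) <= l^2 * (2 + p)" by (simp add: algebra_simps)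
 note [measurable (raw)] = measurable_curried2[OF rv_meas(1)] measurable_curried2[OF rv_meas(2)]
 have ir: "integrable lborel (\<lambda>x. (vx t x + v0 t x)^2)" "integrable lborel (\<lambda>x. (vx t x - v0 t x)^2)"
  by (rule integrable_bound[OF integrable_mult_right[OF i, of 2]];
    use sq_bounds in \<open>auto intro!: AE_I2 simp: algebra_simps\<close>)+
 have "(LBINT x. (r t x)^2) + (LBINT x. (v t x)^2) = (LBINT x. (vx t x + v0 t x)^2) + (LBINT x. (vx t x - v0 t x)^2)"
  using integral_reflect_unit[of "\<lambda>x. (vx t x - v0 t x)^2"] by (simp add: r_def v_def)
 also have "... = (LBINT x. (vx t x + v0 t x)^2 + (vx t x - v0 t x)^2)" using ir by simp
 also have "... = (LBINT x. 2 * ((v0 t x)^2 + (vx t x)^2))"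
  by (intro integral_cong) (auto simp: power2_sum power2_diff)
 also have "... = 2 * (LBINT x. (v0 t x)^2 + (vx t x)^2)" by (rule integral_mult_right_zero)
 also have "... <= 2 * (l^2 * (2 + p))" using sum2 by simp
 finally have 1: "1 / 4 * ((LBINT x. (r t x)^2) + (LBINT x. (v t x)^2)) <= l^2 * ((2 + p) / 2)" by simp
 have 2: "(\<eta>1 t)^2 / (2 * \<beta>1) <= l^2 * ((1 + p * \<beta>1) / (2 * \<beta>1))"
  using divide_right_mono[OF sqb[of 1 "\<eta>1 t" "p * \<beta>1"], of "2 * \<beta>1"] bd(2) sp.coeff_pos by simp
 have 3: "\<alpha>2 * (\<eta>2 t)^2 / (2 * \<beta>1) <= l^2 * ((\<alpha>2 + p * \<beta>1) / (2 * \<beta>1))"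
  using divide_right_mono[OF sqb[of \<alpha>2 "\<eta>2 t" "p * \<beta>1"], of "2 * \<beta>1"] bd(3) sp.coeff_pos by simp
 have 4: "(\<zeta> t)^2 / (2 * \<mu>1) <= l^2 * ((1 + p * \<mu>1) / (2 * \<mu>1))"
  using divide_right_mono[OF sqb[of 1 "\<zeta> t" "p * \<mu>1"], of "2 * \<mu>1"] bd(4) sp.coeff_pos by simp
 have "ds.e t <= C0 * l^2" unfolding ds.e_def C0_def using 1 2 3 4 by (simp only: distrib_left distrib_right mult.commute[of _ "l^2"])
 then have "ds.e t powr (p / 2) <= (C0 * l^2) powr (p / 2)" using p1 ds.e_nonneg by (intro powr_mono2) auto
 also have "... = C0 powr (p / 2) * (l powr 2) powr (p / 2)" using C0_pos l by (simp add: powr_mult)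
 also have "(l powr 2) powr (p / 2) = L" using l by (simp only: powr_powr) simp
 finally show "ds.e t powr (p / 2) <= C0 powr (p / 2) * L" .
qed simp

definition C2 :: real where
 "C2 = 1 / (p * \<beta>1) * (2 * \<beta>1) powr (p / 2) + \<alpha>2 / (p * \<beta>1) * (2 * \<beta>1 / \<alpha>2) powr (p / 2) + 1 / (p * \<mu>1) * (2 * \<mu>1) powr (p / 2)"

lemma C2_nonneg: "0 <= C2" unfolding C2_def using p1 sp.coeff_pos by (intro add_nonneg_nonneg mult_nonneg_nonneg) auto

text \<open>The boundary variables are numbers, so their p-th powers are powers \<open>p / 2\<close>
  of terms of the quadratic energy. They inherit its decay directly; only the integral part of the
  p-energy needs the transport argument.\<close>

lemma B_le_e: "B t <= C2 * ds.e t powr (p / 2)"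
proof -
 have nn: "0 <= 1 / 4 * ((LBINT x. (r t x)^2) + (LBINT x. (v t x)^2))" "0 <= (\<eta>1 t)^2 / (2 * \<beta>1)" "0 <= \<alpha>2 * (\<eta>2 t)^2 / (2 * \<beta>1)" "0 <= (\<zeta> t)^2 / (2 * \<mu>1)"
  using sp.coeff_pos by auto
 have *: "\<bar>y\<bar> powr p <= c powr (p / 2) * ds.e t powr (p / 2)" if "y^2 <= c * ds.e t" "0 <= c" for y c
 proof -
  have "\<bar>y\<bar> powr p = (\<bar>y\<bar> powr 2) powr (p / 2)" by (simp only: powr_powr) simp
  also have "... = (y^2) powr (p / 2)" by simp
  also have "... <= (c * ds.e t) powr (p / 2)" using that p1 by (intro powr_mono2) auto
  finally show ?thesis using that ds.e_nonneg by (simp add: powr_mult)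
 qed
 have "(\<eta>1 t)^2 / (2 * \<beta>1) <= ds.e t" "\<alpha>2 * (\<eta>2 t)^2 / (2 * \<beta>1) <= ds.e t" "(\<zeta> t)^2 / (2 * \<mu>1) <= ds.e t"
  unfolding ds.e_def using nn by linarith+
 then have "(\<eta>1 t)^2 <= 2 * \<beta>1 * ds.e t" "(\<eta>2 t)^2 <= 2 * \<beta>1 / \<alpha>2 * ds.e t" "(\<zeta> t)^2 <= 2 * \<mu>1 * ds.e t"
  using sp.coeff_pos by (auto simp: field_simps)
 note b = this[THEN *]
 have "B t <= 1 / (p * \<beta>1) * ((2 * \<beta>1) powr (p / 2) * ds.e t powr (p / 2)) +
   \<alpha>2 / (p * \<beta>1) * ((2 * \<beta>1 / \<alpha>2) powr (p / 2) * ds.e t powr (p / 2)) + 1 / (p * \<mu>1) * ((2 * \<mu>1) powr (p / 2) * ds.e t powr (p / 2))"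
  unfolding B_def using b sp.coeff_pos p1 by (intro add_mono mult_left_mono) auto
 then show ?thesis by (simp add: C2_def algebra_simps)
qed

definition C3 :: real where
 "C3 = 2 * (ds.c5 p * (2 * 2 powr p * p + C0 powr (p / 2))) / p + C2 * (2 powr (p / 2) * C0 powr (p / 2))"

lemma C3_pos: "0 < C3"
 unfolding C3_def using ds.constants_nonneg(5)[OF p1(1)] C0_pos C2_nonneg p1
 by (intro add_pos_nonneg divide_pos_pos mult_pos_pos mult_nonneg_nonneg) (auto intro!: add_pos_pos)

lemma nice_decay:
 assumes t0: "nice t0" and t: "nice t" and le: "t0 <= t"
 shows "E t <= C3 * exp (- ds.nu p * (t - t0)) * E t0"
proof -
 define x where "x = exp (- ds.nu p * (t - t0))"
 have g: "ds.good t0" "ds.good t" "0 <= t0" "0 <= t" using t0 t by (auto simp: nice_def)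
 have x: "0 < x" by (simp add: x_def)
 have E0: "0 <= E t0" using g by (intro E_nonneg)
 have c5: "0 < ds.c5 p" by (rule ds.constants_nonneg(5)[OF p1(1)])
 have I0: "I t0 <= p * E t0" by (rule E_bounds(1)[OF g(3) order_refl])
 have e0: "ds.e t0 powr (p / 2) <= C0 powr (p / 2) * E t0" by (rule nice_e_le[OF t0])
 have "ennreal (I t) <= 2 * ds.state_power p t" by (rule nice_state_power(2)[OF t])
 also have "... <= 2 * (ennreal (ds.c5 p * x) * (ds.state_power p t0 + ennreal (ds.e t0 powr (p / 2))))"
  unfolding x_def by (intro mult_left_mono ds.state_power_decay[OF g(1,2) le p1(1)]) simp
 also have "... <= 2 * (ennreal (ds.c5 p * x) * (ennreal (2 * 2 powr p * (p * E t0)) + ennreal (C0 powr (p / 2) * E t0)))"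
  using I0 e0 by (intro mult_left_mono add_mono order_trans[OF nice_state_power(1)[OF t0]] ennreal_leI) auto
 also have "... = ennreal (2 * (ds.c5 p * x * (2 * 2 powr p * (p * E t0) + C0 powr (p / 2) * E t0)))"
  using c5 x E0 p1 by (simp add: ennreal_mult' ennreal_plus flip: ennreal_numeral)
 finally have It: "I t <= 2 * (ds.c5 p * x * (2 * 2 powr p * (p * E t0) + C0 powr (p / 2) * E t0))"
  using c5 x E0 p1 by (subst (asm) ennreal_le_iff) auto
 have "B t <= C2 * ds.e t powr (p / 2)" by (rule B_le_e)
 also have "... <= C2 * (2 powr (p / 2) * x * ds.e t0 powr (p / 2))"
  unfolding x_def by (intro mult_left_mono C2_nonneg ds.e_power_decay[OF g(1,2) le p1(1)])
 also have "... <= C2 * (2 powr (p / 2) * x * (C0 powr (p / 2) * E t0))"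
  using C2_nonneg x by (intro mult_left_mono e0) auto
 finally have "B t <= C2 * (2 powr (p / 2) * x * (C0 powr (p / 2) * E t0))" .
 then have "E t <= 2 * (ds.c5 p * x * (2 * 2 powr p * (p * E t0) + C0 powr (p / 2) * E t0)) / p + C2 * (2 powr (p / 2) * x * (C0 powr (p / 2) * E t0))"
  using E_eq[OF g(4)] divide_right_mono[OF It, of p] p1 by simp
 also have "... = C3 * x * E t0" using p1 by (simp add: C3_def field_simps)
 finally show ?thesis by (simp add: x_def)
qed

text \<open>The boundary part is continuous in time. The integral part of one time is compared with
  that of the other up to the factor \<open>2 powr p\<close>, with the \<open>L^p\<close> distance
  of the states as the error.\<close>

lemma E_nearby:
 assumes t: "0 <= t" and d: "0 < d"
 shows "eventually (\<lambda>s. E s <= 2 powr p * E t + d \<and> E t <= 2 powr p * E s + d) (at t within {0..})"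
proof -
 let ?L = "lebesgue_on {0<..<1::real}"
 define D where "D s = (LINT x|?L. \<bar>ut s x - ut t x\<bar> powr p) + (LINT x|?L. \<bar>ux s x - ux t x\<bar> powr p)" for s
 have "((\<lambda>s. 2 powr p * D s / p) \<longlongrightarrow> 2 powr p * (0 + 0) / p) (at t within {0..})" unfolding D_def
  using curves t p1 by (intro tendsto_intros Lp_norm_tendsto_power) (auto simp: Lp_continuous_on_def)
 then have "eventually (\<lambda>s. 2 powr p * D s / p < d / 2) (at t within {0..})" by (rule order_tendstoD) (use d in auto)
 moreover have "(B \<longlongrightarrow> B t) (at t within {0..})" unfolding B_def[abs_def]
  using eta_cont t p1 by (intro tendsto_intros tendsto_powr' tendsto_rabs) (auto simp: continuous_on_def)
 then have "eventually (\<lambda>s. dist (B s) (B t) < d / 2) (at t within {0..})" by (rule tendstoD) (use d in simp)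
 moreover have "eventually (\<lambda>s. s \<in> {0..}) (at t within {0..})" by (simp add: eventually_at_filter)
 ultimately show ?thesis
 proof eventually_elim
  case (elim s)
  have le: "E s <= 2 powr p * E t + d" if D: "2 powr p * D / p < d / 2" and b: "\<bar>B s - B t\<bar> < d / 2" and st: "0 <= s" "0 <= t"
   and D_def: "D = (LINT x|?L. \<bar>ut s x - ut t x\<bar> powr p) + (LINT x|?L. \<bar>ux s x - ux t x\<bar> powr p)" for s t D
  proof -
   have "I s <= 2 powr p * (I t + D)" unfolding I_def D_def
    using Lp_power_le_shift[OF curves_Lp(2)[OF st(1)] curves_Lp(2)[OF st(2)] p1(3)]
     Lp_power_le_shift[OF curves_Lp(3)[OF st(1)] curves_Lp(3)[OF st(2)] p1(3)] by (simp add: algebra_simps)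
   then have "I s / p <= 2 powr p * (I t + D) / p" using p1 by (intro divide_right_mono) auto
   moreover have "B t <= 2 powr p * B t" using B_nonneg[of t] p1 by (simp add: mult_le_cancel_right1 ge_one_powr_ge_zero)
   ultimately show ?thesis unfolding E_eq[OF st(1)] E_eq[OF st(2)] using D b[unfolded abs_less_iff] by (simp only: distrib_left add_divide_distrib times_divide_eq_right) linarith
  qed
  have s: "0 <= s" using elim by simp
  have "D s = (LINT x|?L. \<bar>ut t x - ut s x\<bar> powr p) + (LINT x|?L. \<bar>ux t x - ux s x\<bar> powr p)" by (simp add: D_def abs_minus_commute)
  with le[of "D s" s t] le[of "D s" t s] elim s t show ?case by (simp add: D_def dist_real_def abs_minus_commute)
 qed
qed

lemma E_nearby_right:
 assumes t: "0 <= t" and d: "0 < d"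
 obtains c where "0 < c" "\<And>s. t < s ==> s < t + c ==> E s <= 2 powr p * E t + d \<and> E t <= 2 powr p * E s + d"
proof -
 obtain c where c: "0 < c" "\<And>s. s \<in> {0..} ==> s \<noteq> t ==> dist s t < c ==> E s <= 2 powr p * E t + d \<and> E t <= 2 powr p * E s + d"
  using E_nearby[OF t d] unfolding eventually_at by auto
 show ?thesis using c t by (intro that[of c]) (auto simp: dist_real_def)
qed

text \<open>The estimate between nice times \<open>s0\<close> near 0 and \<open>s\<close> near
  \<open>t\<close>, with one factor \<open>2 powr p\<close> lost at each end. The factor
  \<open>exp (ds.nu p)\<close> pays for starting at \<open>s0 < 1\<close> instead of 0.\<close>

lemma energy_decay:
 assumes t: "0 <= t"
 shows "E t <= 2 powr p * 2 powr p * C3 * exp (ds.nu p) * exp (- ds.nu p * t) * E 0"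
proof -
 define X where "X = C3 * (exp (ds.nu p) * exp (- ds.nu p * t))"
 have X: "0 <= X" using C3_pos by (simp add: X_def)
 have "E t <= 2 powr p * X * (2 powr p * E 0)"
 proof (rule field_le_epsilon)
  fix d :: real assume "0 < d"
  \<comment> \<open>The error enters once at time \<open>t\<close>, and once at time 0 amplified by
    \<open>2 powr p * X\<close>; this choice makes the total equal to \<open>d\<close>.\<close>
  define d' where "d' = d / (1 + 2 powr p * X)"
  have d'1: "0 < 1 + 2 powr p * X" using X by (simp add: add_pos_nonneg)
  have d': "0 < d'" using \<open>0 < d\<close> d'1 by (simp add: d'_def)
  have "d' * (1 + 2 powr p * X) = d" using d'1 by (simp add: d'_def)
  then have d'd: "2 powr p * X * d' + d' = d" by (simp add: algebra_simps)
  obtain c where c: "0 < c" "\<And>s. t < s ==> s < t + c ==> E s <= 2 powr p * E t + d' \<and> E t <= 2 powr p * E s + d'"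
   by (rule E_nearby_right[OF t d']) blast
  obtain c0 where c0: "0 < c0" "\<And>s. 0 < s ==> s < 0 + c0 ==> E s <= 2 powr p * E 0 + d' \<and> E 0 <= 2 powr p * E s + d'"
   by (rule E_nearby_right[OF order_refl d']) blast
  obtain s where s: "nice s" "t < s" "s < t + c" using nice_between[of t "t + c"] t c(1) by auto
  obtain s0 where s0: "nice s0" "0 < s0" "s0 < min (min c0 1) s" using nice_between[of 0 "min (min c0 1) s"] t c0(1) s by auto
  have "ds.nu p * t - ds.nu p <= ds.nu p * (s - s0)"
   using mult_left_mono[of "t - 1" "s - s0" "ds.nu p"] s s0 ds.nu_pos[OF p1(1)] by (simp add: algebra_simps)
  then have "exp (- ds.nu p * (s - s0)) <= exp (ds.nu p) * exp (- ds.nu p * t)" by (simp flip: exp_add)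
  then have "C3 * exp (- ds.nu p * (s - s0)) * E s0 <= X * E s0"
   unfolding X_def using C3_pos E_nonneg[of s0] s0 by (intro mult_right_mono mult_left_mono) auto
  with nice_decay[OF s0(1) s(1)] s0 have "E s <= X * E s0" by simp
  also have "... <= X * (2 powr p * E 0 + d')" using c0(2)[of s0] s0 X by (intro mult_left_mono) auto
  finally have "2 powr p * E s <= 2 powr p * (X * (2 powr p * E 0 + d'))" by simp
  moreover have "E t <= 2 powr p * E s + d'" using c(2)[of s] s by simp
  ultimately show "E t <= 2 powr p * X * (2 powr p * E 0) + d" using d'd by (simp add: algebra_simps)
 qed
 then show ?thesis by (simp add: X_def mult_ac)
qed

text \<open>The trace of u_t at \<open>x = 1\<close> is \<eta>1, the derivative of \<eta>2, so
  \<open>u t 1 - \<eta>2 t\<close> is constant in time and equals the limit value. The deviation at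
  \<open>x\<close> is thus \<eta>2 plus an increment of \<open>u t\<close> between 1 and
  \<open>x\<close>, and both are bounded by the energy at the same time.\<close>

lemma displacement_bound:
 assumes t: "0 <= t" and x: "0 <= x" "x <= 1"
 shows "\<bar>u t x - (u 0 1 - \<eta>2 0)\<bar> powr p <= 2 powr p * ((1 + p) powr p + p * \<beta>1 / \<alpha>2) * E t"
proof -
 define N where "N = (LINT s|lebesgue_on {0<..<1}. \<bar>ux t s\<bar>)"
 have N0: "0 <= N" unfolding N_def by (intro integral_nonneg_AE) auto
 have "u t 1 - u 0 1 = (LINT s|lebesgue_on {0<..<t}. Ut 1 s)" by (rule u_time) (use t in auto)
 also have "... = (LBINT s. ind {0<..<t} s * \<eta>1 s)"
  by (rule lebesgue_on_integral_borel_AE) (use Ut1 in \<open>auto elim!: eventually_mono\<close>)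
 also have "... = \<eta>2 t - \<eta>2 0" using eta_diff(2)[OF order_refl t] by simp
 finally have "\<bar>u t x - (u 0 1 - \<eta>2 0)\<bar> <= N + \<bar>\<eta>2 t\<bar>"
  using u_spatial_oscillation[OF t, of 1 x] x by (simp add: N_def)
 then have "\<bar>u t x - (u 0 1 - \<eta>2 0)\<bar> powr p <= (N + \<bar>\<eta>2 t\<bar>) powr p" using p1 by (intro powr_mono2) auto
 also have "... <= 2 powr p * (N powr p + \<bar>\<eta>2 t\<bar> powr p)" using N0 p1 by (intro powr_add_le) auto
 finally have le: "\<bar>u t x - (u 0 1 - \<eta>2 0)\<bar> powr p <= 2 powr p * (N powr p + \<bar>\<eta>2 t\<bar> powr p)" .
 have "N powr p <= (1 + p) powr p * E t"
 proof (rule le_mult_dense)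
  show "0 <= E t" by (rule E_nonneg[OF t])
  fix L assume L: "E t < L"
  then have Lpos: "0 < L" using \<open>0 <= E t\<close> by simp
  define l where "l = L powr (1 / p)"
  have l: "0 < l" "l powr p = L" using Lpos p1 by (auto simp: l_def powr_powr)
  have fin: "finite_measure (lebesgue_on {0<..<1::real})" by (intro finite_measureI) (simp add: emeasure_restrict_space)
  have m: "measure (lebesgue_on {0<..<1::real}) {0<..<1} = 1" by (simp add: measure_restrict_space)
  have Lux: "Lp p {0<..<1} (ux t)" by (rule curves_Lp(3)[OF t])
  have ci: "integrable (lebesgue_on {0<..<1}) (\<lambda>s::real. l)" using fin by (rule finite_measure.integrable_const)
  have "N <= (LINT s|lebesgue_on {0<..<1}. l + l powr (1 - p) * \<bar>ux t s\<bar> powr p)" unfolding N_def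
   using curves_integrable(3)[OF t] Lux ci powr_interpolation[of l 1 p] l(1) p1 by (intro integral_mono) (auto simp: Lp_def)
  also have "... = l + l powr (1 - p) * (LINT s|lebesgue_on {0<..<1}. \<bar>ux t s\<bar> powr p)"
   using Lux ci m by (subst integral_add) (auto simp: Lp_def)
  also have "(LINT s|lebesgue_on {0<..<1}. \<bar>ux t s\<bar> powr p) <= I t" unfolding I_def by (simp add: integral_nonneg_AE)
  also have "I t <= p * L" by (rule E_bounds(1)[OF t less_imp_le[OF L]])
  finally have "N <= l + l powr (1 - p) * (p * L)" using l by (simp add: mult_left_mono)
  also have "l powr (1 - p) * (p * L) = p * l" using l by (simp flip: l(2) powr_add add: mult.left_commute)
  finally have "N <= (1 + p) * l" by (simp add: algebra_simps)
  then have "N powr p <= ((1 + p) * l) powr p" using N0 p1 by (intro powr_mono2) auto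
  then show "N powr p <= (1 + p) powr p * L" using l p1 by (simp add: powr_mult)
 qed simp
 moreover have "\<bar>\<eta>2 t\<bar> powr p <= p * \<beta>1 / \<alpha>2 * E t" using E_bounds(3)[OF t order_refl] sp.coeff_pos by (simp add: field_simps)
 ultimately have "2 powr p * (N powr p + \<bar>\<eta>2 t\<bar> powr p) <= 2 powr p * (((1 + p) powr p + p * \<beta>1 / \<alpha>2) * E t)"
  by (intro mult_left_mono) (auto simp: distrib_right)
 from order_trans[OF le this] show ?thesis by (simp add: mult.assoc)
qed

end

context string_solution
begin

definition decay_const :: real where
 "decay_const = 2 powr p * 2 powr p * C3 * exp (ds.nu p) * (1 + 2 powr p * ((1 + p) powr p + p * \<beta>1 / \<alpha>2))"

lemma decay:
 shows "0 < decay_const" "0 < ds.nu p"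
  and "0 <= t ==> E t <= decay_const * exp (- ds.nu p * t) * E 0"
  and "0 <= t ==> (SUP x\<in>{0..1}. \<bar>u t x - (u 0 1 - \<eta>2 0)\<bar> powr p) <= decay_const * E 0 * exp (- ds.nu p * t)"
proof -
 define Q where "Q = 2 powr p * ((1 + p) powr p + p * \<beta>1 / \<alpha>2)"
 have Q: "0 <= Q" unfolding Q_def using p1 sp.coeff_pos by (intro mult_nonneg_nonneg add_nonneg_nonneg) auto
 define c where "c = 2 powr p * 2 powr p * C3 * exp (ds.nu p)"
 have c: "0 < c" using C3_pos p1 by (simp add: c_def)
 have dc: "decay_const = c * (1 + Q)" by (simp add: decay_const_def c_def Q_def)
 show "0 < decay_const" unfolding dc using c Q by simp
 show "0 < ds.nu p" by (rule ds.nu_pos[OF p1(1)])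
 assume t: "0 <= t"
 define y where "y = c * exp (- ds.nu p * t) * E 0"
 have E: "E t <= y" using energy_decay[OF t] by (simp add: c_def y_def)
 have y: "0 <= y" using E E_nonneg[OF t] by simp
 have eq: "decay_const * exp (- ds.nu p * t) * E 0 = y + Q * y" by (simp add: dc y_def algebra_simps)
 show "E t <= decay_const * exp (- ds.nu p * t) * E 0" unfolding eq using E mult_nonneg_nonneg[OF Q y] by simp
 have "(SUP x\<in>{0..1}. \<bar>u t x - (u 0 1 - \<eta>2 0)\<bar> powr p) <= Q * E t"
  by (rule cSUP_least) (use displacement_bound[OF t] in \<open>auto simp: Q_def\<close>)
 also have "... <= y + Q * y" using mult_left_mono[OF E Q] y by simp
 finally show "(SUP x\<in>{0..1}. \<bar>u t x - (u 0 1 - \<eta>2 0)\<bar> powr p) <= decay_const * E 0 * exp (- ds.nu p * t)"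
  by (simp add: eq[symmetric] mult_ac)
qed

end

section \<open>Choice of the damping data and conclusion\<close>

lemma damping_representative:
 assumes A2: "assumption_A2 q" and A3: "assumption_A3 \<alpha>1 \<alpha>2 \<beta>1 \<gamma>1 \<mu>1"
 obtains k a b K where "string_parameters k a b K \<alpha>1 \<alpha>2 \<beta>1 \<gamma>1 \<mu>1" "AEL x. 0 < x --> x < 1 --> q x = 2 * k x"
proof -
 obtain a b q_lo q_up where ab: "0 <= a" "a < b" "b <= 1" "0 < q_lo" and omega: "AE x in lebesgue_on {a<..<b}. q_lo <= q x \<and> q x <= q_up"
  using A2 unfolding assumption_A2_def by blast
 obtain C where q: "q \<in> borel_measurable (lebesgue_on {0<..<1})" "AE x in lebesgue_on {0<..<1}. \<bar>q x\<bar> <= C" "AE x in lebesgue_on {0<..<1}. 0 <= q x"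
  using A2 by (auto simp: assumption_A2_def Linf_def)
 obtain q' where q': "borel_fun q'" "AEL x. x \<in> {0<..<1} --> q x = q' x"
  by (rule lebesgue_on_borel_representative[OF q(1)]) auto
 note [measurable] = q'(1)
 have ae: "AEL x. x \<in> {0<..<1} --> \<bar>q x\<bar> <= C" "AEL x. x \<in> {0<..<1} --> 0 <= q x"
   "AEL x. x \<in> {a<..<b} --> q_lo <= q x \<and> q x <= q_up"
  using q(2,3) omega by (simp_all only: AE_lebesgue_on_iff borel_open open_greaterThanLessThan)
 define C' where "C' = max C q_lo"
 define lo where "lo x = (if a < x \<and> x < b then q_lo else 0)" for x
 define k where "k x = (if 0 < x \<and> x < 1 then max (lo x) (min (q' x) C') / 2 else 0)" for x
 \<comment> \<open>The sum of all quantities that \<open>K\<close> has to dominate, each of them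
   nonnegative. The clipping in \<open>k\<close> makes its bounds valid at every point, although
   those of \<open>q\<close> hold only almost everywhere.\<close>
 define K where "K = 1 + C' + 2 / q_lo + 1 / (b - a) + (\<alpha>1 + \<alpha>2 + \<beta>1 + \<gamma>1 + \<mu>1) + (1 / \<alpha>1 + 1 / \<alpha>2 + 1 / \<beta>1 + 1 / \<gamma>1 + 1 / \<mu>1)"
 have pos: "0 < \<alpha>1" "0 < \<alpha>2" "0 < \<beta>1" "0 < \<gamma>1" "0 < \<mu>1" using A3 by (auto simp: assumption_A3_def)
 have inv: "0 < 1 / \<alpha>1" "0 < 1 / \<alpha>2" "0 < 1 / \<beta>1" "0 < 1 / \<gamma>1" "0 < 1 / \<mu>1" "0 < 2 / q_lo" "0 < 1 / (b - a)" "0 < C'"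
  using pos ab by (auto simp: C'_def)
 have lo: "0 <= lo x" "lo x <= C'" for x using ab by (auto simp: lo_def C'_def)
 have ge: "1 <= K * c" if "1 / c <= K" "0 < c" for c using that by (simp add: field_simps)
 have sp: "string_parameters k a b K \<alpha>1 \<alpha>2 \<beta>1 \<gamma>1 \<mu>1"
 proof
  show "borel_fun k" unfolding k_def lo_def by measurable
  show "0 <= k x" for x using lo(1)[of x] by (auto simp: k_def)
  show "k x <= K" for x
  proof -
   have "k x <= C'" using lo[of x] inv(8) by (auto simp: k_def)
   then show ?thesis unfolding K_def using inv pos by linarith
  qed
  show "1 <= K * k x" if "a < x" "x < b" for x
  proof -
   have "q_lo / 2 <= k x" using that ab by (auto simp: k_def lo_def)
   then have "1 / k x <= 2 / q_lo" using ab by (simp add: field_simps)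
   also have "... <= K" unfolding K_def using inv pos by linarith
   finally show ?thesis using \<open>q_lo / 2 <= k x\<close> ab by (intro ge) auto
  qed
  have "1 / (b - a) <= K" "1 / \<alpha>1 <= K" "1 / \<alpha>2 <= K" "1 / \<beta>1 <= K" "1 / \<gamma>1 <= K" "1 / \<mu>1 <= K"
   unfolding K_def using inv pos by linarith+
  then show "1 <= K * (b - a)" "1 <= K * \<alpha>1" "1 <= K * \<alpha>2" "1 <= K * \<beta>1" "1 <= K * \<gamma>1" "1 <= K * \<mu>1"
   using ge pos ab by auto
  show "1 <= K" "\<alpha>1 <= K" "\<alpha>2 <= K" "\<beta>1 <= K" "\<gamma>1 <= K" "\<mu>1 <= K" unfolding K_def using inv pos by linarith+
 qed (use ab pos in auto)
 have "AEL x. 0 < x --> x < 1 --> q x = 2 * k x"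
  using q'(2) ae by eventually_elim (auto simp: k_def lo_def C'_def)
 with sp show ?thesis by (rule that)
qed

text \<open>A weak solution says nothing about its boundary variables at negative times. Setting
  them to 0 there makes them Borel functions on the whole line.\<close>

lemma borel_zero_extension:
 fixes \<eta> :: "real => real"
 assumes "continuous_on {0..} \<eta>"
 shows "(\<lambda>t. if t < 0 then 0 else \<eta> t) \<in> borel_measurable borel" "continuous_on {0..} (\<lambda>t. if t < 0 then 0 else \<eta> t)"
proof -
 have "(\<lambda>t. ind {0..} t *\<^sub>R \<eta> t) \<in> borel_measurable borel"
  by (rule borel_measurable_continuous_on_indicator[OF _ assms]) simp
 also have "(\<lambda>t. ind {0..} t *\<^sub>R \<eta> t) = (\<lambda>t. if t < 0 then 0 else \<eta> t)" by (auto simp: indicator_def)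
 finally show "(\<lambda>t. if t < 0 then 0 else \<eta> t) \<in> borel_measurable borel" .
 show "continuous_on {0..} (\<lambda>t. if t < 0 then 0 else \<eta> t)" using assms by (rule continuous_on_eq) auto
qed

lemma weak_solution_string_solution:
 assumes p: "2 < p" and sol: "weak_solution p q \<alpha>1 \<alpha>2 \<beta>1 \<gamma>1 \<mu>1 u0 u1 \<eta>10 \<eta>20 \<zeta>10 u ut ux \<eta>1 \<eta>2 \<zeta>1"
  and sp: "string_parameters k a b K \<alpha>1 \<alpha>2 \<beta>1 \<gamma>1 \<mu>1" and k: "AEL x. 0 < x --> x < 1 --> q x = 2 * k x"
 obtains Ut Ux v0 vx where "string_solution p u ut ux Ut Ux v0 vx q k K a b \<alpha>1 \<alpha>2 \<beta>1 \<gamma>1 \<mu>1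
  (\<lambda>t. if t < 0 then 0 else \<eta>1 t) (\<lambda>t. if t < 0 then 0 else \<eta>2 t) (\<lambda>t. if t < 0 then 0 else \<zeta>1 t)"
proof -
 let ?\<eta>1 = "\<lambda>t. if t < 0 then 0 else \<eta>1 t" and ?\<eta>2 = "\<lambda>t. if t < 0 then 0 else \<eta>2 t" and ?\<zeta> = "\<lambda>t. if t < 0 then 0 else \<zeta>1 t"
 interpret sp: string_parameters k a b K \<alpha>1 \<alpha>2 \<beta>1 \<gamma>1 \<mu>1 by (rule sp)
 have reg: "solution_regularity p u ut ux" and cont: "continuous_on {0..} \<eta>1" "continuous_on {0..} \<eta>2" "continuous_on {0..} \<zeta>1"
  and eq: "damped_wave_eq q u ut"
  using sol unfolding weak_solution_def by blast+
 from sol obtain Ut Ux where side: "sideways_version p ut Ut" "sideways_version p ux Ux"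
  and tr: "AE t in lebesgue_on {0<..}. Ut 1 t = \<eta>1 t" "AE t in lebesgue_on {0<..}. Ut 0 t = \<zeta>1 t"
  and ode1: "\<And>t. 0 <= t ==> \<eta>1 t = \<eta>1 0 + (LINT s|lebesgue_on {0<..<t}. - \<alpha>1 * \<eta>1 s - \<alpha>2 * \<eta>2 s - \<beta>1 * Ux 1 s)"
  and ode2: "\<And>t. 0 <= t ==> (\<eta>2 has_real_derivative \<eta>1 t) (at t within {0..})"
  and ode3: "\<And>t. 0 <= t ==> \<zeta>1 t = \<zeta>1 0 + (LINT s|lebesgue_on {0<..<t}. - \<gamma>1 * \<zeta>1 s + \<mu>1 * Ux 0 s)"
  unfolding weak_solution_def by blast
 have rep: "\<exists>w. sideways_borel p f G w" if f: "Lp_continuous_on p {0<..<1} {0..} f" "sideways_version p f G"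
   "(\<lambda>z. f (fst z) (snd z)) \<in> borel_measurable (lebesgue_on spacetime)" for f G
 proof -
  obtain w where w: "borel_fun w" "\<And>z. z \<notin> spacetime ==> w z = 0" "AEL z. z \<in> spacetime --> f (fst z) (snd z) = w z"
   by (rule lebesgue_on_borel_representative[OF f(3) spacetime_borel]) blast
  have "sideways_borel p f G (\<lambda>t x. w (t, x))"
   by unfold_locales (use p f w in \<open>auto simp: mem_spacetime\<close>)
  then show ?thesis by blast
 qed
 obtain v0 where v0: "sideways_borel p ut Ut v0" using rep[of ut Ut] reg side by (auto simp: solution_regularity_def)
 obtain vx where vx: "sideways_borel p ux Ux vx" using rep[of ux Ux] reg side by (auto simp: solution_regularity_def)
 have wt: "wave_traces p u ut ux Ut Ux" by unfold_locales (fact p reg side)+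
 have "wave_borel p u ut ux Ut Ux v0 vx" by (intro wave_borel.intro wt v0 vx)
 moreover have "\<bar>k x\<bar> <= K" for x using sp.k_nonneg[of x] sp.k_le[of x] by simp
 ultimately have dw: "damped_wave_traces p u ut ux Ut Ux v0 vx q k K"
  by (intro damped_wave_traces.intro damped_wave_traces_axioms.intro eq sp.k_meas k)
 have ae: "AEL t. 0 < t --> Ut 1 t = ?\<eta>1 t" "AEL t. 0 < t --> Ut 0 t = ?\<zeta> t"
  using tr by (auto simp: AE_lebesgue_on_iff elim!: eventually_mono)
 have i1: "(LINT s|lebesgue_on {0<..<t}. - \<alpha>1 * ?\<eta>1 s - \<alpha>2 * ?\<eta>2 s - \<beta>1 * Ux 1 s) = (LINT s|lebesgue_on {0<..<t}. - \<alpha>1 * \<eta>1 s - \<alpha>2 * \<eta>2 s - \<beta>1 * Ux 1 s)"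
  and i3: "(LINT s|lebesgue_on {0<..<t}. - \<gamma>1 * ?\<zeta> s + \<mu>1 * Ux 0 s) = (LINT s|lebesgue_on {0<..<t}. - \<gamma>1 * \<zeta>1 s + \<mu>1 * Ux 0 s)" for t
  by (auto intro!: integral_cong)
 have d2: "(?\<eta>2 has_real_derivative ?\<eta>1 t) (at t within {0..})" if "0 <= t" for t
  by (rule has_field_derivative_transform_within[OF _ zero_less_one, of \<eta>2]) (use ode2[OF that] that in auto)
 show ?thesis
 proof (rule that[of Ut Ux v0 vx], intro string_solution.intro dw sp string_solution_axioms.intro)
  show "?\<eta>1 t = ?\<eta>1 0 + (LINT s|lebesgue_on {0<..<t}. - \<alpha>1 * ?\<eta>1 s - \<alpha>2 * ?\<eta>2 s - \<beta>1 * Ux 1 s)" if "0 <= t" for t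
   unfolding i1 using ode1[OF that] that by simp
  show "?\<zeta> t = ?\<zeta> 0 + (LINT s|lebesgue_on {0<..<t}. - \<gamma>1 * ?\<zeta> s + \<mu>1 * Ux 0 s)" if "0 <= t" for t
   unfolding i3 using ode3[OF that] that by simp
 qed (fact borel_zero_extension[OF cont(1)] borel_zero_extension[OF cont(2)] borel_zero_extension[OF cont(3)] ae d2)+
qed

theorem theorem2p2:
 fixes p \<alpha>1 \<alpha>2 \<beta>1 \<gamma>1 \<mu>1 :: real and q :: "real \<Rightarrow> real"
 assumes "2 < p"
  and "assumption_A2 q"
  and "assumption_A3 \<alpha>1 \<alpha>2 \<beta>1 \<gamma>1 \<mu>1"
 shows "\<exists>M \<nu>. 0 < M \<and> 0 < \<nu> \<and>
  (\<forall>u0 u1 \<eta>10 \<eta>20 \<zeta>10 u ut ux \<eta>1 \<eta>2 \<zeta>1.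
   W1p p u0 \<longrightarrow> Lp p {0<..<1} u1 \<longrightarrow>
   weak_solution p q \<alpha>1 \<alpha>2 \<beta>1 \<gamma>1 \<mu>1 u0 u1 \<eta>10 \<eta>20 \<zeta>10 u ut ux \<eta>1 \<eta>2 \<zeta>1 \<longrightarrow>
   (\<forall>t\<ge>0.
     energy p \<alpha>2 \<beta>1 \<mu>1 ut ux \<eta>1 \<eta>2 \<zeta>1 t
      \<le> M * exp (- \<nu> * t) * energy p \<alpha>2 \<beta>1 \<mu>1 ut ux \<eta>1 \<eta>2 \<zeta>1 0 \<and>
     (SUP x\<in>{0..1}. \<bar>u t x - (u0 1 - \<eta>20)\<bar> powr p)
      \<le> M * energy p \<alpha>2 \<beta>1 \<mu>1 ut ux \<eta>1 \<eta>2 \<zeta>1 0 * exp (- \<nu> * t)))"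
proof -
 obtain k a b K where sp: "string_parameters k a b K \<alpha>1 \<alpha>2 \<beta>1 \<gamma>1 \<mu>1" and k: "AEL x. 0 < x --> x < 1 --> q x = 2 * k x"
  by (rule damping_representative[OF assms(2,3)])
 \<comment> \<open>The constants are formed from the coefficients, \<open>K\<close> and
   \<open>p\<close> alone, and so are fixed before any solution is considered.\<close>
 define M where "M = string_solution.decay_const p K \<alpha>2 \<beta>1 \<mu>1"
 define \<nu> where "\<nu> = damped_string.nu K p"
 have decay: "0 < M \<and> 0 < \<nu> \<and> (\<forall>t\<ge>0.
   energy p \<alpha>2 \<beta>1 \<mu>1 ut ux \<eta>1 \<eta>2 \<zeta>1 t <= M * exp (- \<nu> * t) * energy p \<alpha>2 \<beta>1 \<mu>1 ut ux \<eta>1 \<eta>2 \<zeta>1 0 \<and>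
   (SUP x\<in>{0..1}. \<bar>u t x - (u0 1 - \<eta>20)\<bar> powr p) <= M * energy p \<alpha>2 \<beta>1 \<mu>1 ut ux \<eta>1 \<eta>2 \<zeta>1 0 * exp (- \<nu> * t))"
  if sol: "weak_solution p q \<alpha>1 \<alpha>2 \<beta>1 \<gamma>1 \<mu>1 u0 u1 \<eta>10 \<eta>20 \<zeta>10 u ut ux \<eta>1 \<eta>2 \<zeta>1"
  for u0 u1 \<eta>10 \<eta>20 \<zeta>10 u ut ux \<eta>1 \<eta>2 \<zeta>1
 proof -
  obtain Ut Ux v0 vx where "string_solution p u ut ux Ut Ux v0 vx q k K a b \<alpha>1 \<alpha>2 \<beta>1 \<gamma>1 \<mu>1
    (\<lambda>t. if t < 0 then 0 else \<eta>1 t) (\<lambda>t. if t < 0 then 0 else \<eta>2 t) (\<lambda>t. if t < 0 then 0 else \<zeta>1 t)"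
   by (rule weak_solution_string_solution[OF assms(1) sol sp k])
  then interpret s: string_solution p u ut ux Ut Ux v0 vx q k K a b \<alpha>1 \<alpha>2 \<beta>1 \<gamma>1 \<mu>1
    "\<lambda>t. if t < 0 then 0 else \<eta>1 t" "\<lambda>t. if t < 0 then 0 else \<eta>2 t" "\<lambda>t. if t < 0 then 0 else \<zeta>1 t" .
  have E: "s.E t = energy p \<alpha>2 \<beta>1 \<mu>1 ut ux \<eta>1 \<eta>2 \<zeta>1 t" if "0 <= t" for t using that by (simp add: s.E_def energy_def)
  have ini: "u 0 1 = u0 1" "\<eta>2 0 = \<eta>20" using sol unfolding weak_solution_def by auto
  show ?thesis unfolding M_def \<nu>_def using s.decay ini E by auto
 qed
 show ?thesis
 proof (cases "0 < M \<and> 0 < \<nu>")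
  case True
  with decay show ?thesis by blast
 next
  \<comment> \<open>By \<open>decay\<close> a single weak solution forces both constants to be
    positive. Otherwise there is no weak solution, and any positive constants will do.\<close>
  case False
  with decay show ?thesis by (intro exI[of _ 1]) (simp, blast)
 qed
qed

end
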